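(* There is a function $\varepsilon:\mathbb{N}\to\mathbb{R}$ with $\varepsilon(n)\to 0$ as $n\to\infty$, and a deterministic protocol in the Robertson–Webb query model, such that the following holds for every $n\ge 2$ and every collection of valuation functions $v_1,\dots,v_n$ (satisfying the conditions in the context). The protocol, run on the cake $[0,1]$ with agents $N=\{1,\dots,n\}$, outputs an envy-free division $(S_1,\dots,S_n)$ of the whole cake: $S_1\cup\dots\cup S_n=[0,1]$, the pieces pairwise intersect in at most finitely many points, and $v_i(S_i)\ge v_i(S_j)$ for all $i,j\in N$. Moreover, the total number of queries (cut queries plus evaluation queries) it makes is at most $n^{8n^2(1+\varepsilon(n))}$.
   Context: The cake is the interval $[0,1]$; a piece is a finite union of closed intervals contained in $[0,1]$. Each agent $i\in N=\{1,\dots,n\}$ has a valuation function $v_i$ defined on pieces satisfying: (non-negativity) $v_i(A)\ge 0$ for every piece $A$; (additivity) $v_i(A\cup B)=v_i(A)+v_i(B)$ whenever $A\cap B$ is empty or finite; (continuity/divisibility) for every interval $[a,b]\subseteq[0,1]$ and every $\lambda\in[0,1]$ there is $c\in[a,b]$ with $v_i([a,c])=\lambda\, v_i([a,b])$. The valuations are unknown to the protocol and are accessed only through Robertson–Webb queries: a cut query takes an agent $i$, a point $x$ and a real $r$ with $v_i([x,1])\ge r$ and returns a point $y$ with $v_i([x,y])=r$; an evaluation query takes an agent $i$ and an interval $[x,y]$ and returns $v_i([x,y])$. *)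

theory Defs
  imports Complex_Main
begin

definition cake_intervals :: "real set set" where
  "cake_intervals = {{a..b} | a b. 0 \<le> a \<and> a \<le> b \<and> b \<le> 1}"

definition piece :: "real set \<Rightarrow> bool" where
  "piece A \<longleftrightarrow> (\<exists>F. finite F \<and> F \<subseteq> cake_intervals \<and> A = \<Union>F)"

(* The type is total, but only the values on pieces are constrained (and used). *)
definition valuation :: "(real set \<Rightarrow> real) \<Rightarrow> bool" where
  "valuation v \<longleftrightarrow>
     (\<forall>A. piece A \<longrightarrow> 0 \<le> v A) \<and>
     (\<forall>A B. piece A \<and> piece B \<and> finite (A \<inter> B) \<longrightarrow> v (A \<union> B) = v A + v B) \<and>
     (\<forall>a b l. 0 \<le> a \<and> a \<le> b \<and> b \<le> 1 \<and> 0 \<le> l \<and> l \<le> 1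
        \<longrightarrow> (\<exists>c\<in>{a..b}. v {a..c} = l * v {a..b}))"

(* A deterministic adaptive protocol is a decision tree: each query node carries a
   continuation that maps the answer received to the rest of the protocol.
   "Cut i x r k" asks agent i for a point y with value r on [x,y];
   "Evaluate i x y k" asks agent i for the value of [x,y].
   Trees are well-founded, so every branch is finite. *)
datatype protocol =
    Output "nat \<Rightarrow> real set"
  | Cut nat real real "real \<Rightarrow> protocol"
  | Evaluate nat real real "real \<Rightarrow> protocol"

definition cut_answer :: "(real set \<Rightarrow> real) \<Rightarrow> real \<Rightarrow> real \<Rightarrow> real \<Rightarrow> bool" where
  "cut_answer w x r y \<longleftrightarrow> x \<le> y \<and> y \<le> 1 \<and> w {x..y} = r"

(* "executes v p q S": some execution of p against v ends with output S after q queries.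
   It is a relation because the answer to a cut query need not be unique when an agent
   assigns value 0 to some intervals; any correct answer may be returned. *)
inductive executes ::
  "(nat \<Rightarrow> real set \<Rightarrow> real) \<Rightarrow> protocol \<Rightarrow> nat \<Rightarrow> (nat \<Rightarrow> real set) \<Rightarrow> bool"
  for v where
  outp: "executes v (Output S) 0 S"
| cut: "cut_answer (v i) x r y \<Longrightarrow> executes v (k y) q S
    \<Longrightarrow> executes v (Cut i x r k) (Suc q) S"
| evaluate: "executes v (k (v i {x..y})) q S
    \<Longrightarrow> executes v (Evaluate i x y k) (Suc q) S"

(* Every query that p can reach against v is legal. Under this condition (and for
   valuations) no execution gets stuck at a cut query without a correct answer, so a
   statement about all executions is not vacuous. *)
primrec legal :: "nat \<Rightarrow> (nat \<Rightarrow> real set \<Rightarrow> real) \<Rightarrow> protocol \<Rightarrow> bool" where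
  "legal n v (Output S) \<longleftrightarrow> True"
| "legal n v (Cut i x r k) \<longleftrightarrow>
     i \<in> {1..n} \<and> 0 \<le> x \<and> x \<le> 1 \<and> 0 \<le> r \<and> r \<le> v i {x..1} \<and>
     (\<forall>y. cut_answer (v i) x r y \<longrightarrow> legal n v (k y))"
| "legal n v (Evaluate i x y k) \<longleftrightarrow>
     i \<in> {1..n} \<and> 0 \<le> x \<and> x \<le> y \<and> y \<le> 1 \<and> legal n v (k (v i {x..y}))"

definition envy_free_division ::
  "nat \<Rightarrow> (nat \<Rightarrow> real set \<Rightarrow> real) \<Rightarrow> (nat \<Rightarrow> real set) \<Rightarrow> bool" where
  "envy_free_division n v S \<longleftrightarrow>
     (\<forall>i\<in>{1..n}. piece (S i)) \<and>
     (\<Union>i\<in>{1..n}. S i) = {0..1} \<and>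
     (\<forall>i\<in>{1..n}. \<forall>j\<in>{1..n}. i \<noteq> j \<longrightarrow> finite (S i \<inter> S j)) \<and>
     (\<forall>i\<in>{1..n}. \<forall>j\<in>{1..n}. v i (S j) \<le> v i (S i))"

end

theory Submission
  imports Defs "HOL-Analysis.Analysis"
begin

text \<open>In the core step a cutter divides a piece of cake into equal parts and the others trim these to an
  equilibrium: an envy-free assignment in which unassigned parts are untrimmed. Repeating it yields many
  envy-free partial divisions (snapshots) and a residue so small that every gap between an agent's piece
  and another piece is either tiny or at least twice the residue. Tiny gaps are matched exactly by pieces
  extracted from the residue. By the pigeonhole principle many snapshots have the same structure. Within
  these the pieces are permuted, and the extracted pieces of unused snapshots compensate the agents who
  would object, until for some \<open>k\<close> all agents with a tiny gap to the piece of \<open>k\<close>, forming a proper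
  subset \<open>I k\<close> of the agents, have held that piece. The lead of the other agents over \<open>I k\<close> then
  exceeds their value of the residue, so that the residue can be divided recursively among \<open>I k\<close>.\<close>

subsection \<open>Equilibria of trimmed pieces\<close>

text \<open>Two obstacles shape the proof. Valuations are known only through the answers received so
  far. Therefore strategies are played as a game, \<open>can\<close>, in which the adversary may
  switch to any profile with the same known values; what is forced there depends on the answers
  alone, and a decision tree can be read off. Moreover an agent may give value zero to an interval,
  so that value is not strictly monotone in the trim. A fictitious second coordinate of positions
  and utilities restores the strictness on which the equilibrium argument depends. Equilibria are
  found as in assignment markets, with trims as prices. The one that is optimal for all agents uses
  only marks that arise from as many rounds of indifference as there are agents, so it costs
  n^(O(n)) cuts. The count is thus dominated by the number of snapshots: (n+1)^(n^2) types times a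
  family of size about n^(4n^2), because each of at most n^2 exchange steps divides the pool by
  n(n^3+1). Up to lower order this is n^(5n^2), which leaves room for crude estimates below
  n^(8n^2).\<close>

locale trimming =
  fixes U :: "'a \<Rightarrow> 'b \<Rightarrow> 'p::linorder \<Rightarrow> 'u::linorder"
    and X :: "nat \<Rightarrow> 'b \<Rightarrow> 'p set" and T :: nat and B :: "'a set" and J :: "'b set"
  assumes X_Suc: "X q j \<subseteq> X (Suc q) j"
    and strict: "\<lbrakk>i \<in> B; j \<in> J; x \<in> X T j; y \<in> X T j; x < y\<rbrakk> \<Longrightarrow> U i j y < U i j x"
    and marks: "\<lbrakk>q < T; i \<in> B; j \<in> J; j' \<in> J; x \<in> X q j; x' \<in> X q j'; U i j' x' \<le> U i j x\<rbrakk>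
      \<Longrightarrow> \<exists>z\<in>X (Suc q) j. U i j z = U i j' x'"
begin

lemma X_mono: "q \<le> q' \<Longrightarrow> X q j \<subseteq> X q' j"
  by (rule lift_Suc_mono_le[where f = "\<lambda>q. X q j"]) (use X_Suc in auto)

lemma X_T: "q \<le> T \<Longrightarrow> x \<in> X q j \<Longrightarrow> x \<in> X T j"
  using X_mono by blast

lemma anti: "\<lbrakk>i \<in> B; j \<in> J; x \<in> X T j; y \<in> X T j; x \<le> y\<rbrakk> \<Longrightarrow> U i j y \<le> U i j x"
  using strict[of i j x y] by (cases "x = y") (auto simp: order_less_le)

lemma pos_less: "\<lbrakk>i \<in> B; j \<in> J; x \<in> X T j; y \<in> X T j; U i j y < U i j x\<rbrakk> \<Longrightarrow> x < y"
  using anti[of i j y x] by force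

lemma pos_le: "\<lbrakk>i \<in> B; j \<in> J; x \<in> X T j; y \<in> X T j; U i j y \<le> U i j x\<rbrakk> \<Longrightarrow> x \<le> y"
  using strict[of i j y x] by force

text \<open>Trims act as prices and \<open>f\<close> as a vector of reserve prices. The floor is a
  parameter because the induction in \<open>equilibrium\<close> raises it in order to keep some
  agents away from the pieces.\<close>

definition quasi :: "'a set \<Rightarrow> 'b set \<Rightarrow> ('b \<Rightarrow> 'p) \<Rightarrow> ('b \<Rightarrow> 'p) \<Rightarrow> ('a \<Rightarrow> 'b) \<Rightarrow> bool" where
  "quasi W D f p \<pi> \<longleftrightarrow> inj_on \<pi> W \<and> \<pi> ` W \<subseteq> D \<and> (\<forall>j\<in>D. p j \<in> X T j \<and> f j \<le> p j) \<and>
     (\<forall>i\<in>W. \<forall>j\<in>D. U i j (p j) \<le> U i (\<pi> i) (p (\<pi> i)))"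

definition equil :: "'a set \<Rightarrow> 'b set \<Rightarrow> ('b \<Rightarrow> 'p) \<Rightarrow> ('b \<Rightarrow> 'p) \<Rightarrow> ('a \<Rightarrow> 'b) \<Rightarrow> bool" where
  "equil W D f p \<pi> \<longleftrightarrow> quasi W D f p \<pi> \<and> (\<forall>j\<in>D - \<pi> ` W. p j = f j)"

abbreviation ut :: "('b \<Rightarrow> 'p) \<Rightarrow> ('a \<Rightarrow> 'b) \<Rightarrow> 'a \<Rightarrow> 'u" where
  "ut p \<pi> i \<equiv> U i (\<pi> i) (p (\<pi> i))"

lemma quasi_card:
  assumes "quasi W D f p \<pi>" "finite D" shows "card W \<le> card D"
  using assms unfolding quasi_def by (metis card_inj_on_le)

text \<open>Agents that strictly gain when \<^term>\<open>p\<close> is replaced by \<^term>\<open>p'\<close> hold pieces whose price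
  falls. If the previous holders of these pieces gain too, then both assignments permute the same
  set of pieces among the gainers, so the two price systems can be pasted.\<close>

lemma paste:
  assumes B: "W \<subseteq> B" and J: "D \<subseteq> J" and fin: "finite W"
    and P: "P \<subseteq> W"
    and q': "inj_on \<pi>' P" "\<pi>' ` P \<subseteq> D" "\<And>j. j \<in> \<pi>' ` P \<Longrightarrow> p' j \<in> X T j"
    and q: "quasi W D f p \<pi>"
    and fl: "\<And>j. j \<in> \<pi>' ` P \<Longrightarrow> f j \<le> p' j"
    and ef': "\<And>i j. i \<in> P \<Longrightarrow> j \<in> \<pi>' ` P \<Longrightarrow> U i j (p' j) \<le> ut p' \<pi>' i"
    and gain: "\<And>i. i \<in> P \<Longrightarrow> ut p \<pi> i < ut p' \<pi>' i"
    and nogain: "\<And>i j. i \<in> W - P \<Longrightarrow> j \<in> \<pi>' ` P \<Longrightarrow> U i j (p' j) \<le> ut p \<pi> i"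
    and own: "\<And>i. i \<in> P \<Longrightarrow> \<exists>i2\<in>P. \<pi> i2 = \<pi>' i"
  shows "quasi W D f (\<lambda>j. if j \<in> \<pi>' ` P then p' j else p j) (\<lambda>i. if i \<in> P then \<pi>' i else \<pi> i)"
proof -
  have finP: "finite P" using P fin finite_subset by blast
  have inj: "inj_on \<pi> W" using q unfolding quasi_def by auto
  have sub: "\<pi>' ` P \<subseteq> \<pi> ` P" using own by force
  have "card (\<pi> ` P) = card P" using inj P by (metis card_image inj_on_subset)
  moreover have "card (\<pi>' ` P) = card P" using q'(1) by (rule card_image)
  ultimately have eq: "\<pi>' ` P = \<pi> ` P" using sub finP by (simp add: card_subset_eq)
  have out: "\<pi> i \<notin> \<pi>' ` P" if "i \<in> W - P" for i
    using that inj P unfolding eq by (auto dest: inj_onD)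
  show ?thesis
    unfolding quasi_def
  proof (intro conjI ballI)
    show "inj_on (\<lambda>i. if i \<in> P then \<pi>' i else \<pi> i) W"
    proof (rule inj_onI)
      fix x y assume xy: "x \<in> W" "y \<in> W"
        "(if x \<in> P then \<pi>' x else \<pi> x) = (if y \<in> P then \<pi>' y else \<pi> y)"
      show "x = y"
        using xy out[of x] out[of y] inj q'(1)
        by (auto split: if_splits dest: inj_onD) (metis imageI)+
    qed
    show "(\<lambda>i. if i \<in> P then \<pi>' i else \<pi> i) ` W \<subseteq> D"
      using q'(2) q unfolding quasi_def by auto
  next
    fix j assume j: "j \<in> D"
    show "(if j \<in> \<pi>' ` P then p' j else p j) \<in> X T j"
      using j q'(3) q unfolding quasi_def by auto
    show "f j \<le> (if j \<in> \<pi>' ` P then p' j else p j)"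
      using j fl q unfolding quasi_def by auto
  next
    fix i j assume i: "i \<in> W" and j: "j \<in> D"
    have e: "U i j (p j) \<le> ut p \<pi> i" using q i j unfolding quasi_def by auto
    show "U i j (if j \<in> \<pi>' ` P then p' j else p j)
      \<le> U i (if i \<in> P then \<pi>' i else \<pi> i)
          (if (if i \<in> P then \<pi>' i else \<pi> i) \<in> \<pi>' ` P
           then p' (if i \<in> P then \<pi>' i else \<pi> i) else p (if i \<in> P then \<pi>' i else \<pi> i))"
    proof (cases "i \<in> P")
      case True
      then show ?thesis using ef'[of i j] gain[of i] e by auto
    next
      case False
      then show ?thesis using out[of i] nogain[of i j] e i by auto
    qed
  qed
qed

theorem equilibrium:
  assumes "finite W" "W \<subseteq> B" "finite D" "D \<subseteq> J" "card W \<le> card D" "q + card W \<le> T"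
    and "\<And>j. j \<in> D \<Longrightarrow> f j \<in> X q j"
  shows "\<exists>p \<pi>. equil W D f p \<pi> \<and> (\<forall>j\<in>D. p j \<in> X (q + card W) j) \<and>
    (\<forall>p' \<pi>'. quasi W D f p' \<pi>' \<longrightarrow> (\<forall>i\<in>W. ut p' \<pi>' i \<le> ut p \<pi> i))"
  using assms
proof (induction "card W" arbitrary: W D f q rule: less_induct)
  case less
  note finW = less.prems(1) and WB = less.prems(2) and finD = less.prems(3) and DJ = less.prems(4)
  have fT: "f j \<in> X T j" if "j \<in> D" for j
    using less.prems(6,7) X_T[of q "f j" j] that by auto
  show ?case
  proof (cases "W = {}")
    case True
    show ?thesis
      by (rule exI[of _ f], rule exI[of _ undefined])
         (use True less.prems(7) fT in \<open>auto simp: equil_def quasi_def\<close>)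
  next
    case False
    then obtain a where a: "a \<in> W" by auto
    define G where "G = W"
    define W0 where "W0 = W - {a}"
    have GB: "G \<subseteq> B" and finG: "finite G" using WB finW G_def by auto
    have cW: "card W = Suc (card W0)" using card.remove[OF finW a] by (simp add: W0_def)
    have W0: "finite W0" "W0 \<subseteq> B" "W0 \<subseteq> G" using finW WB by (auto simp: W0_def G_def)
    have "\<exists>p \<pi>. equil W0 D f p \<pi> \<and> (\<forall>j\<in>D. p j \<in> X (q + card W0) j) \<and>
      (\<forall>p' \<pi>'. quasi W0 D f p' \<pi>' \<longrightarrow> (\<forall>i\<in>W0. ut p' \<pi>' i \<le> ut p \<pi> i))"
      by (rule less.hyps) (use cW W0 less.prems in auto)
    then obtain p0 \<pi>0 where E0: "equil W0 D f p0 \<pi>0"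
      and max0: "\<And>p' \<pi>' i. quasi W0 D f p' \<pi>' \<Longrightarrow> i \<in> W0 \<Longrightarrow> ut p' \<pi>' i \<le> ut p0 \<pi>0 i" by blast
    have Q0: "quasi W0 D f p0 \<pi>0" using E0 equil_def by auto
    define D1 where "D1 = \<pi>0 ` W0"
    define E where "E = D - D1"
    have D1D: "D1 \<subseteq> D" using Q0 unfolding quasi_def D1_def by auto
    have finD1: "finite D1" and finE: "finite E" using finD D1D E_def finite_subset by auto
    have cD1: "card D1 = card W0" using Q0 unfolding quasi_def D1_def by (auto intro: card_image)
    have "card D1 < card D" using cD1 cW less.prems(5) by auto
    then have Ene: "E \<noteq> {}" unfolding E_def using D1D by (metis Diff_eq_empty_iff less_irrefl subset_antisym)
    have p0E: "p0 j = f j" if "j \<in> E" for j using E0 that unfolding equil_def E_def D1_def by auto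
    define o' where "o' i = Max ((\<lambda>e. U i e (f e)) ` E)" for i
    have o_ge: "U i e (f e) \<le> o' i" if "e \<in> E" for i e
      unfolding o'_def using that finE by auto
    have "\<exists>e\<in>E. U i e (f e) = o' i" for i
    proof -
      have "o' i \<in> (\<lambda>e. U i e (f e)) ` E" unfolding o'_def using finE Ene by (intro Max_in) auto
      then show ?thesis by auto
    qed
    then obtain ee where ee: "\<And>i. ee i \<in> E" "\<And>i. U i (ee i) (f (ee i)) = o' i" by metis
    have u0: "o' i \<le> ut p0 \<pi>0 i" if "i \<in> W0" for i
    proof -
      have "U i (ee i) (p0 (ee i)) \<le> ut p0 \<pi>0 i"
        using Q0 that ee(1)[of i] unfolding quasi_def E_def by auto
      then show ?thesis using ee p0E by simp
    qed
    have qT: "q < T" using less.prems(6) cW by auto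
    \<comment> \<open>The trim at which \<open>i\<close> becomes indifferent between
      \<open>j\<close> and the outside option, or the floor if \<open>j\<close> is already worse.
      This is where the next level of marks enters.\<close>
    have "\<exists>y. y \<in> X (Suc q) j \<and> f j \<le> y \<and> U i j y \<le> o' i \<and>
        (if o' i \<le> U i j (f j) then U i j y = o' i else y = f j)" if i: "i \<in> G" and j: "j \<in> D1" for i j
    proof (cases "o' i \<le> U i j (f j)")
      case True
      have jD: "j \<in> D" and iB: "i \<in> B" and eD: "ee i \<in> D" using i j D1D GB ee(1) E_def by auto
      obtain z where z: "z \<in> X (Suc q) j" "U i j z = U i (ee i) (f (ee i))"
        using marks[OF qT iB, of j "ee i" "f j" "f (ee i)"] True ee jD eD DJ less.prems(7) by auto
      have "f j \<le> z"
        by (rule pos_le[OF iB, of j]) (use z ee True jD DJ fT X_T[of "Suc q" z j] qT in auto)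
      then show ?thesis using z ee True by auto
    next
      case False
      then show ?thesis using less.prems(7)[of j] X_Suc[of q j] j D1D by (intro exI[of _ "f j"]) auto
    qed
    then have "\<forall>i\<in>G. \<forall>j\<in>D1. \<exists>y. y \<in> X (Suc q) j \<and> f j \<le> y \<and> U i j y \<le> o' i \<and>
        (if o' i \<le> U i j (f j) then U i j y = o' i else y = f j)" by blast
    then obtain y where y: "\<And>i j. i \<in> G \<Longrightarrow> j \<in> D1 \<Longrightarrow> y i j \<in> X (Suc q) j \<and> f j \<le> y i j \<and> U i j (y i j) \<le> o' i \<and>
        (if o' i \<le> U i j (f j) then U i j (y i j) = o' i else y i j = f j)" by metis
    have yT: "y i j \<in> X T j" if "i \<in> G" "j \<in> D1" for i j
      using y[OF that] X_T[of "Suc q"] qT by auto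
    \<comment> \<open>At or above this floor no agent outside \<open>V\<close> prefers a piece of
      \<open>D1\<close> to its outside option.\<close>
    define \<phi> where "\<phi> V j = Max (insert (f j) ((\<lambda>i. y i j) ` (G - V)))" for V j
    have \<phi>_f: "f j \<le> \<phi> V j" for V j unfolding \<phi>_def using finG by auto
    have \<phi>_y: "y i j \<le> \<phi> V j" if "i \<in> G" "i \<notin> V" for V i j unfolding \<phi>_def using finG that by auto
    have \<phi>_in: "\<phi> V j = f j \<or> (\<exists>i\<in>G - V. \<phi> V j = y i j)" for V j
    proof -
      have "\<phi> V j \<in> insert (f j) ((\<lambda>i. y i j) ` (G - V))" unfolding \<phi>_def using finG by (intro Max_in) auto
      then show ?thesis by auto
    qed
    have \<phi>_X: "\<phi> V j \<in> X (Suc q) j" if "j \<in> D1" for V j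
      using \<phi>_in[of V j] y[of _ j] that less.prems(7)[of j] X_Suc[of q j] D1D by (auto dest!: subsetD)
    have \<phi>_mono: "\<phi> (insert z V) j \<le> \<phi> V j" for z V j
      using \<phi>_in[of "insert z V" j] \<phi>_f \<phi>_y by auto
    define OK where "OK V \<longleftrightarrow> V \<subseteq> G \<and> (\<exists>p \<pi>. quasi V D1 (\<phi> V) p \<pi> \<and> (\<forall>i\<in>V. o' i \<le> ut p \<pi> i))" for V
    have OK0: "OK {}" unfolding OK_def quasi_def using \<phi>_X X_T[of "Suc q"] qT by (auto intro!: exI[of _ "\<phi> {}"])
    have OKc: "card V \<le> card D1" if V: "OK V" for V
    proof -
      obtain p \<pi> where "quasi V D1 (\<phi> V) p \<pi>" using V unfolding OK_def by auto
      then show ?thesis using quasi_card finD1 by blast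
    qed
    have "\<exists>V. OK V \<and> (\<forall>V'. OK V' \<longrightarrow> card V' \<le> card V)"
      by (rule ex_has_greatest_nat[of OK "{}" card "Suc (card D1)"])
         (use OK0 OKc in \<open>auto simp: less_Suc_eq_le\<close>)
    then obtain V where V: "OK V" and Vmax: "\<And>V'. OK V' \<Longrightarrow> card V' \<le> card V" by blast
    have VG: "V \<subseteq> G" using V OK_def by auto
    have finV: "finite V" using VG finG finite_subset by auto
    have cV: "card V \<le> card D1" using OKc V by blast
    \<comment> \<open>As \<open>V\<close> is no larger than \<open>W0\<close>, the level
      \<open>Suc q + card V\<close> stays within \<open>q + card W\<close>.\<close>
    have "\<exists>p \<pi>. equil V D1 (\<phi> V) p \<pi> \<and> (\<forall>j\<in>D1. p j \<in> X (Suc q + card V) j) \<and>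
      (\<forall>p' \<pi>'. quasi V D1 (\<phi> V) p' \<pi>' \<longrightarrow> (\<forall>i\<in>V. ut p' \<pi>' i \<le> ut p \<pi> i))"
      by (rule less.hyps) (use cV cD1 cW finV VG GB finD1 D1D DJ \<phi>_X less.prems(6) in auto)
    then obtain p \<pi> where Ep: "equil V D1 (\<phi> V) p \<pi>" and pX: "\<And>j. j \<in> D1 \<Longrightarrow> p j \<in> X (Suc q + card V) j"
      and maxV: "\<And>p' \<pi>' i. quasi V D1 (\<phi> V) p' \<pi>' \<Longrightarrow> i \<in> V \<Longrightarrow> ut p' \<pi>' i \<le> ut p \<pi> i" by blast
    have Qp: "quasi V D1 (\<phi> V) p \<pi>" using Ep equil_def by auto
    have inj\<pi>: "inj_on \<pi> V" and \<pi>D1: "\<pi> ` V \<subseteq> D1" using Qp unfolding quasi_def by auto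
    have uo: "o' i \<le> ut p \<pi> i" if "i \<in> V" for i
    proof -
      obtain p' \<pi>' where "quasi V D1 (\<phi> V) p' \<pi>'" "\<forall>i\<in>V. o' i \<le> ut p' \<pi>' i" using V OK_def by auto
      then show ?thesis using maxV that by force
    qed
    have pT: "p j \<in> X T j" if "j \<in> D1" for j using Qp that unfolding quasi_def by auto
    have p\<phi>: "\<phi> V j \<le> p j" if "j \<in> D1" for j using Qp that unfolding quasi_def by auto
    have efp: "U i j (p j) \<le> ut p \<pi> i" if "i \<in> V" "j \<in> D1" for i j using Qp that unfolding quasi_def by auto
    have efz: "U z j (p j) \<le> o' z" if "z \<in> G" "z \<notin> V" "j \<in> D1" for z j
    proof -
      have "U z j (p j) \<le> U z j (y z j)"
        by (rule anti) (use that GB D1D DJ yT pT \<phi>_y[of z V j] p\<phi>[of j] in auto)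
      then show ?thesis using y that by force
    qed
    \<comment> \<open>An outsider that would accept a free piece at the current trims can join
      \<open>V\<close>: removing it from the outsiders only lowers the floor. The assignment
      \<open>\<rho>\<close> is allowed to differ from \<open>\<pi>\<close> for the sake of the
      alternating path below.\<close>
    have addable: False
      if z: "z \<in> G" "z \<notin> V" and r: "inj_on \<rho> V" "\<rho> ` V \<subseteq> D1" "\<And>i. i \<in> V \<Longrightarrow> ut p \<rho> i = ut p \<pi> i"
        and j: "j \<in> D1" "j \<notin> \<rho> ` V" "o' z \<le> U z j (p j)" for z \<rho> j
    proof -
      have "quasi (insert z V) D1 (\<phi> (insert z V)) p (\<rho>(z := j))"
        unfolding quasi_def
      proof (intro conjI ballI)
        show "inj_on (\<rho>(z := j)) (insert z V)"
          using r(1) j(2) z(2) by (auto simp: inj_on_def)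
        show "\<rho>(z := j) ` insert z V \<subseteq> D1" using r(2) j(1) by auto
        show "p j' \<in> X T j'" "\<phi> (insert z V) j' \<le> p j'" if "j' \<in> D1" for j'
          using that pT p\<phi>[of j'] \<phi>_mono[of z V j'] by (blast, metis order_trans)
      next
        fix i j' assume "i \<in> insert z V" "j' \<in> D1"
        then show "U i j' (p j') \<le> ut p (\<rho>(z := j)) i"
          using efp[of i j'] r(3)[of i] efz[OF z, of j'] j z by (cases "i = z") (auto intro: order_trans)
      qed
      moreover have "\<forall>i\<in>insert z V. o' i \<le> ut p (\<rho>(z := j)) i"
        using uo r(3) j z by auto
      ultimately have "OK (insert z V)" unfolding OK_def using z VG by blast
      then show False using Vmax[of "insert z V"] finV z by simp
    qed
    \<comment> \<open>Suppose an outsider likes a free piece at its original floor. If that floor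
      was not raised, this outsider can join \<open>V\<close>. If it was raised, the piece sits
      exactly at the mark of some outsider, which is indifferent and can join.\<close>
    have unass: "U z j (f j) < o' z" if j: "j \<in> D1" "j \<notin> \<pi> ` V" and z: "z \<in> G" "z \<notin> V" for j z
    proof (rule ccontr)
      assume "\<not> ?thesis"
      then have zz: "o' z \<le> U z j (f j)" by simp
      have pj: "p j = \<phi> V j" using Ep j unfolding equil_def by auto
      show False
      proof (cases "\<phi> V j = f j")
        case True
        then show False using addable[OF z inj\<pi> \<pi>D1 _ j] zz pj by simp
      next
        case False
        then obtain z' where z': "z' \<in> G" "z' \<notin> V" "\<phi> V j = y z' j" using \<phi>_in[of V j] by auto
        then have "o' z' \<le> U z' j (p j)" using y[of z' j] False pj j by (auto split: if_splits)
        then show False using addable[OF z'(1,2) inj\<pi> \<pi>D1 _ j] by simp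
      qed
    qed
    have pf: "p j = f j" if "j \<in> D1" "j \<notin> \<pi> ` V" for j
    proof -
      have "\<phi> V j = f j"
        using \<phi>_in[of V j] y[of _ j] unass[OF that] that by (fastforce split: if_splits)
      then show ?thesis using Ep that unfolding equil_def by auto
    qed
    define w where "w i = (if i \<in> V then ut p \<pi> i else o' i)" for i
    have efw: "U i j (p j) \<le> w i" if "i \<in> G" "j \<in> D1" for i j
      using efp efz that unfolding w_def by auto
    have D1J: "D1 \<subseteq> J" using D1D DJ by auto
    have p0T: "p0 j \<in> X T j" "f j \<le> p0 j" if "j \<in> D" for j using Q0 that unfolding quasi_def by auto
    have ef0: "U i j (p0 j) \<le> ut p0 \<pi>0 i" if "i \<in> W0" "j \<in> D" for i j using Q0 that unfolding quasi_def by auto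
    \<comment> \<open>Otherwise the agents that gain over \<open>p0\<close> could be pasted into the
      optimal equilibrium of \<open>W0\<close>.\<close>
    have w_le: "w i \<le> ut p0 \<pi>0 i" if "i \<in> W0" for i
    proof (rule ccontr)
      assume neg: "\<not> ?thesis"
      define P where "P = {i \<in> W0. ut p0 \<pi>0 i < w i}"
      have PV: "P \<subseteq> V" by (rule subsetI) (use u0 leD in \<open>fastforce simp: P_def w_def split: if_splits\<close>)
      have iP: "i \<in> P" using that neg P_def by auto
      have P_ut: "w i = ut p \<pi> i" if "i \<in> P" for i using that PV w_def by auto
      have "quasi W0 D f (\<lambda>j. if j \<in> \<pi> ` P then p j else p0 j) (\<lambda>i. if i \<in> P then \<pi> i else \<pi>0 i)"
      proof (rule paste[OF W0(2) DJ W0(1) _ _ _ _ Q0])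
        show "P \<subseteq> W0" using P_def by auto
        show "inj_on \<pi> P" using inj\<pi> PV inj_on_subset by blast
        show "\<pi> ` P \<subseteq> D" using \<pi>D1 PV D1D by auto
        show "p j \<in> X T j" "f j \<le> p j" if "j \<in> \<pi> ` P" for j
          using that PV \<pi>D1 pT p\<phi>[of j] \<phi>_f[of j V] by (auto intro: order_trans)
        show "U i j (p j) \<le> ut p \<pi> i" if "i \<in> P" "j \<in> \<pi> ` P" for i j
          using that PV \<pi>D1 by (intro efp) auto
        show "ut p0 \<pi>0 i < ut p \<pi> i" if "i \<in> P" for i using P_ut[OF that] that unfolding P_def by simp
        show "U i j (p j) \<le> ut p0 \<pi>0 i" if "i \<in> W0 - P" "j \<in> \<pi> ` P" for i j
        proof -
          have "U i j (p j) \<le> w i" using that PV \<pi>D1 W0(3) by (intro efw) auto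
          then show ?thesis using that P_def by auto
        qed
        show "\<exists>i2\<in>P. \<pi>0 i2 = \<pi> i" if i: "i \<in> P" for i
        proof -
          have j: "\<pi> i \<in> D1" "i \<in> W0" using i PV \<pi>D1 P_def by auto
          then obtain i2 where i2: "i2 \<in> W0" "\<pi>0 i2 = \<pi> i" unfolding D1_def by auto
          have "U i (\<pi> i) (p0 (\<pi> i)) < U i (\<pi> i) (p (\<pi> i))"
            using ef0[of i "\<pi> i"] i P_ut[OF i] P_def j D1D by auto
          moreover have jDJ: "\<pi> i \<in> D" "\<pi> i \<in> J" "i \<in> B" "i2 \<in> B" "i2 \<in> G"
            using j i2 D1D D1J W0 by auto
          ultimately have "p (\<pi> i) < p0 (\<pi> i)"
            using pos_less[of i "\<pi> i" "p (\<pi> i)" "p0 (\<pi> i)"] j jDJ pT p0T by auto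
          then have "U i2 (\<pi> i) (p0 (\<pi> i)) < U i2 (\<pi> i) (p (\<pi> i))"
            using strict[of i2 "\<pi> i" "p (\<pi> i)" "p0 (\<pi> i)"] i2 j jDJ pT p0T by auto
          also have "\<dots> \<le> w i2" using efw i2 W0 j by auto
          finally show ?thesis using i2 P_def by auto
        qed
      qed
      from max0[OF this that] show False
        using iP P_ut[OF iP] neg by auto
    qed
    \<comment> \<open>Alternating path. If a free piece is trimmed no more than in
      \<open>p0\<close>, its holder under \<open>\<pi>0\<close> is tied. This holder either joins
      \<open>V\<close>, or moves to the free piece and releases its own, which is again trimmed no
      more than in \<open>p0\<close>. Every move increases the agreement with
      \<open>\<pi>0\<close>.\<close>
    have path: "inj_on \<rho> V \<Longrightarrow> \<rho> ` V \<subseteq> D1 \<Longrightarrow> (\<And>i. i \<in> V \<Longrightarrow> ut p \<rho> i = ut p \<pi> i) \<Longrightarrow>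
      j \<in> D1 \<Longrightarrow> j \<notin> \<rho> ` V \<Longrightarrow> p j \<le> p0 j \<Longrightarrow> False" for \<rho> j
    proof (induction "card {i \<in> V. \<rho> i \<noteq> \<pi>0 i}" arbitrary: \<rho> j rule: less_induct)
      case less
      obtain i where i: "i \<in> W0" "\<pi>0 i = j" using less.prems(4) D1_def by auto
      have iB: "i \<in> B" "i \<in> G" using i W0 by auto
      have jD: "j \<in> D" "j \<in> J" using less.prems(4) D1D D1J by auto
      have "U i j (p0 j) \<le> U i j (p j)"
        by (rule anti) (use iB jD pT p0T less.prems in auto)
      moreover have "U i j (p j) \<le> w i" using efw iB less.prems by auto
      moreover have "w i \<le> U i j (p0 j)" using w_le[OF i(1)] i by auto
      ultimately have tie: "U i j (p j) = w i" "w i = ut p0 \<pi>0 i" using i by auto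
      show False
      proof (cases "i \<in> V")
        case False
        then show False using addable[OF iB(2) False less.prems(1-3) less.prems(4,5)] tie w_def by auto
      next
        case True
        define j' where "j' = \<rho> i"
        have jj: "j' \<noteq> j" "j' \<in> D1" using less.prems True j'_def by auto
        have u': "U i j' (p j') = w i" using less.prems(3)[OF True] True w_def j'_def by auto
        show False
        proof (rule less.hyps[of "\<rho>(i := j)" j'])
          have "{i' \<in> V. (\<rho>(i := j)) i' \<noteq> \<pi>0 i'} \<subset> {i \<in> V. \<rho> i \<noteq> \<pi>0 i}"
            using i True jj j'_def by auto
          then show "card {i' \<in> V. (\<rho>(i := j)) i' \<noteq> \<pi>0 i'} < card {i \<in> V. \<rho> i \<noteq> \<pi>0 i}"
            by (rule psubset_card_mono[rotated]) (use finV in auto)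
          show "inj_on (\<rho>(i := j)) V" using less.prems(1,5) by (auto simp: inj_on_def)
          show "\<rho>(i := j) ` V \<subseteq> D1" using less.prems by auto
          show "ut p (\<rho>(i := j)) i' = ut p \<pi> i'" if "i' \<in> V" for i'
            using that less.prems(3) tie True w_def by auto
          show "j' \<in> D1" by (rule jj)
          show "j' \<notin> \<rho>(i := j) ` V"
            using less.prems(1) True jj j'_def by (auto dest: inj_onD)
          have "U i j' (p0 j') \<le> U i j' (p j')"
            using ef0[OF i(1), of j'] u' tie jj D1D by auto
          then show "p j' \<le> p0 j'"
            using pos_le[of i j' "p j'" "p0 j'"] iB jj D1D D1J pT p0T by auto
        qed
      qed
    qed
    have \<pi>V: "\<pi> ` V = D1"
    proof (rule ccontr)
      assume "\<pi> ` V \<noteq> D1"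
      then obtain j where j: "j \<in> D1" "j \<notin> \<pi> ` V" using \<pi>D1 by auto
      show False
        by (rule path[OF inj\<pi> \<pi>D1 _ j]) (use pf[OF j] p0T j D1D in auto)
    qed
    then have "card V = card W0" using card_image[OF inj\<pi>] cD1 by simp
    then have "card (G - V) = 1" using VG finV cW by (simp add: card_Diff_subset G_def)
    then obtain l where l: "G - V = {l}" by (auto simp: card_1_singleton_iff)
    then have GV: "G = insert l V" "l \<notin> V" using VG by auto
    define e where "e = ee l"
    have e: "e \<in> E" "e \<in> D" "e \<notin> D1" "U l e (f e) = o' l" using ee[of l] E_def e_def by auto
    define pn where "pn j = (if j \<in> D1 then p j else f j)" for j
    define \<pi>n where "\<pi>n = \<pi>(l := e)"
    have utn: "ut pn \<pi>n i = w i" if "i \<in> G" for i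
      using that GV \<pi>D1 e unfolding pn_def \<pi>n_def w_def by auto
    have Qn: "quasi G D f pn \<pi>n"
      unfolding quasi_def
    proof (intro conjI ballI)
      show "inj_on \<pi>n G" using inj\<pi> GV \<pi>D1 e unfolding \<pi>n_def by (auto simp: inj_on_def)
      show "\<pi>n ` G \<subseteq> D" using GV \<pi>D1 e D1D unfolding \<pi>n_def by auto
      show "pn j \<in> X T j" "f j \<le> pn j" if "j \<in> D" for j
        using that pT fT p\<phi>[of j] \<phi>_f[of j V] unfolding pn_def by (auto intro: order_trans)
      show "U i j (pn j) \<le> ut pn \<pi>n i" if "i \<in> G" "j \<in> D" for i j
      proof (cases "j \<in> D1")
        case True
        then show ?thesis using efw that utn pn_def by auto
      next
        case False
        have "o' i \<le> w i" using uo unfolding w_def by auto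
        then show ?thesis using False o_ge[of j i] that utn pn_def E_def by auto
      qed
    qed
    have En: "equil G D f pn \<pi>n"
      unfolding equil_def using Qn \<pi>V GV pn_def \<pi>n_def by (auto simp: fun_upd_def)
    have Xn: "pn j \<in> X (q + card W) j" if "j \<in> D" for j
    proof (cases "j \<in> D1")
      case True
      have "Suc q + card V = q + card W" using \<open>card V = card W0\<close> cW by simp
      then show ?thesis using pX[OF True] True pn_def by metis
    next
      case False
      then show ?thesis using less.prems(7)[OF that] X_mono[of q "q + card W" j] pn_def by auto
    qed
    \<comment> \<open>Agents that gain hold pieces of \<open>D1\<close> whose holders in
      \<open>V\<close> gain too, and counting shows that \<open>l\<close> is not among them. As
      \<open>l\<close> does not gain, the trims of these pieces respect the floor that
      \<open>l\<close> imposes, and pasting contradicts the optimality for \<open>V\<close>.\<close>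
    have maxn: "ut p' \<pi>' i \<le> ut pn \<pi>n i" if q': "quasi G D f p' \<pi>'" and i: "i \<in> G" for p' \<pi>' i
    proof (rule ccontr)
      assume neg: "\<not> ?thesis"
      define P where "P = {i \<in> G. w i < ut p' \<pi>' i}"
      have iP: "i \<in> P" using neg i utn P_def by auto
      have inj': "inj_on \<pi>' G" and \<pi>'D: "\<pi>' ` G \<subseteq> D"
        and p'T: "\<And>j. j \<in> D \<Longrightarrow> p' j \<in> X T j" and fp': "\<And>j. j \<in> D \<Longrightarrow> f j \<le> p' j"
        and ef': "\<And>i j. i \<in> G \<Longrightarrow> j \<in> D \<Longrightarrow> U i j (p' j) \<le> ut p' \<pi>' i"
        using q' unfolding quasi_def by auto
      have own: "\<exists>i2\<in>P \<inter> V. \<pi> i2 = \<pi>' i" if i: "i \<in> P" for i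
      proof -
        have j: "\<pi>' i \<in> D" "i \<in> G" using i \<pi>'D P_def by auto
        have "U i (\<pi>' i) (pn (\<pi>' i)) \<le> w i" using Qn j utn unfolding quasi_def by metis
        then have "U i (\<pi>' i) (pn (\<pi>' i)) < U i (\<pi>' i) (p' (\<pi>' i))" using i P_def by auto
        then have less: "p' (\<pi>' i) < pn (\<pi>' i)"
          using pos_less[of i "\<pi>' i" "p' (\<pi>' i)" "pn (\<pi>' i)"] j GB DJ p'T Qn unfolding quasi_def by blast
        then have jD1: "\<pi>' i \<in> D1" using fp'[OF j(1)] unfolding pn_def by (auto split: if_splits)
        then obtain i2 where i2: "i2 \<in> V" "\<pi> i2 = \<pi>' i" using \<pi>V by (metis imageE)
        have "w i2 = U i2 (\<pi>' i) (p (\<pi>' i))" using i2 w_def by auto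
        also have "\<dots> < U i2 (\<pi>' i) (p' (\<pi>' i))"
          using strict[of i2 "\<pi>' i" "p' (\<pi>' i)" "p (\<pi>' i)"] i2 jD1 less VG GB DJ j p'T pT pn_def by auto
        also have "\<dots> \<le> ut p' \<pi>' i2" using ef' i2 VG j by auto
        finally show ?thesis using i2 P_def VG by auto
      qed
      have PG: "P \<subseteq> G" using P_def by auto
      have PV: "P \<subseteq> V"
      proof -
        have sub: "\<pi>' ` P \<subseteq> \<pi> ` (P \<inter> V)" using own by force
        have "card P = card (\<pi>' ` P)" using inj' PG by (metis card_image inj_on_subset)
        also have "\<dots> \<le> card (\<pi> ` (P \<inter> V))" using sub finV by (intro card_mono) auto
        also have "\<dots> \<le> card (P \<inter> V)" using finV by (intro card_image_le) auto
        finally have "P \<inter> V = P" using PG finG finite_subset by (intro card_seteq) auto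
        then show ?thesis by auto
      qed
      have PD1: "\<pi>' ` P \<subseteq> D1" using own \<pi>D1 by force
      have lw: "ut p' \<pi>' l \<le> o' l" using PV GV P_def w_def by (auto simp: not_less[symmetric])
      have "quasi V D1 (\<phi> V) (\<lambda>j. if j \<in> \<pi>' ` P then p' j else p j) (\<lambda>i. if i \<in> P then \<pi>' i else \<pi> i)"
      proof (rule paste[OF _ D1J finV PV _ PD1 _ Qp])
        show "V \<subseteq> B" using VG GB by auto
        show "inj_on \<pi>' P" using inj' PG inj_on_subset by blast
        show "p' j \<in> X T j" if "j \<in> \<pi>' ` P" for j using that PD1 D1D p'T by auto
        show "\<phi> V j \<le> p' j" if "j \<in> \<pi>' ` P" for j
        proof -
          have j: "j \<in> D1" "j \<in> D" "j \<in> J" using that PD1 D1D D1J by auto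
          have "y l j \<le> p' j"
          proof (cases "o' l \<le> U l j (f j)")
            case True
            have "U l j (p' j) \<le> U l j (y l j)"
              using True y[of l j] ef'[of l j] lw GV j by auto
            then show ?thesis using pos_le[of l j "y l j" "p' j"] GV GB j yT p'T by auto
          next
            case False
            then show ?thesis using y[of l j] GV j fp' by auto
          qed
          then show ?thesis using \<phi>_in[of V j] l fp'[of j] j by auto
        qed
        show "U i j (p' j) \<le> ut p' \<pi>' i" if "i \<in> P" "j \<in> \<pi>' ` P" for i j
          using that PG PD1 D1D by (intro ef') auto
        show "ut p \<pi> i < ut p' \<pi>' i" if "i \<in> P" for i using that PV P_def w_def by auto
        show "U i j (p' j) \<le> ut p \<pi> i" if "i \<in> V - P" "j \<in> \<pi>' ` P" for i j
        proof -
          have "U i j (p' j) \<le> ut p' \<pi>' i" using that VG PD1 D1D by (intro ef') auto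
          also have "\<dots> \<le> ut p \<pi> i" using that VG P_def w_def by auto
          finally show ?thesis .
        qed
        show "\<exists>i2\<in>P. \<pi> i2 = \<pi>' i" if "i \<in> P" for i using own[OF that] by auto
      qed
      from maxV[OF this, of i] show False using iP PV P_def w_def by auto
    qed
    show ?thesis
      using En Xn maxn unfolding G_def by blast
  qed
qed

end

section \<open>Algebra of half-open sets\<close>

text \<open>Unions of half-open intervals with endpoints in \<open>P\<close>. Disjointness is exact for these sets; their
  closures are the pieces of the cake.\<close>

definition meas :: "real set \<Rightarrow> real set \<Rightarrow> bool" where
  "meas P A \<longleftrightarrow> A \<subseteq> {0<..1} \<and>
     (\<forall>x\<in>{0<..1}. \<forall>y\<in>{0<..1}. (\<forall>p\<in>P. x \<le> p \<longleftrightarrow> y \<le> p) \<longrightarrow> (x \<in> A \<longleftrightarrow> y \<in> A))"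

lemma measI:
  "\<lbrakk>A \<subseteq> {0<..1}; \<And>x y. \<lbrakk>x \<in> {0<..1}; y \<in> {0<..1}; \<And>p. p \<in> P \<Longrightarrow> x \<le> p \<longleftrightarrow> y \<le> p; x \<in> A\<rbrakk> \<Longrightarrow> y \<in> A\<rbrakk>
   \<Longrightarrow> meas P A"
  unfolding meas_def by metis

lemma measD:
  "\<lbrakk>meas P A; x \<in> A; y \<in> {0<..1}; \<And>p. p \<in> P \<Longrightarrow> x \<le> p \<longleftrightarrow> y \<le> p\<rbrakk> \<Longrightarrow> y \<in> A"
  unfolding meas_def by blast

lemma meas_sub: "meas P A \<Longrightarrow> A \<subseteq> {0<..1}"
  unfolding meas_def by blast

lemma meas_mono: "\<lbrakk>meas P A; P \<subseteq> P'\<rbrakk> \<Longrightarrow> meas P' A"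
  by (rule measI) (use meas_sub[of P A] measD[of P A] in \<open>blast+\<close>)

lemma meas_empty [simp]: "meas P {}"
  by (rule measI) auto

lemma meas_cake [simp]: "meas P {0<..1}"
  by (rule measI) auto

lemma meas_iff:
  "\<lbrakk>meas P A; x \<in> {0<..1}; y \<in> {0<..1}; \<And>p. p \<in> P \<Longrightarrow> x \<le> p \<longleftrightarrow> y \<le> p\<rbrakk> \<Longrightarrow> x \<in> A \<longleftrightarrow> y \<in> A"
  using measD[of P A x y] measD[of P A y x] by blast

lemma meas_Un [intro]: "\<lbrakk>meas P A; meas P B\<rbrakk> \<Longrightarrow> meas P (A \<union> B)"
  by (rule measI) (use meas_sub[of P A] meas_sub[of P B] meas_iff[of P A] meas_iff[of P B] in blast)+

lemma meas_Int [intro]: "\<lbrakk>meas P A; meas P B\<rbrakk> \<Longrightarrow> meas P (A \<inter> B)"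
  by (rule measI) (use meas_sub[of P A] meas_sub[of P B] meas_iff[of P A] meas_iff[of P B] in blast)+

lemma meas_Diff [intro]: "\<lbrakk>meas P A; meas P B\<rbrakk> \<Longrightarrow> meas P (A - B)"
  by (rule measI) (use meas_sub[of P A] meas_sub[of P B] meas_iff[of P A] meas_iff[of P B] in blast)+

lemma meas_UN [intro]: "(\<And>i. i \<in> I \<Longrightarrow> meas P (A i)) \<Longrightarrow> meas P (\<Union>i\<in>I. A i)"
proof (rule measI)
  assume a: "\<And>i. i \<in> I \<Longrightarrow> meas P (A i)"
  show "(\<Union>i\<in>I. A i) \<subseteq> {0<..1}" using a meas_sub by blast
  fix x y assume xy: "x \<in> {0<..1}" "y \<in> {0<..1}" "\<And>p. p \<in> P \<Longrightarrow> x \<le> p \<longleftrightarrow> y \<le> p" "x \<in> (\<Union>i\<in>I. A i)"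
  then obtain i where i: "i \<in> I" "x \<in> A i" by auto
  then have "y \<in> A i" using measD[OF a[OF i(1)] i(2) xy(2,3)] by blast
  then show "y \<in> (\<Union>i\<in>I. A i)" using i by auto
qed

lemma meas_le [intro]: "\<lbrakk>meas P A; y \<in> P\<rbrakk> \<Longrightarrow> meas P (A \<inter> {..y})"
proof (rule measI)
  assume a: "meas P A" "y \<in> P"
  show "A \<inter> {..y} \<subseteq> {0<..1}" using meas_sub[OF a(1)] by blast
  fix x z assume x: "x \<in> {0<..1}" "z \<in> {0<..1}" "\<And>p. p \<in> P \<Longrightarrow> x \<le> p \<longleftrightarrow> z \<le> p" "x \<in> A \<inter> {..y}"
  have "z \<in> A" using measD[OF a(1) _ x(2,3)] x(4) by simp
  moreover have "z \<le> y" using x(3)[OF a(2)] x(4) by simp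
  ultimately show "z \<in> A \<inter> {..y}" by simp
qed

lemma meas_gt [intro]: "\<lbrakk>meas P A; y \<in> P\<rbrakk> \<Longrightarrow> meas P (A \<inter> {y<..})"
proof -
  assume a: "meas P A" "y \<in> P"
  have "A \<inter> {y<..} = A - (A \<inter> {..y})" by (rule set_eqI, simp add: not_le, blast)
  then show ?thesis using meas_Diff[OF a(1) meas_le[OF a]] by simp
qed

text \<open>A cut point outside the cake lies on the same side of all its points.\<close>

lemma meas_unit: "meas P A \<Longrightarrow> meas (P \<inter> {0..1}) A"
  unfolding meas_def
proof safe
  fix x y :: real
  assume *: "\<forall>x\<in>{0<..1}. \<forall>y\<in>{0<..1}. (\<forall>p\<in>P. (x \<le> p) = (y \<le> p)) \<longrightarrow> (x \<in> A) = (y \<in> A)"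
    and xy: "x \<in> {0<..1}" "y \<in> {0<..1}" "\<forall>p\<in>P \<inter> {0..1}. (x \<le> p) = (y \<le> p)"
  have "\<forall>p\<in>P. (x \<le> p) = (y \<le> p)"
  proof
    fix p assume "p \<in> P"
    then show "(x \<le> p) = (y \<le> p)"
      using xy by (cases "p \<in> {0..1}") auto
  qed
  then have "(x \<in> A) = (y \<in> A)" using * xy(1,2) by blast
  then show "x \<in> A \<Longrightarrow> y \<in> A" "y \<in> A \<Longrightarrow> x \<in> A" by blast+
qed

definition alg :: "real set \<Rightarrow> bool" where
  "alg A \<longleftrightarrow> (\<exists>P. finite P \<and> meas P A)"

lemma alg_meas: "\<lbrakk>finite P; meas P A\<rbrakk> \<Longrightarrow> alg A"
  unfolding alg_def by blast

lemma alg2: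
  assumes "alg A" "alg B"
  obtains P where "finite P" "{0, 1} \<subseteq> P" "P \<subseteq> {0..1}" "meas P A" "meas P B"
proof -
  obtain P P' where P: "finite P" "meas P A" "finite P'" "meas P' B" using assms alg_def by auto
  define R where "R = {0, 1} \<union> ((P \<union> P') \<inter> {0..1})"
  have sub: "P \<inter> {0..1} \<subseteq> R" "P' \<inter> {0..1} \<subseteq> R" unfolding R_def by auto
  have "meas R A" "meas R B"
    using meas_mono[OF meas_unit[OF P(2)] sub(1)] meas_mono[OF meas_unit[OF P(4)] sub(2)] .
  moreover have "finite R" "{0, 1} \<subseteq> R" "R \<subseteq> {0..1}" using P R_def by auto
  ultimately show thesis using that by blast
qed

lemma alg_Un: "\<lbrakk>alg A; alg B\<rbrakk> \<Longrightarrow> alg (A \<union> B)"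
  by (erule alg2) (auto intro: alg_meas)

lemma alg_Diff: "\<lbrakk>alg A; alg B\<rbrakk> \<Longrightarrow> alg (A - B)"
  by (erule alg2) (auto intro: alg_meas)

lemma alg_empty [simp]: "alg {}"
  unfolding alg_def by (rule exI[of _ "{}"]) auto

lemma alg_UN: "\<lbrakk>finite I; \<And>i. i \<in> I \<Longrightarrow> alg (A i)\<rbrakk> \<Longrightarrow> alg (\<Union>i\<in>I. A i)"
  by (induction I rule: finite_induct) (auto intro: alg_Un)

subsection \<open>Cut strategies against an adversary\<close>

locale agents =
  fixes G :: "nat set"
begin

text \<open>A strategy only reacts to the cut points that it is given, so divisibility enters
  through the answers and not through the profiles.\<close>

definition prof :: "(nat \<Rightarrow> real set \<Rightarrow> real) \<Rightarrow> bool" where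
  "prof m \<longleftrightarrow> (\<forall>i\<in>G. (\<forall>A. alg A \<longrightarrow> 0 \<le> m i A) \<and>
     (\<forall>A B. alg A \<longrightarrow> alg B \<longrightarrow> A \<inter> B = {} \<longrightarrow> m i (A \<union> B) = m i A + m i B))"

definition agree :: "real set \<Rightarrow> (nat \<Rightarrow> real set \<Rightarrow> real) \<Rightarrow> (nat \<Rightarrow> real set \<Rightarrow> real) \<Rightarrow> bool" where
  "agree P m m' \<longleftrightarrow> (\<forall>i\<in>G. \<forall>A. meas P A \<longrightarrow> m' i A = m i A)"

definition st :: "real set \<Rightarrow> (nat \<Rightarrow> real set \<Rightarrow> real) \<Rightarrow> bool" where
  "st P m \<longleftrightarrow> finite P \<and> {0, 1} \<subseteq> P \<and> P \<subseteq> {0..1} \<and> prof m"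

text \<open>\<open>can Q K P m\<close>: by at most \<open>K\<close> cuts one can force \<open>Q\<close>, starting from the cut points \<open>P\<close>.
  Only the values of the sets generated by the current cut points are known, so the adversary may
  replace the profile by any other one with the same values on these sets before answering.\<close>

inductive can :: "(real set \<Rightarrow> (nat \<Rightarrow> real set \<Rightarrow> real) \<Rightarrow> bool) \<Rightarrow> nat \<Rightarrow> real set \<Rightarrow>
    (nat \<Rightarrow> real set \<Rightarrow> real) \<Rightarrow> bool" for Q where
  can_done: "(\<And>m'. prof m' \<Longrightarrow> agree P m m' \<Longrightarrow> Q P m') \<Longrightarrow> can Q K P m"
| can_step: "i \<in> G \<Longrightarrow> meas P A \<Longrightarrow> 0 \<le> r \<Longrightarrow> r \<le> m i A \<Longrightarrow>
    (\<And>m' y. prof m' \<Longrightarrow> agree P m m' \<Longrightarrow> y \<in> {0..1} \<Longrightarrow> m' i (A \<inter> {..y}) = r \<Longrightarrow>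
       can Q K (insert y P) m') \<Longrightarrow> can Q (Suc K) P m"

lemma agree_refl [simp]: "agree P m m"
  unfolding agree_def by auto

lemma agree_sym: "agree P m m' \<Longrightarrow> agree P m' m"
  unfolding agree_def by auto

lemma agree_trans: "agree P m m' \<Longrightarrow> agree P m' m'' \<Longrightarrow> agree P m m''"
  unfolding agree_def by auto

lemma agree_mono: "agree P' m m' \<Longrightarrow> P \<subseteq> P' \<Longrightarrow> agree P m m'"
  unfolding agree_def using meas_mono by blast

lemma agreeD: "agree P m m' \<Longrightarrow> meas P A \<Longrightarrow> i \<in> G \<Longrightarrow> m' i A = m i A"
  unfolding agree_def by auto

lemma st_alg: "st P m \<Longrightarrow> meas P A \<Longrightarrow> alg A"
  unfolding st_def using alg_meas by blast

lemma st_insert: "st P m \<Longrightarrow> y \<in> {0..1} \<Longrightarrow> prof m' \<Longrightarrow> st (insert y P) m'"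
  unfolding st_def by auto

lemma can_mono: "can Q K P m \<Longrightarrow> K \<le> K' \<Longrightarrow> can Q K' P m"
proof (induction arbitrary: K' rule: can.induct)
  case (can_step i P A r m K)
  then obtain K'' where "K' = Suc K''" "K \<le> K''" by (cases K') auto
  then show ?case using can_step can.can_step by auto
qed (auto intro: can_done)

text \<open>Sequential composition; the second strategy may depend on all answers to the
  first.\<close>

lemma can_bind:
  assumes "can Q1 K1 P m" "st P m"
    and "\<And>P' m'. \<lbrakk>st P' m'; P \<subseteq> P'; agree P m m'; Q1 P' m'\<rbrakk> \<Longrightarrow> can Q2 K2 P' m'"
  shows "can Q2 (K1 + K2) P m"
proof -
  have "can Q1 K1 P' m' \<Longrightarrow> st P' m' \<Longrightarrow> P \<subseteq> P' \<Longrightarrow> agree P m m' \<Longrightarrow> can Q2 (K1 + K2) P' m'" for P' m'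
  proof (induction rule: can.induct)
    case (can_done P' m' K)
    have "Q1 P' m'" using can_done unfolding st_def by auto
    then have "can Q2 K2 P' m'" using assms(3) can_done by blast
    then show ?case using can_mono by fastforce
  next
    case (can_step i P' A r m' K)
    have "can Q2 (Suc (K + K2)) P' m'"
    proof (rule can.can_step)
      fix m'' y
      assume y: "prof m''" "agree P' m' m''" "y \<in> {0..1}" "m'' i (A \<inter> {..y}) = r"
      show "can Q2 (K + K2) (insert y P') m''"
        by (rule can_step.IH) (use y can_step.prems st_insert agree_mono[of P' m' m'' P] agree_trans in blast)+
    qed (use can_step in auto)
    then show ?case by simp
  qed
  then show ?thesis using assms(1,2) by auto
qed

lemma can_I:
  assumes "st P m" "\<And>m'. st P m' \<Longrightarrow> agree P m m' \<Longrightarrow> Q P m'" shows "can Q K P m"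
  by (rule can_done) (use assms in \<open>auto simp: st_def\<close>)

text \<open>At a leaf the adversary may still choose among all profiles with the known values. Hence
  \<open>Q1\<close> is strengthened to its closure under such changes before \<open>Q2\<close> is
  derived for each of them.\<close>

lemma can_conseq:
  assumes "can Q1 K1 P m" "st P m" "K1 \<le> K2"
    and "\<And>P' m'. \<lbrakk>st P' m'; P \<subseteq> P'; agree P m m'; Q1 P' m'\<rbrakk> \<Longrightarrow> Q2 P' m'"
  shows "can Q2 K2 P m"
proof -
  have 1: "can (\<lambda>P' m'. Q1 P' m' \<and> (\<forall>m''. prof m'' \<longrightarrow> agree P' m' m'' \<longrightarrow> Q1 P' m'')) K1 P m"
    using assms(1)
  proof (induction rule: can.induct)
    case (can_done P m K)
    then show ?case by (intro can.can_done) (blast intro: agree_trans)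
  next
    case (can_step i P A r m K)
    then show ?case by (intro can.can_step[of i P A r]) auto
  qed
  have "can Q2 (K1 + 0) P m"
  proof (rule can_bind[OF 1 assms(2)])
    fix P' m' assume *: "st P' m'" "P \<subseteq> P'" "agree P m m'"
      "Q1 P' m' \<and> (\<forall>m''. prof m'' \<longrightarrow> agree P' m' m'' \<longrightarrow> Q1 P' m'')"
    show "can Q2 0 P' m'"
    proof (rule can_I[OF *(1)])
      fix m'' assume **: "st P' m''" "agree P' m' m''"
      have "agree P m m''" using * ** agree_mono agree_trans by blast
      moreover have "Q1 P' m''" using * ** unfolding st_def by blast
      ultimately show "Q2 P' m''" using assms(4) * ** by blast
    qed
  qed
  then show ?thesis using can_mono assms(3) by force
qed

lemma can_iter:
  assumes "st P m" "\<And>m'. st P m' \<Longrightarrow> agree P m m' \<Longrightarrow> I 0 P m'"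
    and "\<And>t P' m'. \<lbrakk>t < T; st P' m'; P \<subseteq> P'; agree P m m'; I t P' m'\<rbrakk> \<Longrightarrow> can (I (Suc t)) K P' m'"
  shows "can (I (T::nat)) (T * K) P m"
  using assms(3)
proof (induction T)
  case 0
  show ?case using can_I assms(1,2) by simp
next
  case (Suc T)
  have "can (I T) (T * K) P m" by (rule Suc.IH) (use Suc.prems in auto)
  from can_bind[OF this assms(1), of "I (Suc T)" K] show ?case
    using Suc.prems[of T] by (simp add: add.commute)
qed

context
  fixes m i assumes m: "prof m" and i: "i \<in> G"
begin

lemma m_nonneg: "alg A \<Longrightarrow> 0 \<le> m i A"
  using m i unfolding prof_def by blast

lemma m_Un: "alg A \<Longrightarrow> alg B \<Longrightarrow> A \<inter> B = {} \<Longrightarrow> m i (A \<union> B) = m i A + m i B"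
  using m i unfolding prof_def by blast

lemma m_empty: "m i {} = 0"
  using m_Un[of "{}" "{}"] by simp

lemma m_Diff: "alg A \<Longrightarrow> alg B \<Longrightarrow> B \<subseteq> A \<Longrightarrow> m i (A - B) = m i A - m i B"
  using m_Un[of B "A - B"] alg_Diff[of A B] by (simp add: Un_absorb1)

lemma m_mono: "alg A \<Longrightarrow> alg B \<Longrightarrow> B \<subseteq> A \<Longrightarrow> m i B \<le> m i A"
  using m_Diff[of A B] m_nonneg[of "A - B"] alg_Diff by force

lemma m_UN:
  assumes "finite I" "\<And>s. s \<in> I \<Longrightarrow> alg (A s)" "disjoint_family_on A I"
  shows "m i (\<Union>s\<in>I. A s) = (\<Sum>s\<in>I. m i (A s))"
  using assms
proof (induction I rule: finite_induct)
  case (insert x F)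
  have "m i (A x \<union> (\<Union>s\<in>F. A s)) = m i (A x) + m i (\<Union>s\<in>F. A s)"
  proof (rule m_Un)
    show "A x \<inter> (\<Union>s\<in>F. A s) = {}"
    proof -
      have "A x \<inter> A s = {}" if "s \<in> F" for s
        using disjoint_family_onD[OF insert.prems(2), of x s] that insert.hyps(2) by fastforce
      then show ?thesis by auto
    qed
  qed (use insert alg_UN in auto)
  then show ?case using insert by (simp add: disjoint_family_on_def)
qed (auto simp: m_empty)

lemma m_split: "finite P \<Longrightarrow> meas P A \<Longrightarrow> y \<in> P \<Longrightarrow> m i (A \<inter> {..y}) + m i (A \<inter> {y<..}) = m i A"
proof -
  assume a: "finite P" "meas P A" "y \<in> P"
  have "A = (A \<inter> {..y}) \<union> (A \<inter> {y<..})" by auto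
  moreover have "m i ((A \<inter> {..y}) \<union> (A \<inter> {y<..})) = m i (A \<inter> {..y}) + m i (A \<inter> {y<..})"
    using a by (intro m_Un alg_meas[OF a(1)]) auto
  ultimately show ?thesis by simp
qed

end

end

section \<open>Lexicographic pairs of reals\<close>

datatype lex = Lex (major: real) (minor: real)

instantiation lex :: linorder
begin
definition less_lex :: "lex \<Rightarrow> lex \<Rightarrow> bool" where
  "a < b \<longleftrightarrow> major a < major b \<or> major a = major b \<and> minor a < minor b"
definition less_eq_lex :: "lex \<Rightarrow> lex \<Rightarrow> bool" where
  "a \<le> b \<longleftrightarrow> major a < major b \<or> major a = major b \<and> minor a \<le> minor b"
instance
  by standard (auto simp: less_lex_def less_eq_lex_def intro: lex.expand)
end

lemma major_mono: "a \<le> b \<Longrightarrow> major a \<le> major b"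
  by (auto simp: less_eq_lex_def)

lemma finite_real_sep:
  fixes L R :: "real set"
  assumes "finite L" "finite R" "\<And>a b. a \<in> L \<Longrightarrow> b \<in> R \<Longrightarrow> a < b"
  shows "\<exists>h. (\<forall>a\<in>L. a < h) \<and> (\<forall>b\<in>R. h < b)"
proof (cases "L = {}")
  case True
  show ?thesis
  proof (cases "R = {}")
    case False
    have "Min R - 1 < b" if "b \<in> R" for b
      using Min_le[OF assms(2) that] by linarith
    then show ?thesis using True by auto
  qed (use True in auto)
next
  case L: False
  show ?thesis
  proof (cases "R = {}")
    case True
    have "a < Max L + 1" if "a \<in> L" for a
      using Max_ge[OF assms(1) that] by linarith
    then show ?thesis using True by auto
  next
    case False
    then have "Max L < Min R" using assms L by auto
    then obtain h where h: "Max L < h" "h < Min R" using dense by blast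
    have "a < h" if "a \<in> L" for a using Max_ge[OF assms(1) that] h by linarith
    moreover have "h < b" if "b \<in> R" for b using Min_le[OF assms(2) that] h by linarith
    ultimately show ?thesis by blast
  qed
qed

text \<open>Only elements whose major coordinate is \<open>c\<close> restrict the minor coordinate,
  and the reals are dense and unbounded. So the major coordinate of the separating element can be
  prescribed.\<close>

lemma lex_sep:
  assumes "finite L" "finite R" "\<And>a b. a \<in> L \<Longrightarrow> b \<in> R \<Longrightarrow> a < b"
    and "\<And>a. a \<in> L \<Longrightarrow> major a \<le> c" "\<And>b. b \<in> R \<Longrightarrow> c \<le> major b"
  shows "\<exists>h. (\<forall>a\<in>L. a < Lex c h) \<and> (\<forall>b\<in>R. Lex c h < b)"
proof -
  have "\<exists>h. (\<forall>a\<in>minor ` {a \<in> L. major a = c}. a < h) \<and> (\<forall>b\<in>minor ` {b \<in> R. major b = c}. h < b)"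
  proof (rule finite_real_sep)
    fix a b assume "a \<in> minor ` {a \<in> L. major a = c}" "b \<in> minor ` {b \<in> R. major b = c}"
    then show "a < b" using assms(3) by (fastforce simp: less_lex_def)
  qed (use assms in auto)
  then obtain h where h: "\<forall>a\<in>{a \<in> L. major a = c}. minor a < h" "\<forall>b\<in>{b \<in> R. major b = c}. h < minor b"
    by auto
  have "a < Lex c h" if "a \<in> L" for a
    using h(1) assms(4)[OF that] that by (auto simp: less_lex_def)
  moreover have "Lex c h < b" if "b \<in> R" for b
    using h(2) assms(5)[OF that] that by (auto simp: less_lex_def)
  ultimately show ?thesis by blast
qed

lemma le_gt_Un: "(A \<inter> {..y}) \<union> (A \<inter> {y<..}) = (A :: real set)"
  by (rule set_eqI, simp, meson not_le)

lemma disjoint_insert: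
  assumes "disjoint_family_on Z I" "x \<notin> I" "\<And>j. j \<in> I \<Longrightarrow> Z j \<inter> B = {}"
  shows "disjoint_family_on (Z(x := B)) (insert x I)"
  unfolding disjoint_family_on_def
proof (intro ballI impI)
  fix k l assume kl: "k \<in> insert x I" "l \<in> insert x I" "k \<noteq> l"
  show "(Z(x := B)) k \<inter> (Z(x := B)) l = {}"
    using kl assms(2) assms(3)[of k] assms(3)[of l] disjoint_family_onD[OF assms(1), of k l]
    by (cases "k = x"; cases "l = x") auto
qed

section \<open>Smallest marks and equal parts\<close>

context agents
begin

lemma st_prof: "st P m \<Longrightarrow> prof m"
  unfolding st_def by auto

lemma st_m_mono: "\<lbrakk>st P m; i \<in> G; meas P A; meas P B; B \<subseteq> A\<rbrakk> \<Longrightarrow> m i B \<le> m i A"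
  using m_mono[OF st_prof] st_alg by blast

lemma st_nonneg: "\<lbrakk>st P m; i \<in> G; meas P A\<rbrakk> \<Longrightarrow> 0 \<le> m i A"
  using m_nonneg[OF st_prof] st_alg by blast

lemma cut:
  assumes st: "st P m" and "i \<in> G" "meas P A" "0 \<le> r" "r \<le> m i A"
  shows "can (\<lambda>P' m'. \<exists>y\<in>P'. m' i (A \<inter> {..y}) = r) 1 P m"
proof -
  have "can (\<lambda>P' m'. \<exists>y\<in>P'. m' i (A \<inter> {..y}) = r) (Suc 0) P m"
  proof (rule can_step[where i = i and m = m and A = A and r = r])
    fix m' y assume *: "prof m'" "agree P m m'" "y \<in> {0..1}" "m' i (A \<inter> {..y}) = r"
    have st': "st (insert y P) m'" using st_insert[OF st] * by auto
    have me: "meas (insert y P) (A \<inter> {..y})"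
      using meas_mono[OF assms(3), of "insert y P"] by (intro meas_le) auto
    show "can (\<lambda>P' m'. \<exists>y\<in>P'. m' i (A \<inter> {..y}) = r) 0 (insert y P) m'"
      by (rule can_I[OF st']) (use * agreeD[OF _ me assms(2)] in auto)
  qed (use assms in auto)
  then show ?thesis by simp
qed

text \<open>Last diminisher: an agent to whom the current prefix is worth too much shortens it to
  its own mark. Shortening keeps the prefix acceptable to the agents asked before.\<close>

lemma min_mark:
  assumes "finite I" "I \<noteq> {}" "I \<subseteq> G" "st P m" "meas P A" "\<And>i. i \<in> I \<Longrightarrow> 0 \<le> g i \<and> g i \<le> m i A"
  shows "can (\<lambda>P' m'. \<exists>b\<in>I. \<exists>y\<in>P'. m' b (A \<inter> {..y}) = g b \<and> (\<forall>i\<in>I. m' i (A \<inter> {..y}) \<le> g i)) (card I) P m"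
  using assms
proof (induction I rule: finite_ne_induct)
  case (singleton i)
  then have "can (\<lambda>P' m'. \<exists>y\<in>P'. m' i (A \<inter> {..y}) = g i) 1 P m" by (intro cut) auto
  then show ?case by (rule can_conseq[OF _ singleton.prems(2)]) auto
next
  case (insert i F)
  let ?Q = "\<lambda>I P' m'. \<exists>b\<in>I. \<exists>y\<in>P'. m' b (A \<inter> {..y}) = g b \<and> (\<forall>i\<in>I. m' i (A \<inter> {..y}) \<le> g i)"
  have iG: "i \<in> G" "F \<subseteq> G" using insert.prems by auto
  have "can (?Q F) (card F) P m" using insert by auto
  then have "can (?Q (insert i F)) (card F + 1) P m"
  proof (rule can_bind[OF _ insert.prems(2)])
    fix P' m' assume st': "st P' m'" and sub: "P \<subseteq> P'" "agree P m m'" and "?Q F P' m'"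
    then obtain b y where b: "b \<in> F" "y \<in> P'" "m' b (A \<inter> {..y}) = g b" "\<forall>i\<in>F. m' i (A \<inter> {..y}) \<le> g i"
      by blast
    have me: "meas P' (A \<inter> {..y})" using meas_mono[OF insert.prems(3) sub(1)] b(2) by auto
    show "can (?Q (insert i F)) 1 P' m'"
    proof (cases "m' i (A \<inter> {..y}) \<le> g i")
      case True
      show ?thesis
      proof (rule can_I[OF st'])
        fix m'' assume "agree P' m' m''"
        then have "m'' k (A \<inter> {..y}) = m' k (A \<inter> {..y})" if "k \<in> G" for k
          using agreeD me that by blast
        then show "?Q (insert i F) P' m''"
          using True b iG by (intro bexI[of _ b] bexI[of _ y]) auto
      qed
    next
      case False
      have "can (\<lambda>P' m'. \<exists>y'\<in>P'. m' i (A \<inter> {..y} \<inter> {..y'}) = g i) 1 P' m'"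
        by (rule cut[OF st' iG(1) me]) (use False insert.prems(4)[of i] in auto)
      then show ?thesis
      proof (rule can_conseq[OF _ st'])
        fix P'' m'' assume st'': "st P'' m''" and sub': "P' \<subseteq> P''" "agree P' m' m''"
          and "\<exists>y'\<in>P''. m'' i (A \<inter> {..y} \<inter> {..y'}) = g i"
        then obtain y' where y': "y' \<in> P''" "m'' i (A \<inter> {..y} \<inter> {..y'}) = g i" by blast
        have eq: "A \<inter> {..y} \<inter> {..y'} = A \<inter> {..min y y'}" by auto
        have me': "meas P'' (A \<inter> {..y})" "meas P'' (A \<inter> {..y} \<inter> {..y'})"
          using meas_mono[OF me sub'(1)] y' by auto
        have "m'' k (A \<inter> {..min y y'}) \<le> g k" if "k \<in> F" for k
        proof -
          have kG: "k \<in> G" using that iG by auto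
          have "m'' k (A \<inter> {..y} \<inter> {..y'}) \<le> m'' k (A \<inter> {..y})"
            by (rule st_m_mono[OF st'' kG me']) auto
          also have "\<dots> = m' k (A \<inter> {..y})" using agreeD[OF sub'(2) me kG] .
          finally show ?thesis using b(4) that eq by auto
        qed
        moreover have "min y y' \<in> P''" using y' b sub' by (auto simp: min_def)
        ultimately show "?Q (insert i F) P'' m''"
          using y' eq by (intro bexI[of _ i] bexI[of _ "min y y'"]) auto
      qed simp
    qed
  qed
  then show ?case using insert.hyps by simp
qed

lemma equal_cut:
  assumes "st P m" "c \<in> G" "meas P A" "0 \<le> l" "m c A = real (Suc q) * l"
  shows "can (\<lambda>P' m'. \<exists>Z. (\<forall>j<Suc q. meas P' (Z j) \<and> m' c (Z j) = l) \<and>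
    disjoint_family_on Z {..<Suc q} \<and> (\<Union>j<Suc q. Z j) = A) q P m"
  using assms
proof (induction q arbitrary: P m A)
  case 0
  show ?case
  proof (rule can_I[OF 0(1)])
    fix m' assume "agree P m m'"
    then have "m' c A = l" using agreeD[of P m m' A c] 0 by simp
    then show "\<exists>Z. (\<forall>j<Suc 0. meas P (Z j) \<and> m' c (Z j) = l) \<and>
       disjoint_family_on Z {..<Suc 0} \<and> (\<Union>j<Suc 0. Z j) = A"
      using 0 by (intro exI[of _ "\<lambda>_. A"]) (auto simp: disjoint_family_on_def)
  qed
next
  case (Suc q)
  let ?Q = "\<lambda>A q P' m'. \<exists>Z. (\<forall>j<Suc q. meas P' (Z j) \<and> m' c (Z j) = l) \<and>
    disjoint_family_on Z {..<Suc q} \<and> (\<Union>j<Suc q. Z j) = A"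
  have "l \<le> m c A" using Suc.prems(4,5) by (simp add: algebra_simps)
  from cut[OF Suc.prems(1-4) this]
  have "can (?Q A (Suc q)) (1 + q) P m"
  proof (rule can_bind[OF _ Suc.prems(1)])
    fix P' m' assume st': "st P' m'" and sub: "P \<subseteq> P'" "agree P m m'" and "\<exists>y\<in>P'. m' c (A \<inter> {..y}) = l"
    then obtain y where y: "y \<in> P'" "m' c (A \<inter> {..y}) = l" by blast
    have me: "meas P' A" using meas_mono[OF Suc.prems(3) sub(1)] .
    have me': "meas P' (A \<inter> {..y})" "meas P' (A \<inter> {y<..})" using me y by auto
    have "m' c A = m c A" using agreeD[OF sub(2) Suc.prems(3,2)] .
    moreover have "m' c (A \<inter> {..y}) + m' c (A \<inter> {y<..}) = m' c A"
      using m_split[OF st_prof[OF st'] Suc.prems(2) _ me y(1)] st' st_def by auto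
    ultimately have v: "m' c (A \<inter> {y<..}) = real (Suc q) * l"
      using Suc.prems(5) y by (simp add: algebra_simps)
    from Suc.IH[OF st' Suc.prems(2) me'(2) Suc.prems(4) v]
    show "can (?Q A (Suc q)) q P' m'"
    proof (rule can_conseq[OF _ st'])
      fix P'' m'' assume st'': "st P'' m''" and sub': "P' \<subseteq> P''" "agree P' m' m''"
        and "?Q (A \<inter> {y<..}) q P'' m''"
      then obtain Z where Z: "\<forall>j<Suc q. meas P'' (Z j) \<and> m'' c (Z j) = l"
        "disjoint_family_on Z {..<Suc q}" "(\<Union>j<Suc q. Z j) = A \<inter> {y<..}" by blast
      have "m'' c (A \<inter> {..y}) = l" using agreeD[OF sub'(2) me'(1) Suc.prems(2)] y by simp
      moreover have "meas P'' (A \<inter> {..y})" using meas_mono[OF me'(1) sub'(1)] .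
      moreover have "disjoint_family_on (Z(Suc q := A \<inter> {..y})) {..<Suc (Suc q)}"
      proof -
        have "Z j \<inter> (A \<inter> {..y}) = {}" if "j < Suc q" for j
        proof -
          have "Z j \<subseteq> A \<inter> {y<..}" using that Z(3) by blast
          then show ?thesis by auto
        qed
        then show ?thesis
          using disjoint_insert[OF Z(2), of "Suc q" "A \<inter> {..y}"] by (simp add: lessThan_Suc[of "Suc q"])
      qed
      moreover have "(\<Union>j<Suc (Suc q). (Z(Suc q := A \<inter> {..y})) j) = A"
      proof -
        have "(\<Union>j<Suc (Suc q). (Z(Suc q := A \<inter> {..y})) j) =
          (A \<inter> {..y}) \<union> (\<Union>j<Suc q. (Z(Suc q := A \<inter> {..y})) j)"
          by (simp only: lessThan_Suc[of "Suc q"] UN_insert fun_upd_same)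
        also have "(\<Union>j<Suc q. (Z(Suc q := A \<inter> {..y})) j) = (\<Union>j<Suc q. Z j)"
          by (rule SUP_cong) auto
        finally show ?thesis using Z(3) le_gt_Un by simp
      qed
      ultimately show "?Q A (Suc q) P'' m''"
        using Z(1) by (intro exI[of _ "Z(Suc q := A \<inter> {..y})"]) (auto simp: less_Suc_eq)
    qed simp
  qed
  then show ?case by simp
qed

section \<open>Marks with fictitious coordinates\<close>

definition util :: "(nat \<Rightarrow> real set) \<Rightarrow> (nat \<Rightarrow> real set \<Rightarrow> real) \<Rightarrow> (nat \<Rightarrow> nat \<Rightarrow> lex \<Rightarrow> real) \<Rightarrow>
    nat \<Rightarrow> nat \<Rightarrow> lex \<Rightarrow> lex" where
  "util A m H i j x = Lex (m i (A j \<inter> {major x<..})) (H i j x)"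

text \<open>A position \<open>x\<close> stands for the trim \<open>A j \<inter> {major x<..}\<close>. The second components of positions
  and utilities are fictitious: they are chosen when a mark is inserted, so that utilities stay
  strictly monotone even where an agent has value zero.\<close>

definition grid :: "nat set \<Rightarrow> nat set \<Rightarrow> (nat \<Rightarrow> real set) \<Rightarrow> real set \<Rightarrow> (nat \<Rightarrow> real set \<Rightarrow> real) \<Rightarrow>
    (nat \<Rightarrow> lex set) \<Rightarrow> (nat \<Rightarrow> nat \<Rightarrow> lex \<Rightarrow> real) \<Rightarrow> bool" where
  "grid B J A P m X H \<longleftrightarrow> (\<forall>j\<in>J. finite (X j) \<and> (\<forall>x\<in>X j. major x \<in> P)) \<and>
     (\<forall>i\<in>B. \<forall>j\<in>J. \<forall>x\<in>X j. \<forall>y\<in>X j. x < y \<longrightarrow> util A m H i j y < util A m H i j x)"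

text \<open>Later marks leave the tie-breakers of earlier ones alone, so that equalities of
  utilities, once established, survive.\<close>

definition ext :: "nat set \<Rightarrow> nat set \<Rightarrow> (nat \<Rightarrow> lex set) \<Rightarrow> (nat \<Rightarrow> nat \<Rightarrow> lex \<Rightarrow> real) \<Rightarrow>
    (nat \<Rightarrow> lex set) \<Rightarrow> (nat \<Rightarrow> nat \<Rightarrow> lex \<Rightarrow> real) \<Rightarrow> bool" where
  "ext B J X H X' H' \<longleftrightarrow> (\<forall>j\<in>J. X j \<subseteq> X' j) \<and> (\<forall>i\<in>B. \<forall>j\<in>J. \<forall>x\<in>X j. H' i j x = H i j x)"

lemma ext_refl: "ext B J X H X H"
  unfolding ext_def by auto

lemma ext_trans: "ext B J X H X' H' \<Longrightarrow> ext B J X' H' X'' H'' \<Longrightarrow> ext B J X H X'' H''"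
  unfolding ext_def by (intro conjI ballI) (blast, simp add: subset_iff)

lemma util_agree:
  assumes "agree P m m'" "meas P (A j)" "i \<in> G" "major x \<in> P"
  shows "util A m' H i j x = util A m H i j x"
proof -
  have "m' i (A j \<inter> {major x<..}) = m i (A j \<inter> {major x<..})"
    using assms by (intro agreeD[OF assms(1)]) auto
  then show ?thesis unfolding util_def by simp
qed

lemma util_ext:
  "\<lbrakk>ext B J X H X' H'; i \<in> B; j \<in> J; x \<in> X j\<rbrakk> \<Longrightarrow> util A m H' i j x = util A m H i j x"
  unfolding util_def ext_def by simp

lemma grid_agree:
  assumes "agree P m m'" "P \<subseteq> P'" "\<And>j. j \<in> J \<Longrightarrow> meas P (A j)" "B \<subseteq> G" "grid B J A P m X H"
  shows "grid B J A P' m' X H"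
proof -
  have "util A m' H i j x = util A m H i j x" if "i \<in> B" "j \<in> J" "x \<in> X j" for i j x
    by (rule util_agree[where A = A and j = j and P = P])
       (use assms that in \<open>auto simp: grid_def\<close>)
  then show ?thesis using assms(2,5) unfolding grid_def by auto
qed

text \<open>The point \<open>y\<close> separates the positions that \<open>i\<close> prefers to
  \<open>u\<close> from those that it likes less. The tie-breaker of the new position is chosen
  between them, and likewise, for every other agent, the tie-breaker of its utility. For
  \<open>i\<close> itself the latter has to be \<open>minor u\<close>.\<close>

lemma insert_position:
  assumes g: "grid B J A P m X H" and st: "st P m" and BG: "B \<subseteq> G" and me: "\<And>j. j \<in> J \<Longrightarrow> meas P (A j)"
    and i: "i \<in> B" and j: "j \<in> J" and y: "y \<in> P" "m i (A j \<inter> {y<..}) = major u"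
    and new: "\<And>x. x \<in> X j \<Longrightarrow> util A m H i j x \<noteq> u"
    and lo: "\<And>x. x \<in> X j \<Longrightarrow> u < util A m H i j x \<Longrightarrow> major x \<le> y"
    and hi: "\<And>x. x \<in> X j \<Longrightarrow> util A m H i j x < u \<Longrightarrow> y \<le> major x"
  shows "\<exists>X' H'. grid B J A P m X' H' \<and> ext B J X H X' H' \<and> (\<exists>z\<in>X' j. util A m H' i j z = u) \<and>
    (\<forall>j'. j' \<noteq> j \<longrightarrow> X' j' = X j') \<and> (\<exists>z. X' j = insert z (X j))"
proof -
  define Lo where "Lo = {x \<in> X j. u < util A m H i j x}"
  define Hi where "Hi = {x \<in> X j. util A m H i j x < u}"
  have fin: "finite (X j)" and sub: "\<And>x. x \<in> X j \<Longrightarrow> major x \<in> P" using g j unfolding grid_def by auto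
  have strict: "util A m H k j x' < util A m H k j x" if "k \<in> B" "x \<in> X j" "x' \<in> X j" "x < x'" for k x x'
    using g that j unfolding grid_def by blast
  have LH: "Lo \<union> Hi = X j" unfolding Lo_def Hi_def using new by (auto simp: neq_iff)
  have LoHi: "a < b" if "a \<in> Lo" "b \<in> Hi" for a b
  proof (rule ccontr)
    assume "\<not> a < b"
    then have "util A m H i j a \<le> util A m H i j b"
      using strict[OF i, of b a] that unfolding Lo_def Hi_def by (cases "a = b") (auto simp: not_less order_less_le)
    then show False using that unfolding Lo_def Hi_def by (auto dest: order.strict_trans)
  qed
  have "\<exists>h. (\<forall>a\<in>Lo. a < Lex y h) \<and> (\<forall>b\<in>Hi. Lex y h < b)"
  proof (rule lex_sep)
    show "finite Lo" "finite Hi" using fin by (auto simp: Lo_def Hi_def)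
    show "a < b" if "a \<in> Lo" "b \<in> Hi" for a b using LoHi that .
    show "major a \<le> y" if "a \<in> Lo" for a using lo that by (simp add: Lo_def)
    show "y \<le> major b" if "b \<in> Hi" for b using hi that by (simp add: Hi_def)
  qed
  then obtain h where h: "\<And>a. a \<in> Lo \<Longrightarrow> a < Lex y h" "\<And>b. b \<in> Hi \<Longrightarrow> Lex y h < b" by blast
  define z where "z = Lex y h"
  have zX: "z \<notin> X j" using h LH z_def by blast
  have "\<exists>w. (\<forall>a\<in>Lo. Lex (m k (A j \<inter> {y<..})) w < util A m H k j a) \<and>
      (\<forall>b\<in>Hi. util A m H k j b < Lex (m k (A j \<inter> {y<..})) w) \<and> (k = i \<longrightarrow> w = minor u)" if k: "k \<in> B" for k
  proof (cases "k = i")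
    case True
    then have "Lex (m k (A j \<inter> {y<..})) (minor u) = u" using y by simp
    then show ?thesis using True by (intro exI[of _ "minor u"]) (auto simp: Lo_def Hi_def)
  next
    case False
    have kG: "k \<in> G" using k BG by auto
    have mono: "m k (A j \<inter> {s<..}) \<le> m k (A j \<inter> {r<..})" if "r \<in> P" "s \<in> P" "r \<le> s" for r s
      by (rule st_m_mono[OF st kG]) (use me[OF j] that in auto)
    have "\<exists>w. (\<forall>b\<in>util A m H k j ` Hi. b < Lex (m k (A j \<inter> {y<..})) w) \<and>
      (\<forall>a\<in>util A m H k j ` Lo. Lex (m k (A j \<inter> {y<..})) w < a)"
    proof (rule lex_sep)
      fix a b assume "a \<in> util A m H k j ` Hi" "b \<in> util A m H k j ` Lo"
      then show "a < b" using strict[OF k] LoHi LH by blast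
    next
      fix a assume "a \<in> util A m H k j ` Hi"
      then show "major a \<le> m k (A j \<inter> {y<..})"
        using hi mono y(1) sub by (auto simp: Hi_def util_def)
    next
      fix a assume "a \<in> util A m H k j ` Lo"
      then show "m k (A j \<inter> {y<..}) \<le> major a"
        using lo mono y(1) sub by (auto simp: Lo_def util_def)
    qed (use fin in \<open>auto simp: Lo_def Hi_def\<close>)
    then show ?thesis using False by blast
  qed
  then obtain w where w: "\<And>k a. k \<in> B \<Longrightarrow> a \<in> Lo \<Longrightarrow> Lex (m k (A j \<inter> {y<..})) (w k) < util A m H k j a"
      "\<And>k b. k \<in> B \<Longrightarrow> b \<in> Hi \<Longrightarrow> util A m H k j b < Lex (m k (A j \<inter> {y<..})) (w k)" "w i = minor u"
    using i by metis
  define H' where "H' = (\<lambda>k j' x. if j' = j \<and> x = z then w k else H k j' x)"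
  define X' where "X' = X(j := insert z (X j))"
  have uz: "util A m H' k j z = Lex (m k (A j \<inter> {y<..})) (w k)" for k
    unfolding util_def H'_def z_def by simp
  have uo: "util A m H' k j' x = util A m H k j' x" if "x \<in> X j'" for k j' x
    using that zX unfolding util_def H'_def by auto
  have "grid B J A P m X' H'"
    unfolding grid_def
  proof (intro conjI ballI impI)
    fix j' assume j': "j' \<in> J"
    show "finite (X' j')" using g j' unfolding grid_def X'_def by auto
    show "major x \<in> P" if "x \<in> X' j'" for x
      using that g j' y(1) unfolding grid_def X'_def z_def by (auto split: if_splits)
  next
    fix k j' x x' assume a: "k \<in> B" "j' \<in> J" "x \<in> X' j'" "x' \<in> X' j'" "x < x'"
    show "util A m H' k j' x' < util A m H' k j' x"
    proof (cases "j' = j \<and> (x = z \<or> x' = z)")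
      case True
      then consider "j' = j" "x = z" "x' \<in> Hi" | "j' = j" "x' = z" "x \<in> Lo"
        using a h LH z_def unfolding X'_def by (auto dest: order.asym)
      then show ?thesis
      proof cases
        case 1
        then show ?thesis using w(2)[OF a(1), of x'] uz uo[of x' j] subsetD[OF equalityD1[OF LH], of x'] by simp
      next
        case 2
        then show ?thesis using w(1)[OF a(1), of x] uz uo[of x j] subsetD[OF equalityD1[OF LH], of x] by simp
      qed
    next
      case False
      then have "x \<in> X j'" "x' \<in> X j'" using a unfolding X'_def by (auto split: if_splits)
      then show ?thesis using uo g a unfolding grid_def by auto
    qed
  qed
  moreover have "ext B J X H X' H'" unfolding ext_def X'_def H'_def using zX by auto
  moreover have "util A m H' i j z = u" using uz w(3) y(2) by simp
  ultimately show ?thesis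
    unfolding X'_def by (intro exI[of _ "X(j := insert z (X j))"] exI[of _ H']) auto
qed

text \<open>A cut has several correct answers around an interval of value zero, so a new point could
  fall on the wrong side of old positions of the same value. If such positions exist, the point of
  one of them is reused and only the tie-breakers are new. Otherwise monotonicity puts the answer in
  its place.\<close>

lemma insert_mark:
  assumes g: "grid B J A P m X H" and st: "st P m" and BG: "B \<subseteq> G" and me: "\<And>j. j \<in> J \<Longrightarrow> meas P (A j)"
    and i: "i \<in> B" and j: "j \<in> J" and x0: "x0 \<in> X j" "u \<le> util A m H i j x0" and u0: "0 \<le> major u"
  shows "can (\<lambda>P' m'. \<exists>X' H'. grid B J A P' m' X' H' \<and> ext B J X H X' H' \<and> (\<exists>z\<in>X' j. util A m' H' i j z = u) \<and>
    (\<forall>j'. j' \<noteq> j \<longrightarrow> X' j' = X j') \<and> (\<exists>z. X' j = insert z (X j))) 1 P m" (is "can ?Q 1 P m")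
proof -
  have fin: "finite (X j)" and sub: "\<And>x. x \<in> X j \<Longrightarrow> major x \<in> P" using g j unfolding grid_def by auto
  have iG: "i \<in> G" using i BG by auto
  have strict: "util A m H i j x' < util A m H i j x" if "x \<in> X j" "x' \<in> X j" "x < x'" for x x'
    using g that i j unfolding grid_def by blast
  have agr: "grid B J A P m' X H" "util A m' H i j x = util A m H i j x"
    if "agree P m m'" "x \<in> X j" for m' x
    using grid_agree[OF that(1) subset_refl me BG g]
      util_agree[where A = A and j = j, OF that(1) me[OF j] iG] sub that(2) by auto
  define Lo where "Lo = {x \<in> X j. u < util A m H i j x}"
  define Hi where "Hi = {x \<in> X j. util A m H i j x < u}"
  consider (old) "\<exists>x\<in>X j. util A m H i j x = u"
    | (near) y where "\<forall>x\<in>X j. util A m H i j x \<noteq> u" "y \<in> P" "m i (A j \<inter> {y<..}) = major u"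
        "\<forall>x\<in>Lo. major x \<le> y" "\<forall>x\<in>Hi. y \<le> major x"
    | (far) "\<forall>x\<in>X j. major (util A m H i j x) \<noteq> major u"
  proof (cases "\<exists>x\<in>X j. util A m H i j x = u \<or> (\<forall>x\<in>X j. major (util A m H i j x) \<noteq> major u)")
    case True
    then show thesis using old far by blast
  next
    case False
    then have nou: "\<forall>x\<in>X j. util A m H i j x \<noteq> u" and ex: "\<exists>x\<in>X j. major (util A m H i j x) = major u"
      using x0(1) by blast+
    \<comment> \<open>Among the positions that have the value of \<open>u\<close>, the last one
      preferred to \<open>u\<close> supplies the point, or, if there is none, the first one that is
      inferior to \<open>u\<close>.\<close>
    show thesis
    proof (cases "\<exists>x\<in>Lo. major (util A m H i j x) = major u")
      case True
      then obtain x1 where x1: "x1 \<in> Lo" "major (util A m H i j x1) = major u" by blast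
      define a where "a = Max Lo"
      have fLo: "finite Lo" using fin Lo_def by auto
      have a: "a \<in> Lo" "\<And>x. x \<in> Lo \<Longrightarrow> x \<le> a" unfolding a_def using Max_in[OF fLo] Max_ge[OF fLo] x1(1) by blast+
      have "util A m H i j a \<le> util A m H i j x1"
        using strict[of x1 a] a x1 unfolding Lo_def by (cases "x1 = a") (auto simp: order_less_le)
      then have "major (util A m H i j a) \<le> major u" using x1 major_mono by fastforce
      moreover have "major u \<le> major (util A m H i j a)" using a(1) unfolding Lo_def by (auto intro: major_mono)
      ultimately have "m i (A j \<inter> {major a<..}) = major u" unfolding util_def by simp
      moreover have "major a \<le> major x" if "x \<in> Hi" for x
      proof -
        have "\<not> x < a" using strict[of x a] that a(1) unfolding Lo_def Hi_def by auto
        then show ?thesis by (intro major_mono) simp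
      qed
      ultimately show thesis
        using near[OF nou, of "major a"] a sub major_mono unfolding Lo_def by blast
    next
      case noLo: False
      then obtain x1 where x1: "x1 \<in> Hi" "major (util A m H i j x1) = major u"
        using ex nou unfolding Lo_def Hi_def by (metis (mono_tags, lifting) linorder_neqE mem_Collect_eq)
      define a where "a = Min Hi"
      have fHi: "finite Hi" using fin Hi_def by auto
      have a: "a \<in> Hi" "\<And>x. x \<in> Hi \<Longrightarrow> a \<le> x" unfolding a_def using Min_in[OF fHi] Min_le[OF fHi] x1(1) by blast+
      have "util A m H i j x1 \<le> util A m H i j a"
        using strict[of a x1] a x1 unfolding Hi_def by (cases "x1 = a") (auto simp: order_less_le)
      then have "major u \<le> major (util A m H i j a)" using x1 major_mono by fastforce
      moreover have "major (util A m H i j a) \<le> major u" using a(1) unfolding Hi_def by (auto intro: major_mono)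
      ultimately have "m i (A j \<inter> {major a<..}) = major u" unfolding util_def by simp
      moreover have "major x \<le> major a" if "x \<in> Lo" for x
      proof -
        have "\<not> a < x" using strict[of a x] that a(1) unfolding Lo_def Hi_def by auto
        then show ?thesis by (intro major_mono) simp
      qed
      ultimately show thesis
        using near[OF nou, of "major a"] a sub major_mono unfolding Hi_def by blast
    qed
  qed
  then show ?thesis
  proof cases
    case old
    show ?thesis
    proof (rule can_I[OF st])
      fix m' assume ag: "agree P m m'"
      have "\<exists>z\<in>X j. util A m' H i j z = u" using old agr(2)[OF ag] by auto
      moreover have "grid B J A P m' X H" using agr(1)[OF ag x0(1)] .
      moreover have "X j = insert x0 (X j)" using x0(1) by auto
      ultimately show "?Q P m'" using ext_refl by blast
    qed
  next
    case near
    show ?thesis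
    proof (rule can_I[OF st])
      fix m' assume st': "st P m'" and ag: "agree P m m'"
      have gt: "m' i (A j \<inter> {y<..}) = major u" using agreeD[OF ag meas_gt[OF me[OF j] near(2)] iG] near(3) by simp
      show "?Q P m'"
        by (rule insert_position[OF agr(1)[OF ag x0(1)] st' BG me i j near(2) gt])
           (use near agr(2)[OF ag] in \<open>auto simp: Lo_def Hi_def\<close>)
    qed
  next
    case far
    have r: "major u \<le> m i (A j)"
    proof -
      have "major u \<le> m i (A j \<inter> {major x0<..})" using major_mono[OF x0(2)] unfolding util_def by simp
      also have "\<dots> \<le> m i (A j)"
        by (rule st_m_mono[OF st iG]) (use me[OF j] sub x0 in auto)
      finally show ?thesis .
    qed
    have "can (\<lambda>P' m'. \<exists>y\<in>P'. m' i (A j \<inter> {..y}) = m i (A j) - major u) 1 P m"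
      by (rule cut[OF st iG me[OF j]]) (use r u0 in auto)
    then show ?thesis
    proof (rule can_conseq[OF _ st])
      fix P' m' assume st': "st P' m'" and s: "P \<subseteq> P'" and ag: "agree P m m'"
        and "\<exists>y\<in>P'. m' i (A j \<inter> {..y}) = m i (A j) - major u"
      then obtain y where y: "y \<in> P'" "m' i (A j \<inter> {..y}) = m i (A j) - major u" by blast
      have me': "meas P' (A j')" if "j' \<in> J" for j' using meas_mono[OF me[OF that] s] .
      have gt: "m' i (A j \<inter> {y<..}) = major u"
        using m_split[OF st_prof[OF st'] iG _ me'[OF j] y(1)] st' y(2) agreeD[OF ag me[OF j] iG]
        unfolding st_def by auto
      have mono: "m' i (A j \<inter> {b<..}) \<le> m' i (A j \<inter> {a<..})" if "a \<in> P'" "b \<in> P'" "a \<le> b" for a b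
        by (rule st_m_mono[OF st' iG]) (use me'[OF j] that in auto)
      have far': "m' i (A j \<inter> {major x<..}) \<noteq> major u" if "x \<in> X j" for x
        using far that agr(2)[OF ag that] unfolding util_def by auto
      show "?Q P' m'"
      proof (rule insert_position[OF grid_agree[OF ag s me BG g] st' BG me' i j y(1) gt])
        fix x assume x: "x \<in> X j"
        have xP: "major x \<in> P'" using x sub s by auto
        show "util A m' H i j x \<noteq> u" using far'[OF x] unfolding util_def by auto
        show "major x \<le> y" if "u < util A m' H i j x"
        proof (rule ccontr)
          assume "\<not> ?thesis"
          then have "m' i (A j \<inter> {major x<..}) \<le> major u" using mono[OF y(1) xP] gt by auto
          moreover have "major u \<le> m' i (A j \<inter> {major x<..})" using that major_mono[of u "util A m' H i j x"] unfolding util_def by simp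
          ultimately show False using far'[OF x] by auto
        qed
        show "y \<le> major x" if "util A m' H i j x < u"
        proof (rule ccontr)
          assume "\<not> ?thesis"
          then have "major u \<le> m' i (A j \<inter> {major x<..})" using mono[OF xP y(1)] gt by auto
          moreover have "m' i (A j \<inter> {major x<..}) \<le> major u" using that major_mono[of "util A m' H i j x" u] unfolding util_def by simp
          ultimately show False using far'[OF x] by auto
        qed
      qed
    qed simp
  qed
qed

lemma insert_marks:
  assumes "finite R" and "grid B J A P m X H" and "st P m" and BG: "B \<subseteq> G" and finJ: "finite J"
    and "\<And>j. j \<in> J \<Longrightarrow> meas P (A j)"
    and "\<And>i j u. (i, j, u) \<in> R \<Longrightarrow> i \<in> B \<and> j \<in> J \<and> 0 \<le> major u \<and> (\<exists>x\<in>X j. u \<le> util A m H i j x)"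
  shows "can (\<lambda>P' m'. \<exists>X' H'. grid B J A P' m' X' H' \<and> ext B J X H X' H' \<and>
    (\<forall>i j u. (i, j, u) \<in> R \<longrightarrow> (\<exists>z\<in>X' j. util A m' H' i j z = u)) \<and>
    (\<Sum>j\<in>J. card (X' j)) \<le> (\<Sum>j\<in>J. card (X j)) + card R) (card R) P m"
  using assms(1-3,6,7)
proof (induction R rule: finite_induct)
  case empty
  show ?case
  proof (rule can_I[OF empty(2)])
    fix m' assume "agree P m m'"
    then have "grid B J A P m' X H" using grid_agree[OF _ subset_refl empty(3) BG empty(1)] by blast
    then show "\<exists>X' H'. grid B J A P m' X' H' \<and> ext B J X H X' H' \<and>
      (\<forall>i j u. (i, j, u) \<in> {} \<longrightarrow> (\<exists>z\<in>X' j. util A m' H' i j z = u)) \<and>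
      (\<Sum>j\<in>J. card (X' j)) \<le> (\<Sum>j\<in>J. card (X j)) + card {}"
      using ext_refl by (intro exI[of _ X] exI[of _ H]) auto
  qed
next
  case (insert r R)
  let ?Q = "\<lambda>R P' m'. \<exists>X' H'. grid B J A P' m' X' H' \<and> ext B J X H X' H' \<and>
    (\<forall>i j u. (i, j, u) \<in> R \<longrightarrow> (\<exists>z\<in>X' j. util A m' H' i j z = u)) \<and>
    (\<Sum>j\<in>J. card (X' j)) \<le> (\<Sum>j\<in>J. card (X j)) + card R"
  obtain i j u where r: "r = (i, j, u)" by (cases r) auto
  have i: "i \<in> B" "j \<in> J" "0 \<le> major u" "\<exists>x\<in>X j. u \<le> util A m H i j x"
    using insert.prems(4)[of i j u] r by auto
  have "can (?Q R) (card R) P m" using insert by auto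
  then have "can (?Q (insert r R)) (card R + 1) P m"
  proof (rule can_bind[OF _ insert.prems(2)])
    fix P' m' assume st': "st P' m'" and s: "P \<subseteq> P'" "agree P m m'" and "?Q R P' m'"
    then obtain X' H' where X': "grid B J A P' m' X' H'" "ext B J X H X' H'"
      "\<And>i j u. (i, j, u) \<in> R \<Longrightarrow> \<exists>z\<in>X' j. util A m' H' i j z = u"
      "(\<Sum>j\<in>J. card (X' j)) \<le> (\<Sum>j\<in>J. card (X j)) + card R" by blast
    have me': "meas P' (A j')" if "j' \<in> J" for j' using meas_mono[OF insert.prems(3)[OF that] s(1)] .
    obtain x0 where x0: "x0 \<in> X j" "u \<le> util A m H i j x0" using i by auto
    have xP: "major x0 \<in> P" using insert.prems(1) i x0 unfolding grid_def by auto
    have iG: "i \<in> G" using i BG by auto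
    have "util A m' H' i j x0 = util A m H i j x0"
      using util_agree[where A = A and j = j, OF s(2) insert.prems(3)[OF i(2)] iG xP]
        util_ext[where j = j, OF X'(2) i(1,2) x0(1)] by simp
    then have u: "u \<le> util A m' H' i j x0" using x0 by simp
    have x0': "x0 \<in> X' j" using X'(2) x0 i unfolding ext_def by auto
    have "can (\<lambda>P'' m''. \<exists>X'' H''. grid B J A P'' m'' X'' H'' \<and> ext B J X' H' X'' H'' \<and>
          (\<exists>z\<in>X'' j. util A m'' H'' i j z = u) \<and> (\<forall>j'. j' \<noteq> j \<longrightarrow> X'' j' = X' j') \<and> (\<exists>z. X'' j = insert z (X' j))) 1 P' m'"
      by (rule insert_mark[OF X'(1) st' BG me' i(1,2) x0' u i(3)])
    then show "can (?Q (insert r R)) 1 P' m'"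
    proof (rule can_conseq[OF _ st'])
      fix P'' m'' assume st'': "st P'' m''" and s': "P' \<subseteq> P''" "agree P' m' m''"
        and "\<exists>X'' H''. grid B J A P'' m'' X'' H'' \<and> ext B J X' H' X'' H'' \<and>
          (\<exists>z\<in>X'' j. util A m'' H'' i j z = u) \<and> (\<forall>j'. j' \<noteq> j \<longrightarrow> X'' j' = X' j') \<and> (\<exists>z. X'' j = insert z (X' j))"
      then obtain X'' H'' z where X'': "grid B J A P'' m'' X'' H''" "ext B J X' H' X'' H''"
        "\<exists>z\<in>X'' j. util A m'' H'' i j z = u" "\<And>j'. j' \<noteq> j \<Longrightarrow> X'' j' = X' j'" "X'' j = insert z (X' j)" by blast
      have "\<exists>z\<in>X'' j'. util A m'' H'' i' j' z = u'" if ijr: "(i', j', u') \<in> R" for i' j' u'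
      proof -
        obtain z where z: "z \<in> X' j'" "util A m' H' i' j' z = u'" using X'(3) ijr by blast
        have ij: "i' \<in> B" "j' \<in> J" using insert.prems(4)[of i' j' u'] ijr by auto
        have zP: "major z \<in> P'" using X'(1) ij z unfolding grid_def by auto
        have "i' \<in> G" using ij BG by auto
        then have "util A m'' H'' i' j' z = u'"
          using util_agree[where A = A and j = j', OF s'(2) me'[OF ij(2)] _ zP]
            util_ext[where j = j', OF X''(2) ij z(1)] z(2) by simp
        then show ?thesis using z X''(2) ij unfolding ext_def by auto
      qed
      moreover have "(\<Sum>j\<in>J. card (X'' j)) \<le> (\<Sum>j\<in>J. card (X' j)) + 1"
      proof -
        have "(\<Sum>j\<in>J. card (X'' j)) = card (X'' j) + (\<Sum>j\<in>J - {j}. card (X'' j))"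
          using finJ i by (simp add: sum.remove)
        also have "(\<Sum>j\<in>J - {j}. card (X'' j)) = (\<Sum>j\<in>J - {j}. card (X' j))"
          using X''(4) by (intro sum.cong) auto
        also have "card (X'' j) \<le> card (X' j) + 1" unfolding X''(5) by (cases "finite (X' j)") (auto simp: card_insert_if)
        finally show ?thesis using finJ i by (simp add: sum.remove)
      qed
      moreover have "card (insert r R) = card R + 1" using insert.hyps by simp
      ultimately show "?Q (insert r R) P'' m''"
        using X''(1,3) X'(4) ext_trans[OF X'(2) X''(2)] r
        by (intro exI[of _ X''] exI[of _ H'']) auto
    qed simp
  qed
  then show ?case using insert.hyps by simp
qed

section \<open>Levels of indifference marks and the trimmed assignment\<close>

definition levels :: "nat set \<Rightarrow> nat set \<Rightarrow> (nat \<Rightarrow> real set) \<Rightarrow> real set \<Rightarrow> (nat \<Rightarrow> real set \<Rightarrow> real) \<Rightarrow>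
    nat \<Rightarrow> (nat \<Rightarrow> nat \<Rightarrow> lex set) \<Rightarrow> (nat \<Rightarrow> nat \<Rightarrow> lex \<Rightarrow> real) \<Rightarrow> bool" where
  "levels B J A P m T X H \<longleftrightarrow> grid B J A P m (X T) H \<and> (\<forall>q<T. \<forall>j\<in>J. X q j \<subseteq> X (Suc q) j) \<and>
     (\<forall>j\<in>J. X 0 j = {Lex 0 0}) \<and>
     (\<forall>q<T. \<forall>i\<in>B. \<forall>j\<in>J. \<forall>j'\<in>J. \<forall>x\<in>X q j. \<forall>x'\<in>X q j'. util A m H i j' x' \<le> util A m H i j x \<longrightarrow>
        (\<exists>z\<in>X (Suc q) j. util A m H i j z = util A m H i j' x'))"

lemma levels_sub: "levels B J A P m T X H \<Longrightarrow> q \<le> T \<Longrightarrow> j \<in> J \<Longrightarrow> X q j \<subseteq> X T j"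
proof (induction "T - q" arbitrary: q)
  case (Suc d)
  then have "q < T" by auto
  then have "X q j \<subseteq> X (Suc q) j" using Suc.prems unfolding levels_def by auto
  also have "\<dots> \<subseteq> X T j" using Suc \<open>q < T\<close> by auto
  finally show ?case .
qed auto

lemma levels_mark:
  assumes "levels B J A P m T X H" "q < T" "i \<in> B" "j \<in> J" "j' \<in> J" "x \<in> X q j" "x' \<in> X q j'"
    "util A m H i j' x' \<le> util A m H i j x"
  shows "\<exists>z\<in>X (Suc q) j. util A m H i j z = util A m H i j' x'"
proof -
  have "\<forall>q<T. \<forall>i\<in>B. \<forall>j\<in>J. \<forall>j'\<in>J. \<forall>x\<in>X q j. \<forall>x'\<in>X q j'. util A m H i j' x' \<le> util A m H i j x \<longrightarrow>
        (\<exists>z\<in>X (Suc q) j. util A m H i j z = util A m H i j' x')"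
    using assms(1) unfolding levels_def by auto
  from this[rule_format, OF assms(2-8)] show ?thesis .
qed

text \<open>A new level adds at most one mark for each agent, each piece to be marked and each
  existing mark. This multiplies the number of marks by at most \<open>1 + card B * card J\<close>,
  and the same recursion bounds the cuts.\<close>

lemma make_levels:
  assumes st: "st P m" and BG: "B \<subseteq> G" and finB: "finite B" and finJ: "finite J"
    and me: "\<And>j. j \<in> J \<Longrightarrow> meas P (A j)"
  shows "can (\<lambda>P' m'. \<exists>X H. levels B J A P' m' T X H \<and>
    (\<Sum>j\<in>J. card (X T j)) \<le> card J * (1 + card B * card J) ^ T)
    (card J * (1 + card B * card J) ^ T) P m"
proof (induction T)
  case 0
  show ?case
  proof (rule can_I[OF st])
    fix m' assume st': "st P m'"
    have "levels B J A P m' 0 (\<lambda>_ _. {Lex 0 0}) (\<lambda>_ _ _. 0)"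
      using st' unfolding levels_def grid_def st_def by auto
    then show "\<exists>X H. levels B J A P m' 0 X H \<and> (\<Sum>j\<in>J. card (X 0 j)) \<le> card J * (1 + card B * card J) ^ 0"
      by (intro exI[of _ "\<lambda>_ _. {Lex 0 0}"] exI[of _ "\<lambda>_ _ _. 0"]) auto
  qed
next
  case (Suc T)
  let ?N = "card J * (1 + card B * card J) ^ T"
  have "can (\<lambda>P' m'. \<exists>X H. levels B J A P' m' (Suc T) X H \<and>
    (\<Sum>j\<in>J. card (X (Suc T) j)) \<le> card J * (1 + card B * card J) ^ Suc T)
    (?N + card B * card J * ?N) P m"
  proof (rule can_bind[OF Suc st])
    fix P' m' assume st': "st P' m'" and s: "P \<subseteq> P'" "agree P m m'"
      and "\<exists>X H. levels B J A P' m' T X H \<and> (\<Sum>j\<in>J. card (X T j)) \<le> ?N"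
    then obtain X H where L: "levels B J A P' m' T X H" and N: "(\<Sum>j\<in>J. card (X T j)) \<le> ?N" by blast
    have g: "grid B J A P' m' (X T) H" using L levels_def by auto
    have me': "meas P' (A j')" if "j' \<in> J" for j' using meas_mono[OF me[OF that] s(1)] .
    have finX: "finite (X T j)" if "j \<in> J" for j using g that grid_def by auto
    define S where "S = (SIGMA j':J. X T j')"
    have finS: "finite S" "card S = (\<Sum>j\<in>J. card (X T j))"
      unfolding S_def using finJ finX by (auto simp: card_SigmaI)
    define R0 where "R0 = (\<lambda>(i, j, (j', x')). (i, j, util A m' H i j' x')) ` (B \<times> J \<times> S)"
    \<comment> \<open>A utility can be reached by further trimming only if it does not exceed that
      of some position already present on \<open>j\<close>.\<close>
    define R where "R = {(i, j, u) \<in> R0. \<exists>x\<in>X T j. u \<le> util A m' H i j x}"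
    have finR0: "finite R0" unfolding R0_def using finB finJ finS by simp
    have RR0: "R \<subseteq> R0" unfolding R_def by auto
    have finR: "finite R" using finR0 RR0 finite_subset by blast
    have "card R \<le> card R0" using finR0 RR0 card_mono by blast
    also have "\<dots> \<le> card (B \<times> J \<times> S)"
      unfolding R0_def using finB finJ finS by (intro card_image_le) simp
    also have "\<dots> = card B * card J * card S" by (simp add: card_cartesian_product)
    also have "\<dots> \<le> card B * card J * ?N" using finS N by (intro mult_left_mono) auto
    finally have cR: "card R \<le> card B * card J * ?N" .
    have Rp: "i \<in> B \<and> j \<in> J \<and> 0 \<le> major u \<and> (\<exists>x\<in>X T j. u \<le> util A m' H i j x)" if R: "(i, j, u) \<in> R" for i j u
    proof -
      obtain j' x' where j': "j' \<in> J" "x' \<in> X T j'" "u = util A m' H i j' x'" and ij: "i \<in> B" "j \<in> J"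
        using R unfolding R_def R0_def S_def by auto
      have "major x' \<in> P'" using g j' unfolding grid_def by auto
      then have "0 \<le> major u"
        using st_nonneg[OF st' _ meas_gt[OF me'[OF j'(1)]]] ij BG unfolding j'(3) util_def by auto
      then show ?thesis using R ij unfolding R_def by auto
    qed
    have "can (\<lambda>P'' m''. \<exists>X' H'. grid B J A P'' m'' X' H' \<and> ext B J (X T) H X' H' \<and>
      (\<forall>i j u. (i, j, u) \<in> R \<longrightarrow> (\<exists>z\<in>X' j. util A m'' H' i j z = u)) \<and>
      (\<Sum>j\<in>J. card (X' j)) \<le> (\<Sum>j\<in>J. card (X T j)) + card R) (card R) P' m'"
      by (rule insert_marks[OF finR g st' BG finJ me' Rp])
    then show "can (\<lambda>P' m'. \<exists>X H. levels B J A P' m' (Suc T) X H \<and>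
      (\<Sum>j\<in>J. card (X (Suc T) j)) \<le> card J * (1 + card B * card J) ^ Suc T) (card B * card J * ?N) P' m'"
    proof (rule can_conseq[OF _ st' cR])
      fix P'' m'' assume st'': "st P'' m''" and s': "P' \<subseteq> P''" "agree P' m' m''"
        and "\<exists>X' H'. grid B J A P'' m'' X' H' \<and> ext B J (X T) H X' H' \<and>
          (\<forall>i j u. (i, j, u) \<in> R \<longrightarrow> (\<exists>z\<in>X' j. util A m'' H' i j z = u)) \<and>
          (\<Sum>j\<in>J. card (X' j)) \<le> (\<Sum>j\<in>J. card (X T j)) + card R"
      then obtain X' H' where X': "grid B J A P'' m'' X' H'" "ext B J (X T) H X' H'"
        "\<And>i j u. (i, j, u) \<in> R \<Longrightarrow> \<exists>z\<in>X' j. util A m'' H' i j z = u"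
        "(\<Sum>j\<in>J. card (X' j)) \<le> (\<Sum>j\<in>J. card (X T j)) + card R" by blast
      define XX where "XX = X(Suc T := X')"
      have XXq: "XX q = X q" if "q \<le> T" for q using that XX_def by auto
      have ut: "util A m'' H' i j x = util A m' H i j x" if "i \<in> B" "j \<in> J" "x \<in> X q j" "q \<le> T" for i j x q
      proof -
        have x: "x \<in> X T j" using levels_sub[OF L that(4,2)] that(3) by auto
        have "major x \<in> P'" using g that(2) x unfolding grid_def by auto
        then show ?thesis
          using util_agree[where A = A and j = j and i = i, OF s'(2) me'[OF that(2)]] that(1) BG
            util_ext[where j = j, OF X'(2) that(1,2) x] by auto
      qed
      have "levels B J A P'' m'' (Suc T) XX H'"
        unfolding levels_def
      proof (intro conjI ballI allI impI)
        show "grid B J A P'' m'' (XX (Suc T)) H'" using X'(1) XX_def by simp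
        show "XX 0 j = {Lex 0 0}" if "j \<in> J" for j using XXq[of 0] L that unfolding levels_def by auto
        show "XX q j \<subseteq> XX (Suc q) j" if "q < Suc T" "j \<in> J" for q j
        proof (cases "q = T")
          case True
          then show ?thesis using X'(2) that unfolding XX_def ext_def by auto
        next
          case False
          then show ?thesis using XXq[of q] XXq[of "Suc q"] L that unfolding levels_def by auto
        qed
        fix q i j j' x x' assume a: "q < Suc T" "i \<in> B" "j \<in> J" "j' \<in> J" "x \<in> XX q j" "x' \<in> XX q j'"
          "util A m'' H' i j' x' \<le> util A m'' H' i j x"
        have q: "q \<le> T" "x \<in> X q j" "x' \<in> X q j'" using a XXq[of q] by auto
        have le: "util A m' H i j' x' \<le> util A m' H i j x"
          using a(7) ut[OF a(2,3) q(2,1)] ut[OF a(2,4) q(3,1)] by simp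
        show "\<exists>z\<in>XX (Suc q) j. util A m'' H' i j z = util A m'' H' i j' x'"
        proof (cases "q = T")
          case True
          then have "(i, j, util A m' H i j' x') \<in> R" using a q le unfolding R_def R0_def S_def by force
          then show ?thesis using X'(3) True XX_def ut[OF a(2,4) q(3,1)] by fastforce
        next
          case False
          then have qT: "q < T" using q by simp
          then obtain z where z: "z \<in> X (Suc q) j" "util A m' H i j z = util A m' H i j' x'"
            using levels_mark[OF L qT a(2-4) q(2,3) le] by auto
          then have "util A m'' H' i j z = util A m'' H' i j' x'"
            using ut[OF a(2,3) z(1)] ut[OF a(2,4) q(3,1)] qT by simp
          then show ?thesis using z XXq[of "Suc q"] qT by auto
        qed
      qed
      moreover have "(\<Sum>j\<in>J. card (XX (Suc T) j)) \<le> card J * (1 + card B * card J) ^ Suc T"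
      proof -
        have "(\<Sum>j\<in>J. card (XX (Suc T) j)) \<le> ?N + card B * card J * ?N"
          using X'(4) N cR unfolding XX_def by auto
        then show ?thesis by (simp add: algebra_simps)
      qed
      ultimately show "\<exists>X H. levels B J A P'' m'' (Suc T) X H \<and>
        (\<Sum>j\<in>J. card (X (Suc T) j)) \<le> card J * (1 + card B * card J) ^ Suc T" by blast
    qed
  qed
  then show ?case by (simp add: algebra_simps)
qed

text \<open>With \<open>Lex 0 0\<close>, no trim at all, as the floor of every piece, unassigned
  pieces are untrimmed. Forgetting the minor coordinates turns the lexicographic comparison into a
  weak inequality of values, which is what envy-freeness asks for.\<close>

theorem trimmed_assignment:
  fixes A :: "nat \<Rightarrow> real set"
  assumes st: "st P m" and BG: "B \<subseteq> G" and finB: "finite B" and finJ: "finite J" and le: "card B \<le> card J"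
    and me: "\<And>j. j \<in> J \<Longrightarrow> meas P (A j)"
  shows "can (\<lambda>P' m'. \<exists>y \<pi>. inj_on \<pi> B \<and> \<pi> ` B \<subseteq> J \<and> (\<forall>j\<in>J. y j \<in> P') \<and>
      (\<forall>i\<in>B. \<forall>j\<in>J. m' i (A j \<inter> {y j<..}) \<le> m' i (A (\<pi> i) \<inter> {y (\<pi> i)<..})) \<and>
      (\<forall>j\<in>J - \<pi> ` B. y j = 0)) (card J * (1 + card B * card J) ^ card B) P m"
proof (rule can_conseq[OF make_levels[where A = A and B = B and J = J and T = "card B", OF st BG finB finJ me] st order_refl])
  fix P' m' assume st': "st P' m'"
    and "\<exists>X H. levels B J A P' m' (card B) X H \<and>
      (\<Sum>j\<in>J. card (X (card B) j)) \<le> card J * (1 + card B * card J) ^ card B"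
  then obtain X H where L: "levels B J A P' m' (card B) X H" by blast
  \<comment> \<open>The locale wants monotone levels for all indices and all pieces, so the levels
    are frozen at \<open>card B\<close> and pieces outside \<open>J\<close> get no
    positions.\<close>
  define X' where "X' q j = (if j \<in> J then X (min q (card B)) j else {})" for q j
  have g: "grid B J A P' m' (X (card B)) H" using L levels_def by auto
  interpret trimming "util A m' H" X' "card B" B J
  proof
    show "X' q j \<subseteq> X' (Suc q) j" for q j
      using L unfolding X'_def levels_def by (cases "q < card B") (auto simp: min_def Suc_le_eq)
    show "util A m' H i j y < util A m' H i j x"
      if "i \<in> B" "j \<in> J" "x \<in> X' (card B) j" "y \<in> X' (card B) j" "x < y" for i j x y
      using g that unfolding grid_def X'_def by auto
    show "\<exists>z\<in>X' (Suc q) j. util A m' H i j z = util A m' H i j' x'"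
      if "q < card B" "i \<in> B" "j \<in> J" "j' \<in> J" "x \<in> X' q j" "x' \<in> X' q j'"
        "util A m' H i j' x' \<le> util A m' H i j x" for q i j j' x x'
      using L that unfolding X'_def levels_def by (auto simp: min_def Suc_le_eq)
  qed
  have "\<exists>p \<pi>. equil B J (\<lambda>_. Lex 0 0) p \<pi> \<and> (\<forall>j\<in>J. p j \<in> X' (0 + card B) j) \<and>
    (\<forall>p' \<pi>'. quasi B J (\<lambda>_. Lex 0 0) p' \<pi>' \<longrightarrow> (\<forall>i\<in>B. ut p' \<pi>' i \<le> ut p \<pi> i))"
    by (rule equilibrium) (use finB finJ le L in \<open>auto simp: X'_def levels_def\<close>)
  then obtain p \<pi> where p: "equil B J (\<lambda>_. Lex 0 0) p \<pi>" and pX: "\<forall>j\<in>J. p j \<in> X' (card B) j" by auto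
  have "m' i (A j \<inter> {major (p j)<..}) \<le> m' i (A (\<pi> i) \<inter> {major (p (\<pi> i))<..})" if "i \<in> B" "j \<in> J" for i j
  proof -
    have "util A m' H i j (p j) \<le> util A m' H i (\<pi> i) (p (\<pi> i))"
      using p that unfolding equil_def quasi_def by auto
    then show ?thesis using major_mono unfolding util_def by fastforce
  qed
  then show "\<exists>y \<pi>. inj_on \<pi> B \<and> \<pi> ` B \<subseteq> J \<and> (\<forall>j\<in>J. y j \<in> P') \<and>
      (\<forall>i\<in>B. \<forall>j\<in>J. m' i (A j \<inter> {y j<..}) \<le> m' i (A (\<pi> i) \<inter> {y (\<pi> i)<..})) \<and>
      (\<forall>j\<in>J - \<pi> ` B. y j = 0)"
    using p pX g unfolding equil_def quasi_def grid_def X'_def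
    by (intro exI[of _ "\<lambda>j. major (p j)"] exI[of _ \<pi>]) auto
qed

end

subsection \<open>The core procedure\<close>

text \<open>The bound of \<open>trimmed_assignment\<close> with both cardinalities replaced by
  \<open>n\<close>.\<close>

definition trim_cost :: "nat \<Rightarrow> nat" where
  "trim_cost n = n * (1 + n * n) ^ n"

lemma trim_cost_bound: "a \<le> n \<Longrightarrow> b \<le> n \<Longrightarrow> b * (1 + a * b) ^ a \<le> trim_cost n"
proof -
  assume ab: "a \<le> n" "b \<le> n"
  have "(1 + a * b) ^ a \<le> (1 + n * n) ^ a" using ab by (intro power_mono add_mono mult_mono) auto
  also have "\<dots> \<le> (1 + n * n) ^ n" using ab by (intro power_increasing) auto
  finally show ?thesis unfolding trim_cost_def using ab by (intro mult_mono) auto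
qed

text \<open>The price of halving the residue for everybody: \<open>n\<close> rounds, in each of
  which every agent is the cutter once.\<close>

definition shrink_cost :: "nat \<Rightarrow> nat" where
  "shrink_cost n = n * (n * (n + trim_cost n))"

text \<open>By Bernoulli \<open>(1 + 1/n)^n\<close> is at least 2, while its product with
  \<open>(1 - 1/n)^n\<close> is at most 1.\<close>

lemma one_minus_inverse_power: "1 \<le> n \<Longrightarrow> (1 - 1 / real n) ^ (n * L) \<le> (1 / 2) ^ L"
proof -
  assume n: "1 \<le> n"
  define x where "x = 1 / real n"
  have x: "0 \<le> x" "x \<le> 1" "real n * x = 1" using n x_def by auto
  have a: "2 \<le> (1 + x) ^ n" using Bernoulli_inequality[of x n] x by simp
  have "(1 - x) * (1 + x) = 1 - x * x" by (simp add: algebra_simps)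
  moreover have "x * x \<le> 1" using x mult_le_one by blast
  ultimately have "((1 - x) * (1 + x)) ^ n \<le> 1" by (intro power_le_one) auto
  then have b: "(1 - x) ^ n * (1 + x) ^ n \<le> 1" by (simp add: power_mult_distrib)
  have "(1 - x) ^ n * 2 \<le> (1 - x) ^ n * (1 + x) ^ n" using a x by (intro mult_left_mono) auto
  from order_trans[OF this b] have "(1 - 1 / real n) ^ n * 2 \<le> 1" unfolding x_def .
  then have "((1 - 1 / real n) ^ n) ^ L \<le> (1 / 2) ^ L"
    using n by (intro power_mono) auto
  then show ?thesis by (simp add: power_mult)
qed

context agents
begin

definition ef :: "nat set \<Rightarrow> (nat \<Rightarrow> real set \<Rightarrow> real) \<Rightarrow> (nat \<Rightarrow> real set) \<Rightarrow> bool" where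
  "ef N m X \<longleftrightarrow> (\<forall>i\<in>N. \<forall>j\<in>N. m i (X j) \<le> m i (X i))"

definition alloc :: "nat set \<Rightarrow> real set \<Rightarrow> real set \<Rightarrow> (nat \<Rightarrow> real set) \<Rightarrow> bool" where
  "alloc N P A X \<longleftrightarrow> (\<forall>i\<in>N. meas P (X i) \<and> X i \<subseteq> A) \<and> disjoint_family_on X N"

lemma alloc_mono: "alloc N P A X \<Longrightarrow> P \<subseteq> P' \<Longrightarrow> A \<subseteq> A' \<Longrightarrow> alloc N P' A' X"
  unfolding alloc_def by (blast intro: meas_mono)

lemma alloc_meas: "alloc N P A X \<Longrightarrow> meas P (\<Union>i\<in>N. X i)"
  unfolding alloc_def by auto

lemma ef_agree: "\<lbrakk>ef N m X; alloc N P A X; agree P m m'; N \<subseteq> G\<rbrakk> \<Longrightarrow> ef N m' X"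
  unfolding ef_def alloc_def using agreeD by (metis subsetD)

lemma alloc_empty [simp]: "alloc N P A (\<lambda>_. {})"
  unfolding alloc_def disjoint_family_on_def by auto

lemma alloc_combine:
  assumes X: "alloc N P A X" and Y: "alloc N P (A - (\<Union>i\<in>N. X i)) Y"
  shows "alloc N P A (\<lambda>i. X i \<union> Y i)"
  unfolding alloc_def disjoint_family_on_def
proof (intro conjI ballI impI)
  show "meas P (X i \<union> Y i)" "X i \<union> Y i \<subseteq> A" if "i \<in> N" for i
    using X Y that unfolding alloc_def by auto
  show "(X i \<union> Y i) \<inter> (X j \<union> Y j) = {}" if ij: "i \<in> N" "j \<in> N" "i \<noteq> j" for i j
  proof -
    have "X i \<inter> X j = {}" "Y i \<inter> Y j = {}"
      using X Y ij unfolding alloc_def disjoint_family_on_def by blast+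
    moreover have "Y i \<inter> X j = {}" "Y j \<inter> X i = {}"
      using Y ij unfolding alloc_def by blast+
    ultimately show ?thesis by blast
  qed
qed

lemma m_Un_alloc:
  assumes st: "st P m" and "i \<in> G" and X: "alloc N P A X" and Y: "alloc N P (A - (\<Union>i\<in>N. X i)) Y" and "j \<in> N"
  shows "m i (X j \<union> Y j) = m i (X j) + m i (Y j)"
proof (rule m_Un[OF st_prof[OF st] assms(2)])
  show "alg (X j)" "alg (Y j)" using X Y assms(5) st_alg[OF st] unfolding alloc_def by auto
  show "X j \<inter> Y j = {}" using Y assms(5) unfolding alloc_def by blast
qed

lemma ef_combine:
  assumes st: "st P m" and NG: "N \<subseteq> G" and X: "alloc N P A X" and Y: "alloc N P (A - (\<Union>i\<in>N. X i)) Y"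
    and "ef N m X" "ef N m Y"
  shows "ef N m (\<lambda>i. X i \<union> Y i)"
  unfolding ef_def
proof (intro ballI)
  fix i j assume ij: "i \<in> N" "j \<in> N"
  have iG: "i \<in> G" using ij NG by auto
  show "m i (X j \<union> Y j) \<le> m i (X i \<union> Y i)"
    using m_Un_alloc[OF st iG X Y] ij assms(5,6) unfolding ef_def by (simp add: add_mono)
qed

text \<open>The cutter stays out of the trimming, so one of the \<open>n\<close> equal parts is
  unassigned and hence untrimmed. The cutter takes it and envies nobody. In its eyes the residue is
  the sum of its gaps to the other pieces, and the largest gap is at least the average.\<close>

lemma core:
  assumes st: "st P m" and NG: "N \<subseteq> G" and finN: "finite N" and c: "c \<in> N" and R: "meas P R"
  shows "can (\<lambda>P' m'. \<exists>X. alloc N P' R X \<and> ef N m' X \<and>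
      m' c (R - (\<Union>i\<in>N. X i)) \<le> (1 - 1 / card N) * m' c R \<and>
      (2 \<le> card N \<longrightarrow> (\<exists>j\<in>N - {c}. m' c (R - (\<Union>i\<in>N. X i)) / card N \<le> m' c (X c) - m' c (X j)))) (card N + trim_cost (card N)) P m"
proof -
  define n where "n = card N"
  have n0: "0 < n" unfolding n_def using c finN by (auto simp: card_gt_0_iff)
  define q where "q = n - 1"
  have nq: "n = Suc q" using n0 q_def by auto
  define l where "l = m c R / n"
  have cG: "c \<in> G" using c NG by auto
  have l0: "0 \<le> l" unfolding l_def using st_nonneg[OF st cG R] by simp
  have lR: "m c R = real (Suc q) * l" unfolding l_def using n0 nq by simp
  let ?Q = "\<lambda>P' m'. \<exists>X. alloc N P' R X \<and> ef N m' X \<and>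
      m' c (R - (\<Union>i\<in>N. X i)) \<le> (1 - 1 / n) * m' c R \<and>
      (2 \<le> n \<longrightarrow> (\<exists>j\<in>N - {c}. m' c (R - (\<Union>i\<in>N. X i)) / n \<le> m' c (X c) - m' c (X j)))"
  have "can ?Q (q + trim_cost n) P m"
  proof (rule can_bind[OF equal_cut[OF st cG R l0 lR] st])
    fix P' m' assume st': "st P' m'" and s: "P \<subseteq> P'" "agree P m m'"
      and "\<exists>Z. (\<forall>j<Suc q. meas P' (Z j) \<and> m' c (Z j) = l) \<and>
        disjoint_family_on Z {..<Suc q} \<and> (\<Union>j<Suc q. Z j) = R"
    then obtain Z where Z: "\<And>j. j < n \<Longrightarrow> meas P' (Z j)" "\<And>j. j < n \<Longrightarrow> m' c (Z j) = l"
      "disjoint_family_on Z {..<n}" "(\<Union>j<n. Z j) = R" unfolding nq by blast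
    define B where "B = N - {c}"
    have B: "B \<subseteq> G" "finite B" "card B \<le> card {..<n}" "card B = n - 1"
      unfolding B_def n_def using NG finN c by (auto simp: card_Diff_subset)
    have "can (\<lambda>P' m'. \<exists>y \<pi>. inj_on \<pi> B \<and> \<pi> ` B \<subseteq> {..<n} \<and> (\<forall>j\<in>{..<n}. y j \<in> P') \<and>
      (\<forall>i\<in>B. \<forall>j\<in>{..<n}. m' i (Z j \<inter> {y j<..}) \<le> m' i (Z (\<pi> i) \<inter> {y (\<pi> i)<..})) \<and>
      (\<forall>j\<in>{..<n} - \<pi> ` B. y j = 0)) (card {..<n} * (1 + card B * card {..<n}) ^ card B) P' m'"
      by (rule trimmed_assignment[OF st' B(1,2) _ B(3)]) (use Z in auto)
    then show "can ?Q (trim_cost n) P' m'"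
    proof (rule can_conseq[OF _ st'])
      show "card {..<n} * (1 + card B * card {..<n}) ^ card B \<le> trim_cost n"
        using trim_cost_bound[of "card B" n "card {..<n}"] B by simp
      fix P'' m'' assume st'': "st P'' m''" and s': "P' \<subseteq> P''" "agree P' m' m''"
        and "\<exists>y \<pi>. inj_on \<pi> B \<and> \<pi> ` B \<subseteq> {..<n} \<and> (\<forall>j\<in>{..<n}. y j \<in> P'') \<and>
      (\<forall>i\<in>B. \<forall>j\<in>{..<n}. m'' i (Z j \<inter> {y j<..}) \<le> m'' i (Z (\<pi> i) \<inter> {y (\<pi> i)<..})) \<and>
      (\<forall>j\<in>{..<n} - \<pi> ` B. y j = 0)"
      then obtain y \<pi> where inj: "inj_on \<pi> B" and \<pi>: "\<pi> ` B \<subseteq> {..<n}" and y: "\<And>j. j < n \<Longrightarrow> y j \<in> P''"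
        and e: "\<And>i j. i \<in> B \<Longrightarrow> j < n \<Longrightarrow> m'' i (Z j \<inter> {y j<..}) \<le> m'' i (Z (\<pi> i) \<inter> {y (\<pi> i)<..})"
        and un: "\<And>j. j < n \<Longrightarrow> j \<notin> \<pi> ` B \<Longrightarrow> y j = 0" by (metis DiffI lessThan_iff)
      have "card (\<pi> ` B) = n - 1" using card_image[OF inj] B by simp
      then have "\<pi> ` B \<noteq> {..<n}" using n0 by auto
      then obtain j0 where j0: "j0 < n" "j0 \<notin> \<pi> ` B" using \<pi> by auto
      define \<sigma> where "\<sigma> = \<pi>(c := j0)"
      have Nc: "N = insert c B" "c \<notin> B" unfolding B_def using c by auto
      have inj\<sigma>: "inj_on \<sigma> N" unfolding Nc(1) \<sigma>_def using inj j0 Nc(2) by (auto simp: inj_on_def)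
      have \<sigma>n: "\<sigma> i < n" if "i \<in> N" for i using that \<pi> j0 unfolding Nc(1) \<sigma>_def by auto
      define X where "X i = Z (\<sigma> i) \<inter> {y (\<sigma> i)<..}" for i
      have meZ: "meas P'' (Z j)" if "j < n" for j using meas_mono[OF Z(1)[OF that] s'(1)] .
      have meR: "meas P'' R" using meas_mono[OF R] s(1) s'(1) by blast
      have meX: "meas P'' (X i)" if "i \<in> N" for i
        unfolding X_def using meZ[OF \<sigma>n[OF that]] y[OF \<sigma>n[OF that]] by auto
      have mcZ: "m'' c (Z j) = l" if "j < n" for j
        using agreeD[OF s'(2) Z(1)[OF that] cG] Z(2)[OF that] by simp
      have Xc: "X c = Z j0"
        using un[OF j0] meas_sub[OF meZ[OF j0(1)]] unfolding X_def \<sigma>_def by auto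
      have XZ: "X i \<subseteq> Z (\<sigma> i)" for i unfolding X_def by auto
      have disj: "disjoint_family_on X N"
        unfolding disjoint_family_on_def
      proof (intro ballI impI)
        fix i j assume ij: "i \<in> N" "j \<in> N" "i \<noteq> j"
        have "\<sigma> i \<noteq> \<sigma> j" using ij inj\<sigma> by (auto dest: inj_onD)
        then have "Z (\<sigma> i) \<inter> Z (\<sigma> j) = {}"
          using disjoint_family_onD[OF Z(3), of "\<sigma> i" "\<sigma> j"] \<sigma>n ij by auto
        then show "X i \<inter> X j = {}" using XZ by blast
      qed
      have XR: "X i \<subseteq> R" if "i \<in> N" for i using XZ[of i] \<sigma>n[OF that] Z(4) by blast
      have al: "alloc N P'' R X" unfolding alloc_def using meX XR disj by auto
      have leXc: "m'' c (X i) \<le> l" if "i \<in> N" for i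
        using st_m_mono[OF st'' cG meZ[OF \<sigma>n[OF that]] meX[OF that] XZ] mcZ[OF \<sigma>n[OF that]] by simp
      have efX: "ef N m'' X"
        unfolding ef_def
      proof (intro ballI)
        fix i j assume ij: "i \<in> N" "j \<in> N"
        show "m'' i (X j) \<le> m'' i (X i)"
        proof (cases "i = c")
          case True
          then show ?thesis using leXc[OF ij(2)] Xc mcZ[OF j0(1)] by simp
        next
          case False
          then have iB: "i \<in> B" using ij B_def by auto
          show ?thesis using e[OF iB \<sigma>n[OF ij(2)]] False unfolding X_def \<sigma>_def by auto
        qed
      qed
      define R' where "R' = R - (\<Union>i\<in>N. X i)"
      have mcR: "m'' c R = n * l"
        using agreeD[OF s(2) R cG] agreeD[OF s'(2) meas_mono[OF R s(1)] cG] lR nq by simp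
      have algs: "alg R" "\<And>i. i \<in> N \<Longrightarrow> alg (X i)" using st_alg[OF st''] meR meX by auto
      have "m'' c R' = m'' c R - m'' c (\<Union>i\<in>N. X i)"
        unfolding R'_def by (rule m_Diff[OF st_prof[OF st''] cG]) (use algs alg_UN[OF finN] XR in auto)
      also have "m'' c (\<Union>i\<in>N. X i) = (\<Sum>i\<in>N. m'' c (X i))"
        by (rule m_UN[OF st_prof[OF st''] cG finN algs(2) disj])
      finally have R'v: "m'' c R' = (\<Sum>i\<in>N. l - m'' c (X i))"
        using mcR by (simp add: sum_subtractf n_def)
      have "m'' c R' \<le> (1 - 1 / n) * m'' c R"
      proof -
        have "(\<Sum>i\<in>N. l - m'' c (X i)) = (\<Sum>i\<in>B. l - m'' c (X i))"
          using Xc mcZ[OF j0(1)] Nc B(2) by simp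
        also have "\<dots> \<le> (\<Sum>i\<in>B. l)"
          using st_nonneg[OF st'' cG meX] Nc by (intro sum_mono) auto
        also have "\<dots> = (1 - 1 / n) * m'' c R"
          using B(4) n0 mcR by (simp add: field_simps of_nat_diff)
        finally show ?thesis using R'v by simp
      qed
      moreover have "\<exists>j\<in>N - {c}. m'' c R' / n \<le> m'' c (X c) - m'' c (X j)" if n2: "2 \<le> n"
      proof (rule ccontr)
        assume neg: "\<not> ?thesis"
        have "B \<noteq> {}" using B(4) n2 by auto
        then have "(\<Sum>i\<in>B. l - m'' c (X i)) < (\<Sum>i\<in>B. m'' c R' / n)"
          using Xc mcZ[OF j0(1)] B(2) neg by (intro sum_strict_mono) (auto simp: not_le B_def)
        also have "\<dots> \<le> m'' c R'"
        proof -
          have "0 \<le> m'' c R'"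
            unfolding R'_def by (rule st_nonneg[OF st'' cG]) (use meR meX in auto)
          then have "real (n - 1) * (m'' c R' / n) \<le> real n * (m'' c R' / n)" by (intro mult_right_mono) auto
          then show ?thesis using B(4) n0 by simp
        qed
        finally have "(\<Sum>i\<in>N. l - m'' c (X i)) < m'' c R'"
          using Xc mcZ[OF j0(1)] Nc B(2) by simp
        then show False using R'v by simp
      qed
      ultimately show "?Q P'' m''" using al efX unfolding R'_def by blast
    qed
  qed
  then show ?thesis
    by (rule can_conseq[OF _ st]) (use nq in \<open>auto simp: n_def\<close>)
qed

text \<open>One run of \<open>core\<close> guarantees progress only in the eyes of its cutter, so
  each agent gets its turn; the other runs do not enlarge the residue.\<close>

lemma shrink_cutters:
  assumes "finite C" "C \<subseteq> N" and st: "st P m" and NG: "N \<subseteq> G" and finN: "finite N" and R: "meas P R"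
  shows "can (\<lambda>P' m'. \<exists>X. alloc N P' R X \<and> ef N m' X \<and>
      (\<forall>c\<in>C. m' c (R - (\<Union>i\<in>N. X i)) \<le> (1 - 1 / card N) * m' c R)) (card C * (card N + trim_cost (card N))) P m"
  using assms(1,2)
proof (induction C rule: finite_induct)
  case empty
  show ?case
    by (rule can_I[OF st], rule exI[of _ "\<lambda>_. {}"]) (auto simp: ef_def)
next
  case (insert c C)
  let ?n = "card N"
  let ?Q = "\<lambda>C P' m'. \<exists>X. alloc N P' R X \<and> ef N m' X \<and>
      (\<forall>c\<in>C. m' c (R - (\<Union>i\<in>N. X i)) \<le> (1 - 1 / ?n) * m' c R)"
  have c: "c \<in> N" "c \<in> G" using insert.prems NG by auto
  have n0: "0 < ?n" using c finN by (auto simp: card_gt_0_iff)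
  have "can (?Q C) (card C * (?n + trim_cost ?n)) P m" using insert by auto
  then have "can (?Q (insert c C)) (card C * (?n + trim_cost ?n) + (?n + trim_cost ?n)) P m"
  proof (rule can_bind[OF _ st])
    fix P' m' assume st': "st P' m'" and s: "P \<subseteq> P'" "agree P m m'" and "?Q C P' m'"
    then obtain X where X: "alloc N P' R X" "ef N m' X"
      "\<And>c. c \<in> C \<Longrightarrow> m' c (R - (\<Union>i\<in>N. X i)) \<le> (1 - 1 / ?n) * m' c R" by blast
    define R1 where "R1 = R - (\<Union>i\<in>N. X i)"
    have meR: "meas P' R" using meas_mono[OF R s(1)] .
    have meR1: "meas P' R1" unfolding R1_def using meR alloc_meas[OF X(1)] by auto
    show "can (?Q (insert c C)) (?n + trim_cost ?n) P' m'"
    proof (rule can_conseq[OF core[OF st' NG finN c(1) meR1] st' order_refl])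
      fix P'' m'' assume st'': "st P'' m''" and s': "P' \<subseteq> P''" "agree P' m' m''"
        and "\<exists>X. alloc N P'' R1 X \<and> ef N m'' X \<and> m'' c (R1 - (\<Union>i\<in>N. X i)) \<le> (1 - 1 / ?n) * m'' c R1 \<and>
          (2 \<le> ?n \<longrightarrow> (\<exists>j\<in>N - {c}. m'' c (R1 - (\<Union>i\<in>N. X i)) / ?n \<le> m'' c (X c) - m'' c (X j)))"
      then obtain Y where Y: "alloc N P'' R1 Y" "ef N m'' Y" "m'' c (R1 - (\<Union>i\<in>N. Y i)) \<le> (1 - 1 / ?n) * m'' c R1"
        by blast
      have X': "alloc N P'' R X" "ef N m'' X" using alloc_mono[OF X(1) s'(1)] ef_agree[OF X(2,1) s'(2) NG] by auto
      have eq: "R - (\<Union>i\<in>N. X i \<union> Y i) = R1 - (\<Union>i\<in>N. Y i)" unfolding R1_def by blast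
      have me: "meas P'' R1" "meas P'' R" "meas P'' (R1 - (\<Union>i\<in>N. Y i))"
        using meas_mono[OF meR1 s'(1)] meas_mono[OF meR s'(1)] alloc_meas[OF Y(1)] by auto
      have "m'' d (R - (\<Union>i\<in>N. X i \<union> Y i)) \<le> (1 - 1 / ?n) * m'' d R" if d: "d \<in> insert c C" for d
      proof (cases "d = c")
        case True
        have "m'' c R1 \<le> m'' c R" by (rule st_m_mono[OF st'' c(2) me(2,1)]) (auto simp: R1_def)
        then have "(1 - 1 / ?n) * m'' c R1 \<le> (1 - 1 / ?n) * m'' c R" using n0 by (intro mult_left_mono) auto
        then show ?thesis using Y(3) True eq by simp
      next
        case False
        then have dC: "d \<in> C" "d \<in> G" using d insert.prems NG by auto
        have "m'' d (R1 - (\<Union>i\<in>N. Y i)) \<le> m'' d R1" by (rule st_m_mono[OF st'' dC(2) me(1,3)]) auto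
        also have "\<dots> = m' d R1" using agreeD[OF s'(2) meR1 dC(2)] .
        also have "\<dots> \<le> (1 - 1 / ?n) * m' d R" using X(3)[OF dC(1)] R1_def by simp
        also have "m' d R = m'' d R" using agreeD[OF s'(2) meR dC(2)] by simp
        finally show ?thesis using eq by simp
      qed
      then show "?Q (insert c C) P'' m''"
        using alloc_combine[OF X'(1)] ef_combine[OF st'' NG X'(1)] X' Y(1,2) unfolding R1_def by blast
    qed
  qed
  then show ?case using insert.hyps by (simp add: algebra_simps)
qed

lemma shrink_rounds:
  assumes st: "st P m" and NG: "N \<subseteq> G" and finN: "finite N" and N0: "N \<noteq> {}" and R: "meas P R"
  shows "can (\<lambda>P' m'. \<exists>X. alloc N P' R X \<and> ef N m' X \<and>
      (\<forall>c\<in>N. m' c (R - (\<Union>i\<in>N. X i)) \<le> (1 - 1 / card N) ^ t * m' c R)) (t * (card N * (card N + trim_cost (card N)))) P m"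
proof (rule can_iter[where I = "\<lambda>t P' m'. \<exists>X. alloc N P' R X \<and> ef N m' X \<and>
      (\<forall>c\<in>N. m' c (R - (\<Union>i\<in>N. X i)) \<le> (1 - 1 / card N) ^ t * m' c R)", OF st])
  fix m' show "\<exists>X. alloc N P R X \<and> ef N m' X \<and>
      (\<forall>c\<in>N. m' c (R - (\<Union>i\<in>N. X i)) \<le> (1 - 1 / card N) ^ 0 * m' c R)"
    by (rule exI[of _ "\<lambda>_. {}"]) (auto simp: ef_def)
next
  let ?n = "card N"
  fix t P' m' assume st': "st P' m'" and s: "P \<subseteq> P'" "agree P m m'"
    and "\<exists>X. alloc N P' R X \<and> ef N m' X \<and> (\<forall>c\<in>N. m' c (R - (\<Union>i\<in>N. X i)) \<le> (1 - 1 / ?n) ^ t * m' c R)"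
  then obtain X where X: "alloc N P' R X" "ef N m' X"
    "\<And>c. c \<in> N \<Longrightarrow> m' c (R - (\<Union>i\<in>N. X i)) \<le> (1 - 1 / ?n) ^ t * m' c R" by blast
  have n0: "0 < ?n" using N0 finN by (auto simp: card_gt_0_iff)
  define R1 where "R1 = R - (\<Union>i\<in>N. X i)"
  have meR: "meas P' R" using meas_mono[OF R s(1)] .
  have meR1: "meas P' R1" unfolding R1_def using meR alloc_meas[OF X(1)] by auto
  show "can (\<lambda>P' m'. \<exists>X. alloc N P' R X \<and> ef N m' X \<and>
      (\<forall>c\<in>N. m' c (R - (\<Union>i\<in>N. X i)) \<le> (1 - 1 / ?n) ^ Suc t * m' c R)) (?n * (?n + trim_cost ?n)) P' m'"
  proof (rule can_conseq[OF shrink_cutters[OF finN subset_refl st' NG finN meR1] st' order_refl])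
    fix P'' m'' assume st'': "st P'' m''" and s': "P' \<subseteq> P''" "agree P' m' m''"
      and "\<exists>X. alloc N P'' R1 X \<and> ef N m'' X \<and> (\<forall>c\<in>N. m'' c (R1 - (\<Union>i\<in>N. X i)) \<le> (1 - 1 / ?n) * m'' c R1)"
    then obtain Y where Y: "alloc N P'' R1 Y" "ef N m'' Y"
      "\<And>c. c \<in> N \<Longrightarrow> m'' c (R1 - (\<Union>i\<in>N. Y i)) \<le> (1 - 1 / ?n) * m'' c R1" by blast
    have X': "alloc N P'' R X" "ef N m'' X" using alloc_mono[OF X(1) s'(1)] ef_agree[OF X(2,1) s'(2) NG] by auto
    have eq: "R - (\<Union>i\<in>N. X i \<union> Y i) = R1 - (\<Union>i\<in>N. Y i)" unfolding R1_def by blast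
    have "m'' d (R - (\<Union>i\<in>N. X i \<union> Y i)) \<le> (1 - 1 / ?n) ^ Suc t * m'' d R" if d: "d \<in> N" for d
    proof -
      have dG: "d \<in> G" using d NG by auto
      have "m'' d R1 \<le> (1 - 1 / ?n) ^ t * m'' d R"
        using X(3)[OF d] agreeD[OF s'(2) meR1 dG] agreeD[OF s'(2) meR dG] R1_def by simp
      then have "(1 - 1 / ?n) * m'' d R1 \<le> (1 - 1 / ?n) * ((1 - 1 / ?n) ^ t * m'' d R)"
        using n0 by (intro mult_left_mono) auto
      then show ?thesis using Y(3)[OF d] eq by (simp add: mult.assoc)
    qed
    then show "\<exists>X. alloc N P'' R X \<and> ef N m'' X \<and>
      (\<forall>c\<in>N. m'' c (R - (\<Union>i\<in>N. X i)) \<le> (1 - 1 / ?n) ^ Suc t * m'' c R)"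
      using alloc_combine[OF X'(1)] ef_combine[OF st'' NG X'(1)] X' Y(1,2) unfolding R1_def by blast
  qed
qed

lemma shrink:
  assumes st: "st P m" and NG: "N \<subseteq> G" and finN: "finite N" and N0: "N \<noteq> {}" and R: "meas P R"
  shows "can (\<lambda>P' m'. \<exists>X. alloc N P' R X \<and> ef N m' X \<and>
      (\<forall>c\<in>N. 2 ^ L * m' c (R - (\<Union>i\<in>N. X i)) \<le> m' c R)) (L * shrink_cost (card N)) P m"
proof (rule can_conseq[OF shrink_rounds[OF st NG finN N0 R, of "card N * L"] st])
  let ?n = "card N"
  have n1: "1 \<le> ?n" using N0 finN by (simp add: Suc_le_eq card_gt_0_iff)
  show "?n * L * (?n * (?n + trim_cost ?n)) \<le> L * shrink_cost ?n" unfolding shrink_cost_def by (simp add: algebra_simps)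
  fix P' m' assume st': "st P' m'" and s: "P \<subseteq> P'" "agree P m m'"
    and "\<exists>X. alloc N P' R X \<and> ef N m' X \<and> (\<forall>c\<in>N. m' c (R - (\<Union>i\<in>N. X i)) \<le> (1 - 1 / ?n) ^ (?n * L) * m' c R)"
  then obtain X where X: "alloc N P' R X" "ef N m' X"
    "\<And>c. c \<in> N \<Longrightarrow> m' c (R - (\<Union>i\<in>N. X i)) \<le> (1 - 1 / ?n) ^ (?n * L) * m' c R" by blast
  have "2 ^ L * m' c (R - (\<Union>i\<in>N. X i)) \<le> m' c R" if c: "c \<in> N" for c
  proof -
    have "0 \<le> m' c R" using st_nonneg[OF st' _ meas_mono[OF R s(1)]] c NG by auto
    then have "(1 - 1 / ?n) ^ (?n * L) * m' c R \<le> (1 / 2) ^ L * m' c R"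
      by (intro mult_right_mono one_minus_inverse_power n1)
    then have "m' c (R - (\<Union>i\<in>N. X i)) \<le> (1 / 2) ^ L * m' c R" using X(3)[OF c] by simp
    then have "2 ^ L * m' c (R - (\<Union>i\<in>N. X i)) \<le> 2 ^ L * ((1 / 2) ^ L * m' c R)" by (intro mult_left_mono) auto
    then show ?thesis by (simp add: power_divide)
  qed
  then show "\<exists>X. alloc N P' R X \<and> ef N m' X \<and> (\<forall>c\<in>N. 2 ^ L * m' c (R - (\<Union>i\<in>N. X i)) \<le> m' c R)"
    using X by blast
qed

subsection \<open>Snapshots and separated gaps\<close>

text \<open>The later runs refine the cut points and may change the profile, so a goal once reached
  has to survive refinement.\<close>

lemma can_family:
  assumes "finite J" "st P m"
    and "\<And>j P' m'. \<lbrakk>j \<in> J; st P' m'; P \<subseteq> P'; agree P m m'\<rbrakk> \<Longrightarrow> can (Q j) K P' m'"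
    and "\<And>j P' m' P'' m''. \<lbrakk>j \<in> J; Q j P' m'; st P' m'; st P'' m''; P' \<subseteq> P''; agree P' m' m''\<rbrakk> \<Longrightarrow> Q j P'' m''"
  shows "can (\<lambda>P' m'. \<forall>j\<in>J. Q j P' m') (card J * K) P m"
  using assms(1,3,4)
proof (induction J rule: finite_induct)
  case empty
  show ?case by (rule can_I[OF assms(2)]) auto
next
  case (insert j J)
  have "can (\<lambda>P' m'. \<forall>j\<in>J. Q j P' m') (card J * K) P m" using insert.IH insert.prems by blast
  then have "can (\<lambda>P' m'. \<forall>j\<in>insert j J. Q j P' m') (card J * K + K) P m"
  proof (rule can_bind[OF _ assms(2)])
    fix P' m' assume a: "st P' m'" "P \<subseteq> P'" "agree P m m'" "\<forall>j\<in>J. Q j P' m'"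
    have "can (Q j) K P' m'" using insert.prems(1) a by blast
    then show "can (\<lambda>P' m'. \<forall>j\<in>insert j J. Q j P' m') K P' m'"
      by (rule can_conseq[OF _ a(1) order_refl]) (use a insert.prems(2) in blast)
  qed
  then show ?case using insert.hyps by (simp add: add.commute)
qed

definition snaps :: "nat set \<Rightarrow> real set \<Rightarrow> (nat \<Rightarrow> real set \<Rightarrow> real) \<Rightarrow> real set \<Rightarrow> nat \<Rightarrow>
    (nat \<Rightarrow> nat \<Rightarrow> real set) \<Rightarrow> bool" where
  "snaps N P m A S cs \<longleftrightarrow> (\<forall>s<S. alloc N P A (cs s) \<and> ef N m (cs s)) \<and>
     disjoint_family_on (\<lambda>s. \<Union>i\<in>N. cs s i) {..<S}"

definition rest :: "nat set \<Rightarrow> real set \<Rightarrow> nat \<Rightarrow> (nat \<Rightarrow> nat \<Rightarrow> real set) \<Rightarrow> real set" where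
  "rest N A S cs = A - (\<Union>s<S. \<Union>i\<in>N. cs s i)"

lemma snaps_agree:
  assumes "snaps N P m A S cs" "P \<subseteq> P'" "agree P m m'" "N \<subseteq> G"
  shows "snaps N P' m' A S cs"
  using assms(1) alloc_mono[OF _ assms(2) subset_refl] ef_agree[OF _ _ assms(3,4)] unfolding snaps_def by blast

lemma meas_rest:
  assumes "meas P A" "snaps N P m A S cs" shows "meas P (rest N A S cs)"
  using assms unfolding rest_def snaps_def by (intro meas_Diff meas_UN) (auto simp: alloc_def)

text \<open>Later runs only diminish the residue, so the gap that \<open>core\<close> provides in
  each snapshot remains a fixed fraction of it. In the end this gap makes some \<open>I k\<close> a
  proper subset.\<close>

lemma snapshots:
  assumes st: "st P m" and NG: "N \<subseteq> G" and finN: "finite N" and c: "c \<in> N" and A: "meas P A" and n2: "2 \<le> card N"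
  shows "can (\<lambda>P' m'. \<exists>cs. snaps N P' m' A S cs \<and>
    (\<forall>s<S. \<exists>j\<in>N - {c}. m' c (rest N A S cs) / card N \<le> m' c (cs s c) - m' c (cs s j)))
    (S * (card N + trim_cost (card N))) P m"
proof (rule can_iter[where I = "\<lambda>S P' m'. \<exists>cs. snaps N P' m' A S cs \<and>
    (\<forall>s<S. \<exists>j\<in>N - {c}. m' c (rest N A S cs) / card N \<le> m' c (cs s c) - m' c (cs s j))", OF st])
  fix m' show "\<exists>cs. snaps N P m' A 0 cs \<and>
    (\<forall>s<0. \<exists>j\<in>N - {c}. m' c (rest N A 0 cs) / card N \<le> m' c (cs s c) - m' c (cs s j))"
    by (simp add: snaps_def disjoint_family_on_def)
next
  fix t P' m' assume st': "st P' m'" and s: "P \<subseteq> P'" "agree P m m'"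
    and "\<exists>cs. snaps N P' m' A t cs \<and>
    (\<forall>s<t. \<exists>j\<in>N - {c}. m' c (rest N A t cs) / card N \<le> m' c (cs s c) - m' c (cs s j))"
  then obtain cs where sn: "snaps N P' m' A t cs"
    and gap: "\<And>s. s < t \<Longrightarrow> \<exists>j\<in>N - {c}. m' c (rest N A t cs) / card N \<le> m' c (cs s c) - m' c (cs s j)" by blast
  have meA: "meas P' A" using meas_mono[OF A s(1)] .
  let ?R = "rest N A t cs"
  have meR: "meas P' ?R" using meas_rest[OF meA sn] .
  have cG: "c \<in> G" using c NG by auto
  show "can (\<lambda>P' m'. \<exists>cs. snaps N P' m' A (Suc t) cs \<and>
    (\<forall>s<Suc t. \<exists>j\<in>N - {c}. m' c (rest N A (Suc t) cs) / card N \<le> m' c (cs s c) - m' c (cs s j)))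
    (card N + trim_cost (card N)) P' m'"
  proof (rule can_conseq[OF core[OF st' NG finN c meR] st' order_refl])
    fix P'' m'' assume st'': "st P'' m''" and s': "P' \<subseteq> P''" "agree P' m' m''"
      and "\<exists>X. alloc N P'' ?R X \<and> ef N m'' X \<and> m'' c (?R - (\<Union>i\<in>N. X i)) \<le> (1 - 1 / card N) * m'' c ?R \<and>
      (2 \<le> card N \<longrightarrow> (\<exists>j\<in>N - {c}. m'' c (?R - (\<Union>i\<in>N. X i)) / card N \<le> m'' c (X c) - m'' c (X j)))"
    then obtain Y where Y: "alloc N P'' ?R Y" "ef N m'' Y"
      "\<exists>j\<in>N - {c}. m'' c (?R - (\<Union>i\<in>N. Y i)) / card N \<le> m'' c (Y c) - m'' c (Y j)" using n2 by blast
    define cs' where "cs' = cs(t := Y)"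
    have old: "cs' s = cs s" if "s < t" for s using that cs'_def by auto
    have eqR: "rest N A (Suc t) cs' = ?R - (\<Union>i\<in>N. Y i)"
      unfolding rest_def lessThan_Suc using old by (auto simp: cs'_def)
    have RA: "?R \<subseteq> A" unfolding rest_def by auto
    have sn'': "snaps N P'' m'' A t cs" by (rule snaps_agree[OF sn s' NG])
    have sub: "(\<Union>i\<in>N. Y i) \<subseteq> ?R" using Y(1) unfolding alloc_def by auto
    have "disjoint_family_on (\<lambda>s. \<Union>i\<in>N. cs' s i) (insert t {..<t})"
      unfolding disjoint_family_on_def
    proof (intro ballI impI)
      fix a b assume ab: "a \<in> insert t {..<t}" "b \<in> insert t {..<t}" "a \<noteq> b"
      have d1: "(\<Union>i\<in>N. cs a i) \<inter> (\<Union>i\<in>N. cs b i) = {}" if "a < t" "b < t"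
        using sn'' disjoint_family_onD[of "\<lambda>s. \<Union>i\<in>N. cs s i" "{..<t}" a b] that ab unfolding snaps_def by blast
      have d2: "(\<Union>i\<in>N. cs a i) \<inter> (\<Union>i\<in>N. Y i) = {}" if "a < t" for a
        using sub that unfolding rest_def by blast
      show "(\<Union>i\<in>N. cs' a i) \<inter> (\<Union>i\<in>N. cs' b i) = {}"
        using ab d1 d2[of a] d2[of b] unfolding cs'_def by (cases "a = t"; cases "b = t") auto
    qed
    then have sn3: "snaps N P'' m'' A (Suc t) cs'"
      using sn'' Y(1,2) alloc_mono[OF Y(1) subset_refl RA] unfolding snaps_def lessThan_Suc
      by (auto simp: less_Suc_eq old cs'_def)
    have meA'': "meas P'' A" using meas_mono[OF meA s'(1)] .
    have "\<exists>j\<in>N - {c}. m'' c (rest N A (Suc t) cs') / card N \<le> m'' c (cs' s c) - m'' c (cs' s j)" if "s < Suc t" for s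
    proof (cases "s = t")
      case True
      then show ?thesis using Y(3) eqR cs'_def by auto
    next
      case False
      then have "s < t" using that by auto
      then obtain j where j: "j \<in> N - {c}" "m' c ?R / card N \<le> m' c (cs s c) - m' c (cs s j)" using gap by blast
      have "meas P' (cs s c)" "meas P' (cs s j)" using sn \<open>s < t\<close> c j(1) unfolding snaps_def alloc_def by auto
      then have "m'' c (cs s c) = m' c (cs s c)" "m'' c (cs s j) = m' c (cs s j)" "m'' c ?R = m' c ?R"
        using agreeD[OF s'(2) _ cG] meR by auto
      moreover have "m'' c (rest N A (Suc t) cs') \<le> m'' c ?R"
        by (rule st_m_mono[OF st'' cG meas_mono[OF meR s'(1)] meas_rest[OF meA'' sn3]]) (use eqR in auto)
      ultimately have "m'' c (rest N A (Suc t) cs') / card N \<le> m'' c (cs s c) - m'' c (cs s j)"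
        using j(2) divide_right_mono[of "m'' c (rest N A (Suc t) cs')" "m'' c ?R" "card N"] by simp
      then show ?thesis using j old \<open>s < t\<close> by auto
    qed
    then show "\<exists>cs. snaps N P'' m'' A (Suc t) cs \<and>
      (\<forall>s<Suc t. \<exists>j\<in>N - {c}. m'' c (rest N A (Suc t) cs) / card N \<le> m'' c (cs s c) - m'' c (cs s j))"
      using sn3 by blast
  qed
qed

text \<open>Every gap that is neither small nor large compared with the residue becomes large after one
  more shrinking phase, and large gaps stay large. So at most one phase per gap is needed.\<close>

lemma separate_gaps:
  fixes \<theta> :: real
  assumes st: "st P m" and NG: "N \<subseteq> G" and finN: "finite N" and c: "c \<in> N" and A: "meas P A"
    and sn: "snaps N P m A S cs"
    and gap: "\<And>s. s < S \<Longrightarrow> \<exists>j\<in>N - {c}. m c (rest N A S cs) / card N \<le> m c (cs s c) - m c (cs s j)"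
    and L: "2 * \<theta> \<le> 2 ^ L" "2 * card N \<le> (2::real) ^ L"
  defines "r \<equiv> \<lambda>m X i. m i (rest N A S cs - (\<Union>k\<in>N. X k))"
    and "g \<equiv> \<lambda>m s i k. m i (cs s i) - m i (cs s k)"
  shows "can (\<lambda>P' m'. \<exists>X. alloc N P' (rest N A S cs) X \<and> ef N m' X \<and>
      (\<forall>s<S. \<exists>j\<in>N - {c}. 2 * r m' X c \<le> g m' s c j) \<and>
      (\<forall>s<S. \<forall>i\<in>N. \<forall>k\<in>N. 2 * r m' X i \<le> g m' s i k \<or> \<theta> * g m' s i k \<le> r m' X i))
    ((1 + S * (card N * card N)) * (L * shrink_cost (card N))) P m"
proof -
  let ?R = "rest N A S cs" and ?K = "L * shrink_cost (card N)" and ?n = "card N"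
  have meR: "meas P ?R" using meas_rest[OF A sn] .
  have N0: "N \<noteq> {}" "c \<in> G" using c NG by auto
  have n0: "0 < ?n" using c finN by (auto simp: card_gt_0_iff)
  define bad where "bad m X = {(s, i, k) \<in> {..<S} \<times> N \<times> N. \<not> 2 * r m X i \<le> g m s i k}" for m X
  define good where "good m X \<longleftrightarrow> (\<forall>s<S. \<forall>i\<in>N. \<forall>k\<in>N. 2 * r m X i \<le> g m s i k \<or> \<theta> * g m s i k \<le> r m X i)" for m X
  define I where "I t P' m' \<longleftrightarrow> (\<exists>X. alloc N P' ?R X \<and> ef N m' X \<and>
    (\<forall>s<S. \<exists>j\<in>N - {c}. 2 * r m' X c \<le> g m' s c j) \<and> (good m' X \<or> card (bad m' X) + t \<le> S * (?n * ?n)))" for t P' m'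
  have finbad: "finite (bad m X)" for m X
    unfolding bad_def using finN by (auto intro: finite_subset[OF _ finite_cartesian_product[OF finite_lessThan finite_cartesian_product]])
  have cardbad: "card (bad m X) \<le> S * (?n * ?n)" for m X
  proof -
    have "card (bad m X) \<le> card ({..<S} \<times> N \<times> N)"
      unfolding bad_def using finN by (intro card_mono) auto
    then show ?thesis by (simp add: card_cartesian_product)
  qed
  have g_agree: "g m' s i k = g m s i k" if "agree P' m m'" "snaps N P' m A S cs" "s < S" "i \<in> N" "k \<in> N" for P' m m' s i k
  proof -
    have "meas P' (cs s i)" "meas P' (cs s k)" using that unfolding snaps_def alloc_def by auto
    then show ?thesis unfolding g_def using agreeD[OF that(1)] that NG by auto
  qed
  have r_agree: "r m' X i = r m X i" if "agree P' m m'" "meas P' ?R" "alloc N P' ?R X" "i \<in> N" for P' m m' X i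
    unfolding r_def using agreeD[OF that(1)] that alloc_meas[OF that(3)] NG by auto
  \<comment> \<open>A first phase makes one gap of the cutter large in every snapshot: it turns the
    fraction \<open>1 / card N\<close> into the factor 2, by
    \<open>2 * card N \<le> 2 ^ L\<close>.\<close>
  have "can (I 0) ?K P m"
  proof (rule can_conseq[OF shrink[OF st NG finN N0(1) meR] st order_refl])
    fix P' m' assume st': "st P' m'" and s: "P \<subseteq> P'" "agree P m m'"
      and "\<exists>X. alloc N P' ?R X \<and> ef N m' X \<and> (\<forall>c\<in>N. 2 ^ L * m' c (?R - (\<Union>i\<in>N. X i)) \<le> m' c ?R)"
    then obtain X where X: "alloc N P' ?R X" "ef N m' X" "\<And>c. c \<in> N \<Longrightarrow> 2 ^ L * r m' X c \<le> m' c ?R"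
      unfolding r_def by blast
    have "\<exists>j\<in>N - {c}. 2 * r m' X c \<le> g m' s c j" if sS: "s < S" for s
    proof -
      obtain j where j: "j \<in> N - {c}" "m c ?R / ?n \<le> g m s c j" using gap[OF sS] unfolding g_def by blast
      have "0 \<le> r m' X c"
        unfolding r_def by (rule st_nonneg[OF st' N0(2)]) (use meas_mono[OF meR s(1)] alloc_meas[OF X(1)] in auto)
      then have "2 * ?n * r m' X c \<le> 2 ^ L * r m' X c" using L(2) by (intro mult_right_mono) auto
      also have "\<dots> \<le> m' c ?R" by (rule X(3)[OF c])
      also have "\<dots> = m c ?R" using agreeD[OF s(2) meR N0(2)] .
      finally have "2 * r m' X c \<le> m c ?R / ?n" using n0 by (simp add: field_simps)
      also have "\<dots> \<le> g m' s c j" using j g_agree[OF s(2) sn sS c] by auto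
      finally show ?thesis using j by auto
    qed
    then show "I 0 P' m'" unfolding I_def using X(1,2) cardbad by auto
  qed
  then have "can (I (S * (?n * ?n))) (?K + S * (?n * ?n) * ?K) P m"
  proof (rule can_bind[OF _ st])
    fix P1 m1 assume st1: "st P1 m1" and s1: "P \<subseteq> P1" "agree P m m1" and I0: "I 0 P1 m1"
    have sn1: "snaps N P1 m1 A S cs" by (rule snaps_agree[OF sn s1 NG])
    have meR1: "meas P1 ?R" using meas_mono[OF meR s1(1)] .
    show "can (I (S * (?n * ?n))) (S * (?n * ?n) * ?K) P1 m1"
    proof (rule can_iter[where I = I, OF st1])
      fix m' assume "st P1 m'" and ag: "agree P1 m1 m'"
      obtain X where X: "alloc N P1 ?R X" "ef N m1 X" "\<forall>s<S. \<exists>j\<in>N - {c}. 2 * r m1 X c \<le> g m1 s c j"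
        using I0 I_def by auto
      have "\<forall>s<S. \<exists>j\<in>N - {c}. 2 * r m' X c \<le> g m' s c j"
        using X(3) r_agree[OF ag meR1 X(1) c] g_agree[OF ag sn1 _ c] by (metis DiffD1)
      then show "I 0 P1 m'" unfolding I_def using X(1) ef_agree[OF X(2,1) ag NG] cardbad by auto
    next
      fix t P' m' assume st': "st P' m'" and s: "P1 \<subseteq> P'" "agree P1 m1 m'" and It: "I t P' m'"
      have sn': "snaps N P' m' A S cs" by (rule snaps_agree[OF sn1 s NG])
      have meR': "meas P' ?R" using meas_mono[OF meR1 s(1)] .
      obtain X where X: "alloc N P' ?R X" "ef N m' X" "\<And>s. s < S \<Longrightarrow> \<exists>j\<in>N - {c}. 2 * r m' X c \<le> g m' s c j"
        "good m' X \<or> card (bad m' X) + t \<le> S * (?n * ?n)" using It I_def by auto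
      show "can (I (Suc t)) ?K P' m'"
      proof (cases "good m' X")
        case True
        show ?thesis
        proof (rule can_I[OF st'])
          fix m'' assume ag: "agree P' m' m''"
          have "good m'' X"
            using True r_agree[OF ag meR' X(1)] g_agree[OF ag sn'] unfolding good_def by simp
          moreover have "\<forall>s<S. \<exists>j\<in>N - {c}. 2 * r m'' X c \<le> g m'' s c j"
            using X(3) r_agree[OF ag meR' X(1) c] g_agree[OF ag sn' _ c] by (metis DiffD1)
          ultimately show "I (Suc t) P' m''" unfolding I_def using X(1) ef_agree[OF X(2,1) ag NG] by auto
        qed
      next
        case False
        then obtain s0 i0 k0 where b0: "s0 < S" "i0 \<in> N" "k0 \<in> N" "\<not> 2 * r m' X i0 \<le> g m' s0 i0 k0"
          "\<not> \<theta> * g m' s0 i0 k0 \<le> r m' X i0" unfolding good_def by blast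
        define R1 where "R1 = ?R - (\<Union>k\<in>N. X k)"
        have meR1': "meas P' R1" unfolding R1_def using meR' alloc_meas[OF X(1)] by auto
        show ?thesis
        proof (rule can_conseq[OF shrink[OF st' NG finN N0(1) meR1'] st' order_refl])
          fix P'' m'' assume st'': "st P'' m''" and s'': "P' \<subseteq> P''" and ag: "agree P' m' m''"
            and "\<exists>X. alloc N P'' R1 X \<and> ef N m'' X \<and> (\<forall>c\<in>N. 2 ^ L * m'' c (R1 - (\<Union>i\<in>N. X i)) \<le> m'' c R1)"
          then obtain Y where Y: "alloc N P'' R1 Y" "ef N m'' Y"
            "\<And>c. c \<in> N \<Longrightarrow> 2 ^ L * m'' c (R1 - (\<Union>i\<in>N. Y i)) \<le> m'' c R1" by blast
          have X'': "alloc N P'' ?R X" "ef N m'' X"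
            using alloc_mono[OF X(1) s'' subset_refl] ef_agree[OF X(2,1) ag NG] by auto
          define Z where "Z i = X i \<union> Y i" for i
          have Y': "alloc N P'' (?R - (\<Union>k\<in>N. X k)) Y" using Y(1) R1_def by simp
          have Z: "alloc N P'' ?R Z" "ef N m'' Z"
            unfolding Z_def using alloc_combine[OF X''(1) Y'] ef_combine[OF st'' NG X''(1) Y' X''(2) Y(2)] by auto
          have eqZ: "?R - (\<Union>k\<in>N. Z k) = R1 - (\<Union>i\<in>N. Y i)" unfolding Z_def R1_def by blast
          have meas'': "meas P'' R1" "meas P'' (R1 - (\<Union>i\<in>N. Y i))"
            using meas_mono[OF meR1' s''] alloc_meas[OF Y(1)] by auto
          have mR1: "m'' i R1 = r m' X i" if "i \<in> N" for i
            using agreeD[OF ag meR1'] that NG unfolding r_def R1_def by auto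
          have rle: "r m'' Z i \<le> r m' X i" if "i \<in> N" for i
          proof -
            have "m'' i (R1 - (\<Union>i\<in>N. Y i)) \<le> m'' i R1"
              by (rule st_m_mono[OF st'' _ meas'']) (use that NG in auto)
            then show ?thesis using mR1[OF that] eqZ unfolding r_def by simp
          qed
          have gg: "g m'' s i k = g m' s i k" if "s < S" "i \<in> N" "k \<in> N" for s i k
            by (rule g_agree[OF ag sn' that])
          have gaps: "\<forall>s<S. \<exists>j\<in>N - {c}. 2 * r m'' Z c \<le> g m'' s c j"
          proof (intro allI impI)
            fix s assume sS: "s < S"
            then obtain j where "j \<in> N - {c}" "2 * r m' X c \<le> g m' s c j" using X(3) by blast
            then show "\<exists>j\<in>N - {c}. 2 * r m'' Z c \<le> g m'' s c j"
              using rle[OF c] gg[OF sS c, of j] by (intro bexI[of _ j]) auto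
          qed
          have bsub: "bad m'' Z \<subseteq> bad m' X"
            unfolding bad_def using rle gg by force
          \<comment> \<open>The residue was less than \<open>\<theta>\<close> times the gap, and it
            has dropped by the factor \<open>2 ^ L\<close>, which is at least
            \<open>2 * \<theta>\<close>.\<close>
          have "2 * r m'' Z i0 \<le> g m'' s0 i0 k0"
          proof -
            have rn: "0 \<le> r m'' Z i0"
              unfolding r_def eqZ by (rule st_nonneg[OF st'' _ meas''(2)]) (use b0 NG in auto)
            have "2 ^ L * r m'' Z i0 \<le> r m' X i0" using Y(3)[OF b0(2)] mR1[OF b0(2)] eqZ unfolding r_def by simp
            also have "\<dots> < \<theta> * g m' s0 i0 k0" using b0(5) by simp
            finally have lt: "2 ^ L * r m'' Z i0 < \<theta> * g m' s0 i0 k0" .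
            have g0: "0 \<le> g m' s0 i0 k0"
              using sn' b0 unfolding snaps_def ef_def g_def by auto
            have "2 * (\<theta> * g m' s0 i0 k0) \<le> 2 ^ L * g m' s0 i0 k0"
              using mult_right_mono[OF L(1) g0] by (simp add: mult.assoc)
            then have "2 * (2 ^ L * r m'' Z i0) < 2 ^ L * g m' s0 i0 k0" using lt by linarith
            then have "2 ^ L * (2 * r m'' Z i0) < 2 ^ L * g m' s0 i0 k0" by (simp add: algebra_simps)
            then show ?thesis using gg[OF b0(1-3)] by simp
          qed
          then have "(s0, i0, k0) \<notin> bad m'' Z" unfolding bad_def by auto
          moreover have "(s0, i0, k0) \<in> bad m' X" unfolding bad_def using b0 by auto
          ultimately have "card (bad m'' Z) < card (bad m' X)"
            using bsub finbad by (intro psubset_card_mono) auto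
          then have "card (bad m'' Z) + Suc t \<le> S * (?n * ?n)" using X(4) False by linarith
          then show "I (Suc t) P'' m''" unfolding I_def using Z gaps by blast
        qed
      qed
    qed
  qed
  then show ?thesis
  proof (rule can_conseq[OF _ st])
    show "?K + S * (?n * ?n) * ?K \<le> (1 + S * (?n * ?n)) * ?K" by simp
    fix P' m' assume "I (S * (?n * ?n)) P' m'"
    then obtain X where X: "alloc N P' ?R X" "ef N m' X" "\<forall>s<S. \<exists>j\<in>N - {c}. 2 * r m' X c \<le> g m' s c j"
      "good m' X \<or> card (bad m' X) + S * (?n * ?n) \<le> S * (?n * ?n)" unfolding I_def by blast
    have "good m' X"
    proof (cases "good m' X")
      case False
      then have "bad m' X = {}" using X(4) finbad by auto
      then show ?thesis unfolding good_def bad_def by blast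
    qed
    then show "\<exists>X. alloc N P' ?R X \<and> ef N m' X \<and>
      (\<forall>s<S. \<exists>j\<in>N - {c}. 2 * r m' X c \<le> g m' s c j) \<and>
      (\<forall>s<S. \<forall>i\<in>N. \<forall>k\<in>N. 2 * r m' X i \<le> g m' s i k \<or> \<theta> * g m' s i k \<le> r m' X i)"
      using X(1-3) unfolding good_def by blast
  qed
qed

subsection \<open>Isomorphic families\<close>

text \<open>The last-diminisher procedure, with several claims per agent.\<close>

lemma claims:
  fixes \<delta> :: "nat \<Rightarrow> real" and m :: "nat \<Rightarrow> real set \<Rightarrow> real"
  assumes "finite C" "own ` C \<subseteq> N" "N \<subseteq> G" "finite N" "st P m" "meas P R"
    and "\<And>i. 0 \<le> \<delta> i" "\<And>c. c \<in> C \<Longrightarrow> card C * \<delta> (own c) \<le> m (own c) R"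
  shows "can (\<lambda>P' m'. \<exists>T. (\<forall>c\<in>C. meas P' (T c) \<and> T c \<subseteq> R \<and> \<delta> (own c) \<le> m' (own c) (T c)) \<and>
    disjoint_family_on T C) (card C * card N) P m"
  using assms(1,2,5,6,8)
proof (induction "card C" arbitrary: C P m R)
  case 0
  then have C: "C = {}" by simp
  show ?case by (rule can_I[OF 0(4)]) (auto simp: C disjoint_family_on_def)
next
  case (Suc q)
  let ?Q = "\<lambda>C R P' m'. \<exists>T. (\<forall>c\<in>C. meas P' (T c) \<and> T c \<subseteq> R \<and> \<delta> (own c) \<le> m' (own c) (T c)) \<and>
    disjoint_family_on T C"
  define I where "I = own ` C"
  have finI: "finite I" "I \<noteq> {}" "I \<subseteq> G" "I \<subseteq> N"
    unfolding I_def using Suc.hyps(2) Suc.prems(1,2) assms(3) by auto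
  have cI: "card I \<le> card N" using finI assms(4) by (intro card_mono) auto
  have cC: "card C = Suc q" using Suc.hyps(2) by simp
  have \<delta>R: "0 \<le> \<delta> i \<and> \<delta> i \<le> m i R" if i: "i \<in> I" for i
  proof -
    obtain c where c: "c \<in> C" "i = own c" using i I_def by auto
    have "\<delta> i \<le> real (Suc q) * \<delta> i" using assms(7)[of i] by (simp add: algebra_simps)
    then show ?thesis using Suc.prems(5)[OF c(1)] c assms(7) cC by auto
  qed
  have "can (?Q C R) (card I + q * card N) P m"
  proof (rule can_bind[OF min_mark[OF finI(1,2,3) Suc.prems(3,4) \<delta>R] Suc.prems(3)])
    fix P' m' assume st': "st P' m'" and s: "P \<subseteq> P'" "agree P m m'"
      and "\<exists>b\<in>I. \<exists>y\<in>P'. m' b (R \<inter> {..y}) = \<delta> b \<and> (\<forall>i\<in>I. m' i (R \<inter> {..y}) \<le> \<delta> i)"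
    then obtain b y where b: "b \<in> I" "y \<in> P'" "m' b (R \<inter> {..y}) = \<delta> b" "\<And>i. i \<in> I \<Longrightarrow> m' i (R \<inter> {..y}) \<le> \<delta> i"
      by blast
    \<comment> \<open>Only one claim of the agent with the smallest mark is served; its other claims
      stay in the race.\<close>
    obtain c0 where c0: "c0 \<in> C" "own c0 = b" using b I_def by auto
    define C' where "C' = C - {c0}"
    have C': "q = card C'" "finite C'" "own ` C' \<subseteq> N" "C' \<subseteq> C"
      unfolding C'_def using c0 cC Suc.prems(1,2) by auto
    have meR: "meas P' R" using meas_mono[OF Suc.prems(4) s(1)] .
    have me: "meas P' (R \<inter> {..y})" "meas P' (R \<inter> {y<..})" using meR b by auto
    have val: "card C' * \<delta> (own c) \<le> m' (own c) (R \<inter> {y<..})" if c: "c \<in> C'" for c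
    proof -
      have cI: "own c \<in> I" "own c \<in> G" using c C' finI I_def by auto
      have "m' (own c) (R \<inter> {..y}) + m' (own c) (R \<inter> {y<..}) = m' (own c) R"
        using m_split[OF st_prof[OF st'] cI(2) _ meR b(2)] st' st_def by auto
      moreover have "m' (own c) R = m (own c) R" using agreeD[OF s(2) Suc.prems(4) cI(2)] .
      moreover have "real (Suc q) * \<delta> (own c) \<le> m (own c) R" using Suc.prems(5)[of c] c C'(4) cC by auto
      ultimately show ?thesis using b(4)[OF cI(1)] C'(1) by (simp add: algebra_simps)
    qed
    have "can (?Q C' (R \<inter> {y<..})) (card C' * card N) P' m'"
      by (rule Suc.hyps(1)[OF C'(1-3) st' me(2) val])
    then show "can (?Q C R) (q * card N) P' m'"
    proof (rule can_conseq[OF _ st'])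
      fix P'' m'' assume st'': "st P'' m''" and s': "P' \<subseteq> P''" "agree P' m' m''" and "?Q C' (R \<inter> {y<..}) P'' m''"
      then obtain T where T: "\<forall>c\<in>C'. meas P'' (T c) \<and> T c \<subseteq> R \<inter> {y<..} \<and> \<delta> (own c) \<le> m'' (own c) (T c)"
        "disjoint_family_on T C'" by blast
      define T' where "T' = T(c0 := R \<inter> {..y})"
      have bG: "b \<in> G" using b finI by auto
      have v: "m'' b (R \<inter> {..y}) = \<delta> b" using agreeD[OF s'(2) me(1) bG] b by simp
      have d: "disjoint_family_on T' (insert c0 C')"
        unfolding T'_def
      proof (rule disjoint_insert[OF T(2)])
        show "c0 \<notin> C'" using C'_def by auto
        fix j assume "j \<in> C'"
        then have "T j \<subseteq> R \<inter> {y<..}" using T by auto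
        then show "T j \<inter> (R \<inter> {..y}) = {}" by auto
      qed
      have CC: "C = insert c0 C'" using c0 C'_def by auto
      have "meas P'' (T' c) \<and> T' c \<subseteq> R \<and> \<delta> (own c) \<le> m'' (own c) (T' c)" if "c \<in> C" for c
      proof (cases "c = c0")
        case True
        then show ?thesis using v c0 meas_mono[OF me(1) s'(1)] unfolding T'_def by auto
      next
        case False
        then show ?thesis using T(1) that CC unfolding T'_def by auto
      qed
      then show "?Q C R P'' m''" using d CC by blast
    qed (use C' in simp)
  qed
  then show ?case
    by (rule can_conseq[OF _ Suc.prems(3)]) (use cI cC in auto)
qed

text \<open>Each piece is cut at the smallest mark, which satisfies one agent exactly; this agent leaves.\<close>

lemma extract_chain:
  assumes "finite I" "I \<subseteq> G" "st P m" "meas P R" "\<And>i. i \<in> I \<Longrightarrow> 0 \<le> g i \<and> g i \<le> m i R"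
  shows "can (\<lambda>P' m'. \<exists>pos d. bij_betw pos I {1..card I} \<and> (\<forall>t. meas P' (d t) \<and> d t \<subseteq> R) \<and>
    disjoint_family_on d UNIV \<and> (\<forall>i\<in>I. (\<Sum>t=1..pos i. m' i (d t)) = g i)) (card I * card I) P m"
  using assms
proof (induction "card I" arbitrary: I P m R g)
  case 0
  then have I: "I = {}" by simp
  show ?case
    by (rule can_I[OF 0(4)], rule exI[of _ "\<lambda>_. 0"], rule exI[of _ "\<lambda>_. {}"])
       (auto simp: I disjoint_family_on_def bij_betw_def)
next
  case (Suc q)
  let ?Q = "\<lambda>I R g P' m'. \<exists>pos d. bij_betw pos I {1..card I} \<and> (\<forall>t. meas P' (d t) \<and> d t \<subseteq> R) \<and>
    disjoint_family_on d UNIV \<and> (\<forall>i\<in>I. (\<Sum>t=1..pos i. m' i (d t)) = g i)"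
  have ne: "I \<noteq> {}" and cI: "card I = Suc q" using Suc.hyps(2) by auto
  have "can (?Q I R g) (card I + q * q) P m"
  proof (rule can_bind[OF min_mark[OF Suc.prems(1) ne Suc.prems(2-5)] Suc.prems(3)])
    fix P' m' assume st': "st P' m'" and s: "P \<subseteq> P'" "agree P m m'"
      and "\<exists>b\<in>I. \<exists>y\<in>P'. m' b (R \<inter> {..y}) = g b \<and> (\<forall>i\<in>I. m' i (R \<inter> {..y}) \<le> g i)"
    then obtain b y where b: "b \<in> I" "y \<in> P'" "m' b (R \<inter> {..y}) = g b" "\<And>i. i \<in> I \<Longrightarrow> m' i (R \<inter> {..y}) \<le> g i"
      by blast
    define I' where "I' = I - {b}"
    have I': "q = card I'" "finite I'" "I' \<subseteq> G" "I' \<subseteq> I"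
      unfolding I'_def using b cI Suc.prems(1,2) by auto
    have meR: "meas P' R" using meas_mono[OF Suc.prems(4) s(1)] .
    have me: "meas P' (R \<inter> {..y})" "meas P' (R \<inter> {y<..})" using meR b by auto
    \<comment> \<open>What each remaining agent still lacks, since the piece just cut belongs to all
      later prefixes.\<close>
    define g' where "g' i = g i - m' i (R \<inter> {..y})" for i
    have val: "0 \<le> g' i \<and> g' i \<le> m' i (R \<inter> {y<..})" if i: "i \<in> I'" for i
    proof -
      have iG: "i \<in> G" "i \<in> I" using i I' by auto
      have "m' i (R \<inter> {..y}) + m' i (R \<inter> {y<..}) = m' i R"
        using m_split[OF st_prof[OF st'] iG(1) _ meR b(2)] st' st_def by auto
      moreover have "m' i R = m i R" using agreeD[OF s(2) Suc.prems(4) iG(1)] .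
      ultimately show ?thesis using b(4)[OF iG(2)] Suc.prems(5)[OF iG(2)] unfolding g'_def by simp
    qed
    have "can (?Q I' (R \<inter> {y<..}) g') (card I' * card I') P' m'"
      by (rule Suc.hyps(1)[OF I'(1-3) st' me(2) val])
    then show "can (?Q I R g) (q * q) P' m'"
    proof (rule can_conseq[OF _ st'])
      fix P'' m'' assume st'': "st P'' m''" and s': "P' \<subseteq> P''" "agree P' m' m''" and "?Q I' (R \<inter> {y<..}) g' P'' m''"
      then obtain pos d where p: "bij_betw pos I' {1..card I'}" and d: "\<And>t. meas P'' (d t)" "\<And>t. d t \<subseteq> R \<inter> {y<..}"
        "disjoint_family_on d UNIV" and v: "\<And>i. i \<in> I' \<Longrightarrow> (\<Sum>t=1..pos i. m'' i (d t)) = g' i" by blast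
      define pos' where "pos' i = (if i = b then 1 else Suc (pos i))" for i
      \<comment> \<open>The new piece gets number 1 and the others move up by one. Prefixes start at
        1, so number 0 can be empty.\<close>
      define d' where "d' t = (if t = 0 then {} else if t = 1 then R \<inter> {..y} else d (t - 1))" for t
      have eqI: "I = insert b I'" "b \<notin> I'" using b I'_def by auto
      have inj: "inj_on pos I'" and im: "pos ` I' = {1..q}" using p I'(1) unfolding bij_betw_def by auto
      have "inj_on pos' (insert b I')"
      proof (rule inj_onI)
        have p1: "1 \<le> pos i" if "i \<in> I'" for i using im that by auto
        fix x z assume "x \<in> insert b I'" "z \<in> insert b I'" "pos' x = pos' z"
        then show "x = z" using p1[of x] p1[of z] inj_onD[OF inj, of x z] eqI(2) unfolding pos'_def
          by (cases "x = b"; cases "z = b") auto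
      qed
      moreover have "pos' ` insert b I' = {1..card I}"
      proof -
        have "pos' ` insert b I' = insert 1 (pos' ` I')" unfolding pos'_def by auto
        also have "pos' ` I' = Suc ` pos ` I'" using eqI(2) unfolding pos'_def by (auto simp: image_iff)
        also have "insert 1 (Suc ` pos ` I') = {1..card I}"
          unfolding im cI image_Suc_atLeastAtMost by auto
        finally show ?thesis .
      qed
      ultimately have bij: "bij_betw pos' I {1..card I}" using eqI by (simp add: bij_betw_def)
      have md: "meas P'' (d' t)" "d' t \<subseteq> R" for t
        using d(1,2)[of "t - 1"] meas_mono[OF me(1) s'(1)] unfolding d'_def by auto
      have disj: "disjoint_family_on d' UNIV"
        unfolding disjoint_family_on_def
      proof (intro ballI impI)
        fix u t :: nat assume ut: "u \<noteq> t"
        have yy: "(R \<inter> {..y}) \<inter> d t = {}" for t using d(2)[of t] by auto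
        have "d (u - 1) \<inter> d (t - 1) = {}" if "u > 1" "t > 1"
          using disjoint_family_onD[OF d(3), of "u - 1" "t - 1"] ut that by auto
        then show "d' u \<inter> d' t = {}" using ut yy[of "u - 1"] yy[of "t - 1"] unfolding d'_def by auto
      qed
      have sumd: "(\<Sum>t=1..pos' i. m'' i (d' t)) = g i" if i: "i \<in> I" for i
      proof -
        have iG: "i \<in> G" using i Suc.prems by auto
        have e: "m'' i (R \<inter> {..y}) = m' i (R \<inter> {..y})" using agreeD[OF s'(2) me(1) iG] .
        show ?thesis
        proof (cases "i = b")
          case True
          then show ?thesis using b(3) e unfolding pos'_def d'_def by simp
        next
          case False
          have "(\<Sum>t=1..Suc (pos i). m'' i (d' t)) = m'' i (d' 1) + (\<Sum>t=Suc 1..Suc (pos i). m'' i (d' t))"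
            by (rule sum.atLeast_Suc_atMost) simp
          also have "(\<Sum>t=Suc 1..Suc (pos i). m'' i (d' t)) = (\<Sum>t=1..pos i. m'' i (d' (Suc t)))"
            by (rule sum.shift_bounds_cl_Suc_ivl)
          also have "\<dots> = (\<Sum>t=1..pos i. m'' i (d t))" by (intro sum.cong) (auto simp: d'_def)
          also have "\<dots> = g' i" using v False i eqI by auto
          finally show ?thesis using False e unfolding pos'_def g'_def d'_def by simp
        qed
      qed
      show "?Q I R g P'' m''" using bij md disj sumd by blast
    qed (use I' in simp)
  qed
  then show ?case
    by (rule can_conseq[OF _ Suc.prems(3)]) (use cI in auto)
qed

text \<open>A family of snapshots of the same type. Agent \<open>i \<in> I k\<close> is indifferent between its own piece and
  the piece of \<open>k\<close> enlarged by the first \<open>pos k i\<close> extracted pieces; for \<open>i \<notin> I k\<close> the gap exceeds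
  twice the whole residue.\<close>

definition iso :: "nat set \<Rightarrow> real set \<Rightarrow> (nat \<Rightarrow> real set \<Rightarrow> real) \<Rightarrow> real set \<Rightarrow> nat set \<Rightarrow>
    (nat \<Rightarrow> nat \<Rightarrow> real set) \<Rightarrow> (nat \<Rightarrow> nat set) \<Rightarrow> (nat \<Rightarrow> nat \<Rightarrow> nat) \<Rightarrow> (nat \<Rightarrow> nat \<Rightarrow> nat \<Rightarrow> real set) \<Rightarrow> bool" where
  "iso N P m R \<S> cs I pos d \<longleftrightarrow>
     (\<forall>k\<in>N. k \<in> I k \<and> I k \<subseteq> N \<and> bij_betw (pos k) (I k) {..<card (I k)} \<and> pos k k = 0) \<and>
     (\<forall>s\<in>\<S>. \<forall>k\<in>N. \<forall>t. meas P (d s k t) \<and> d s k t \<subseteq> R) \<and>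
     disjoint_family_on (\<lambda>(s, k, t). d s k t) (\<S> \<times> N \<times> UNIV) \<and>
     (\<forall>s\<in>\<S>. \<forall>k\<in>N. \<forall>i\<in>I k. m i (cs s k) + (\<Sum>t=1..pos k i. m i (d s k t)) = m i (cs s i)) \<and>
     (\<forall>s\<in>\<S>. \<forall>k\<in>N. \<forall>i\<in>N - I k. m i (cs s k) + 2 * m i R \<le> m i (cs s i))"

lemma pigeonhole_fibre:
  assumes "finite B" "f ` A \<subseteq> B" "finite A" "card B * M \<le> card A" "0 < M" "B \<noteq> {}"
  shows "\<exists>b\<in>B. M \<le> card {a \<in> A. f a = b}"
proof (rule ccontr)
  assume neg: "\<not> ?thesis"
  have "card A = (\<Sum>b\<in>B. card {a \<in> A. f a = b})"
  proof -
    have "A = (\<Union>b\<in>B. {a \<in> A. f a = b})" using assms(2) by auto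
    also have "card \<dots> = (\<Sum>b\<in>B. card {a \<in> A. f a = b})"
      using assms(1,3) by (intro card_UN_disjoint) auto
    finally show ?thesis .
  qed
  moreover have "(\<Sum>b\<in>B. card {a \<in> A. f a = b}) \<le> card B * (M - 1)"
    using neg sum_bounded_above[of B "\<lambda>b. card {a \<in> A. f a = b}" "M - 1"] by (force simp: not_le)
  ultimately have "card A \<le> card B * (M - 1)" by simp
  moreover have "card B * (M - 1) < card B * M" using assms(1,5,6) by (simp add: card_gt_0_iff)
  ultimately show False using assms(4) by linarith
qed

text \<open>There is one claim on the residue for every snapshot, piece and agent, each worth the
  fraction \<open>1 / \<theta>\<close>, where \<open>\<theta>\<close> is the number of claims. A gap
  that is not large is at most that fraction. So every snapshot and piece has a reserve of its own,
  \<open>\<rho>\<close>, from which all tiny gaps to this piece can be extracted exactly.\<close>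

lemma iso_family:
  assumes st: "st P m" and NG: "N \<subseteq> G" and finN: "finite N" and n2: "2 \<le> card N" and A: "meas P A"
    and S0: "0 < S" and SM: "(card N + 1) ^ (card N * card N) * M \<le> S" and M0: "0 < M"
    and L: "2 * (S * card N * card N) \<le> 2 ^ L"
  shows "can (\<lambda>P' m'. \<exists>cs X \<S> I pos d. snaps N P' m' A S cs \<and> alloc N P' (rest N A S cs) X \<and> ef N m' X \<and>
      \<S> \<subseteq> {..<S} \<and> M \<le> card \<S> \<and> iso N P' m' (rest N A S cs - (\<Union>i\<in>N. X i)) \<S> cs I pos d \<and> (\<exists>k\<in>N. I k \<noteq> N))
    (S * (card N + trim_cost (card N)) + ((1 + S * (card N * card N)) * (L * shrink_cost (card N)) +
      (S * card N * card N * card N + S * card N * (card N * card N)))) P m"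
proof -
  let ?n = "card N"
  let ?Q = "\<lambda>P' m'. \<exists>cs X \<S> I pos d. snaps N P' m' A S cs \<and> alloc N P' (rest N A S cs) X \<and> ef N m' X \<and>
      \<S> \<subseteq> {..<S} \<and> M \<le> card \<S> \<and> iso N P' m' (rest N A S cs - (\<Union>i\<in>N. X i)) \<S> cs I pos d \<and> (\<exists>k\<in>N. I k \<noteq> N)"
  obtain c where c: "c \<in> N" using n2 by fastforce
  define \<theta> where "\<theta> = real (S * ?n * ?n)"
  have \<theta>L: "2 * \<theta> \<le> 2 ^ L"
  proof -
    have "real (2 * (S * ?n * ?n)) \<le> real (2 ^ L)" using L by (rule of_nat_mono)
    then show ?thesis unfolding \<theta>_def by simp
  qed
  have "?n \<le> S * ?n * ?n" using S0 n2 by simp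
  then have "real ?n \<le> \<theta>" unfolding \<theta>_def by (rule of_nat_mono)
  then have nL: "2 * ?n \<le> (2::real) ^ L" using \<theta>L by linarith
  have \<theta>0: "0 < \<theta>" unfolding \<theta>_def using S0 n2 by simp
  show ?thesis
  proof (rule can_bind[OF snapshots[OF st NG finN c A n2] st])
    fix P1 m1 assume st1: "st P1 m1" and s1: "P \<subseteq> P1" "agree P m m1"
      and "\<exists>cs. snaps N P1 m1 A S cs \<and>
        (\<forall>s<S. \<exists>j\<in>N - {c}. m1 c (rest N A S cs) / ?n \<le> m1 c (cs s c) - m1 c (cs s j))"
    then obtain cs where sn: "snaps N P1 m1 A S cs"
      and gap: "\<And>s. s < S \<Longrightarrow> \<exists>j\<in>N - {c}. m1 c (rest N A S cs) / ?n \<le> m1 c (cs s c) - m1 c (cs s j)" by blast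
    have A1: "meas P1 A" using meas_mono[OF A s1(1)] .
    let ?R = "rest N A S cs"
    show "can ?Q ((1 + S * (?n * ?n)) * (L * shrink_cost ?n) + (S * ?n * ?n * ?n + S * ?n * (?n * ?n))) P1 m1"
    proof (rule can_bind[OF separate_gaps[OF st1 NG finN c A1 sn gap \<theta>L nL] st1])
      fix P2 m2 assume st2: "st P2 m2" and s2: "P1 \<subseteq> P2" "agree P1 m1 m2"
        and "\<exists>X. alloc N P2 ?R X \<and> ef N m2 X \<and>
          (\<forall>s<S. \<exists>j\<in>N - {c}. 2 * m2 c (?R - (\<Union>k\<in>N. X k)) \<le> m2 c (cs s c) - m2 c (cs s j)) \<and>
          (\<forall>s<S. \<forall>i\<in>N. \<forall>k\<in>N. 2 * m2 i (?R - (\<Union>k\<in>N. X k)) \<le> m2 i (cs s i) - m2 i (cs s k) \<or>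
             \<theta> * (m2 i (cs s i) - m2 i (cs s k)) \<le> m2 i (?R - (\<Union>k\<in>N. X k)))"
      then obtain X where X: "alloc N P2 ?R X" "ef N m2 X"
        and gapc: "\<And>s. s < S \<Longrightarrow> \<exists>j\<in>N - {c}. 2 * m2 c (?R - (\<Union>k\<in>N. X k)) \<le> m2 c (cs s c) - m2 c (cs s j)"
        and good: "\<And>s i k. s < S \<Longrightarrow> i \<in> N \<Longrightarrow> k \<in> N \<Longrightarrow>
          2 * m2 i (?R - (\<Union>k\<in>N. X k)) \<le> m2 i (cs s i) - m2 i (cs s k) \<or>
             \<theta> * (m2 i (cs s i) - m2 i (cs s k)) \<le> m2 i (?R - (\<Union>k\<in>N. X k))" by blast
      define R where "R = ?R - (\<Union>k\<in>N. X k)"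
      define r where "r i = m2 i R" for i
      define g where "g s i k = m2 i (cs s i) - m2 i (cs s k)" for s i k
      have sn2: "snaps N P2 m2 A S cs" by (rule snaps_agree[OF sn s2 NG])
      have A2: "meas P2 A" using meas_mono[OF A1 s2(1)] .
      have R2: "meas P2 R" unfolding R_def using meas_rest[OF A2 sn2] alloc_meas[OF X(1)] by auto
      have r0: "0 \<le> r i" if "i \<in> N" for i unfolding r_def by (rule st_nonneg[OF st2 _ R2]) (use that NG in auto)
      have g0: "0 \<le> g s i k" if "s < S" "i \<in> N" "k \<in> N" for s i k
        using sn2 that unfolding g_def snaps_def ef_def by auto
      define C where "C = {..<S} \<times> N \<times> N"
      define own :: "nat \<times> nat \<times> nat \<Rightarrow> nat" where "own = (\<lambda>(s, k, i). i)"
      define \<delta> where "\<delta> i = (if i \<in> N then r i / \<theta> else 0)" for i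
      have C: "finite C" "own ` C \<subseteq> N" "card C = S * ?n * ?n"
        unfolding C_def own_def using finN by (auto simp: card_cartesian_product)
      have \<delta>R: "card C * \<delta> (own x) \<le> m2 (own x) R" if x: "x \<in> C" for x
      proof -
        have "own x \<in> N" using C x by auto
        then have "real (card C) * \<delta> (own x) = \<theta> * (r (own x) / \<theta>)" unfolding \<delta>_def C(3) \<theta>_def by simp
        then show ?thesis using \<theta>0 r_def by simp
      qed
      have \<delta>0: "0 \<le> \<delta> i" for i unfolding \<delta>_def using r0 \<theta>0 by simp
      have "can (\<lambda>P' m'. \<exists>T. (\<forall>x\<in>C. meas P' (T x) \<and> T x \<subseteq> R \<and> \<delta> (own x) \<le> m' (own x) (T x)) \<and>
          disjoint_family_on T C) (card C * card N) P2 m2"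
        by (rule claims[OF C(1,2) NG finN st2 R2 \<delta>0 \<delta>R])
      then have cl: "can (\<lambda>P' m'. \<exists>T. (\<forall>x\<in>C. meas P' (T x) \<and> T x \<subseteq> R \<and> \<delta> (own x) \<le> m' (own x) (T x)) \<and>
          disjoint_family_on T C) (S * ?n * ?n * ?n) P2 m2" using C(3) by simp
      show "can ?Q (S * ?n * ?n * ?n + S * ?n * (?n * ?n)) P2 m2"
      proof (rule can_bind[OF cl st2])
        fix P3 m3 assume st3: "st P3 m3" and s3: "P2 \<subseteq> P3" "agree P2 m2 m3"
          and "\<exists>T. (\<forall>x\<in>C. meas P3 (T x) \<and> T x \<subseteq> R \<and> \<delta> (own x) \<le> m3 (own x) (T x)) \<and> disjoint_family_on T C"
        then obtain T where T: "\<And>x. x \<in> C \<Longrightarrow> meas P3 (T x)" "\<And>x. x \<in> C \<Longrightarrow> T x \<subseteq> R"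
          "\<And>x. x \<in> C \<Longrightarrow> \<delta> (own x) \<le> m3 (own x) (T x)" "disjoint_family_on T C" by blast
        define \<rho> where "\<rho> s k = (\<Union>i\<in>N. T (s, k, i))" for s k
        define I0 where "I0 s k = {i \<in> N - {k}. \<not> 2 * r i \<le> g s i k}" for s k
        have I0: "finite (I0 s k)" "I0 s k \<subseteq> N" "card (I0 s k) \<le> ?n" for s k
          unfolding I0_def using finN by (auto intro: card_mono)
        have \<rho>3: "meas P3 (\<rho> s k)" if "s < S" "k \<in> N" for s k
          unfolding \<rho>_def using T(1) that C_def by auto
        have g\<rho>: "0 \<le> g s i k \<and> g s i k \<le> m3 i (\<rho> s k)" if "s < S" "k \<in> N" "i \<in> I0 s k" for s k i
        proof -
          have iN: "i \<in> N" using that I0_def by auto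
          have x: "(s, k, i) \<in> C" using that iN C_def by auto
          have "\<theta> * g s i k \<le> r i" using good[of s i k] that iN unfolding I0_def R_def[symmetric] r_def g_def by auto
          then have "g s i k \<le> \<delta> i" using iN \<theta>0 unfolding \<delta>_def by (simp add: field_simps)
          also have "\<delta> i \<le> m3 i (T (s, k, i))" using T(3)[OF x] own_def by simp
          also have "\<dots> \<le> m3 i (\<rho> s k)"
            by (rule st_m_mono[OF st3 _ \<rho>3 T(1)[OF x]]) (use iN NG that \<rho>_def in auto)
          finally show ?thesis using g0 that iN by auto
        qed
        define Qe where "Qe = (\<lambda>(s, k) P' m'. \<exists>pos d. bij_betw pos (I0 s k) {1..card (I0 s k)} \<and>
          (\<forall>t. meas P' (d t) \<and> d t \<subseteq> \<rho> s k) \<and> disjoint_family_on d UNIV \<and>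
          (\<forall>i\<in>I0 s k. (\<Sum>t=1..pos i. m' i (d t)) = g s i k))"
        have "can (\<lambda>P' m'. \<forall>x\<in>{..<S} \<times> N. Qe x P' m') (card ({..<S} \<times> N) * (?n * ?n)) P3 m3"
        proof (rule can_family[OF _ st3])
          show "finite ({..<S} \<times> N)" using finN by auto
          fix x P' m' assume x: "x \<in> {..<S} \<times> N" and st': "st P' m'" and s': "P3 \<subseteq> P'" "agree P3 m3 m'"
          obtain s k where xk: "x = (s, k)" "s < S" "k \<in> N" using x by auto
          have v: "0 \<le> g s i k \<and> g s i k \<le> m' i (\<rho> s k)" if "i \<in> I0 s k" for i
            using g\<rho>[OF xk(2,3) that] agreeD[OF s'(2) \<rho>3[OF xk(2,3)], of i] that I0(2)[of s k] NG by auto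
          have "can (Qe x) (card (I0 s k) * card (I0 s k)) P' m'"
            using extract_chain[OF I0(1) subset_trans[OF I0(2) NG] st' meas_mono[OF \<rho>3[OF xk(2,3)] s'(1)] v]
            unfolding Qe_def xk by simp
          then show "can (Qe x) (?n * ?n) P' m'" by (rule can_mono) (intro mult_mono I0(3); simp)
        next
          fix x P' m' P'' m'' assume x: "x \<in> {..<S} \<times> N" and q: "Qe x P' m'" and s': "P' \<subseteq> P''" "agree P' m' m''"
          obtain s k where xk: "x = (s, k)" using x by auto
          obtain pos d where pd: "bij_betw pos (I0 s k) {1..card (I0 s k)}" "\<And>t. meas P' (d t)" "\<And>t. d t \<subseteq> \<rho> s k"
            "disjoint_family_on d UNIV" "\<And>i. i \<in> I0 s k \<Longrightarrow> (\<Sum>t=1..pos i. m' i (d t)) = g s i k"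
            using q unfolding Qe_def xk prod.case by blast
          have "(\<Sum>t=1..pos i. m'' i (d t)) = g s i k" if i: "i \<in> I0 s k" for i
          proof -
            have "i \<in> G" using i I0(2) NG by blast
            then have "m'' i (d t) = m' i (d t)" for t using agreeD[OF s'(2) pd(2)] by simp
            then show ?thesis using pd(5)[OF i] by simp
          qed
          then show "Qe x P'' m''" unfolding Qe_def xk prod.case
            using pd(1,3,4) meas_mono[OF pd(2) s'(1)] by blast
        qed
        then have cx: "can (\<lambda>P' m'. \<forall>x\<in>{..<S} \<times> N. Qe x P' m') (S * ?n * (?n * ?n)) P3 m3"
          by (simp add: card_cartesian_product)
        show "can ?Q (S * ?n * (?n * ?n)) P3 m3"
        proof (rule can_conseq[OF cx st3 order_refl])
          fix P4 m4 assume st4: "st P4 m4" and s4: "P3 \<subseteq> P4" "agree P3 m3 m4" and Qx: "\<forall>x\<in>{..<S} \<times> N. Qe x P4 m4"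
          have s24: "P2 \<subseteq> P4" "agree P2 m2 m4"
            using s3(1) s4(1) agree_trans[OF s3(2) agree_mono[OF s4(2) s3(1)]] by auto
          have "\<forall>x\<in>{..<S} \<times> N. \<exists>pos d. bij_betw pos (I0 (fst x) (snd x)) {1..card (I0 (fst x) (snd x))} \<and>
            (\<forall>t. meas P4 (d t) \<and> d t \<subseteq> \<rho> (fst x) (snd x)) \<and> disjoint_family_on d UNIV \<and>
            (\<forall>i\<in>I0 (fst x) (snd x). (\<Sum>t=1..pos i. m4 i (d t)) = g (fst x) i (snd x))"
            using Qx unfolding Qe_def by auto
          then obtain po de where pd: "\<And>x. x \<in> {..<S} \<times> N \<Longrightarrow> bij_betw (po x) (I0 (fst x) (snd x)) {1..card (I0 (fst x) (snd x))} \<and>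
            (\<forall>t. meas P4 (de x t) \<and> de x t \<subseteq> \<rho> (fst x) (snd x)) \<and> disjoint_family_on (de x) UNIV \<and>
            (\<forall>i\<in>I0 (fst x) (snd x). (\<Sum>t=1..po x i. m4 i (de x t)) = g (fst x) i (snd x))" by metis
          define I where "I s k = insert k (I0 s k)" for s k
          define d where "d s k = de (s, k)" for s k
          \<comment> \<open>The value \<open>card N\<close> codes that \<open>i\<close> is not in
            \<open>I s k\<close>; members have positions below \<open>card (I s k)\<close>. In this
            way one function into \<open>{..card N}\<close> records both the sets and the
            orders.\<close>
          define ps where "ps s k i = (if i = k then 0 else if i \<in> I0 s k then po (s, k) i else ?n)" for s k i
          have kI0: "k \<notin> I0 s k" for s k unfolding I0_def by auto
          have cI: "card (I s k) = Suc (card (I0 s k))" for s k unfolding I_def using I0(1) kI0 by simp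
          have IN: "I s k \<subseteq> N" if "k \<in> N" for s k unfolding I_def using that I0(2) by auto
          have cIn: "card (I s k) \<le> ?n" if "k \<in> N" for s k using IN[OF that] finN by (rule card_mono[rotated])
          have bij: "bij_betw (ps s k) (I s k) {..<card (I s k)}" if sk: "s < S" "k \<in> N" for s k
          proof -
            have b: "inj_on (po (s, k)) (I0 s k)" "po (s, k) ` I0 s k = {1..card (I0 s k)}"
              using pd[of "(s, k)"] sk unfolding bij_betw_def by auto
            have p1: "1 \<le> po (s, k) i" if "i \<in> I0 s k" for i using b(2) that by auto
            have "inj_on (ps s k) (I s k)"
            proof (rule inj_onI)
              fix x z assume "x \<in> I s k" "z \<in> I s k" "ps s k x = ps s k z"
              then show "x = z" using p1[of x] p1[of z] b(1) unfolding ps_def I_def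
                by (auto split: if_splits dest: inj_onD)
            qed
            moreover have "ps s k ` I s k = {..<card (I s k)}"
            proof -
              have "ps s k ` I s k = insert 0 (po (s, k) ` I0 s k)"
                unfolding I_def ps_def using kI0 by (auto simp: image_iff)
              also have "\<dots> = {..<card (I s k)}" unfolding b(2) cI by auto
              finally show ?thesis .
            qed
            ultimately show ?thesis by (simp add: bij_betw_def)
          qed
          have psn: "ps s k i < ?n \<longleftrightarrow> i \<in> I s k" and psle: "ps s k i \<le> ?n" if sk: "s < S" "k \<in> N" for s k i
          proof -
            have "ps s k i < ?n" if "i \<in> I s k"
            proof -
              have "ps s k i \<in> {..<card (I s k)}" using bij[OF sk] that unfolding bij_betw_def by auto
              then show ?thesis using cIn[OF sk(2), of s] by auto
            qed
            moreover have "ps s k i = ?n" if "i \<notin> I s k" using that unfolding ps_def I_def by auto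
            ultimately show "ps s k i < ?n \<longleftrightarrow> i \<in> I s k" "ps s k i \<le> ?n" by (force, force)
          qed
          define ty where "ty s = restrict (\<lambda>(k, i). ps s k i) (N \<times> N)" for s
          define Ty where "Ty = (N \<times> N) \<rightarrow>\<^sub>E {..?n}"
          have Ty: "finite Ty" "card Ty = (?n + 1) ^ (?n * ?n)"
            unfolding Ty_def using finN by (auto simp: card_PiE card_cartesian_product intro!: finite_PiE)
          have "ty s \<in> Ty" if "s < S" for s
            unfolding ty_def Ty_def restrict_PiE_iff using psle[OF that] by auto
          then have "ty ` {..<S} \<subseteq> Ty" by auto
          then have "\<exists>\<tau>\<in>Ty. M \<le> card {s \<in> {..<S}. ty s = \<tau>}"
            by (intro pigeonhole_fibre) (use Ty SM M0 in \<open>auto simp: Ty_def PiE_eq_empty_iff\<close>)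
          then obtain \<tau> where \<tau>: "M \<le> card {s \<in> {..<S}. ty s = \<tau>}" by blast
          define \<S> where "\<S> = {s \<in> {..<S}. ty s = \<tau>}"
          have "\<S> \<noteq> {}" using \<tau> M0 \<S>_def by (metis card.empty not_le)
          then obtain s0 where s0: "s0 \<in> \<S>" by auto
          have same: "ps s k i = ps s0 k i" if "s \<in> \<S>" "k \<in> N" "i \<in> N" for s k i
          proof -
            have "ty s (k, i) = ty s0 (k, i)" using that s0 \<S>_def by auto
            then show ?thesis using that unfolding ty_def by simp
          qed
          have SS: "s < S" if "s \<in> \<S>" for s using that \<S>_def by auto
          have sameI: "I s k = I s0 k" if "s \<in> \<S>" "k \<in> N" for s k
          proof (rule set_eqI)
            fix i
            show "i \<in> I s k \<longleftrightarrow> i \<in> I s0 k"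
              using psn[OF SS[OF that(1)] that(2), of i] psn[OF SS[OF s0] that(2), of i] same[OF that, of i]
                IN[OF that(2), of s] IN[OF that(2), of s0] by (cases "i \<in> N") auto
          qed
          have \<rho>R: "\<rho> s k \<subseteq> R" if "s < S" "k \<in> N" for s k unfolding \<rho>_def using T(2) that C_def by auto
          have \<rho>d: "\<rho> s k \<inter> \<rho> s' k' = {}" if "s < S" "k \<in> N" "s' < S" "k' \<in> N" "(s, k) \<noteq> (s', k')" for s k s' k'
          proof -
            have "T (s, k, i) \<inter> T (s', k', i') = {}" if "i \<in> N" "i' \<in> N" for i i'
              using disjoint_family_onD[OF T(4), of "(s, k, i)" "(s', k', i')"] that
                \<open>s < S\<close> \<open>k \<in> N\<close> \<open>s' < S\<close> \<open>k' \<in> N\<close> \<open>(s, k) \<noteq> (s', k')\<close> unfolding C_def by auto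
            then show ?thesis unfolding \<rho>_def by blast
          qed
          have dd: "meas P4 (d s k t)" "d s k t \<subseteq> \<rho> s k" if "s < S" "k \<in> N" for s k t
            using pd[of "(s, k)"] that unfolding d_def by auto
          have R4: "m4 i R = r i" if "i \<in> N" for i using agreeD[OF s24(2) R2] that NG unfolding r_def by auto
          have cs4: "m4 i (cs s k) = m2 i (cs s k)" if "s < S" "i \<in> N" "k \<in> N" for s i k
            using sn2 that NG agreeD[OF s24(2)] unfolding snaps_def alloc_def by blast
          have iso: "iso N P4 m4 R \<S> cs (I s0) (ps s0) d"
            unfolding iso_def
          proof (intro conjI ballI allI)
            fix k assume k: "k \<in> N"
            show "k \<in> I s0 k" unfolding I_def by auto
            show "I s0 k \<subseteq> N" by (rule IN[OF k])
            show "bij_betw (ps s0 k) (I s0 k) {..<card (I s0 k)}" by (rule bij[OF SS[OF s0] k])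
            show "ps s0 k k = 0" unfolding ps_def by simp
          next
            fix s k t assume sk: "s \<in> \<S>" "k \<in> N"
            show "meas P4 (d s k t)" "d s k t \<subseteq> R" using dd[OF SS[OF sk(1)] sk(2)] \<rho>R[OF SS[OF sk(1)] sk(2)] by blast+
          next
            show "disjoint_family_on (\<lambda>(s, k, t). d s k t) (\<S> \<times> N \<times> UNIV)"
              unfolding disjoint_family_on_def
            proof (intro ballI impI)
              fix x z :: "nat \<times> nat \<times> nat" assume xz: "x \<in> \<S> \<times> N \<times> UNIV" "z \<in> \<S> \<times> N \<times> UNIV" "x \<noteq> z"
              obtain s k t s' k' t' where e: "x = (s, k, t)" "z = (s', k', t')" by (cases x, cases z) auto
              have m: "s < S" "k \<in> N" "s' < S" "k' \<in> N" using xz SS unfolding e by auto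
              have "d s k t \<inter> d s' k' t' = {}"
              proof (cases "(s, k) = (s', k')")
                case True
                then have "t \<noteq> t'" using xz e by auto
                then show ?thesis using pd[of "(s, k)"] m True unfolding d_def disjoint_family_on_def by auto
              next
                case False
                then show ?thesis using \<rho>d[OF m False] dd(2)[OF m(1,2), of t] dd(2)[OF m(3,4), of t'] by blast
              qed
              then show "(case x of (s, k, t) \<Rightarrow> d s k t) \<inter> (case z of (s, k, t) \<Rightarrow> d s k t) = {}" unfolding e by simp
            qed
          next
            fix s k i assume sk: "s \<in> \<S>" "k \<in> N" and "i \<in> I s0 k"
            then have iI: "i \<in> I s k" "i \<in> N" using sameI[OF sk] IN[OF sk(2), of s0] by auto
            show "m4 i (cs s k) + (\<Sum>t = 1..ps s0 k i. m4 i (d s k t)) = m4 i (cs s i)"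
            proof (cases "i = k")
              case True
              then show ?thesis unfolding ps_def by simp
            next
              case False
              then have i0: "i \<in> I0 s k" using iI I_def by auto
              have "(\<Sum>t = 1..ps s k i. m4 i (d s k t)) = g s i k"
                using pd[of "(s, k)"] SS[OF sk(1)] sk(2) i0 False unfolding ps_def d_def by auto
              then show ?thesis
                using same[OF sk iI(2)] cs4[OF SS[OF sk(1)] iI(2)] sk(2) iI(2) unfolding g_def by simp
            qed
          next
            fix s k i assume sk: "s \<in> \<S>" "k \<in> N" and i: "i \<in> N - I s0 k"
            then have "i \<notin> I s k" "i \<in> N" using sameI by auto
            then have "2 * r i \<le> g s i k" unfolding I_def I0_def by auto
            then show "m4 i (cs s k) + 2 * m4 i R \<le> m4 i (cs s i)"
              using R4 cs4[OF SS[OF sk(1)] \<open>i \<in> N\<close>] sk(2) \<open>i \<in> N\<close> unfolding g_def by simp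
          qed
          \<comment> \<open>The cutter has a large gap to some piece \<open>j\<close>, so it does
            not belong to \<open>I s0 j\<close>.\<close>
          obtain j where j: "j \<in> N - {c}" "2 * r c \<le> g s0 c j"
            using gapc[OF SS[OF s0]] unfolding R_def[symmetric] r_def g_def by blast
          then have "c \<notin> I s0 j" unfolding I_def I0_def by auto
          then have ex: "\<exists>k\<in>N. I s0 k \<noteq> N" using j c by blast
          have "snaps N P4 m4 A S cs" "alloc N P4 ?R X" "ef N m4 X"
            using snaps_agree[OF sn2 s24 NG] alloc_mono[OF X(1) s24(1) subset_refl] ef_agree[OF X(2,1) s24(2) NG] by auto
          moreover have "\<S> \<subseteq> {..<S}" "M \<le> card \<S>" using \<tau> \<S>_def by auto
          ultimately show "?Q P4 m4" using iso ex unfolding R_def by blast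
        qed
      qed
    qed
  qed
qed

end

subsection \<open>Permutations from cyclic shifts\<close>

text \<open>Send a piece to the next agent in its order, and a completed piece to \<open>k1\<close>. Rotating along a
  cycle of this map moves at least one agent to a piece it has not held before.\<close>

lemma minimal_invariant_set:
  assumes "finite N" "N \<noteq> {}" "h ` N \<subseteq> N"
  obtains C where "C \<noteq> {}" "C \<subseteq> N" "h ` C = C"
proof -
  define F where "F = {C. C \<noteq> {} \<and> C \<subseteq> N \<and> h ` C \<subseteq> C}"
  have "finite F" unfolding F_def using assms(1) by (auto intro: finite_subset[of _ "Pow N"])
  moreover have "F \<noteq> {}" using assms unfolding F_def by auto
  ultimately obtain C where C: "C \<in> F" and minC: "\<And>C'. C' \<in> F \<Longrightarrow> C' \<subseteq> C \<Longrightarrow> C' = C"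
    using finite_has_minimal[of F] by blast
  have "h ` C \<in> F" using C unfolding F_def by auto
  then have "h ` C = C" using minC C unfolding F_def by auto
  then show thesis using that C unfolding F_def by auto
qed

text \<open>Positions below \<open>v k\<close> have held \<open>k\<close> before, and
  \<open>v k\<close> is the first new one. Pieces off the cycle stay with their owners, who are in
  position 0. A completed piece, for which \<open>I k = N\<close>, may go to anybody and is sent to
  \<open>k1\<close> because \<open>k1\<close> itself is not completed.\<close>

lemma rotation:
  fixes v :: "nat \<Rightarrow> nat"
  assumes finN: "finite N"
    and I: "\<And>k. k \<in> N \<Longrightarrow> k \<in> I k \<and> I k \<subseteq> N \<and> bij_betw (pos k) (I k) {..<card (I k)} \<and> pos k k = 0"
    and v: "\<And>k. k \<in> N \<Longrightarrow> 1 \<le> v k \<and> v k \<le> card (I k)"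
    and comp: "\<And>k. k \<in> N \<Longrightarrow> v k = card (I k) \<Longrightarrow> I k = N"
    and k1: "k1 \<in> N" "I k1 \<noteq> N"
  shows "\<exists>\<sigma>. bij_betw \<sigma> N N \<and> (\<forall>i\<in>N. i \<in> I (\<sigma> i) \<and> pos (\<sigma> i) i \<le> v (\<sigma> i)) \<and> (\<exists>i\<in>N. pos (\<sigma> i) i = v (\<sigma> i))"
proof -
  define h where "h k = (if v k < card (I k) then inv_into (I k) (pos k) (v k) else k1)" for k
  have hI: "h k \<in> I k" "pos k (h k) = v k" if "k \<in> N" "v k < card (I k)" for k
  proof -
    have "v k \<in> pos k ` I k" using I[OF that(1)] that(2) unfolding bij_betw_def by auto
    then show "h k \<in> I k" "pos k (h k) = v k" unfolding h_def using that(2)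
      by (auto simp: inv_into_into f_inv_into_f)
  qed
  have full: "I k = N" "h k = k1" if "k \<in> N" "\<not> v k < card (I k)" for k
    using comp[OF that(1)] v[OF that(1)] that(2) unfolding h_def by auto
  have hN: "h k \<in> N" if "k \<in> N" for k
    using hI(1)[OF that] I[OF that] full(2)[OF that] k1 by (cases "v k < card (I k)") auto
  then have "h ` N \<subseteq> N" by auto
  then obtain C where C: "C \<noteq> {}" "C \<subseteq> N" "h ` C = C"
    using minimal_invariant_set[OF finN, of h] k1(1) by (metis empty_iff)
  have finC: "finite C" using C finN finite_subset by blast
  have injC: "inj_on h C" using C(3) finC by (simp add: eq_card_imp_inj_on)
  define \<tau> where "\<tau> k = (if k \<in> C then h k else k)" for k
  have inj\<tau>: "inj_on \<tau> N"
  proof (rule inj_onI)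
    fix a b assume ab: "a \<in> N" "b \<in> N" "\<tau> a = \<tau> b"
    have "h x \<in> C" if "x \<in> C" for x using C(3) that by auto
    then show "a = b" using ab inj_onD[OF injC, of a b] unfolding \<tau>_def by (auto split: if_splits)
  qed
  have "\<tau> ` N \<subseteq> N" using hN unfolding \<tau>_def by auto
  then have "\<tau> ` N = N" using finN inj\<tau> by (simp add: endo_inj_surj)
  then have bij: "bij_betw \<tau> N N" using inj\<tau> by (simp add: bij_betw_def)
  define \<sigma> where "\<sigma> = inv_into N \<tau>"
  have bij\<sigma>: "bij_betw \<sigma> N N" unfolding \<sigma>_def by (rule bij_betw_inv_into[OF bij])
  have pr: "\<tau> k \<in> I k \<and> pos k (\<tau> k) \<le> v k" if k: "k \<in> N" for k
  proof (cases "k \<in> C")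
    case True
    show ?thesis
    proof (cases "v k < card (I k)")
      case True
      then show ?thesis using hI[OF k True] \<open>k \<in> C\<close> \<tau>_def by auto
    next
      case False
      have "\<tau> k = k1" using full(2)[OF k False] True \<tau>_def by auto
      moreover have "k1 \<in> I k" using full(1)[OF k False] k1 by auto
      moreover have "pos k k1 < card (I k)" using I[OF k] \<open>k1 \<in> I k\<close> unfolding bij_betw_def by auto
      ultimately show ?thesis using False v[OF k] by auto
    qed
  next
    case False
    then show ?thesis using I[OF k] unfolding \<tau>_def by auto
  qed
  \<comment> \<open>If all pieces of \<open>C\<close> were completed, they would all be sent to
    \<open>k1\<close>, so that \<open>k1\<close> would lie in \<open>C\<close> and be completed as
    well.\<close>
  have "\<exists>k\<in>C. v k < card (I k)"
  proof (rule ccontr)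
    assume neg: "\<not> ?thesis"
    obtain k where k: "k \<in> C" using C by auto
    then have "k1 \<in> C" using full(2)[of k] neg C by (metis image_eqI subsetD)
    then have "\<not> v k1 < card (I k1)" using neg by auto
    then show False using full(1)[of k1] k1 by auto
  qed
  then obtain k2 where k2: "k2 \<in> C" "k2 \<in> N" "v k2 < card (I k2)" using C by auto
  have "\<sigma> (\<tau> k2) = k2" unfolding \<sigma>_def using inj\<tau> k2(2) by simp
  moreover have "\<tau> k2 = h k2" using k2(1) \<tau>_def by simp
  ultimately have "pos (\<sigma> (\<tau> k2)) (\<tau> k2) = v (\<sigma> (\<tau> k2))" using hI(2)[OF k2(2,3)] by simp
  moreover have "\<tau> k2 \<in> N" using bij k2 by (auto simp: bij_betw_def)
  moreover have "i \<in> I (\<sigma> i) \<and> pos (\<sigma> i) i \<le> v (\<sigma> i)" if "i \<in> N" for i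
  proof -
    have "\<sigma> i \<in> N" using bij\<sigma> that by (auto simp: bij_betw_def)
    moreover have "\<tau> (\<sigma> i) = i" unfolding \<sigma>_def using bij that by (simp add: bij_betw_inv_into_right)
    ultimately show ?thesis using pr[of "\<sigma> i"] by auto
  qed
  ultimately show ?thesis using bij\<sigma> by blast
qed

section \<open>Selections from finite sets\<close>

lemma top_subset:
  fixes h :: "'a \<Rightarrow> real"
  assumes "finite A" "q \<le> card A"
  shows "\<exists>T\<subseteq>A. card T = q \<and> (\<forall>a\<in>T. \<forall>b\<in>A - T. h b \<le> h a)"
  using assms(2)
proof (induction q)
  case (Suc q)
  then obtain T where T: "T \<subseteq> A" "card T = q" "\<forall>a\<in>T. \<forall>b\<in>A - T. h b \<le> h a" by auto
  have finT: "finite T" using T(1) assms(1) finite_subset by blast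
  have "A - T \<noteq> {}" using T Suc.prems assms(1) by (metis Diff_eq_empty_iff Suc_n_not_le_n card_mono finT le_trans)
  then have "Max (h ` (A - T)) \<in> h ` (A - T)" using assms(1) by (intro Max_in) auto
  then obtain a where a0: "a \<in> A - T" "h a = Max (h ` (A - T))" by auto
  have a: "a \<in> A - T" "\<And>b. b \<in> A - T \<Longrightarrow> h b \<le> h a"
    using a0 assms(1) by auto
  show ?case
    by (rule exI[of _ "insert a T"]) (use T a finT in auto)
qed auto

text \<open>Discard the \<open>q\<close> largest elements for each criterion. Any \<open>q\<close>
  of the remaining elements are dominated, criterion by criterion, by the discarded ones, which lie
  outside the selection.\<close>

lemma top_selection:
  fixes h :: "'x \<Rightarrow> 'a \<Rightarrow> real"
  assumes "finite A" "finite \<Xi>" "(card \<Xi> + 1) * q \<le> card A"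
  shows "\<exists>Q\<subseteq>A. card Q = q \<and> (\<forall>x\<in>\<Xi>. (\<forall>a\<in>A. 0 \<le> h x a) \<longrightarrow> (\<Sum>a\<in>Q. h x a) \<le> (\<Sum>a\<in>A - Q. h x a))"
proof -
  have "q \<le> card A" using assms(3) by (metis One_nat_def add_gr_0 le_trans less_one mult_le_mono1 mult.commute mult.right_neutral nat_mult_1 Suc_leI)
  then have "\<forall>x. \<exists>T\<subseteq>A. card T = q \<and> (\<forall>a\<in>T. \<forall>b\<in>A - T. h x b \<le> h x a)"
    using top_subset[OF assms(1)] by blast
  then obtain T where T: "\<And>x. T x \<subseteq> A" "\<And>x. card (T x) = q" "\<And>x a b. a \<in> T x \<Longrightarrow> b \<in> A - T x \<Longrightarrow> h x b \<le> h x a"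
    by metis
  define R where "R = A - (\<Union>x\<in>\<Xi>. T x)"
  have "card (\<Union>x\<in>\<Xi>. T x) \<le> (\<Sum>x\<in>\<Xi>. card (T x))" by (rule card_UN_le[OF assms(2)])
  then have "card (\<Union>x\<in>\<Xi>. T x) \<le> card \<Xi> * q" using T(2) by simp
  moreover have "card A - card (\<Union>x\<in>\<Xi>. T x) \<le> card R" unfolding R_def by (rule diff_card_le_card_Diff) (use assms(1,2) T(1) finite_subset in \<open>auto intro: finite_subset\<close>)
  ultimately have "q \<le> card R" using assms(3) by (simp add: algebra_simps)
  then obtain Q where Q: "Q \<subseteq> R" "card Q = q" by (meson obtain_subset_with_card_n)
  have QA: "Q \<subseteq> A" using Q R_def by auto
  have "(\<Sum>a\<in>Q. h x a) \<le> (\<Sum>a\<in>A - Q. h x a)" if x: "x \<in> \<Xi>" and nn: "\<forall>a\<in>A. 0 \<le> h x a" for x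
  proof -
    have TQ: "T x \<subseteq> A - Q" using T(1) Q(1) x R_def by blast
    have finT: "finite (T x)" "finite Q" using T(1) QA assms(1) finite_subset by blast+
    obtain f where f: "bij_betw f Q (T x)" using finite_same_card_bij[OF finT(2,1)] Q(2) T(2) by auto
    have "(\<Sum>a\<in>Q. h x a) \<le> (\<Sum>a\<in>Q. h x (f a))"
    proof (rule sum_mono)
      fix a assume a: "a \<in> Q"
      have "f a \<in> T x" using f a by (auto simp: bij_betw_def)
      moreover have "a \<in> A - T x" using a Q R_def x by auto
      ultimately show "h x a \<le> h x (f a)" using T(3) by blast
    qed
    also have "\<dots> = (\<Sum>a\<in>T x. h x a)" by (rule sum.reindex_bij_betw[OF f])
    also have "\<dots> \<le> (\<Sum>a\<in>A - Q. h x a)" using TQ assms(1) nn by (intro sum_mono2) auto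
    finally show ?thesis .
  qed
  then show ?thesis using QA Q(2) by blast
qed

lemma disjoint_groups:
  assumes "finite A" "r * q \<le> card A"
  shows "\<exists>g. (\<forall>j<r. g j \<subseteq> A \<and> card (g j) = q) \<and> disjoint_family_on g {..<r}"
  using assms
proof (induction r arbitrary: A)
  case 0
  then show ?case by (auto simp: disjoint_family_on_def)
next
  case (Suc r)
  obtain B where B: "B \<subseteq> A" "card B = q"
    using Suc.prems by (metis le_add1 mult_Suc obtain_subset_with_card_n order_trans)
  have finB: "finite B" using B Suc.prems(1) finite_subset by blast
  have "r * q \<le> card (A - B)" using Suc.prems B finB by (simp add: card_Diff_subset)
  from Suc.IH[OF _ this] obtain g where g: "\<forall>j<r. g j \<subseteq> A - B \<and> card (g j) = q" "disjoint_family_on g {..<r}"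
    using Suc.prems(1) by auto
  have "disjoint_family_on (g(r := B)) {..<Suc r}"
    unfolding disjoint_family_on_def
  proof (intro ballI impI)
    fix a b assume ab: "a \<in> {..<Suc r}" "b \<in> {..<Suc r}" "a \<noteq> b"
    have "g j \<inter> B = {}" "B \<inter> g j = {}" if "j < r" for j using g(1) that by auto
    then show "(g(r := B)) a \<inter> (g(r := B)) b = {}"
      using ab disjoint_family_onD[OF g(2), of a b] by (cases "a = r"; cases "b = r") auto
  qed
  moreover have "\<forall>j<Suc r. (g(r := B)) j \<subseteq> A \<and> card ((g(r := B)) j) = q"
    using g(1) B by (auto simp: less_Suc_eq)
  ultimately show ?case by blast
qed

subsection \<open>Exchanging pieces\<close>

context agents
begin

text \<open>State of the exchange. For a family \<open>s \<in> \<D>\<close> the pieces have been permuted: \<open>i\<close> holds the piece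
  \<open>k = \<sigma> s i\<close> with the extracted pieces \<open>d s k 1, \<dots>, d s k (pos k i)\<close>. The pool \<open>\<P>\<close> is untouched. The
  sets \<open>Z k t f\<close> compensate the agents \<open>f\<close> in the first \<open>t\<close> positions of \<open>k\<close> for the pieces \<open>d s k t\<close>
  handed to others; agents further back do not mind because of families in which \<open>f\<close> holds \<open>k\<close>.\<close>

definition exch :: "nat set \<Rightarrow> real set \<Rightarrow> (nat \<Rightarrow> real set \<Rightarrow> real) \<Rightarrow> nat set \<Rightarrow> (nat \<Rightarrow> nat set) \<Rightarrow>
    (nat \<Rightarrow> nat \<Rightarrow> nat) \<Rightarrow> (nat \<Rightarrow> nat \<Rightarrow> nat \<Rightarrow> real set) \<Rightarrow> (nat \<Rightarrow> nat) \<Rightarrow> (nat \<Rightarrow> nat) \<Rightarrow> nat set \<Rightarrow> nat set \<Rightarrow>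
    (nat \<Rightarrow> nat \<Rightarrow> nat) \<Rightarrow> (nat \<Rightarrow> nat \<Rightarrow> nat \<Rightarrow> real set) \<Rightarrow> bool" where
  "exch N P m \<S> I pos d v w \<P> \<D> \<sigma> Z \<longleftrightarrow>
     \<P> \<subseteq> \<S> \<and> \<D> \<subseteq> \<S> \<and> \<P> \<inter> \<D> = {} \<and>
     (\<forall>s\<in>\<D>. bij_betw (\<sigma> s) N N \<and> (\<forall>i\<in>N. i \<in> I (\<sigma> s i) \<and> pos (\<sigma> s i) i < v (\<sigma> s i))) \<and>
     (\<forall>k\<in>N. v k \<le> w k \<and> w k \<le> card (I k)) \<and>
     (\<forall>k t f. meas P (Z k t f) \<and> Z k t f \<subseteq> (\<Union>s\<in>\<S> - (\<D> \<union> \<P>). d s k t)) \<and>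
     (\<forall>k t f. \<not> (k \<in> N \<and> 1 \<le> t \<and> t < w k \<and> f \<in> I k \<and> pos k f < t) \<longrightarrow> Z k t f = {}) \<and>
     (\<forall>k\<in>N. \<forall>t f f'. f \<noteq> f' \<longrightarrow> Z k t f \<inter> Z k t f' = {}) \<and>
     (\<forall>k\<in>N. \<forall>t f f'. 1 \<le> t \<and> t < w k \<and> f \<in> I k \<and> f' \<in> I k \<and> pos k f < t \<and> pos k f' < t \<longrightarrow>
        m f (Z k t f') \<le> m f (Z k t f)) \<and>
     (\<forall>k\<in>N. \<forall>t f j. 1 \<le> t \<and> t < w k \<and> f \<in> I k \<and> pos k f < t \<and> j \<in> N \<and> t \<le> pos k j \<longrightarrow>
        (\<Sum>s\<in>{s\<in>\<D>. \<sigma> s j = k}. m f (d s k t)) + (\<Sum>s\<in>\<P>. m f (d s k t)) \<le> m f (Z k t f)) \<and>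
     (\<forall>k\<in>N. \<forall>t f i. 1 \<le> t \<and> t < w k \<and> f \<in> I k \<and> pos k f < t \<and> i \<in> I k \<and> t \<le> pos k i \<longrightarrow>
        m i (Z k t f) \<le> (\<Sum>s\<in>{s\<in>\<D>. \<sigma> s f = k}. m i (d s k t))) \<and>
     (\<forall>k\<in>N. \<forall>f\<in>I k. pos k f < v k \<longrightarrow> (\<exists>s\<in>\<D>. \<sigma> s f = k) \<and>
        (\<forall>i\<in>N. \<forall>t<card N. (\<Sum>s\<in>\<P>. m i (d s k t)) \<le> (\<Sum>s\<in>{s\<in>\<D>. \<sigma> s f = k}. m i (d s k t))))"

text \<open>In these clauses the agents in the first \<open>v k\<close> positions are those that
  have held \<open>k\<close>, and compensations for the pieces \<open>d s k t\<close> exist for all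
  \<open>t < w k\<close>. So \<open>w\<close> runs ahead of \<open>v\<close>: the compensation has
  to be arranged before the next position is served.\<close>

lemma exchD:
  assumes "exch N P m \<S> I pos d v w \<P> \<D> \<sigma> Z"
  shows "\<P> \<subseteq> \<S>" "\<D> \<subseteq> \<S>" "\<P> \<inter> \<D> = {}"
    and "\<And>s. s \<in> \<D> \<Longrightarrow> bij_betw (\<sigma> s) N N"
    and "\<And>s i. s \<in> \<D> \<Longrightarrow> i \<in> N \<Longrightarrow> i \<in> I (\<sigma> s i) \<and> pos (\<sigma> s i) i < v (\<sigma> s i)"
    and "\<And>k. k \<in> N \<Longrightarrow> v k \<le> w k \<and> w k \<le> card (I k)"
    and "\<And>k t f. meas P (Z k t f)" "\<And>k t f. Z k t f \<subseteq> (\<Union>s\<in>\<S> - (\<D> \<union> \<P>). d s k t)"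
    and "\<And>k t f. \<not> (k \<in> N \<and> 1 \<le> t \<and> t < w k \<and> f \<in> I k \<and> pos k f < t) \<Longrightarrow> Z k t f = {}"
    and "\<And>k t f f'. k \<in> N \<Longrightarrow> f \<noteq> f' \<Longrightarrow> Z k t f \<inter> Z k t f' = {}"
    and "\<And>k t f f'. \<lbrakk>k \<in> N; 1 \<le> t; t < w k; f \<in> I k; f' \<in> I k; pos k f < t; pos k f' < t\<rbrakk> \<Longrightarrow>
      m f (Z k t f') \<le> m f (Z k t f)"
    and "\<And>k t f j. \<lbrakk>k \<in> N; 1 \<le> t; t < w k; f \<in> I k; pos k f < t; j \<in> N; t \<le> pos k j\<rbrakk> \<Longrightarrow>
      (\<Sum>s\<in>{s\<in>\<D>. \<sigma> s j = k}. m f (d s k t)) + (\<Sum>s\<in>\<P>. m f (d s k t)) \<le> m f (Z k t f)"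
    and "\<And>k t f i. \<lbrakk>k \<in> N; 1 \<le> t; t < w k; f \<in> I k; pos k f < t; i \<in> I k; t \<le> pos k i\<rbrakk> \<Longrightarrow>
      m i (Z k t f) \<le> (\<Sum>s\<in>{s\<in>\<D>. \<sigma> s f = k}. m i (d s k t))"
    and "\<And>k f. \<lbrakk>k \<in> N; f \<in> I k; pos k f < v k\<rbrakk> \<Longrightarrow> \<exists>s\<in>\<D>. \<sigma> s f = k"
    and "\<And>k f i t. \<lbrakk>k \<in> N; f \<in> I k; pos k f < v k; i \<in> N; t < card N\<rbrakk> \<Longrightarrow>
      (\<Sum>s\<in>\<P>. m i (d s k t)) \<le> (\<Sum>s\<in>{s\<in>\<D>. \<sigma> s f = k}. m i (d s k t))"
proof -
  note E = assms[unfolded exch_def]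
  show "\<P> \<subseteq> \<S>" "\<D> \<subseteq> \<S>" "\<P> \<inter> \<D> = {}" using E by auto
  show "\<And>s. s \<in> \<D> \<Longrightarrow> bij_betw (\<sigma> s) N N" using E[THEN conjunct2, THEN conjunct2, THEN conjunct2, THEN conjunct1] by blast
  show "\<And>s i. s \<in> \<D> \<Longrightarrow> i \<in> N \<Longrightarrow> i \<in> I (\<sigma> s i) \<and> pos (\<sigma> s i) i < v (\<sigma> s i)" using E[THEN conjunct2, THEN conjunct2, THEN conjunct2, THEN conjunct1] by blast
  show "\<And>k. k \<in> N \<Longrightarrow> v k \<le> w k \<and> w k \<le> card (I k)" using E[THEN conjunct2, THEN conjunct2, THEN conjunct2, THEN conjunct2, THEN conjunct1] by blast
  show "\<And>k t f. meas P (Z k t f)" "\<And>k t f. Z k t f \<subseteq> (\<Union>s\<in>\<S> - (\<D> \<union> \<P>). d s k t)" using E[THEN conjunct2, THEN conjunct2, THEN conjunct2, THEN conjunct2, THEN conjunct2, THEN conjunct1] by blast+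
  show "\<And>k t f. \<not> (k \<in> N \<and> 1 \<le> t \<and> t < w k \<and> f \<in> I k \<and> pos k f < t) \<Longrightarrow> Z k t f = {}" using E[THEN conjunct2, THEN conjunct2, THEN conjunct2, THEN conjunct2, THEN conjunct2, THEN conjunct2, THEN conjunct1] by blast
  show "\<And>k t f f'. k \<in> N \<Longrightarrow> f \<noteq> f' \<Longrightarrow> Z k t f \<inter> Z k t f' = {}" using E[THEN conjunct2, THEN conjunct2, THEN conjunct2, THEN conjunct2, THEN conjunct2, THEN conjunct2, THEN conjunct2, THEN conjunct1] by blast
  show "\<And>k t f f'. \<lbrakk>k \<in> N; 1 \<le> t; t < w k; f \<in> I k; f' \<in> I k; pos k f < t; pos k f' < t\<rbrakk> \<Longrightarrow>
      m f (Z k t f') \<le> m f (Z k t f)" using E[THEN conjunct2, THEN conjunct2, THEN conjunct2, THEN conjunct2, THEN conjunct2, THEN conjunct2, THEN conjunct2, THEN conjunct2, THEN conjunct1] by blast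
  show "\<And>k t f j. \<lbrakk>k \<in> N; 1 \<le> t; t < w k; f \<in> I k; pos k f < t; j \<in> N; t \<le> pos k j\<rbrakk> \<Longrightarrow>
      (\<Sum>s\<in>{s\<in>\<D>. \<sigma> s j = k}. m f (d s k t)) + (\<Sum>s\<in>\<P>. m f (d s k t)) \<le> m f (Z k t f)" using E[THEN conjunct2, THEN conjunct2, THEN conjunct2, THEN conjunct2, THEN conjunct2, THEN conjunct2, THEN conjunct2, THEN conjunct2, THEN conjunct2, THEN conjunct1] by blast
  show "\<And>k t f i. \<lbrakk>k \<in> N; 1 \<le> t; t < w k; f \<in> I k; pos k f < t; i \<in> I k; t \<le> pos k i\<rbrakk> \<Longrightarrow>
      m i (Z k t f) \<le> (\<Sum>s\<in>{s\<in>\<D>. \<sigma> s f = k}. m i (d s k t))" using E[THEN conjunct2, THEN conjunct2, THEN conjunct2, THEN conjunct2, THEN conjunct2, THEN conjunct2, THEN conjunct2, THEN conjunct2, THEN conjunct2, THEN conjunct2, THEN conjunct1] by blast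
  show "\<And>k f. \<lbrakk>k \<in> N; f \<in> I k; pos k f < v k\<rbrakk> \<Longrightarrow> \<exists>s\<in>\<D>. \<sigma> s f = k" using E[THEN conjunct2, THEN conjunct2, THEN conjunct2, THEN conjunct2, THEN conjunct2, THEN conjunct2, THEN conjunct2, THEN conjunct2, THEN conjunct2, THEN conjunct2, THEN conjunct2] by blast
  show "\<And>k f i t. \<lbrakk>k \<in> N; f \<in> I k; pos k f < v k; i \<in> N; t < card N\<rbrakk> \<Longrightarrow>
      (\<Sum>s\<in>\<P>. m i (d s k t)) \<le> (\<Sum>s\<in>{s\<in>\<D>. \<sigma> s f = k}. m i (d s k t))" using E[THEN conjunct2, THEN conjunct2, THEN conjunct2, THEN conjunct2, THEN conjunct2, THEN conjunct2, THEN conjunct2, THEN conjunct2, THEN conjunct2, THEN conjunct2, THEN conjunct2] by blast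
qed

lemma exch_agree:
  assumes E: "exch N P m \<S> I pos d v w \<P> \<D> \<sigma> Z" and s: "P \<subseteq> P'" "agree P m m'" and NG: "N \<subseteq> G"
    and me: "\<And>s k t. s \<in> \<S> \<Longrightarrow> k \<in> N \<Longrightarrow> meas P (d s k t)" and IN: "\<And>k. k \<in> N \<Longrightarrow> I k \<subseteq> N"
  shows "exch N P' m' \<S> I pos d v w \<P> \<D> \<sigma> Z"
proof -
  have md: "m' i (d s k t) = m i (d s k t)" if "i \<in> N" "s \<in> \<S>" "k \<in> N" for i s k t
    using agreeD[OF s(2) me] that NG by auto
  have mZ: "m' i (Z k t f) = m i (Z k t f)" if "i \<in> N" for i k t f
    using agreeD[OF s(2) exchD(7)[OF E]] that NG by auto
  have sP: "(\<Sum>s\<in>\<P>. m' i (d s k t)) = (\<Sum>s\<in>\<P>. m i (d s k t))" if "i \<in> N" "k \<in> N" for i k t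
    using md that exchD(1)[OF E] by (intro sum.cong) auto
  have sD: "(\<Sum>s\<in>{s\<in>\<D>. \<sigma> s j = k}. m' i (d s k t)) = (\<Sum>s\<in>{s\<in>\<D>. \<sigma> s j = k}. m i (d s k t))"
    if "i \<in> N" "k \<in> N" for i j k t
    using md that exchD(2)[OF E] by (intro sum.cong) auto
  show ?thesis
    unfolding exch_def
  proof (intro conjI ballI allI impI)
    show "\<P> \<subseteq> \<S>" "\<D> \<subseteq> \<S>" "\<P> \<inter> \<D> = {}" using exchD[OF E] by auto
    show "bij_betw (\<sigma> s) N N" if "s \<in> \<D>" for s using exchD(4)[OF E that] .
    show "i \<in> I (\<sigma> s i)" "pos (\<sigma> s i) i < v (\<sigma> s i)" if "s \<in> \<D>" "i \<in> N" for s i using exchD(5)[OF E that] by auto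
    show "v k \<le> w k" "w k \<le> card (I k)" if "k \<in> N" for k using exchD(6)[OF E that] by auto
    show "meas P' (Z k t f)" for k t f using meas_mono[OF exchD(7)[OF E] s(1)] .
    show "Z k t f \<subseteq> (\<Union>s\<in>\<S> - (\<D> \<union> \<P>). d s k t)" for k t f using exchD(8)[OF E] .
    show "Z k t f = {}" if "\<not> (k \<in> N \<and> 1 \<le> t \<and> t < w k \<and> f \<in> I k \<and> pos k f < t)" for k t f using exchD(9)[OF E that] .
    show "Z k t f \<inter> Z k t f' = {}" if "k \<in> N" "f \<noteq> f'" for k t f f' using exchD(10)[OF E that] .
    show "m' f (Z k t f') \<le> m' f (Z k t f)"
      if "k \<in> N" "1 \<le> t \<and> t < w k \<and> f \<in> I k \<and> f' \<in> I k \<and> pos k f < t \<and> pos k f' < t" for k t f f'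
    proof -
      have "f \<in> N" using that IN by auto
      then show ?thesis using exchD(11)[OF E] that mZ by auto
    qed
    show "(\<Sum>s\<in>{s\<in>\<D>. \<sigma> s j = k}. m' f (d s k t)) + (\<Sum>s\<in>\<P>. m' f (d s k t)) \<le> m' f (Z k t f)"
      if "k \<in> N" "1 \<le> t \<and> t < w k \<and> f \<in> I k \<and> pos k f < t \<and> j \<in> N \<and> t \<le> pos k j" for k t f j
    proof -
      have "f \<in> N" using that IN by auto
      then show ?thesis using exchD(12)[OF E, of k t f j] that mZ sP sD by auto
    qed
    show "m' i (Z k t f) \<le> (\<Sum>s\<in>{s\<in>\<D>. \<sigma> s f = k}. m' i (d s k t))"
      if "k \<in> N" "1 \<le> t \<and> t < w k \<and> f \<in> I k \<and> pos k f < t \<and> i \<in> I k \<and> t \<le> pos k i" for k t f i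
    proof -
      have "i \<in> N" using that IN by auto
      then show ?thesis using exchD(13)[OF E, of k t f i] that mZ sD by auto
    qed
    show "\<exists>s\<in>\<D>. \<sigma> s f = k" if "k \<in> N" "f \<in> I k" "pos k f < v k" for k f using exchD(14)[OF E that] .
    show "(\<Sum>s\<in>\<P>. m' i (d s k t)) \<le> (\<Sum>s\<in>{s\<in>\<D>. \<sigma> s f = k}. m' i (d s k t))"
      if "k \<in> N" "f \<in> I k" "pos k f < v k" "i \<in> N" "t < card N" for k f i t
      using exchD(15)[OF E that] sP sD that by auto
  qed
qed

text \<open>Before position \<open>v k0\<close> may receive \<open>k0\<close>, the agents
  \<open>F\<close> in earlier positions have to be compensated for the extracted pieces number
  \<open>v k0\<close>. The pool is split into one group more than \<open>F\<close> has agents, and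
  \<open>F\<close> trims the bundles of these pieces to an equilibrium. The group left over is
  untrimmed and becomes the new pool. Hence each agent of \<open>F\<close> values its compensation
  at least as much as all pieces of this number that the new pool can still hand out.\<close>

lemma exchange_event:
  assumes st: "st P m" and NG: "N \<subseteq> G" and finN: "finite N" and finS: "finite \<S>"
    and I: "\<And>k. k \<in> N \<Longrightarrow> k \<in> I k \<and> I k \<subseteq> N \<and> bij_betw (pos k) (I k) {..<card (I k)} \<and> pos k k = 0"
    and me: "\<And>s k t. s \<in> \<S> \<Longrightarrow> k \<in> N \<Longrightarrow> meas P (d s k t)"
    and disj: "disjoint_family_on (\<lambda>(s, k, t). d s k t) (\<S> \<times> N \<times> UNIV)"
    and E: "exch N P m \<S> I pos d v w \<P> \<D> \<sigma> Z"
    and k0: "k0 \<in> N" "w k0 = v k0" "1 \<le> v k0" "v k0 < card (I k0)" and cP: "card N * q \<le> card \<P>"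
  shows "can (\<lambda>P' m'. \<exists>\<P>' Z'. card \<P>' = q \<and> \<P>' \<subseteq> \<P> \<and> exch N P' m' \<S> I pos d v (w(k0 := Suc (w k0))) \<P>' \<D> \<sigma> Z')
    (trim_cost (card N)) P m"
proof -
  define t0 where "t0 = v k0"
  define F where "F = {f \<in> I k0. pos k0 f < t0}"
  have IN: "I k \<subseteq> N" if "k \<in> N" for k using I that by auto
  have finI: "finite (I k)" if "k \<in> N" for k using IN[OF that] finN finite_subset by blast
  have cIn: "card (I k) \<le> card N" if "k \<in> N" for k using IN[OF that] finN card_mono by blast
  have F: "F \<subseteq> N" "F \<subseteq> G" "finite F" using F_def IN[OF k0(1)] NG finI[OF k0(1)] by auto
  have "bij_betw (pos k0) F {..<t0}"
  proof -
    have "pos k0 ` F = {..<t0}"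
    proof (intro equalityI subsetI)
      fix x assume "x \<in> {..<t0}"
      then have "x \<in> pos k0 ` I k0" using I[OF k0(1)] k0(4) t0_def unfolding bij_betw_def by auto
      then show "x \<in> pos k0 ` F" using \<open>x \<in> {..<t0}\<close> F_def by auto
    qed (auto simp: F_def)
    moreover have "inj_on (pos k0) F" using I[OF k0(1)] F_def unfolding bij_betw_def by (auto intro: inj_on_subset)
    ultimately show ?thesis by (simp add: bij_betw_def)
  qed
  then have cF: "card F = t0" using bij_betw_same_card by fastforce
  have t0n: "t0 + 1 \<le> card N" using k0 cIn[OF k0(1)] t0_def by auto
  note D = exchD[OF E]
  have finP: "finite \<P>" using D(1) finS finite_subset by blast
  have finD: "finite \<D>" using D(2) finS finite_subset by blast
  have "(t0 + 1) * q \<le> card \<P>" using cP t0n by (meson le_trans mult_le_mono1)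
  from disjoint_groups[OF finP this] obtain g where g: "\<And>j. j < t0 + 1 \<Longrightarrow> g j \<subseteq> \<P>" "\<And>j. j < t0 + 1 \<Longrightarrow> card (g j) = q"
    and gd: "disjoint_family_on g {..<t0 + 1}" by blast
  define A where "A j = (\<Union>s\<in>(if j < t0 + 1 then g j else {}). d s k0 t0)" for j
  have gS: "g j \<subseteq> \<S>" if "j < t0 + 1" for j using g(1)[OF that] D(1) by auto
  have meA: "meas P (A j)" for j unfolding A_def
    by (intro meas_UN me) (use gS k0(1) in \<open>fastforce split: if_splits\<close>)+
  have "card F \<le> card {..<t0 + 1}" using cF by simp
  from trimmed_assignment[OF st F(2,3) _ this, of A] meA
  have "can (\<lambda>P' m'. \<exists>y \<pi>. inj_on \<pi> F \<and> \<pi> ` F \<subseteq> {..<t0 + 1} \<and> (\<forall>j\<in>{..<t0 + 1}. y j \<in> P') \<and>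
      (\<forall>i\<in>F. \<forall>j\<in>{..<t0 + 1}. m' i (A j \<inter> {y j<..}) \<le> m' i (A (\<pi> i) \<inter> {y (\<pi> i)<..})) \<and>
      (\<forall>j\<in>{..<t0 + 1} - \<pi> ` F. y j = 0)) (card {..<t0 + 1} * (1 + card F * card {..<t0 + 1}) ^ card F) P m"
    by auto
  then show ?thesis
  proof (rule can_conseq[OF _ st])
    show "card {..<t0 + 1} * (1 + card F * card {..<t0 + 1}) ^ card F \<le> trim_cost (card N)"
      by (rule trim_cost_bound) (use cF t0n in auto)
    fix P' m' assume st': "st P' m'" and s: "P \<subseteq> P'" "agree P m m'"
      and "\<exists>y \<pi>. inj_on \<pi> F \<and> \<pi> ` F \<subseteq> {..<t0 + 1} \<and> (\<forall>j\<in>{..<t0 + 1}. y j \<in> P') \<and>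
      (\<forall>i\<in>F. \<forall>j\<in>{..<t0 + 1}. m' i (A j \<inter> {y j<..}) \<le> m' i (A (\<pi> i) \<inter> {y (\<pi> i)<..})) \<and>
      (\<forall>j\<in>{..<t0 + 1} - \<pi> ` F. y j = 0)"
    then obtain y \<pi> where inj: "inj_on \<pi> F" and \<pi>0: "\<pi> ` F \<subseteq> {..<t0 + 1}" and y0: "\<forall>j\<in>{..<t0 + 1}. y j \<in> P'"
      and e0: "\<forall>i\<in>F. \<forall>j\<in>{..<t0 + 1}. m' i (A j \<inter> {y j<..}) \<le> m' i (A (\<pi> i) \<inter> {y (\<pi> i)<..})"
      and un0: "\<forall>j\<in>{..<t0 + 1} - \<pi> ` F. y j = 0" by blast
    have \<pi>: "\<pi> f < t0 + 1" if "f \<in> F" for f using \<pi>0 that by auto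
    have y: "y j \<in> P'" if "j < t0 + 1" for j using y0 that by auto
    have e: "m' i (A j \<inter> {y j<..}) \<le> m' i (A (\<pi> i) \<inter> {y (\<pi> i)<..})" if "i \<in> F" "j < t0 + 1" for i j
      using e0 that by auto
    have un: "y j = 0" if "j < t0 + 1" "j \<notin> \<pi> ` F" for j using un0 that by auto
    have "card (\<pi> ` F) = t0" using card_image[OF inj] cF by simp
    then have "\<not> {..<t0 + 1} \<subseteq> \<pi> ` F" using card_mono[of "\<pi> ` F" "{..<t0 + 1}"] F(3) by auto
    then obtain j0 where j0: "j0 < t0 + 1" "j0 \<notin> \<pi> ` F" by auto
    define \<P>' where "\<P>' = g j0"
    have P'P: "\<P>' \<subseteq> \<P>" using g(1)[OF j0(1)] \<P>'_def by simp
    have finP': "finite \<P>'" using P'P finP finite_subset by blast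
    define t where "t f = A (\<pi> f) \<inter> {y (\<pi> f)<..}" for f
    define Z' where "Z' = Z(k0 := (Z k0)(t0 := (\<lambda>f. if f \<in> F then t f else {})))"
    have Z'old: "Z' k u f = Z k u f" if "(k, u) \<noteq> (k0, t0)" for k u f using that unfolding Z'_def by auto
    have Z'new: "Z' k0 t0 f = (if f \<in> F then t f else {})" for f unfolding Z'_def by simp
    have me': "meas P' (d s k t)" if "s \<in> \<S>" "k \<in> N" for s k t using meas_mono[OF me[OF that] s(1)] .
    have E': "exch N P' m' \<S> I pos d v w \<P> \<D> \<sigma> Z" by (rule exch_agree[OF E s NG me IN])
    note D' = exchD[OF E']
    have nn: "0 \<le> m' i (d s k u)" if "i \<in> N" "s \<in> \<S>" "k \<in> N" for i s k u
      using st_nonneg[OF st' _ me'[OF that(2,3)]] that(1) NG by auto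
    have sumP': "(\<Sum>s\<in>\<P>'. m' i (d s k u)) \<le> (\<Sum>s\<in>\<P>. m' i (d s k u))" if "i \<in> N" "k \<in> N" for i k u
      using P'P finP nn that D(1) by (intro sum_mono2) auto
    have meA': "meas P' (A j)" for j using meas_mono[OF meA s(1)] .
    have met: "meas P' (t f)" if "f \<in> F" for f unfolding t_def using meA' y[OF \<pi>[OF that]] by auto
    have dd: "d s k u \<inter> d s' k u = {}" if "s \<in> \<S>" "s' \<in> \<S>" "s \<noteq> s'" "k \<in> N" for s s' k u
      using disjoint_family_onD[OF disj, of "(s, k, u)" "(s', k, u)"] that by auto
    have Aval: "m' i (A j) = (\<Sum>s\<in>g j. m' i (d s k0 t0))" if "i \<in> N" "j < t0 + 1" for i j
    proof -
      have "m' i (\<Union>s\<in>g j. d s k0 t0) = (\<Sum>s\<in>g j. m' i (d s k0 t0))"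
      proof (rule m_UN[OF st_prof[OF st']])
        show "i \<in> G" using that NG by auto
        show "finite (g j)" using g(1)[OF that(2)] finP finite_subset by blast
        show "alg (d s k0 t0)" if "s \<in> g j" for s using st_alg[OF st' me'] that gS \<open>j < t0 + 1\<close> k0(1) by blast
        show "disjoint_family_on (\<lambda>s. d s k0 t0) (g j)"
          unfolding disjoint_family_on_def using dd gS[OF that(2)] k0(1) by blast
      qed
      then show ?thesis unfolding A_def using that by simp
    qed
    have Adisj: "A j \<inter> A j' = {}" if "j < t0 + 1" "j' < t0 + 1" "j \<noteq> j'" for j j'
    proof -
      have "g j \<inter> g j' = {}" using disjoint_family_onD[OF gd, of j j'] that by auto
      then have "d s k0 t0 \<inter> d s' k0 t0 = {}" if "s \<in> g j" "s' \<in> g j'" for s s'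
        using dd[of s s' k0 t0] gS \<open>j < t0 + 1\<close> \<open>j' < t0 + 1\<close> that k0(1) by blast
      then show ?thesis unfolding A_def using that by auto
    qed
    have le_t: "m' i (t f) \<le> (\<Sum>s\<in>\<P>. m' i (d s k0 t0))" if "i \<in> N" "f \<in> F" for i f
    proof -
      have "m' i (t f) \<le> m' i (A (\<pi> f))"
        by (rule st_m_mono[OF st' _ meA' met[OF that(2)]]) (use that NG t_def in auto)
      also have "\<dots> = (\<Sum>s\<in>g (\<pi> f). m' i (d s k0 t0))" by (rule Aval[OF that(1) \<pi>[OF that(2)]])
      also have "\<dots> \<le> (\<Sum>s\<in>\<P>. m' i (d s k0 t0))"
        using g(1)[OF \<pi>[OF that(2)]] finP nn that(1) k0(1) D(1) by (intro sum_mono2) auto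
      finally show ?thesis .
    qed
    have pool_le: "(\<Sum>s\<in>\<P>'. m' f (d s k0 t0)) \<le> m' f (t f)" if "f \<in> F" for f
    proof -
      have "0 < x" if "x \<in> A j0" for x using subsetD[OF meas_sub[OF meA'] that] by simp
      then have "A j0 \<inter> {y j0<..} = A j0" using un[OF j0] by auto
      then have "m' f (A j0) \<le> m' f (t f)" using e[OF that j0(1)] unfolding t_def by simp
      then show ?thesis using Aval[OF _ j0(1)] that F \<P>'_def by auto
    qed
    let ?w = "w(k0 := Suc (w k0))"
    have cases: "(k, u) = (k0, t0) \<or> u < w k" if "u < ?w k" "k \<in> N" for k u
      using that k0(2) t0_def by (auto split: if_splits)
    have FI: "f \<in> F \<longleftrightarrow> f \<in> I k0 \<and> pos k0 f < t0" for f unfolding F_def by auto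
    \<comment> \<open>Nobody in position \<open>t0\<close> or later has held \<open>k0\<close> so
      far, so only the new pool has to be outweighed.\<close>
    have D0: "{s\<in>\<D>. \<sigma> s j = k0} = {}" if "j \<in> N" "t0 \<le> pos k0 j" for j
      using D(5)[of _ j] that t0_def by fastforce
    have "exch N P' m' \<S> I pos d v ?w \<P>' \<D> \<sigma> Z'"
      unfolding exch_def
    proof (intro conjI ballI allI impI)
      show "\<P>' \<subseteq> \<S>" "\<D> \<subseteq> \<S>" "\<P>' \<inter> \<D> = {}" using D(1-3) P'P by auto
      show "bij_betw (\<sigma> s) N N" if "s \<in> \<D>" for s using D(4)[OF that] .
      show "i \<in> I (\<sigma> s i)" "pos (\<sigma> s i) i < v (\<sigma> s i)" if "s \<in> \<D>" "i \<in> N" for s i using D(5)[OF that] by auto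
      show "v k \<le> ?w k" "?w k \<le> card (I k)" if "k \<in> N" for k using D(6)[OF that] k0 by auto
      show "meas P' (Z' k u f)" for k u f
        using D'(7) Z'old Z'new[of f] met[of f] by (cases "(k, u) = (k0, t0)") (auto split: if_splits)
      show "Z' k u f \<subseteq> (\<Union>s\<in>\<S> - (\<D> \<union> \<P>'). d s k u)" for k u f
      proof (cases "(k, u) = (k0, t0)")
        case True
        show ?thesis
        proof (cases "f \<in> F")
          case fF: True
          have "\<pi> f \<noteq> j0" using j0 fF by auto
          then have "g (\<pi> f) \<inter> \<P>' = {}"
            using disjoint_family_onD[OF gd, of "\<pi> f" j0] \<pi>[OF fF] j0(1) \<P>'_def by auto
          then have "g (\<pi> f) \<subseteq> \<S> - (\<D> \<union> \<P>')" using gS[OF \<pi>[OF fF]] g(1)[OF \<pi>[OF fF]] D(3) by auto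
          then show ?thesis using True Z'new[of f] \<pi>[OF fF] fF unfolding t_def A_def by auto
        next
          case False
          then show ?thesis using True Z'new[of f] by auto
        qed
      next
        case False
        then show ?thesis using D(8)[of k u f] Z'old[OF False] P'P by fastforce
      qed
      show "Z' k u f = {}" if "\<not> (k \<in> N \<and> 1 \<le> u \<and> u < ?w k \<and> f \<in> I k \<and> pos k f < u)" for k u f
      proof (cases "(k, u) = (k0, t0)")
        case True
        then show ?thesis using that Z'new[of f] FI[of f] k0 t0_def by auto
      next
        case False
        then show ?thesis using that D(9)[of k u f] Z'old[OF False] by (auto split: if_splits)
      qed
      show "Z' k u f \<inter> Z' k u f' = {}" if "k \<in> N" "f \<noteq> f'" for k u f f'
      proof (cases "(k, u) = (k0, t0)")
        case True
        have "t f \<inter> t f' = {}" if ff: "f \<in> F" "f' \<in> F"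
        proof -
          have "\<pi> f \<noteq> \<pi> f'" using inj ff \<open>f \<noteq> f'\<close> by (auto dest: inj_onD)
          then have "A (\<pi> f) \<inter> A (\<pi> f') = {}" using Adisj \<pi> ff by auto
          then show ?thesis unfolding t_def by auto
        qed
        then show ?thesis using True Z'new by auto
      next
        case False
        then show ?thesis using that D(10) Z'old[OF False] by auto
      qed
      show "m' f (Z' k u f') \<le> m' f (Z' k u f)"
        if k: "k \<in> N" and a: "1 \<le> u \<and> u < ?w k \<and> f \<in> I k \<and> f' \<in> I k \<and> pos k f < u \<and> pos k f' < u" for k u f f'
      proof (cases "(k, u) = (k0, t0)")
        case True
        then have "f \<in> F" "f' \<in> F" using a FI by auto
        then show ?thesis using True Z'new e[of f "\<pi> f'"] \<pi>[of f'] unfolding t_def by auto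
      next
        case False
        then show ?thesis using D'(11)[OF k] a cases[OF _ k, of u] Z'old[OF False] by auto
      qed
      show "(\<Sum>s\<in>{s\<in>\<D>. \<sigma> s j = k}. m' f (d s k u)) + (\<Sum>s\<in>\<P>'. m' f (d s k u)) \<le> m' f (Z' k u f)"
        if k: "k \<in> N" and a: "1 \<le> u \<and> u < ?w k \<and> f \<in> I k \<and> pos k f < u \<and> j \<in> N \<and> u \<le> pos k j" for k u f j
      proof (cases "(k, u) = (k0, t0)")
        case True
        then have fF: "f \<in> F" using a FI by auto
        have "{s\<in>\<D>. \<sigma> s j = k0} = {}" using D0 a True by auto
        then have "(\<Sum>s\<in>{s\<in>\<D>. \<sigma> s j = k0}. m' f (d s k0 t0)) = 0" by (simp only: sum.empty)
        then show ?thesis using True Z'new fF pool_le[OF fF] by simp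
      next
        case False
        have "u < w k" using cases[OF _ k, of u] a False by auto
        then have "(\<Sum>s\<in>{s\<in>\<D>. \<sigma> s j = k}. m' f (d s k u)) + (\<Sum>s\<in>\<P>. m' f (d s k u)) \<le> m' f (Z k u f)"
          using D'(12)[OF k, of u f j] a by auto
        moreover have "f \<in> N" using a IN[OF k] by auto
        ultimately show ?thesis using sumP'[of f k u] k Z'old[OF False] by auto
      qed
      show "m' i (Z' k u f) \<le> (\<Sum>s\<in>{s\<in>\<D>. \<sigma> s f = k}. m' i (d s k u))"
        if k: "k \<in> N" and a: "1 \<le> u \<and> u < ?w k \<and> f \<in> I k \<and> pos k f < u \<and> i \<in> I k \<and> u \<le> pos k i" for k u f i
      proof (cases "(k, u) = (k0, t0)")
        case True
        have fF: "f \<in> F" using a FI True by auto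
        have iN: "i \<in> N" using a IN[OF k] by auto
        \<comment> \<open>An agent further back is not tempted: the compensation of \<open>f\<close>
          was cut from the pool, and the pool is worth no more to this agent than the pieces missing
          where \<open>f\<close> holds \<open>k0\<close>.\<close>
        have "(\<Sum>s\<in>\<P>. m' i (d s k0 t0)) \<le> (\<Sum>s\<in>{s\<in>\<D>. \<sigma> s f = k0}. m' i (d s k0 t0))"
          by (rule D'(15)[OF k0(1)]) (use fF FI t0_def iN t0n in auto)
        then show ?thesis using le_t[OF iN fF] True Z'new fF by auto
      next
        case False
        then show ?thesis using D'(13)[OF k] a cases[OF _ k, of u] Z'old[OF False] by auto
      qed
      show "\<exists>s\<in>\<D>. \<sigma> s f = k" if "k \<in> N" "f \<in> I k" "pos k f < v k" for k f using D(14)[OF that] .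
      show "(\<Sum>s\<in>\<P>'. m' i (d s k u)) \<le> (\<Sum>s\<in>{s\<in>\<D>. \<sigma> s f = k}. m' i (d s k u))"
        if "k \<in> N" "f \<in> I k" "pos k f < v k" "i \<in> N" "u < card N" for k f i u
        using D'(15)[OF that] sumP'[OF that(4,1), of u] by linarith
    qed
    then show "\<exists>\<P>' Z'. card \<P>' = q \<and> \<P>' \<subseteq> \<P> \<and> exch N P' m' \<S> I pos d v (w(k0 := Suc (w k0))) \<P>' \<D> \<sigma> Z'"
      using g(2)[OF j0(1)] P'P \<P>'_def by blast
  qed
qed

text \<open>The permutation \<open>\<sigma>0\<close> is applied to all of the pool except a part
  \<open>Q\<close>. For every agent, piece and index, \<open>Q\<close> is worth no more than the
  part \<open>W\<close> that is used up. These are \<open>card N ^ 3\<close> criteria for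
  \<open>top_selection\<close>, and they supply the last clause of \<open>exch\<close> for the
  pieces that change hands now.\<close>

lemma exchange_family:
  assumes st: "st P m" and NG: "N \<subseteq> G" and finN: "finite N" and N0: "N \<noteq> {}" and finS: "finite \<S>"
    and I: "\<And>k. k \<in> N \<Longrightarrow> k \<in> I k \<and> I k \<subseteq> N \<and> bij_betw (pos k) (I k) {..<card (I k)} \<and> pos k k = 0"
    and me: "\<And>s k t. s \<in> \<S> \<Longrightarrow> k \<in> N \<Longrightarrow> meas P (d s k t)"
    and E: "exch N P m \<S> I pos d v w \<P> \<D> \<sigma> Z"
    and \<sigma>0: "bij_betw \<sigma>0 N N" "\<And>i. i \<in> N \<Longrightarrow> i \<in> I (\<sigma>0 i) \<and> pos (\<sigma>0 i) i < w (\<sigma>0 i)"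
    and new: "\<And>k. k \<in> N \<Longrightarrow> w k \<noteq> v k \<Longrightarrow> w k = Suc (v k) \<and> (\<forall>i\<in>N. \<sigma>0 i = k \<longrightarrow> pos k i = v k)"
    and q: "(card N ^ 3 + 1) * q \<le> card \<P>" "1 \<le> q"
  shows "\<exists>\<P>' \<D>' \<sigma>'. card \<P>' = q \<and> exch N P m \<S> I pos d w w \<P>' \<D>' \<sigma>' Z"
proof -
  note D = exchD[OF E]
  have IN: "I k \<subseteq> N" if "k \<in> N" for k using I that by auto
  have finP: "finite \<P>" "finite \<D>" using D(1,2) finS finite_subset by auto
  have nn: "0 \<le> m i (d s k u)" if "i \<in> N" "s \<in> \<S>" "k \<in> N" for i s k u
    using st_nonneg[OF st _ me[OF that(2,3)]] that(1) NG by auto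
  have "card (N \<times> N \<times> {..<card N}) = card N ^ 3" by (simp add: card_cartesian_product power3_eq_cube)
  then have "(card (N \<times> N \<times> {..<card N}) + 1) * q \<le> card \<P>" using q by simp
  from top_selection[OF finP(1) _ this, of "\<lambda>(i, k, t) s. m i (d s k t)"] finN
  obtain Q where Q: "Q \<subseteq> \<P>" "card Q = q" and top: "\<And>x. x \<in> N \<times> N \<times> {..<card N} \<Longrightarrow>
    (\<forall>s\<in>\<P>. 0 \<le> (case x of (i, k, t) \<Rightarrow> m i (d s k t))) \<Longrightarrow>
    (\<Sum>s\<in>Q. case x of (i, k, t) \<Rightarrow> m i (d s k t)) \<le> (\<Sum>s\<in>\<P> - Q. case x of (i, k, t) \<Rightarrow> m i (d s k t))"
    by auto
  define W where "W = \<P> - Q"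
  have topW: "(\<Sum>s\<in>Q. m i (d s k t)) \<le> (\<Sum>s\<in>W. m i (d s k t))" if "i \<in> N" "k \<in> N" "t < card N" for i k t
  proof -
    have "\<forall>s\<in>\<P>. 0 \<le> m i (d s k t)" using nn D(1) that by blast
    then show ?thesis using top[of "(i, k, t)"] that unfolding W_def by auto
  qed
  have finQ: "finite Q" "finite W" using Q finP finite_subset W_def by auto
  have QW: "\<P> = Q \<union> W" "Q \<inter> W = {}" unfolding W_def using Q by auto
  have "q < card \<P>"
  proof -
    have "1 \<le> card N" using finN N0 by (simp add: Suc_le_eq card_gt_0_iff)
    then have "1 * q \<le> card N ^ 3 * q" by (intro mult_right_mono) auto
    then have "q \<le> card N ^ 3 * q" by simp
    then show ?thesis using q unfolding add_mult_distrib by linarith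
  qed
  then have W0: "W \<noteq> {}" using QW Q(2) by force
  define \<D>' where "\<D>' = \<D> \<union> W"
  define \<sigma>' where "\<sigma>' s = (if s \<in> W then \<sigma>0 else \<sigma> s)" for s
  have WD: "W \<inter> \<D> = {}" "W \<subseteq> \<S>" unfolding W_def using D(1,3) by auto
  have fib: "{s\<in>\<D>'. \<sigma>' s j = k} = {s\<in>\<D>. \<sigma> s j = k} \<union> (if \<sigma>0 j = k then W else {})" for j k
    unfolding \<D>'_def \<sigma>'_def using WD by auto
  have sumfib: "(\<Sum>s\<in>{s\<in>\<D>'. \<sigma>' s j = k}. m i (d s k t)) =
      (\<Sum>s\<in>{s\<in>\<D>. \<sigma> s j = k}. m i (d s k t)) + (if \<sigma>0 j = k then \<Sum>s\<in>W. m i (d s k t) else 0)" for i j k t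
    unfolding fib using finQ finP WD by (subst sum.union_disjoint) auto
  have sW: "0 \<le> (\<Sum>s\<in>W. m i (d s k t))" if "i \<in> N" "k \<in> N" for i k t
    using nn that WD by (intro sum_nonneg) auto
  have sQ: "(\<Sum>s\<in>\<P>. m i (d s k t)) = (\<Sum>s\<in>Q. m i (d s k t)) + (\<Sum>s\<in>W. m i (d s k t))" for i k t
    unfolding QW(1) using finQ QW(2) by (rule sum.union_disjoint)
  have rest: "\<S> - (\<D>' \<union> Q) = \<S> - (\<D> \<union> \<P>)" unfolding \<D>'_def QW(1) by auto
  have "exch N P m \<S> I pos d w w Q \<D>' \<sigma>' Z"
    unfolding exch_def rest
  proof (intro conjI ballI allI impI)
    show "Q \<subseteq> \<S>" "\<D>' \<subseteq> \<S>" "Q \<inter> \<D>' = {}" using D(1-3) Q WD QW unfolding \<D>'_def by auto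
    show "bij_betw (\<sigma>' s) N N" if "s \<in> \<D>'" for s using D(4) that \<sigma>0 unfolding \<D>'_def \<sigma>'_def by auto
    show "i \<in> I (\<sigma>' s i)" "pos (\<sigma>' s i) i < w (\<sigma>' s i)" if s: "s \<in> \<D>'" "i \<in> N" for s i
    proof -
      have "i \<in> I (\<sigma>' s i) \<and> pos (\<sigma>' s i) i < w (\<sigma>' s i)"
      proof (cases "s \<in> W")
        case True
        then show ?thesis using \<sigma>0(2)[OF s(2)] \<sigma>'_def by simp
      next
        case False
        then have sD: "s \<in> \<D>" using s \<D>'_def by auto
        then have "\<sigma> s i \<in> N" using D(4)[OF sD] s(2) by (auto simp: bij_betw_def)
        then show ?thesis using D(5)[OF sD s(2)] D(6)[of "\<sigma> s i"] False \<sigma>'_def by auto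
      qed
      then show "i \<in> I (\<sigma>' s i)" "pos (\<sigma>' s i) i < w (\<sigma>' s i)" by auto
    qed
    show "w k \<le> w k" "w k \<le> card (I k)" if "k \<in> N" for k using D(6)[OF that] by auto
    show "meas P (Z k t f)" for k t f using D(7) .
    show "Z k t f \<subseteq> (\<Union>s\<in>\<S> - (\<D> \<union> \<P>). d s k t)" for k t f using D(8) .
    show "Z k t f = {}" if "\<not> (k \<in> N \<and> 1 \<le> t \<and> t < w k \<and> f \<in> I k \<and> pos k f < t)" for k t f using D(9)[OF that] .
    show "Z k t f \<inter> Z k t f' = {}" if "k \<in> N" "f \<noteq> f'" for k t f f' using D(10)[OF that] .
    show "m f (Z k t f') \<le> m f (Z k t f)"
      if "k \<in> N" "1 \<le> t \<and> t < w k \<and> f \<in> I k \<and> f' \<in> I k \<and> pos k f < t \<and> pos k f' < t" for k t f f'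
      using D(11) that by auto
    show "(\<Sum>s\<in>{s\<in>\<D>'. \<sigma>' s j = k}. m f (d s k t)) + (\<Sum>s\<in>Q. m f (d s k t)) \<le> m f (Z k t f)"
      if k: "k \<in> N" and a: "1 \<le> t \<and> t < w k \<and> f \<in> I k \<and> pos k f < t \<and> j \<in> N \<and> t \<le> pos k j" for k t f j
    proof -
      have "f \<in> N" using a IN[OF k] by auto
      then show ?thesis using D(12)[OF k, of t f j] a sumfib[where i = f and j = j and k = k and t = t] sQ[of f k t] sW[of f k t] k by auto
    qed
    show "m i (Z k t f) \<le> (\<Sum>s\<in>{s\<in>\<D>'. \<sigma>' s f = k}. m i (d s k t))"
      if k: "k \<in> N" and a: "1 \<le> t \<and> t < w k \<and> f \<in> I k \<and> pos k f < t \<and> i \<in> I k \<and> t \<le> pos k i" for k t f i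
    proof -
      have "i \<in> N" using a IN[OF k] by auto
      then show ?thesis using D(13)[OF k, of t f i] a sumfib[where i = i and j = f and k = k and t = t] sW[of i k t] k by auto
    qed
  next
    fix k f assume k: "k \<in> N" and f: "f \<in> I k" "pos k f < w k"
    \<comment> \<open>The only position that is newly served at \<open>k\<close> is
      \<open>v k\<close>. As positions are injective, its agent is the one to whom
      \<open>\<sigma>0\<close> gives \<open>k\<close>.\<close>
    have key: "pos k f < v k \<or> \<sigma>0 f = k"
    proof (cases "pos k f < v k")
      case False
      then have wv: "w k \<noteq> v k" using f by auto
      obtain i where i: "i \<in> N" "\<sigma>0 i = k" using bij_betw_imp_surj_on[OF \<sigma>0(1)] k by (metis imageE)
      have "pos k i = v k" "pos k f = v k" using new[OF k wv] i f False by auto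
      moreover have "i \<in> I k" using \<sigma>0(2)[OF i(1)] i(2) by auto
      ultimately have "i = f" using I[OF k] f(1) inj_onD[of "pos k" "I k" i f] by (auto simp: bij_betw_def)
      then show ?thesis using i by auto
    qed auto
    show "\<exists>s\<in>\<D>'. \<sigma>' s f = k"
      using key
    proof
      assume "pos k f < v k"
      then obtain s where "s \<in> \<D>" "\<sigma> s f = k" using D(14)[OF k f(1)] by auto
      then show ?thesis using WD unfolding \<D>'_def \<sigma>'_def by auto
    next
      assume "\<sigma>0 f = k"
      then show ?thesis using W0 unfolding \<D>'_def \<sigma>'_def by auto
    qed
    fix i t assume it: "i \<in> N" "t < card N"
    show "(\<Sum>s\<in>Q. m i (d s k t)) \<le> (\<Sum>s\<in>{s\<in>\<D>'. \<sigma>' s f = k}. m i (d s k t))"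
      using key
    proof
      assume "pos k f < v k"
      then show ?thesis using D(15)[OF k f(1) _ it] sumfib[where i = i and j = f and k = k and t = t] sQ[of i k t] sW[OF it(1) k, of t] by auto
    next
      assume a: "\<sigma>0 f = k"
      have "0 \<le> (\<Sum>s\<in>{s\<in>\<D>. \<sigma> s f = k}. m i (d s k t))"
        using nn it k D(2) by (intro sum_nonneg) auto
      then show ?thesis using topW[OF it(1) k it(2)] sumfib[where i = i and j = f and k = k and t = t] a by auto
    qed
  qed
  then show ?thesis using Q(2) by blast
qed

lemma exchange_events:
  assumes NG: "N \<subseteq> G" and finN: "finite N" and finS: "finite \<S>"
    and I: "\<And>k. k \<in> N \<Longrightarrow> k \<in> I k \<and> I k \<subseteq> N \<and> bij_betw (pos k) (I k) {..<card (I k)} \<and> pos k k = 0"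
    and disj: "disjoint_family_on (\<lambda>(s, k, t). d s k t) (\<S> \<times> N \<times> UNIV)"
    and K: "finite K" "K \<subseteq> N" "\<And>k. k \<in> K \<Longrightarrow> 1 \<le> v k \<and> v k < card (I k)"
    and st: "st P m" and me: "\<And>s k t. s \<in> \<S> \<Longrightarrow> k \<in> N \<Longrightarrow> meas P (d s k t)"
    and E: "exch N P m \<S> I pos d v v \<P> \<D> \<sigma> Z" and cP: "card N ^ card K * q \<le> card \<P>"
  shows "can (\<lambda>P' m'. \<exists>\<P>' Z'. q \<le> card \<P>' \<and>
      exch N P' m' \<S> I pos d v (\<lambda>k. if k \<in> K then Suc (v k) else v k) \<P>' \<D> \<sigma> Z')
    (card K * trim_cost (card N)) P m"
  using K cP
proof (induction K arbitrary: q rule: finite_induct)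
  case empty
  show ?case
  proof (rule can_I[OF st])
    fix m' assume "agree P m m'"
    then have "exch N P m' \<S> I pos d v v \<P> \<D> \<sigma> Z" using exch_agree[OF E subset_refl _ NG me] I by blast
    then show "\<exists>\<P>' Z'. q \<le> card \<P>' \<and>
      exch N P m' \<S> I pos d v (\<lambda>k. if k \<in> {} then Suc (v k) else v k) \<P>' \<D> \<sigma> Z'"
      using empty by auto
  qed
next
  case (insert k K)
  let ?w = "\<lambda>K k. if k \<in> K then Suc (v k) else v k"
  have "can (\<lambda>P' m'. \<exists>\<P>' Z'. card N * q \<le> card \<P>' \<and> exch N P' m' \<S> I pos d v (?w K) \<P>' \<D> \<sigma> Z')
    (card K * trim_cost (card N)) P m"
    by (rule insert.IH) (use insert.prems insert.hyps in \<open>auto simp: algebra_simps\<close>)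
  then have "can (\<lambda>P' m'. \<exists>\<P>' Z'. q \<le> card \<P>' \<and> exch N P' m' \<S> I pos d v (?w (insert k K)) \<P>' \<D> \<sigma> Z')
    (card K * trim_cost (card N) + trim_cost (card N)) P m"
  proof (rule can_bind[OF _ st])
    fix P' m' assume st': "st P' m'" and s: "P \<subseteq> P'" "agree P m m'"
      and "\<exists>\<P>' Z'. card N * q \<le> card \<P>' \<and> exch N P' m' \<S> I pos d v (?w K) \<P>' \<D> \<sigma> Z'"
    then obtain \<P>1 Z1 where E1: "card N * q \<le> card \<P>1" "exch N P' m' \<S> I pos d v (?w K) \<P>1 \<D> \<sigma> Z1" by blast
    have k: "k \<in> N" "?w K k = v k" "1 \<le> v k" "v k < card (I k)" using insert by auto
    have eq: "(?w K)(k := Suc (?w K k)) = ?w (insert k K)" using insert.hyps by (auto simp: fun_eq_iff)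
    have me': "meas P' (d s k t)" if "s \<in> \<S>" "k \<in> N" for s k t using meas_mono[OF me[OF that] s(1)] .
    have "can (\<lambda>P'' m''. \<exists>\<P>' Z'. card \<P>' = q \<and> \<P>' \<subseteq> \<P>1 \<and>
        exch N P'' m'' \<S> I pos d v ((?w K)(k := Suc (?w K k))) \<P>' \<D> \<sigma> Z') (trim_cost (card N)) P' m'"
      by (rule exchange_event[OF st' NG finN finS I me' disj E1(2) k E1(1)])
    then show "can (\<lambda>P' m'. \<exists>\<P>' Z'. q \<le> card \<P>' \<and> exch N P' m' \<S> I pos d v (?w (insert k K)) \<P>' \<D> \<sigma> Z')
      (trim_cost (card N)) P' m'"
      unfolding eq by (rule can_conseq[OF _ st' order_refl]) auto
  qed
  then show ?case using insert.hyps by (simp add: add.commute)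
qed

text \<open>A round serves one new position at every piece of a nonempty set \<open>K\<close>, so
  the number of unserved positions drops by \<open>card K\<close>. The events divide the pool by
  \<open>card N ^ card K\<close> and the selection divides it by \<open>card N ^ 3 + 1\<close>;
  together this is at most \<open>(card N * (card N ^ 3 + 1)) ^ card K\<close>. As long as every
  completed piece has \<open>I k = N\<close>, \<open>rotation\<close> provides a further
  round.\<close>

lemma exchange:
  assumes NG: "N \<subseteq> G" and finN: "finite N" and finS: "finite \<S>"
    and I: "\<And>k. k \<in> N \<Longrightarrow> k \<in> I k \<and> I k \<subseteq> N \<and> bij_betw (pos k) (I k) {..<card (I k)} \<and> pos k k = 0"
    and disj: "disjoint_family_on (\<lambda>(s, k, t). d s k t) (\<S> \<times> N \<times> UNIV)"
    and k1: "k1 \<in> N" "I k1 \<noteq> N"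
    and "st P m" and "\<And>s k t. s \<in> \<S> \<Longrightarrow> k \<in> N \<Longrightarrow> meas P (d s k t)"
    and "exch N P m \<S> I pos d v v \<P> \<D> \<sigma> Z" and "\<And>k. k \<in> N \<Longrightarrow> 1 \<le> v k"
    and "(card N * (card N ^ 3 + 1)) ^ (\<Sum>k\<in>N. card (I k) - v k) \<le> card \<P>"
  shows "can (\<lambda>P' m'. \<exists>v \<P> \<D> \<sigma> Z k. exch N P' m' \<S> I pos d v v \<P> \<D> \<sigma> Z \<and> k \<in> N \<and> v k = card (I k) \<and> I k \<noteq> N)
    ((\<Sum>k\<in>N. card (I k) - v k) * trim_cost (card N)) P m"
  using assms(8-)
proof (induction "\<Sum>k\<in>N. card (I k) - v k" arbitrary: P m v \<P> \<D> \<sigma> Z rule: less_induct)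
  case less
  note st = less.prems(1) and me = less.prems(2) and E = less.prems(3) and v1 = less.prems(4)
  let ?n = "card N" and ?\<mu> = "\<lambda>v. \<Sum>k\<in>N. card (I k) - v k"
  let ?c = "?n * (?n ^ 3 + 1)"
  let ?Q = "\<lambda>P' m'. \<exists>v \<P> \<D> \<sigma> Z k. exch N P' m' \<S> I pos d v v \<P> \<D> \<sigma> Z \<and> k \<in> N \<and> v k = card (I k) \<and> I k \<noteq> N"
  have IN: "I k \<subseteq> N" if "k \<in> N" for k using I that by auto
  have N0: "N \<noteq> {}" using k1 by auto
  have n1: "1 \<le> ?n" using finN N0 by (simp add: Suc_le_eq card_gt_0_iff)
  show ?case
  proof (cases "\<exists>k\<in>N. v k = card (I k) \<and> I k \<noteq> N")
    case True
    show ?thesis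
    proof (rule can_I[OF st])
      fix m' assume "agree P m m'"
      then have "exch N P m' \<S> I pos d v v \<P> \<D> \<sigma> Z" using exch_agree[OF E subset_refl _ NG me IN] by blast
      then show "?Q P m'" using True by blast
    qed
  next
    case False
    note D = exchD[OF E]
    have "\<exists>\<sigma>. bij_betw \<sigma> N N \<and> (\<forall>i\<in>N. i \<in> I (\<sigma> i) \<and> pos (\<sigma> i) i \<le> v (\<sigma> i)) \<and> (\<exists>i\<in>N. pos (\<sigma> i) i = v (\<sigma> i))"
      by (rule rotation[OF finN I _ _ k1]) (use v1 D(6) False in auto)
    then obtain \<sigma>0 where \<sigma>0: "bij_betw \<sigma>0 N N" "\<And>i. i \<in> N \<Longrightarrow> i \<in> I (\<sigma>0 i)" "\<And>i. i \<in> N \<Longrightarrow> pos (\<sigma>0 i) i \<le> v (\<sigma>0 i)"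
      "\<exists>i\<in>N. pos (\<sigma>0 i) i = v (\<sigma>0 i)" by blast
    have \<sigma>N: "\<sigma>0 i \<in> N" if "i \<in> N" for i using \<sigma>0(1) that by (auto simp: bij_betw_def)
    define K where "K = {k \<in> N. \<exists>i\<in>N. \<sigma>0 i = k \<and> pos k i = v k}"
    have K: "finite K" "K \<subseteq> N" "K \<noteq> {}" using finN \<sigma>0(4) \<sigma>N unfolding K_def by auto
    have Kv: "1 \<le> v k \<and> v k < card (I k)" if k: "k \<in> K" for k
    proof -
      obtain i where i: "i \<in> N" "\<sigma>0 i = k" "pos k i = v k" "k \<in> N" using k K_def by auto
      then have "pos k i \<in> {..<card (I k)}" using I[OF i(4)] \<sigma>0(2)[OF i(1)] i(2) bij_betwE by blast
      then show ?thesis using i v1 by auto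
    qed
    define v' where "v' k = (if k \<in> K then Suc (v k) else v k)" for k
    have mu: "?\<mu> v = ?\<mu> v' + card K"
    proof -
      have "?\<mu> v = (\<Sum>k\<in>N. (card (I k) - v' k) + (if k \<in> K then 1 else 0))"
        by (rule sum.cong) (use Kv v'_def in force)+
      also have "\<dots> = ?\<mu> v' + card K" using K finN by (simp add: sum.distrib sum.If_cases Int_absorb1)
      finally show ?thesis .
    qed
    have K1: "1 \<le> card K" using K by (simp add: Suc_le_eq card_gt_0_iff)
    define q where "q = ?c ^ ?\<mu> v'"
    have q1: "1 \<le> q" unfolding q_def using n1 by simp
    have "?n ^ card K * ((?n ^ 3 + 1) * q) \<le> ?n ^ card K * ((?n ^ 3 + 1) ^ card K * q)"
      using K1 by (intro mult_le_mono order_refl self_le_power) auto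
    also have "\<dots> = ?c ^ ?\<mu> v" unfolding mu q_def power_add power_mult_distrib by (simp only: mult_ac)
    finally have sz: "?n ^ card K * ((?n ^ 3 + 1) * q) \<le> card \<P>" using less.prems(5) by simp
    have "can (\<lambda>P' m'. \<exists>\<P>' Z'. (?n ^ 3 + 1) * q \<le> card \<P>' \<and>
      exch N P' m' \<S> I pos d v (\<lambda>k. if k \<in> K then Suc (v k) else v k) \<P>' \<D> \<sigma> Z') (card K * trim_cost ?n) P m"
      by (rule exchange_events[OF NG finN finS I disj K(1,2) Kv st me E sz])
    then have "can ?Q (card K * trim_cost ?n + ?\<mu> v' * trim_cost ?n) P m"
    proof (rule can_bind[OF _ st])
      fix P' m' assume st': "st P' m'" and s: "P \<subseteq> P'" "agree P m m'"
        and "\<exists>\<P>' Z'. (?n ^ 3 + 1) * q \<le> card \<P>' \<and>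
          exch N P' m' \<S> I pos d v (\<lambda>k. if k \<in> K then Suc (v k) else v k) \<P>' \<D> \<sigma> Z'"
      then obtain \<P>1 Z1 where c1: "(?n ^ 3 + 1) * q \<le> card \<P>1" and E1: "exch N P' m' \<S> I pos d v v' \<P>1 \<D> \<sigma> Z1"
        unfolding v'_def[abs_def] by blast
      have me': "meas P' (d s k t)" if "s \<in> \<S>" "k \<in> N" for s k t using meas_mono[OF me[OF that] s(1)] .
      have "\<exists>\<P>' \<D>' \<sigma>'. card \<P>' = q \<and> exch N P' m' \<S> I pos d v' v' \<P>' \<D>' \<sigma>' Z1"
      proof (rule exchange_family[OF st' NG finN N0 finS I me' E1 \<sigma>0(1) _ _ c1 q1])
        fix i assume i: "i \<in> N"
        show "i \<in> I (\<sigma>0 i) \<and> pos (\<sigma>0 i) i < v' (\<sigma>0 i)"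
        proof (cases "pos (\<sigma>0 i) i = v (\<sigma>0 i)")
          case True
          then have "\<sigma>0 i \<in> K" using i \<sigma>N K_def by auto
          then show ?thesis using \<sigma>0(2)[OF i] True v'_def by auto
        next
          case False
          then show ?thesis using \<sigma>0(2,3)[OF i] v'_def by auto
        qed
      next
        fix k assume k: "k \<in> N" "v' k \<noteq> v k"
        then have "k \<in> K" using v'_def by (cases "k \<in> K") auto
        then obtain i where i: "i \<in> N" "\<sigma>0 i = k" "pos k i = v k" using K_def by auto
        have "\<forall>i'\<in>N. \<sigma>0 i' = k \<longrightarrow> pos k i' = v k"
          using i \<sigma>0(1) by (metis bij_betw_imp_inj_on inj_onD)
        then show "v' k = Suc (v k) \<and> (\<forall>i\<in>N. \<sigma>0 i = k \<longrightarrow> pos k i = v k)" using \<open>k \<in> K\<close> v'_def by auto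
      qed
      then obtain \<P>2 \<D>2 \<sigma>2 where E2: "card \<P>2 = q" "exch N P' m' \<S> I pos d v' v' \<P>2 \<D>2 \<sigma>2 Z1" by blast
      have lt: "?\<mu> v' < ?\<mu> v" using mu K1 by linarith
      have v1': "1 \<le> v' k" if "k \<in> N" for k using v1[OF that] v'_def by auto
      have "?c ^ ?\<mu> v' \<le> card \<P>2" using E2(1) q_def by simp
      from less.hyps[OF lt st' me' E2(2) v1' this]
      show "can ?Q (?\<mu> v' * trim_cost ?n) P' m'" .
    qed
    then show ?thesis using mu by (simp add: algebra_simps)
  qed
qed

end

section \<open>Values after the exchange\<close>

lemma sum_prefix: "p < n \<Longrightarrow> (\<Sum>t=1..p. f t) = (\<Sum>t<n. if 1 \<le> t \<and> t \<le> p then f t else (0::real))" for n p :: nat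
proof -
  assume p: "p < n"
  have "(\<Sum>t<n. if 1 \<le> t \<and> t \<le> p then f t else 0) = sum f ({..<n} \<inter> {t. 1 \<le> t \<and> t \<le> p})"
    by (simp add: sum.inter_restrict)
  also have "{..<n} \<inter> {t. 1 \<le> t \<and> t \<le> p} = {1..p}" using p by auto
  finally show ?thesis by simp
qed

context agents
begin

text \<open>Compare the two sides index by index. If \<open>t\<close> lies in neither prefix, the
  compensations are envy-free. If it lies only in the prefix of \<open>j\<close>, the compensation
  of \<open>i\<close> covers it. If it lies only in the prefix of \<open>i\<close>, the compensation
  of \<open>j\<close> is worth at most the pieces that \<open>j\<close> misses. If it lies in both,
  neither agent is compensated.\<close>

lemma exch_column_in:
  assumes st: "st P m" and NG: "N \<subseteq> G" and finN: "finite N" and finS: "finite \<S>"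
    and I: "\<And>k. k \<in> N \<Longrightarrow> k \<in> I k \<and> I k \<subseteq> N \<and> bij_betw (pos k) (I k) {..<card (I k)} \<and> pos k k = 0"
    and me: "\<And>s k t. s \<in> \<S> \<Longrightarrow> k \<in> N \<Longrightarrow> meas P (d s k t)"
    and E: "exch N P m \<S> I pos d v v \<P> \<D> \<sigma> Z"
    and k: "k \<in> N" and i: "i \<in> I k" and j: "j \<in> N"
  shows "(\<Sum>s\<in>{s\<in>\<D>. \<sigma> s j = k}. (\<Sum>t=1..pos k j. m i (d s k t)) - (\<Sum>t=1..pos k i. m i (d s k t)))
    + (\<Sum>t<card N. m i (Z k t j)) \<le> (\<Sum>t<card N. m i (Z k t i))"
proof -
  note D = exchD[OF E]
  let ?n = "card N"
  define F where "F = {s\<in>\<D>. \<sigma> s j = k}"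
  define g where "g t = (\<Sum>s\<in>F. m i (d s k t))" for t
  have iN: "i \<in> N" "i \<in> G" using i I[OF k] NG by auto
  have cIn: "card (I k) \<le> ?n" using I[OF k] finN card_mono by blast
  have g0: "0 \<le> g t" for t
    unfolding g_def F_def using st_nonneg[OF st iN(2) me[OF _ k]] D(2) by (intro sum_nonneg) auto
  have pool0: "0 \<le> (\<Sum>s\<in>\<P>. m i (d s k t))" for t
    using st_nonneg[OF st iN(2) me[OF _ k]] D(1) by (intro sum_nonneg) auto
  have Z0: "0 \<le> m i (Z k t f)" for t f using st_nonneg[OF st iN(2) D(7)] .
  have Ze: "Z k t f = {} \<Longrightarrow> m i (Z k t f) = 0" for t f using m_empty[OF st_prof[OF st] iN(2)] by simp
  have FI: "j \<in> I k \<and> pos k j < v k" if "s \<in> F" for s using D(5)[of s j] that j F_def by auto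
  show ?thesis
  proof (cases "j \<in> I k")
    case False
    then have "F = {}" using FI by auto
    moreover have "Z k t j = {}" for t using D(9)[of k t j] False by auto
    moreover have "0 \<le> (\<Sum>t<?n. m i (Z k t i))" by (rule sum_nonneg) (rule Z0)
    ultimately show ?thesis using Ze[of 0 j] unfolding F_def[symmetric] by simp
  next
    case jI: True
    have pn: "pos k i < ?n" "pos k j < ?n" using bij_betwE[of "pos k" "I k" "{..<card (I k)}"] I[OF k] i jI cIn by (auto dest: less_le_trans)
    have sw: "(\<Sum>s\<in>F. \<Sum>t=1..p. m i (d s k t)) = (\<Sum>t<?n. if 1 \<le> t \<and> t \<le> p then g t else 0)" if "p < ?n" for p
      using sum_prefix[OF that, of g] unfolding g_def by (subst sum.swap) simp
    have "(if 1 \<le> t \<and> t \<le> pos k j then g t else 0) - (if 1 \<le> t \<and> t \<le> pos k i then g t else 0) + m i (Z k t j)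
        \<le> m i (Z k t i)" if t: "t < ?n" for t
    proof (cases "1 \<le> t \<and> t < v k")
      case False
      then have "Z k t j = {}" "Z k t i = {}" using D(9) by blast+
      moreover have "g t = 0" if "1 \<le> t" "t \<le> pos k j"
      proof -
        have "F = {}" using FI False that by fastforce
        then show ?thesis unfolding g_def by simp
      qed
      ultimately show ?thesis using Ze g0[of t] by auto
    next
      case tv: True
      consider "pos k i < t" "pos k j < t" | "pos k i < t" "t \<le> pos k j" | "t \<le> pos k i" "pos k j < t"
        | "t \<le> pos k i" "t \<le> pos k j" by linarith
      then show ?thesis
      proof cases
        case 1
        then show ?thesis using D(11)[OF k, of t i j] tv i jI by auto
      next
        case 2
        have "Z k t j = {}" using D(9)[of k t j] 2 by auto
        then show ?thesis using D(12)[OF k, of t i j] tv i j 2 Ze pool0[of t] unfolding g_def F_def by auto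
      next
        case 3
        then show ?thesis using D(13)[OF k, of t j i] tv i jI Z0[of t i] unfolding g_def F_def by auto
      next
        case 4
        have "Z k t j = {}" using D(9)[of k t j] 4 by auto
        then show ?thesis using 4 Ze Z0[of t i] by auto
      qed
    qed
    then have "(\<Sum>t<?n. (if 1 \<le> t \<and> t \<le> pos k j then g t else 0) - (if 1 \<le> t \<and> t \<le> pos k i then g t else 0) + m i (Z k t j))
        \<le> (\<Sum>t<?n. m i (Z k t i))" by (intro sum_mono) auto
    then show ?thesis
      using sw[OF pn(1)] sw[OF pn(2)] unfolding F_def[symmetric] sum.distrib sum_subtractf by linarith
  qed
qed

text \<open>For \<open>i \<notin> I k\<close>, each time \<open>j\<close> holds \<open>k\<close> the advantage of \<open>i\<close> is twice the residue, while all
  that \<open>j\<close> receives from the residue is worth at most the residue.\<close>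

lemma exch_division:
  assumes st: "st P m" and NG: "N \<subseteq> G" and finN: "finite N" and A: "meas P A"
    and sn: "snaps N P m A S cs" and X: "alloc N P (rest N A S cs) X" "ef N m X"
    and SS: "\<S> \<subseteq> {..<S}" and iso: "iso N P m (rest N A S cs - (\<Union>i\<in>N. X i)) \<S> cs I pos d"
    and E: "exch N P m \<S> I pos d v v \<P> \<D> \<sigma> Z" and k0: "k0 \<in> N" "v k0 = card (I k0)"
  shows "\<exists>Y. alloc N P A Y \<and> ef N m Y \<and>
    (\<forall>i\<in>N - I k0. \<forall>j\<in>I k0. m i (Y j) + m i (A - (\<Union>i\<in>N. Y i)) \<le> m i (Y i))"
proof -
  note D = exchD[OF E]
  let ?n = "card N"
  define R where "R = rest N A S cs - (\<Union>i\<in>N. X i)"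
  note is' = iso[folded R_def, unfolded iso_def]
  have I: "k \<in> I k \<and> I k \<subseteq> N \<and> bij_betw (pos k) (I k) {..<card (I k)} \<and> pos k k = 0" if "k \<in> N" for k
    using is' that by blast
  have d: "meas P (d s k t)" "d s k t \<subseteq> R" if "s \<in> \<S>" "k \<in> N" for s k t using is' that by blast+
  have disj: "disjoint_family_on (\<lambda>(s, k, t). d s k t) (\<S> \<times> N \<times> UNIV)" using is' by blast
  have dd: "d s k t \<inter> d s' k' t' = {}" if "s \<in> \<S>" "k \<in> N" "s' \<in> \<S>" "k' \<in> N" "(s, k, t) \<noteq> (s', k', t')" for s k t s' k' t'
    using disjoint_family_onD[OF disj, of "(s, k, t)" "(s', k', t')"] that by auto
  have val: "m i (cs s k) + (\<Sum>t=1..pos k i. m i (d s k t)) = m i (cs s i)" if "s \<in> \<S>" "k \<in> N" "i \<in> I k" for s k i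
    using is' that by blast
  have big: "m i (cs s k) + 2 * m i R \<le> m i (cs s i)" if "s \<in> \<S>" "k \<in> N" "i \<in> N - I k" for s k i
    using is' that by blast
  have DS: "\<D> \<subseteq> {..<S}" "finite \<D>" "finite \<S>" using D(2) SS finite_subset[of _ "{..<S}"] by auto
  have cs: "alloc N P A (cs s)" "ef N m (cs s)" if "s < S" for s using sn that unfolding snaps_def by auto
  have csd: "cs s i \<inter> cs s' j = {}" if "s < S" "s' < S" "i \<in> N" "j \<in> N" "(s, i) \<noteq> (s', j)" for s s' i j
  proof (cases "s = s'")
    case True
    then show ?thesis using cs(1)[OF that(1)] that unfolding alloc_def disjoint_family_on_def by auto
  next
    case False
    have "disjoint_family_on (\<lambda>s. \<Union>i\<in>N. cs s i) {..<S}" using sn unfolding snaps_def by auto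
    from disjoint_family_onD[OF this, of s s'] show ?thesis using False that by auto
  qed
  \<comment> \<open>Snapshots outside \<open>\<D>\<close> keep their owners. Among them are those of
    the pool and those whose extracted pieces serve as compensation.\<close>
  define \<tau> where "\<tau> s i = (if s \<in> \<D> then \<sigma> s i else i)" for s i
  have \<tau>: "bij_betw (\<tau> s) N N" for s
  proof (cases "s \<in> \<D>")
    case True
    then show ?thesis using D(4) unfolding \<tau>_def by simp
  next
    case False
    then have "\<tau> s = id" unfolding \<tau>_def by auto
    then show ?thesis by simp
  qed
  have \<tau>N: "\<tau> s i \<in> N" if "i \<in> N" for s i using bij_betwE[OF \<tau>] that by blast
  have \<sigma>N: "\<sigma> s i \<in> N" if "i \<in> N" "s \<in> \<D>" for s i using bij_betwE[OF D(4)] that by blast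
  have \<tau>i: "\<tau> s i \<noteq> \<tau> s j" if "i \<in> N" "j \<in> N" "i \<noteq> j" for s i j
    using \<tau>[of s] that unfolding bij_betw_def by (auto dest: inj_onD)
  \<comment> \<open>Agent \<open>i\<close> receives its permuted snapshot pieces \<open>C\<close>,
    the extracted pieces \<open>U\<close> that go with them, and its compensations \<open>V\<close>,
    in addition to \<open>X\<close>.\<close>
  define C where "C i = (\<Union>s<S. cs s (\<tau> s i))" for i
  define e where "e i s = (\<Union>t\<in>{1..pos (\<sigma> s i) i}. d s (\<sigma> s i) t)" for i s
  define U where "U i = (\<Union>s\<in>\<D>. e i s)" for i
  define f where "f i k = (\<Union>t<?n. Z k t i)" for i k
  define V where "V i = (\<Union>k\<in>N. f i k)" for i
  have mcs: "meas P (cs s i)" "cs s i \<subseteq> A" if "s < S" "i \<in> N" for s i using cs(1)[OF that(1)] that unfolding alloc_def by auto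
  have C: "alloc N P A C"
    unfolding alloc_def disjoint_family_on_def
  proof (intro conjI ballI impI)
    show "meas P (C i)" "C i \<subseteq> A" if "i \<in> N" for i unfolding C_def using mcs \<tau>N[OF that] by (intro meas_UN UN_least; simp)+
    fix i j assume ij: "i \<in> N" "j \<in> N" "i \<noteq> j"
    have "cs s (\<tau> s i) \<inter> cs s' (\<tau> s' j) = {}" if "s < S" "s' < S" for s s'
      by (rule csd) (use that ij \<tau>N \<tau>i in auto)
    then show "C i \<inter> C j = {}" unfolding C_def by auto
  qed
  have UC: "(\<Union>i\<in>N. C i) = (\<Union>s<S. \<Union>i\<in>N. cs s i)"
  proof -
    have "(\<Union>i\<in>N. cs s (\<tau> s i)) = (\<Union>i\<in>N. cs s i)" for s
      using bij_betw_imp_surj_on[OF \<tau>] by (metis image_image)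
    moreover have "(\<Union>i\<in>N. C i) = (\<Union>s<S. \<Union>i\<in>N. cs s (\<tau> s i))" unfolding C_def by (rule SUP_commute)
    ultimately show ?thesis by simp
  qed
  have X': "alloc N P (A - (\<Union>i\<in>N. C i)) X" using X(1) unfolding UC rest_def .
  define CX where "CX i = C i \<union> X i" for i
  have CX: "alloc N P A CX" unfolding CX_def by (rule alloc_combine[OF C X'])
  have RCX: "A - (\<Union>i\<in>N. CX i) = R" unfolding CX_def R_def rest_def UC[symmetric] by auto
  have me: "meas P (e i s)" "e i s \<subseteq> R" if "i \<in> N" "s \<in> \<D>" for i s
    unfolding e_def using d \<sigma>N[OF that] that(2) D(2) by (intro meas_UN UN_least; blast)+
  have U: "alloc N P R U"
    unfolding alloc_def disjoint_family_on_def
  proof (intro conjI ballI impI)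
    show "meas P (U i)" "U i \<subseteq> R" if "i \<in> N" for i unfolding U_def using me[OF that] by auto
    fix i j assume ij: "i \<in> N" "j \<in> N" "i \<noteq> j"
    have "d s (\<sigma> s i) t \<inter> d s' (\<sigma> s' j) t' = {}" if s: "s \<in> \<D>" "s' \<in> \<D>" for s s' t t'
    proof (rule dd)
      show "(s, \<sigma> s i, t) \<noteq> (s', \<sigma> s' j, t')" using \<tau>i[OF ij, of s] s unfolding \<tau>_def by auto
    qed (use s D(2) \<sigma>N ij in auto)
    then show "U i \<inter> U j = {}" unfolding U_def e_def by (simp add: disjoint_iff) blast
  qed
  have Zsub: "Z k t i \<subseteq> (\<Union>s\<in>\<S> - \<D>. d s k t)" for k t i using D(8)[of k t i] by auto
  have ZR: "Z k t i \<subseteq> R" if "k \<in> N" for k t i using Zsub[of k t i] d(2)[OF _ that] by blast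
  have Zd: "Z k t i \<inter> Z k' t' j = {}" if "k \<in> N" "k' \<in> N" "(k, t, i) \<noteq> (k', t', j)" for k t i k' t' j
  proof (cases "(k, t) = (k', t')")
    case True
    then show ?thesis using D(10)[of k i j t] that by auto
  next
    case False
    then have "d s k t \<inter> d s' k' t' = {}" if "s \<in> \<S>" "s' \<in> \<S>" for s s' using dd[of s k s' k' t t'] that \<open>k \<in> N\<close> \<open>k' \<in> N\<close> by auto
    then show ?thesis using Zsub[of k t i] Zsub[of k' t' j] by blast
  qed
  have Ud: "U i \<inter> Z k t j = {}" if "i \<in> N" "k \<in> N" for i j k t
  proof -
    have "d s (\<sigma> s i) t' \<inter> d s' k t = {}" if "s \<in> \<D>" "s' \<in> \<S> - \<D>" for s s' t'
      by (rule dd) (use that D(2) \<sigma>N \<open>i \<in> N\<close> \<open>k \<in> N\<close> in auto)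
    then have "U i \<inter> (\<Union>s\<in>\<S> - \<D>. d s k t) = {}" unfolding U_def e_def by (simp add: disjoint_iff) blast
    then show ?thesis using Zsub[of k t j] by blast
  qed
  have V: "alloc N P (R - (\<Union>i\<in>N. U i)) V"
    unfolding alloc_def disjoint_family_on_def
  proof (intro conjI ballI impI)
    show "meas P (V i)" for i unfolding V_def f_def by (intro meas_UN D(7))
    show "V i \<subseteq> R - (\<Union>i\<in>N. U i)" for i unfolding V_def f_def using ZR Ud by blast
    show "V i \<inter> V j = {}" if "i \<noteq> j" for i j
    proof -
      have "Z k t i \<inter> Z k' t' j = {}" if "k \<in> N" "k' \<in> N" for k k' t t' using Zd[OF that] \<open>i \<noteq> j\<close> by auto
      then show ?thesis unfolding V_def f_def by (simp add: disjoint_iff) blast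
    qed
  qed
  define UV where "UV i = U i \<union> V i" for i
  have UV: "alloc N P R UV" unfolding UV_def by (rule alloc_combine[OF U V])
  define Y where "Y i = CX i \<union> UV i" for i
  have UV': "alloc N P (A - (\<Union>i\<in>N. CX i)) UV" using UV unfolding RCX .
  have Y: "alloc N P A Y" unfolding Y_def by (rule alloc_combine[OF CX UV'])
  have meR: "meas P R" unfolding R_def using meas_rest[OF A sn] alloc_meas[OF X(1)] by auto
  have key: "m i (Y j) + (if \<exists>k\<in>N. i \<notin> I k \<and> (\<exists>s\<in>\<D>. \<sigma> s j = k) then m i R else 0) \<le> m i (Y i)"
    if ij: "i \<in> N" "j \<in> N" for i j
  proof -
    have iG: "i \<in> G" using ij NG by auto
    note pr = st_prof[OF st] and alg = st_alg[OF st]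
    have nn: "0 \<le> m i B" if "meas P B" for B using st_nonneg[OF st iG that] .
    have vY: "m i (Y l) = m i (C l) + m i (X l) + (m i (U l) + m i (V l))" if "l \<in> N" for l
      using m_Un_alloc[OF st iG CX UV' that] m_Un_alloc[OF st iG C X' that] m_Un_alloc[OF st iG U V that]
      unfolding Y_def CX_def UV_def by simp
    have vC: "m i (C l) = (\<Sum>s<S. m i (cs s (\<tau> s l)))" if "l \<in> N" for l
      unfolding C_def
    proof (rule m_UN[OF pr iG])
      show "disjoint_family_on (\<lambda>s. cs s (\<tau> s l)) {..<S}"
        unfolding disjoint_family_on_def using csd \<tau>N[OF that] by auto
    qed (use alg mcs(1) \<tau>N[OF that] in auto)
    have ve: "m i (e l s) = (\<Sum>t=1..pos (\<sigma> s l) l. m i (d s (\<sigma> s l) t))" if "l \<in> N" "s \<in> \<D>" for l s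
      unfolding e_def
    proof (rule m_UN[OF pr iG])
      show "disjoint_family_on (d s (\<sigma> s l)) {1..pos (\<sigma> s l) l}"
        unfolding disjoint_family_on_def
      proof (intro ballI impI)
        show "d s (\<sigma> s l) t \<inter> d s (\<sigma> s l) t' = {}" if "t \<noteq> t'" for t t'
          by (rule dd) (use that \<open>l \<in> N\<close> \<open>s \<in> \<D>\<close> \<sigma>N D(2) in auto)
      qed
      show "alg (d s (\<sigma> s l) t)" for t using alg d(1) \<sigma>N that D(2) by blast
    qed simp
    have vU: "m i (U l) = (\<Sum>s\<in>\<D>. m i (e l s))" if "l \<in> N" for l
      unfolding U_def
    proof (rule m_UN[OF pr iG DS(2)])
      show "disjoint_family_on (e l) \<D>"
        unfolding disjoint_family_on_def
      proof (intro ballI impI)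
        fix s s' assume s: "s \<in> \<D>" "s' \<in> \<D>" "s \<noteq> s'"
        have "d s (\<sigma> s l) t \<inter> d s' (\<sigma> s' l) t' = {}" for t t' by (rule dd) (use s D(2) \<sigma>N that in auto)
        then show "e l s \<inter> e l s' = {}" unfolding e_def by (simp add: disjoint_iff) blast
      qed
    qed (use alg me that in auto)
    have vf: "m i (f l k) = (\<Sum>t<?n. m i (Z k t l))" if "k \<in> N" for l k
      unfolding f_def
    proof (rule m_UN[OF pr iG])
      show "disjoint_family_on (\<lambda>t. Z k t l) {..<?n}" unfolding disjoint_family_on_def using Zd that by auto
    qed (use alg D(7) in auto)
    have vV: "m i (V l) = (\<Sum>k\<in>N. m i (f l k))" for l
      unfolding V_def
    proof (rule m_UN[OF pr iG finN])
      show "disjoint_family_on (f l) N"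
        unfolding disjoint_family_on_def
      proof (intro ballI impI)
        fix k k' assume k: "k \<in> N" "k' \<in> N" "k \<noteq> k'"
        then have "Z k t l \<inter> Z k' t' l = {}" for t t' using Zd by auto
        then show "f l k \<inter> f l k' = {}" unfolding f_def by (simp add: disjoint_iff) blast
      qed
      show "alg (f l k)" for k unfolding f_def using alg_UN[of "{..<?n}"] alg D(7) by auto
    qed
    have split: "(\<Sum>s<S. g s) = (\<Sum>s\<in>{..<S} - \<D>. g s) + (\<Sum>s\<in>\<D>. g s)" for g :: "nat \<Rightarrow> real"
      using sum.subset_diff[OF DS(1), of g] by simp
    \<comment> \<open>Extraction is exact, so \<open>i\<close> values its own share of the family
      \<open>s\<close> like its original piece. Hence this is the lead of \<open>j\<close> over
      \<open>i\<close> in \<open>s\<close>, in the eyes of \<open>i\<close>.\<close>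
    define \<Delta> where "\<Delta> s = m i (cs s (\<sigma> s j)) + m i (e j s) - m i (cs s i)" for s
    have own: "m i (cs s (\<sigma> s i)) + m i (e i s) = m i (cs s i)" if "s \<in> \<D>" for s
      using val[of s "\<sigma> s i" i] ve[OF ij(1) that] that D(2) \<sigma>N[OF ij(1) that] D(5)[OF that ij(1)] by auto
    have out: "(\<Sum>s\<in>{..<S} - \<D>. m i (cs s (\<tau> s j))) \<le> (\<Sum>s\<in>{..<S} - \<D>. m i (cs s (\<tau> s i)))"
      using cs(2) ij unfolding ef_def \<tau>_def by (intro sum_mono) auto
    have vCU: "m i (C l) + m i (U l) = (\<Sum>s\<in>{..<S} - \<D>. m i (cs s (\<tau> s l))) + (\<Sum>s\<in>\<D>. m i (cs s (\<sigma> s l)) + m i (e l s))"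
      if "l \<in> N" for l
      unfolding vC[OF that] split vU[OF that] sum.distrib by (simp add: \<tau>_def)
    have "m i (C j) + m i (U j) \<le> m i (C i) + m i (U i) + (\<Sum>s\<in>\<D>. \<Delta> s)"
      using out unfolding vCU[OF ij(1)] vCU[OF ij(2)] \<Delta>_def sum_subtractf by (simp add: own)
    moreover have "m i (X j) \<le> m i (X i)" using X(2) ij unfolding ef_def by auto
    ultimately have diff: "m i (Y j) \<le> m i (Y i) + ((\<Sum>s\<in>\<D>. \<Delta> s) + (\<Sum>k\<in>N. m i (f j k)) - (\<Sum>k\<in>N. m i (f i k)))"
      unfolding vY[OF ij(1)] vY[OF ij(2)] vV by linarith
    define F where "F k = {s\<in>\<D>. \<sigma> s j = k}" for k
    have grp: "(\<Sum>s\<in>\<D>. g s) = (\<Sum>k\<in>N. \<Sum>s\<in>F k. g s)" for g :: "nat \<Rightarrow> real"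
      unfolding F_def by (rule sum.group[symmetric]) (use DS finN \<sigma>N ij in auto)
    define x where "x k = (\<Sum>s\<in>F k. m i (e j s)) + m i (f j k)" for k
    define K where "K = {k \<in> N. i \<notin> I k \<and> F k \<noteq> {}}"
    have x0: "0 \<le> x k" for k
      unfolding x_def f_def by (intro add_nonneg_nonneg sum_nonneg nn) (use me(1) ij D(7) F_def in auto)
    have R0: "0 \<le> m i R" using nn meR by auto
    have col: "(\<Sum>s\<in>F k. \<Delta> s) + m i (f j k) - m i (f i k) \<le> (if k \<in> K then x k - 2 * m i R else 0)" if k: "k \<in> N" for k
    proof (cases "i \<in> I k")
      case True
      have "\<Delta> s = (\<Sum>t=1..pos k j. m i (d s k t)) - (\<Sum>t=1..pos k i. m i (d s k t))" if "s \<in> F k" for s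
        using val[of s k i] k True that ve[OF ij(2)] D(2) unfolding \<Delta>_def F_def by auto
      then have "(\<Sum>s\<in>F k. \<Delta> s) = (\<Sum>s\<in>F k. (\<Sum>t=1..pos k j. m i (d s k t)) - (\<Sum>t=1..pos k i. m i (d s k t)))" by simp
      moreover have "k \<notin> K" using True K_def by auto
      ultimately show ?thesis
        using exch_column_in[OF st NG finN DS(3) I d(1) E k True ij(2)] vf[OF k] unfolding F_def by simp
    next
      case False
      have "Z k t i = {}" for t using D(9)[of k t i] False by blast
      then have fi: "m i (f i k) = 0" unfolding f_def using m_empty[OF pr iG] by simp
      show ?thesis
      proof (cases "F k = {}")
        case Fe: True
        have "Z k t j = {}" for t
          using D(9)[of k t j] D(14)[OF k, of j] Fe unfolding F_def by fastforce
        then have "m i (f j k) = 0" unfolding f_def using m_empty[OF pr iG] by simp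
        then show ?thesis using Fe fi K_def by simp
      next
        case Fn: False
        have "\<Delta> s \<le> m i (e j s) - 2 * m i R" if "s \<in> F k" for s
          using big[of s k i] k False ij(1) that D(2) unfolding \<Delta>_def F_def by auto
        then have "(\<Sum>s\<in>F k. \<Delta> s) \<le> (\<Sum>s\<in>F k. m i (e j s) - 2 * m i R)" by (rule sum_mono)
        also have "\<dots> = (\<Sum>s\<in>F k. m i (e j s)) - card (F k) * (2 * m i R)" by (simp add: sum_subtractf)
        also have "\<dots> \<le> (\<Sum>s\<in>F k. m i (e j s)) - 2 * m i R"
        proof -
          have "1 \<le> card (F k)" using Fn DS(2) F_def by (simp add: Suc_le_eq card_gt_0_iff)
          then have "1 * (2 * m i R) \<le> card (F k) * (2 * m i R)" using R0 by (intro mult_right_mono) auto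
          then show ?thesis by simp
        qed
        finally show ?thesis using fi Fn False k unfolding x_def K_def by simp
      qed
    qed
    have "(\<Sum>s\<in>\<D>. \<Delta> s) + (\<Sum>k\<in>N. m i (f j k)) - (\<Sum>k\<in>N. m i (f i k)) = (\<Sum>k\<in>N. (\<Sum>s\<in>F k. \<Delta> s) + m i (f j k) - m i (f i k))"
      unfolding grp[of \<Delta>] by (simp add: sum.distrib sum_subtractf)
    also have "\<dots> \<le> (\<Sum>k\<in>N. if k \<in> K then x k - 2 * m i R else 0)" by (rule sum_mono) (rule col)
    also have "\<dots> = (\<Sum>k\<in>K. x k - 2 * m i R)"
    proof -
      have "N \<inter> K = K" using K_def by auto
      then show ?thesis using sum.inter_restrict[OF finN, of "\<lambda>k. x k - 2 * m i R" K] by simp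
    qed
    also have "\<dots> \<le> (if K \<noteq> {} then - m i R else 0)"
    proof (cases "K = {}")
      case False
      \<comment> \<open>Over all columns, \<open>j\<close> gets no more than \<open>R\<close> from
        the residue. A single column in \<open>K\<close> already subtracts twice the value of
        \<open>R\<close>, so \<open>i\<close> stays ahead by at least this value.\<close>
      have "(\<Sum>k\<in>K. x k) \<le> (\<Sum>k\<in>N. x k)" using x0 finN K_def by (intro sum_mono2) auto
      also have "\<dots> = m i (UV j)"
        using m_Un_alloc[OF st iG U V ij(2)] grp[of "\<lambda>s. m i (e j s)"] vU[OF ij(2)] vV unfolding x_def UV_def by (simp add: sum.distrib)
      also have "\<dots> \<le> m i R" using st_m_mono[OF st iG meR] UV ij(2) unfolding alloc_def by blast
      finally have "(\<Sum>k\<in>K. x k) \<le> m i R" .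
      moreover have "1 * (2 * m i R) \<le> card K * (2 * m i R)"
      proof (rule mult_right_mono)
        have "1 \<le> card K" using False finN K_def by (simp add: Suc_le_eq card_gt_0_iff)
        then show "1 \<le> real (card K)" by simp
      qed (use R0 in simp)
      ultimately show ?thesis using False by (simp add: sum_subtractf)
    qed simp
    finally have "m i (Y j) + (if K \<noteq> {} then m i R else 0) \<le> m i (Y i)" using diff by (auto split: if_splits)
    moreover have "K \<noteq> {} \<longleftrightarrow> (\<exists>k\<in>N. i \<notin> I k \<and> (\<exists>s\<in>\<D>. \<sigma> s j = k))" unfolding K_def F_def by auto
    ultimately show ?thesis by simp
  qed
  have R0: "0 \<le> m i R" if "i \<in> N" for i using st_nonneg[OF st _ meR] that NG by auto
  have "ef N m Y"
    unfolding ef_def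
  proof (intro ballI)
    fix i j assume ij: "i \<in> N" "j \<in> N"
    show "m i (Y j) \<le> m i (Y i)" using key[OF ij] R0[OF ij(1)] by (auto split: if_splits)
  qed
  moreover have "m i (Y j) + m i (A - (\<Union>i\<in>N. Y i)) \<le> m i (Y i)" if ij: "i \<in> N - I k0" "j \<in> I k0" for i j
  proof -
    have jN: "j \<in> N" using ij I[OF k0(1)] by auto
    have "pos k0 j < v k0" using ij I[OF k0(1)] k0(2) unfolding bij_betw_def by auto
    then have "\<exists>k\<in>N. i \<notin> I k \<and> (\<exists>s\<in>\<D>. \<sigma> s j = k)" using D(14)[OF k0(1) ij(2)] ij k0(1) by auto
    then have "m i (Y j) + m i R \<le> m i (Y i)" using key[of i j] ij jN by auto
    moreover have "m i (A - (\<Union>i\<in>N. Y i)) \<le> m i R"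
    proof (rule st_m_mono[OF st _ meR])
      show "meas P (A - (\<Union>i\<in>N. Y i))" using A alloc_meas[OF Y] by auto
      show "A - (\<Union>i\<in>N. Y i) \<subseteq> R" unfolding RCX[symmetric] Y_def by auto
    qed (use ij NG in auto)
    ultimately show ?thesis by simp
  qed
  ultimately show ?thesis using Y by blast
qed

end

subsection \<open>Domination and recursion\<close>

text \<open>The factor by which the pool shrinks for each position served: \<open>n\<close> for its
  event and \<open>n ^ 3 + 1\<close> for the selection of the next pool.\<close>

definition exch_factor :: "nat \<Rightarrow> nat" where
  "exch_factor n = n * (n ^ 3 + 1)"

text \<open>There are at most \<open>n * n\<close> positions to serve; the leading factor pays for
  the start, where every agent holds its own piece.\<close>

definition family_size :: "nat \<Rightarrow> nat" where
  "family_size n = (n ^ 3 + 1) * exch_factor n ^ (n * n)"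

text \<open>Pigeonhole: the number of types times the size of the family wanted.\<close>

definition snap_count :: "nat \<Rightarrow> nat" where
  "snap_count n = (n + 1) ^ (n * n) * family_size n"

text \<open>Twice the number of claims has to be at most \<open>2 ^ halvings n\<close>. The exponent
  arises from \<open>x \<le> 2 ^ x\<close> for each base and stays polynomial in
  \<open>n\<close>.\<close>

definition halvings :: "nat \<Rightarrow> nat" where
  "halvings n = 2 * (n * n) + ((n + 1) * (n * n) + ((n ^ 3 + 1) + exch_factor n * (n * n)))"

definition dom_cost :: "nat \<Rightarrow> nat" where
  "dom_cost n = snap_count n * (n + trim_cost n) + ((1 + snap_count n * (n * n)) * (halvings n * shrink_cost n) +
     (snap_count n * n * n * n + snap_count n * n * (n * n))) + n * n * trim_cost n"

definition total_cost :: "nat \<Rightarrow> nat" where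
  "total_cost n = (\<Sum>k\<le>n. dom_cost k)"

lemma total_cost_mono: "k \<le> n \<Longrightarrow> total_cost k \<le> total_cost n"
  unfolding total_cost_def by (rule sum_mono2) auto

lemma halvings_bound: "2 * (snap_count n * n * n) \<le> 2 ^ halvings n"
proof -
  have le2: "x \<le> 2 ^ x" for x :: nat using less_exp[of x] by simp
  have gen: "2 * (a ^ q * (b * c ^ q) * n * n) \<le> 2 ^ (2 * (n * n) + (a * q + (b + c * q)))" for a b c q n :: nat
  proof -
    have "a ^ q \<le> (2 ^ a) ^ q" "c ^ q \<le> (2 ^ c) ^ q" using le2 by (intro power_mono; simp)+
    then have "2 * (n * n) * (a ^ q * (b * c ^ q)) \<le> 2 ^ (2 * (n * n)) * ((2 ^ a) ^ q * (2 ^ b * (2 ^ c) ^ q))"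
      using le2 by (intro mult_mono) auto
    then show ?thesis by (simp only: power_add power_mult ac_simps)
  qed
  show ?thesis unfolding halvings_def snap_count_def family_size_def by (rule gen)
qed

context agents
begin

lemma iso_agree:
  assumes iso: "iso N P m R \<S> cs I pos d" and s: "P \<subseteq> P'" "agree P m m'" and NG: "N \<subseteq> G"
    and R: "meas P R" and cs: "\<And>s k. s \<in> \<S> \<Longrightarrow> k \<in> N \<Longrightarrow> meas P (cs s k)"
  shows "iso N P' m' R \<S> cs I pos d"
proof -
  note is' = iso[unfolded iso_def]
  have I: "k \<in> I k \<and> I k \<subseteq> N \<and> bij_betw (pos k) (I k) {..<card (I k)} \<and> pos k k = 0" if "k \<in> N" for k
    using is' that by blast
  have d: "meas P (d s k t) \<and> d s k t \<subseteq> R" if "s \<in> \<S>" "k \<in> N" for s k t using is' that by blast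
  have eq: "m' i B = m i B" if "i \<in> N" "meas P B" for i B using agreeD[OF s(2) that(2)] that(1) NG by auto
  show ?thesis
    unfolding iso_def
  proof (intro conjI ballI allI)
    fix s k i assume a: "s \<in> \<S>" "k \<in> N"
    show "m' i (cs s k) + (\<Sum>t=1..pos k i. m' i (d s k t)) = m' i (cs s i)" if i: "i \<in> I k"
    proof -
      have iN: "i \<in> N" using i I[OF a(2)] by auto
      have "m i (cs s k) + (\<Sum>t=1..pos k i. m i (d s k t)) = m i (cs s i)" using is' a i by blast
      then show ?thesis using eq[OF iN] cs a iN d[OF a] by simp
    qed
    show "m' i (cs s k) + 2 * m' i R \<le> m' i (cs s i)" if i: "i \<in> N - I k"
    proof -
      have "m i (cs s k) + 2 * m i R \<le> m i (cs s i)" using is' a i by blast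
      then show ?thesis using eq[of i] cs a i R by simp
    qed
    show "meas P' (d s k t)" "d s k t \<subseteq> R" for t using d[OF a] meas_mono[OF _ s(1)] by auto
  next
    show "disjoint_family_on (\<lambda>(s, k, t). d s k t) (\<S> \<times> N \<times> UNIV)" using is' by blast
  qed (use I in auto)
qed

text \<open>At \<open>v = 0\<close> nobody has held anything, and position 0 of a piece is its
  owner, who needs no extracted piece. So \<open>exchange_family\<close> applies to the identity
  without any compensation.\<close>

lemma exch_start:
  assumes st: "st P m" and NG: "N \<subseteq> G" and finN: "finite N" and N0: "N \<noteq> {}" and finS: "finite \<S>"
    and I: "\<And>k. k \<in> N \<Longrightarrow> k \<in> I k \<and> I k \<subseteq> N \<and> bij_betw (pos k) (I k) {..<card (I k)} \<and> pos k k = 0"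
    and me: "\<And>s k t. s \<in> \<S> \<Longrightarrow> k \<in> N \<Longrightarrow> meas P (d s k t)"
    and q: "(card N ^ 3 + 1) * q \<le> card \<S>" "1 \<le> q"
  shows "\<exists>\<P> \<D> \<sigma> Z. card \<P> = q \<and> exch N P m \<S> I pos d (\<lambda>_. 1) (\<lambda>_. 1) \<P> \<D> \<sigma> Z"
proof -
  have c1: "1 \<le> card (I k)" if "k \<in> N" for k
    using I[OF that] finN by (metis Suc_leI card_gt_0_iff empty_iff finite_subset One_nat_def)
  have E: "exch N P m \<S> I pos d (\<lambda>_. 0) (\<lambda>_. 1) \<S> {} (\<lambda>_ i. i) (\<lambda>_ _ _. {})"
    unfolding exch_def using c1 by auto
  have "\<exists>\<P>' \<D>' \<sigma>'. card \<P>' = q \<and> exch N P m \<S> I pos d (\<lambda>_. 1) (\<lambda>_. 1) \<P>' \<D>' \<sigma>' (\<lambda>_ _ _. {})"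
    by (rule exchange_family[OF st NG finN N0 finS I me E, of "\<lambda>i. i"]) (use q I in \<open>auto simp: bij_betw_def\<close>)
  then show ?thesis by blast
qed

text \<open>The exchange stops at a piece \<open>k\<close> with \<open>I k \<noteq> N\<close> that
  all members of \<open>I k\<close> have held. This \<open>I k\<close> is the set \<open>B\<close>,
  by \<open>exch_division\<close>.\<close>

lemma domination:
  assumes st: "st P m" and NG: "N \<subseteq> G" and finN: "finite N" and n2: "2 \<le> card N" and A: "meas P A"
  shows "can (\<lambda>P' m'. \<exists>Y B. alloc N P' A Y \<and> ef N m' Y \<and> B \<subset> N \<and> B \<noteq> {} \<and>
    (\<forall>i\<in>N - B. \<forall>j\<in>B. m' i (Y j) + m' i (A - (\<Union>i\<in>N. Y i)) \<le> m' i (Y i))) (dom_cost (card N)) P m"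
proof -
  let ?n = "card N"
  let ?S = "snap_count ?n"
  let ?Q = "\<lambda>P' m'. \<exists>Y B. alloc N P' A Y \<and> ef N m' Y \<and> B \<subset> N \<and> B \<noteq> {} \<and>
    (\<forall>i\<in>N - B. \<forall>j\<in>B. m' i (Y j) + m' i (A - (\<Union>i\<in>N. Y i)) \<le> m' i (Y i))"
  have N0: "N \<noteq> {}" using n2 by auto
  have c0: "1 \<le> exch_factor ?n" using n2 unfolding exch_factor_def by simp
  have M0: "0 < family_size ?n" using c0 unfolding family_size_def by simp
  have S0: "0 < ?S" using M0 unfolding snap_count_def by simp
  have SM: "(?n + 1) ^ (?n * ?n) * family_size ?n \<le> ?S" unfolding snap_count_def by simp
  have "can ?Q (?S * (?n + trim_cost ?n) + ((1 + ?S * (?n * ?n)) * (halvings ?n * shrink_cost ?n) +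
      (?S * ?n * ?n * ?n + ?S * ?n * (?n * ?n))) + ?n * ?n * trim_cost ?n) P m"
  proof (rule can_bind[OF iso_family[OF st NG finN n2 A S0 SM M0 halvings_bound] st])
    fix P' m' assume st': "st P' m'" and s: "P \<subseteq> P'" "agree P m m'"
      and "\<exists>cs X \<S> I pos d. snaps N P' m' A ?S cs \<and> alloc N P' (rest N A ?S cs) X \<and> ef N m' X \<and>
      \<S> \<subseteq> {..<?S} \<and> family_size ?n \<le> card \<S> \<and> iso N P' m' (rest N A ?S cs - (\<Union>i\<in>N. X i)) \<S> cs I pos d \<and> (\<exists>k\<in>N. I k \<noteq> N)"
    then obtain cs X \<S> I pos d k1 where sn: "snaps N P' m' A ?S cs" and X: "alloc N P' (rest N A ?S cs) X" "ef N m' X"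
      and SS: "\<S> \<subseteq> {..<?S}" and cS: "family_size ?n \<le> card \<S>"
      and iso: "iso N P' m' (rest N A ?S cs - (\<Union>i\<in>N. X i)) \<S> cs I pos d" and k1: "k1 \<in> N" "I k1 \<noteq> N" by blast
    have A': "meas P' A" using meas_mono[OF A s(1)] .
    have finS: "finite \<S>" using SS finite_subset by blast
    have I: "k \<in> I k \<and> I k \<subseteq> N \<and> bij_betw (pos k) (I k) {..<card (I k)} \<and> pos k k = 0" if "k \<in> N" for k
      using iso that unfolding iso_def by blast
    have me: "meas P' (d s k t)" if "s \<in> \<S>" "k \<in> N" for s k t using iso that unfolding iso_def by blast
    have disj: "disjoint_family_on (\<lambda>(s, k, t). d s k t) (\<S> \<times> N \<times> UNIV)" using iso unfolding iso_def by blast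
    let ?q = "exch_factor ?n ^ (?n * ?n)"
    have q: "(?n ^ 3 + 1) * ?q \<le> card \<S>" "1 \<le> ?q" using cS c0 unfolding family_size_def by auto
    have "\<exists>\<P> \<D> \<sigma> Z. card \<P> = ?q \<and> exch N P' m' \<S> I pos d (\<lambda>_. 1) (\<lambda>_. 1) \<P> \<D> \<sigma> Z"
      by (rule exch_start[OF st' NG finN N0 finS I me q])
    then obtain \<P> \<D> \<sigma> Z where E: "card \<P> = ?q" "exch N P' m' \<S> I pos d (\<lambda>_. 1) (\<lambda>_. 1) \<P> \<D> \<sigma> Z" by blast
    let ?\<mu> = "\<Sum>k\<in>N. card (I k) - 1"
    have "?\<mu> \<le> (\<Sum>k\<in>N. ?n)"
      using card_mono[OF finN] I by (intro sum_mono) (meson diff_le_self le_trans)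
    then have \<mu>: "?\<mu> \<le> ?n * ?n" by simp
    then have "(?n * (?n ^ 3 + 1)) ^ ?\<mu> \<le> card \<P>"
      unfolding E(1) exch_factor_def[symmetric] using c0 by (rule power_increasing)
    from exchange[OF NG finN finS I disj k1 st' me E(2) _ this]
    have "can (\<lambda>P' m'. \<exists>v \<P> \<D> \<sigma> Z k. exch N P' m' \<S> I pos d v v \<P> \<D> \<sigma> Z \<and> k \<in> N \<and> v k = card (I k) \<and> I k \<noteq> N)
      (?\<mu> * trim_cost ?n) P' m'" by simp
    then show "can ?Q (?n * ?n * trim_cost ?n) P' m'"
    proof (rule can_conseq[OF _ st'])
      show "?\<mu> * trim_cost ?n \<le> ?n * ?n * trim_cost ?n" using \<mu> by (rule mult_right_mono) simp
      fix P2 m2 assume st2: "st P2 m2" and s2: "P' \<subseteq> P2" "agree P' m' m2"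
        and "\<exists>v \<P> \<D> \<sigma> Z k. exch N P2 m2 \<S> I pos d v v \<P> \<D> \<sigma> Z \<and> k \<in> N \<and> v k = card (I k) \<and> I k \<noteq> N"
      then obtain v \<P> \<D> \<sigma> Z k where E2: "exch N P2 m2 \<S> I pos d v v \<P> \<D> \<sigma> Z" and k: "k \<in> N" "v k = card (I k)" "I k \<noteq> N"
        by blast
      have sn2: "snaps N P2 m2 A ?S cs" using snaps_agree[OF sn s2 NG] .
      have X2: "alloc N P2 (rest N A ?S cs) X" "ef N m2 X"
        using alloc_mono[OF X(1) s2(1) subset_refl] ef_agree[OF X(2,1) s2(2) NG] .
      have iso2: "iso N P2 m2 (rest N A ?S cs - (\<Union>i\<in>N. X i)) \<S> cs I pos d"
      proof (rule iso_agree[OF iso s2 NG])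
        show "meas P' (rest N A ?S cs - (\<Union>i\<in>N. X i))" using meas_rest[OF A' sn] alloc_meas[OF X(1)] by auto
        show "meas P' (cs s k)" if "s \<in> \<S>" "k \<in> N" for s k using sn SS that unfolding snaps_def alloc_def by blast
      qed
      show "?Q P2 m2"
        using exch_division[OF st2 NG finN meas_mono[OF A' s2(1)] sn2 X2 SS iso2 E2 k(1,2)] I[OF k(1)] k by blast
    qed
  qed
  then show ?thesis unfolding dom_cost_def .
qed

text \<open>An agent outside \<open>B\<close> leads every member of \<open>B\<close> by the value of
  the whole residue, so it envies nobody, however the residue is divided inside
  \<open>B\<close>.\<close>

lemma envy_free:
  assumes "st P m" and "N \<subseteq> G" and "finite N" and "N \<noteq> {}" and "meas P A"
  shows "can (\<lambda>P' m'. \<exists>X. alloc N P' A X \<and> ef N m' X \<and> (\<Union>i\<in>N. X i) = A) (total_cost (card N)) P m"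
  using assms
proof (induction "card N" arbitrary: N P m A rule: less_induct)
  case less
  note st = less.prems(1) and NG = less.prems(2) and finN = less.prems(3) and A = less.prems(5)
  let ?n = "card N"
  let ?Q = "\<lambda>P' m'. \<exists>X. alloc N P' A X \<and> ef N m' X \<and> (\<Union>i\<in>N. X i) = A"
  show ?case
  proof (cases "2 \<le> ?n")
    case False
    then have "?n = 1" using less.prems(3,4) card_gt_0_iff[of N] by linarith
    then obtain a where N: "N = {a}" by (meson card_1_singletonE)
    show ?thesis
    proof (rule can_I[OF st])
      fix m' show "?Q P m'"
        by (rule exI[of _ "\<lambda>_. A"]) (use A in \<open>auto simp: N alloc_def ef_def disjoint_family_on_def\<close>)
    qed
  next
    case True
    have "can ?Q (dom_cost ?n + total_cost (?n - 1)) P m"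
    proof (rule can_bind[OF domination[OF st NG finN True A] st])
      fix P' m' assume st': "st P' m'" and s: "P \<subseteq> P'" "agree P m m'"
        and "\<exists>Y B. alloc N P' A Y \<and> ef N m' Y \<and> B \<subset> N \<and> B \<noteq> {} \<and>
          (\<forall>i\<in>N - B. \<forall>j\<in>B. m' i (Y j) + m' i (A - (\<Union>i\<in>N. Y i)) \<le> m' i (Y i))"
      then obtain Y B where Y: "alloc N P' A Y" "ef N m' Y" and B: "B \<subset> N" "B \<noteq> {}"
        and dom: "\<And>i j. i \<in> N - B \<Longrightarrow> j \<in> B \<Longrightarrow> m' i (Y j) + m' i (A - (\<Union>i\<in>N. Y i)) \<le> m' i (Y i)" by blast
      define R where "R = A - (\<Union>i\<in>N. Y i)"
      have A': "meas P' A" using meas_mono[OF A s(1)] .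
      have R: "meas P' R" unfolding R_def using A' alloc_meas[OF Y(1)] by auto
      have cB: "card B < ?n" using psubset_card_mono[OF finN B(1)] .
      have finB: "finite B" "B \<subseteq> G" using B NG finN finite_subset by auto
      show "can ?Q (total_cost (?n - 1)) P' m'"
      proof (rule can_conseq[OF less.hyps[OF cB st' finB(2,1) B(2) R] st'])
        show "total_cost (card B) \<le> total_cost (?n - 1)" using cB by (intro total_cost_mono) simp
        fix P2 m2 assume st2: "st P2 m2" and s2: "P' \<subseteq> P2" "agree P' m' m2"
          and "\<exists>X. alloc B P2 R X \<and> ef B m2 X \<and> (\<Union>i\<in>B. X i) = R"
        then obtain X where X: "alloc B P2 R X" "ef B m2 X" "(\<Union>i\<in>B. X i) = R" by blast
        have Y2: "alloc N P2 A Y" "ef N m2 Y" using alloc_mono[OF Y(1) s2(1) subset_refl] ef_agree[OF Y(2,1) s2(2) NG] .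
        define X' where "X' i = (if i \<in> B then X i else {})" for i
        have X': "alloc N P2 (A - (\<Union>i\<in>N. Y i)) X'"
          using X(1) unfolding R_def[symmetric] X'_def alloc_def disjoint_family_on_def by auto
        have UX': "(\<Union>i\<in>N. X' i) = R" using X(3) B unfolding X'_def by (auto split: if_splits)
        have val: "m2 i (Y j \<union> X' j) = m2 i (Y j) + m2 i (X' j)" if "i \<in> N" "j \<in> N" for i j
          using m_Un_alloc[OF st2 _ Y2(1) X' that(2)] that NG by auto
        have ef: "ef N m2 (\<lambda>i. Y i \<union> X' i)"
          unfolding ef_def
        proof (intro ballI)
          fix i j assume ij: "i \<in> N" "j \<in> N"
          have iG: "i \<in> G" using ij NG by auto
          have Yij: "m2 i (Y j) \<le> m2 i (Y i)" using Y2(2) ij unfolding ef_def by auto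
          have nn: "0 \<le> m2 i (X' i)" using st_nonneg[OF st2 iG] X' ij unfolding alloc_def by auto
          have e: "j \<notin> B \<Longrightarrow> m2 i (X' j) = 0" unfolding X'_def using m_empty[OF st_prof[OF st2] iG] by simp
          have "m2 i (Y j) + m2 i (X' j) \<le> m2 i (Y i) + m2 i (X' i)"
          proof (cases "j \<in> B")
            case False
            then show ?thesis using Yij nn e by simp
          next
            case jB: True
            show ?thesis
            proof (cases "i \<in> B")
              case True
              then show ?thesis using Yij X(2) jB unfolding ef_def X'_def by (simp add: add_mono)
            next
              case False
              have "meas P' (Y i)" "meas P' (Y j)" using Y(1) ij unfolding alloc_def by auto
              then have "m2 i (Y j) + m2 i R \<le> m2 i (Y i)"
                using dom[of i j] agreeD[OF s2(2) _ iG] R ij jB False unfolding R_def by simp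
              moreover have "m2 i (X' j) \<le> m2 i R"
                using st_m_mono[OF st2 iG meas_mono[OF R s2(1)]] X' ij unfolding alloc_def R_def by blast
              ultimately show ?thesis using nn by linarith
            qed
          qed
          then show "m2 i (Y j \<union> X' j) \<le> m2 i (Y i \<union> X' i)" using val ij by simp
        qed
        have "(\<Union>i\<in>N. Y i \<union> X' i) = A"
          using UX' Y(1) unfolding R_def UN_Un_distrib alloc_def by auto
        then show "?Q P2 m2" using alloc_combine[OF Y2(1) X'] ef by blast
      qed
    qed
    moreover have "dom_cost ?n + total_cost (?n - 1) = total_cost ?n"
      using True unfolding total_cost_def by (cases ?n) (auto simp: atMost_Suc)
    ultimately show ?thesis by simp
  qed
qed

end

subsection \<open>Queries\<close>

lemma atom_exists:
  assumes P: "finite P" "{0, 1} \<subseteq> P" and x: "x \<in> {0<..1::real}"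
  shows "\<exists>p\<in>P. \<exists>q\<in>P. x \<in> {p<..q} \<and> (\<forall>y\<in>{p<..q}. \<forall>z\<in>P. x \<le> z \<longleftrightarrow> y \<le> z)"
proof -
  define p where "p = Max {z\<in>P. z < x}"
  define q where "q = Min {z\<in>P. x \<le> z}"
  have p: "p \<in> {z\<in>P. z < x}" unfolding p_def using P x by (intro Max_in) auto
  have q: "q \<in> {z\<in>P. x \<le> z}" unfolding q_def using P x by (intro Min_in) auto
  have pm: "z \<le> p" if "z \<in> P" "z < x" for z unfolding p_def using P that by (intro Max_ge) auto
  have qm: "q \<le> z" if "z \<in> P" "x \<le> z" for z unfolding q_def using P that by (intro Min_le) auto
  have "x \<le> z \<longleftrightarrow> y \<le> z" if "y \<in> {p<..q}" "z \<in> P" for y z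
    using pm[OF that(2)] qm[OF that(2)] that(1) by fastforce
  then have "x \<in> {p<..q} \<and> (\<forall>y\<in>{p<..q}. \<forall>z\<in>P. x \<le> z \<longleftrightarrow> y \<le> z)" using p q by simp
  then show ?thesis using p q by blast
qed

lemma closure_UN_finite: "finite I \<Longrightarrow> closure (\<Union>i\<in>I. f i) = (\<Union>i\<in>I. closure (f i))"
  by (induction I rule: finite_induct) auto

lemma meas_atoms:
  assumes P: "finite P" "{0, 1} \<subseteq> P" "P \<subseteq> {0..1}" and A: "meas P A"
  shows "A = (\<Union>(p, q)\<in>{(p, q). p \<in> P \<and> q \<in> P \<and> p < q \<and> {p<..q} \<subseteq> A}. {p<..q})"
proof (intro equalityI subsetI)
  fix x assume x: "x \<in> A"
  then have x1: "x \<in> {0<..1}" using meas_sub[OF A] by auto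
  obtain p q where pq: "p \<in> P" "q \<in> P" "x \<in> {p<..q}" "\<And>y z. y \<in> {p<..q} \<Longrightarrow> z \<in> P \<Longrightarrow> x \<le> z \<longleftrightarrow> y \<le> z"
    using atom_exists[OF P(1,2) x1] by metis
  have "{p<..q} \<subseteq> A"
  proof
    fix y assume y: "y \<in> {p<..q}"
    then have "y \<in> {0<..1}" using P(3) pq(1,2) by fastforce
    then show "y \<in> A" using measD[OF A x _ pq(4)[OF y]] by blast
  qed
  then show "x \<in> (\<Union>(p, q)\<in>{(p, q). p \<in> P \<and> q \<in> P \<and> p < q \<and> {p<..q} \<subseteq> A}. {p<..q})" using pq by force
qed auto

text \<open>The closure of an atom adds only its left endpoint, a point of \<open>P\<close>. This
  makes the closures of disjoint sets meet in finitely many points.\<close>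

lemma closure_meas:
  assumes P: "finite P" "{0, 1} \<subseteq> P" "P \<subseteq> {0..1}" and A: "meas P A"
  shows "piece (closure A)" "closure A \<subseteq> A \<union> P"
proof -
  let ?J = "{(p, q). p \<in> P \<and> q \<in> P \<and> p < q \<and> {p<..q} \<subseteq> A}"
  have fin: "finite ?J" by (rule finite_subset[of _ "P \<times> P"]) (use P(1) in auto)
  have "closure A = (\<Union>j\<in>?J. closure (case j of (p, q) \<Rightarrow> {p<..q}))"
    by (subst meas_atoms[OF P A]) (rule closure_UN_finite[OF fin])
  also have "\<dots> = (\<Union>(p, q)\<in>?J. {p..q})" by (intro SUP_cong) auto
  finally have c: "closure A = (\<Union>(p, q)\<in>?J. {p..q})" .
  show "piece (closure A)"
    unfolding piece_def c
    by (rule exI[of _ "(\<lambda>(p, q). {p..q}) ` ?J"]) (use fin P(3) in \<open>auto simp: cake_intervals_def subset_iff\<close>)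
  show "closure A \<subseteq> A \<union> P" unfolding c by (auto simp: subset_iff less_eq_real_def)
qed

definition closed_value :: "(nat \<Rightarrow> real set \<Rightarrow> real) \<Rightarrow> nat \<Rightarrow> real set \<Rightarrow> real" where
  "closed_value v i A = v i (closure A)"

lemma closed_value_Ioc: "p < q \<Longrightarrow> closed_value v i {p<..q} = v i {p..q}"
  unfolding closed_value_def by simp

text \<open>After each cut the new prefix is evaluated by all agents; by
  \<open>agree_by_prefixes\<close> this determines the values of all sets generated by the cut
  points.\<close>

primrec evaluate_all :: "nat list \<Rightarrow> real \<Rightarrow> (nat \<Rightarrow> real) \<Rightarrow> ((nat \<Rightarrow> real) \<Rightarrow> protocol) \<Rightarrow> protocol" where
  "evaluate_all [] y w k = k w"
| "evaluate_all (j # js) y w k = Evaluate j 0 y (\<lambda>x. evaluate_all js y (w(j := x)) k)"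

lemma legal_evaluate_all:
  "\<lbrakk>set js \<subseteq> {1..n}; 0 \<le> y; y \<le> 1; legal n v (k (\<lambda>j. if j \<in> set js then v j {0..y} else w j))\<rbrakk>
   \<Longrightarrow> legal n v (evaluate_all js y w k)"
proof (induction js arbitrary: w)
  case (Cons j js)
  have "(\<lambda>i. if i \<in> set (j # js) then v i {0..y} else w i) =
      (\<lambda>i. if i \<in> set js then v i {0..y} else (w(j := v j {0..y})) i)" by auto
  then show ?case using Cons by auto
qed simp

lemma executes_evaluate_all:
  "executes v (evaluate_all js y w k) q S \<Longrightarrow>
   \<exists>q'. q = length js + q' \<and> executes v (k (\<lambda>j. if j \<in> set js then v j {0..y} else w j)) q' S"
proof (induction js arbitrary: w q)
  case (Cons j js)
  from Cons.prems obtain q1 where q1: "q = Suc q1" "executes v (evaluate_all js y (w(j := v j {0..y})) k) q1 S"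
    by (auto elim: executes.cases)
  have "(\<lambda>i. if i \<in> set (j # js) then v i {0..y} else w i) =
      (\<lambda>i. if i \<in> set js then v i {0..y} else (w(j := v j {0..y})) i)" by auto
  then show ?case using Cons.IH[OF q1(2)] q1(1) by auto
qed simp

context agents
begin

text \<open>Proceed through the cut points from left to right. A generated set contains an atom
  entirely or not at all, and an atom is the difference of two prefixes.\<close>

lemma agree_by_prefixes:
  assumes P: "finite P" "{0, 1} \<subseteq> P" "P \<subseteq> {0..1}" and m: "prof m" "prof m'"
    and eq: "\<And>i p. i \<in> G \<Longrightarrow> p \<in> P \<Longrightarrow> 0 < p \<Longrightarrow> m' i {0<..p} = m i {0<..p}"
  shows "agree P m m'"
  unfolding agree_def
proof (intro ballI allI impI)
  fix i A assume i: "i \<in> G" and A: "meas P A"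
  have alg: "meas P B \<Longrightarrow> alg B" for B using alg_meas[OF P(1)] .
  have e: "m' i {} = m i {}" using m_empty[OF m(1) i] m_empty[OF m(2) i] by simp
  have eq0: "m' i ({0<..1} \<inter> {..p}) = m i ({0<..1} \<inter> {..p})" if "p \<in> P" for p
  proof (cases "p = 0")
    case True
    have "{0<..1} \<inter> {..0::real} = {}" by auto
    then show ?thesis using True e by simp
  next
    case False
    have "{0<..1} \<inter> {..p} = {0<..p}" using that P(3) by auto
    then show ?thesis using eq[OF i that] False that P(3) by auto
  qed
  have "m' i (A \<inter> {..r}) = m i (A \<inter> {..r})" if "r \<in> P" for r
    using that
  proof (induction "card {q\<in>P. q < r}" arbitrary: r rule: less_induct)
    case less
    show ?case
    proof (cases "r = 0")
      case True
      have "A \<inter> {..0} = {}" using meas_sub[OF A] by auto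
      then show ?thesis using True e by simp
    next
      case False
      then have r: "r \<in> {0<..1}" using less.prems P(3) by fastforce
      obtain p q where pq: "p \<in> P" "q \<in> P" "r \<in> {p<..q}" "\<And>y z. y \<in> {p<..q} \<Longrightarrow> z \<in> P \<Longrightarrow> r \<le> z \<longleftrightarrow> y \<le> z"
        using atom_exists[OF P(1,2) r] by metis
      have qr: "q = r" using pq(3) pq(4)[of q r] less.prems by auto
      have "card {q\<in>P. q < p} < card {q\<in>P. q < r}"
        by (rule psubset_card_mono) (use P(1) pq in auto)
      then have IH: "m' i (A \<inter> {..p}) = m i (A \<inter> {..p})" using less.hyps pq(1) by blast
      have at: "{0<..1} \<inter> {p<..r} = {p<..r}" using pq(1) P(3) r by auto
      have me: "meas P ({0<..1} \<inter> {..p})" "meas P ({0<..1} \<inter> {..r})" "meas P {p<..r}"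
        "meas P (A \<inter> {..p})" "meas P (A \<inter> {..r})" "meas P (A \<inter> {p<..r})"
      proof -
        have "meas P ({0<..1} \<inter> {..r} \<inter> {p<..})" "meas P (A \<inter> {..r} \<inter> {p<..})"
          using A pq(1) less.prems by (intro meas_gt meas_le; simp)+
        moreover have "{0<..1} \<inter> {..r} \<inter> {p<..} = {p<..r}" "A \<inter> {..r} \<inter> {p<..} = A \<inter> {p<..r}"
          using at by (fastforce simp: set_eq_iff)+
        ultimately show "meas P {p<..r}" "meas P (A \<inter> {p<..r})" by auto
      qed (use A pq(1) less.prems in auto)
      have ats: "m' i {p<..r} = m i {p<..r}"
      proof -
        have "{p<..r} = ({0<..1} \<inter> {..r}) - ({0<..1} \<inter> {..p})" using at r by (fastforce simp: set_eq_iff)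
        moreover have "({0<..1} \<inter> {..p}) \<subseteq> ({0<..1} \<inter> {..r})" using pq(3) by auto
        ultimately show ?thesis
          using m_Diff[OF m(1) i alg[OF me(2)] alg[OF me(1)]] m_Diff[OF m(2) i alg[OF me(2)] alg[OF me(1)]]
            eq0[OF pq(1)] eq0[OF less.prems] by simp
      qed
      have "A \<inter> {p<..r} = {} \<or> A \<inter> {p<..r} = {p<..r}"
      proof -
        have "y \<in> A \<longleftrightarrow> r \<in> A" if y: "y \<in> {p<..r}" for y
        proof (rule meas_iff[OF A])
          show "y \<in> {0<..1}" using y at by auto
          show "y \<le> z \<longleftrightarrow> r \<le> z" if "z \<in> P" for z using pq(4)[of y z] y qr that by auto
        qed (rule r)
        then show ?thesis by blast
      qed
      then have "m' i (A \<inter> {p<..r}) = m i (A \<inter> {p<..r})" using ats e by auto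
      moreover have "A \<inter> {..r} = (A \<inter> {..p}) \<union> (A \<inter> {p<..r})" using pq(3) by auto
      moreover have "(A \<inter> {..p}) \<inter> (A \<inter> {p<..r}) = {}" by auto
      ultimately show ?thesis
        using m_Un[OF m(1) i alg[OF me(4)] alg[OF me(6)]] m_Un[OF m(2) i alg[OF me(4)] alg[OF me(6)]] IH by simp
    qed
  qed
  from this[of 1] have "m' i (A \<inter> {..1}) = m i (A \<inter> {..1})" using P(2) by auto
  moreover have "A \<inter> {..1} = A" using meas_sub[OF A] by auto
  ultimately show "m' i A = m i A" by simp
qed

lemma prof_closed_value:
  assumes v: "\<And>i. i \<in> G \<Longrightarrow> valuation (v i)"
  shows "prof (closed_value v)"
  unfolding prof_def
proof (intro ballI conjI allI impI)
  fix i A B assume i: "i \<in> G" and A: "alg A"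
  show "0 \<le> closed_value v i A"
    using alg2[OF A A] closure_meas(1) v[OF i] unfolding closed_value_def valuation_def by metis
  assume B: "alg B" and AB: "A \<inter> B = {}"
  obtain P where P: "finite P" "{0, 1} \<subseteq> P" "P \<subseteq> {0..1}" "meas P A" "meas P B" using alg2[OF A B] by metis
  have "closure A \<inter> closure B \<subseteq> P" using closure_meas(2)[OF P(1-4)] closure_meas(2)[OF P(1-3,5)] AB by auto
  then have "finite (closure A \<inter> closure B)" using P(1) finite_subset by blast
  then have "v i (closure A \<union> closure B) = v i (closure A) + v i (closure B)"
    using closure_meas(1)[OF P(1-4)] closure_meas(1)[OF P(1-3,5)] v[OF i] unfolding valuation_def by blast
  then show "closed_value v i (A \<union> B) = closed_value v i A + closed_value v i B"
    unfolding closed_value_def by simp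
qed

definition solves :: "nat \<Rightarrow> nat \<Rightarrow> (nat \<Rightarrow> real set \<Rightarrow> real) \<Rightarrow> protocol \<Rightarrow> bool" where
  "solves n K v p \<longleftrightarrow> legal n v p \<and> (\<forall>q S. executes v p q S \<longrightarrow> envy_free_division n v S \<and> q \<le> K)"

lemma solves_Output:
  assumes G: "G = {1..n}" and P: "finite P" "{0, 1} \<subseteq> P" "P \<subseteq> {0..1}"
    and X: "alloc G P {0<..1} X" "ef G (closed_value v) X" "(\<Union>i\<in>G. X i) = {0<..1}"
  shows "solves n K v (Output (\<lambda>i. closure (X i)))"
proof -
  have me: "meas P (X i)" if "i \<in> G" for i using X(1) that unfolding alloc_def by auto
  have "envy_free_division n v (\<lambda>i. closure (X i))"
    unfolding envy_free_division_def G[symmetric]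
  proof (intro conjI ballI impI)
    show "piece (closure (X i))" if "i \<in> G" for i using closure_meas(1)[OF P me[OF that]] .
    have "(\<Union>i\<in>G. closure (X i)) = closure (\<Union>i\<in>G. X i)" using G closure_UN_finite[of G X] by simp
    then show "(\<Union>i\<in>G. closure (X i)) = {0..1}" using X(3) by simp
    show "finite (closure (X i) \<inter> closure (X j))" if "i \<in> G" "j \<in> G" "i \<noteq> j" for i j
    proof -
      have "X i \<inter> X j = {}" using X(1) that unfolding alloc_def disjoint_family_on_def by auto
      then have "closure (X i) \<inter> closure (X j) \<subseteq> P"
        using closure_meas(2)[OF P me[OF that(1)]] closure_meas(2)[OF P me[OF that(2)]] by auto
      then show ?thesis using P(1) finite_subset by blast
    qed
    show "v i (closure (X j)) \<le> v i (closure (X i))" if "i \<in> G" "j \<in> G" for i j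
      using X(2) that unfolding ef_def closed_value_def by auto
  qed
  then show ?thesis unfolding solves_def by (auto elim: executes.cases)
qed

text \<open>A query acts on an interval, whereas strategies cut arbitrary generated sets. Since no
  known point gives the value \<open>r\<close>, the cut falls strictly inside one atom, and this
  atom belongs to \<open>A\<close>.\<close>

lemma cut_position:
  assumes P: "finite P" "{0, 1} \<subseteq> P" "P \<subseteq> {0..1}" and m: "prof m" and i: "i \<in> G" and A: "meas P A"
    and r: "0 \<le> r" "r \<le> m i A" and new: "\<And>y. y \<in> P \<Longrightarrow> m i (A \<inter> {..y}) \<noteq> r"
  obtains p q where "p \<in> P" "q \<in> P" "p < q" "{p<..q} \<subseteq> A" "m i (A \<inter> {..p}) < r"
    "r < m i (A \<inter> {..p}) + m i {p<..q}"
proof -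
  let ?L = "{x\<in>P. m i (A \<inter> {..x}) < r}"
  define p where "p = Max ?L"
  have "A \<inter> {..0} = {}" "A \<inter> {..1} = A" using meas_sub[OF A] by fastforce+
  then have ends: "m i (A \<inter> {..0}) < r" "r < m i (A \<inter> {..1})"
    using new[of 0] new[of 1] P(2) r m_empty[OF m i] by auto
  then have "p \<in> ?L" unfolding p_def using P by (intro Max_in) auto
  then have p: "p \<in> P" "m i (A \<inter> {..p}) < r" by auto
  have pm: "x \<le> p" if "x \<in> P" "m i (A \<inter> {..x}) < r" for x unfolding p_def using P(1) that by (intro Max_ge) auto
  have "p \<noteq> 1" using ends p by auto
  then have p1: "p < 1" using p(1) P(3) by fastforce
  define q where "q = Min {x\<in>P. p < x}"
  have "q \<in> {x\<in>P. p < x}" unfolding q_def using P p1 by (intro Min_in) auto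
  then have q: "q \<in> P" "p < q" by auto
  have qm: "q \<le> x" if "x \<in> P" "p < x" for x unfolding q_def using P(1) that by (intro Min_le) auto
  have rq: "r < m i (A \<inter> {..q})" using pm[OF q(1)] new[OF q(1)] q(2) by linarith
  have unit: "{p<..q} \<subseteq> {0<..1}" using p(1) q(1) P(3) by fastforce
  have same: "y \<in> A \<longleftrightarrow> q \<in> A" if y: "y \<in> {p<..q}" for y
  proof (rule meas_iff[OF A])
    show "y \<in> {0<..1}" "q \<in> {0<..1}" using y unit q(2) by (meson greaterThanAtMost_iff order_refl subsetD)+
    show "y \<le> z \<longleftrightarrow> q \<le> z" if "z \<in> P" for z using qm[OF that] y by fastforce
  qed
  have sp: "A \<inter> {..q} = (A \<inter> {..p}) \<union> (A \<inter> {p<..q})" using q(2) by auto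
  have "q \<in> A"
  proof (rule ccontr)
    assume "q \<notin> A"
    then have "A \<inter> {p<..q} = {}" using same by blast
    then show False using sp rq p(2) by simp
  qed
  then have sub: "{p<..q} \<subseteq> A" using same by blast
  have "A \<inter> {p<..q} = A \<inter> {..q} \<inter> {p<..}" by auto
  moreover have "meas P (A \<inter> {..q} \<inter> {p<..})" using A p(1) q(1) by (intro meas_gt meas_le)
  ultimately have "meas P {p<..q}" using sub by (simp add: Int_absorb1)
  then have "m i (A \<inter> {..q}) = m i (A \<inter> {..p}) + m i {p<..q}"
    unfolding sp using m_Un[OF m i, of "A \<inter> {..p}" "{p<..q}"] alg_meas[OF P(1)] A p(1) sub
    by (auto simp: Int_absorb1 disjoint_iff)
  then show thesis using that[OF p(1) q sub p(2)] rq by simp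
qed

text \<open>The answers determine the values of all sets generated by the cut points, so the continuation can
  be chosen for any one of the profiles that are consistent with them.\<close>

lemma realize_cut:
  assumes G: "G = {1..n}" and P: "finite P" "{0, 1} \<subseteq> P" "P \<subseteq> {0..1}"
    and v0: "\<And>i. i \<in> G \<Longrightarrow> valuation (v0 i)" and i: "i \<in> G" and A: "meas P A"
    and r: "0 \<le> r" "r \<le> closed_value v0 i A"
    and new: "\<And>y. y \<in> P \<Longrightarrow> closed_value v0 i (A \<inter> {..y}) \<noteq> r"
    and cont: "\<And>v1 y. \<lbrakk>\<And>i. i \<in> G \<Longrightarrow> valuation (v1 i); agree P (closed_value v0) (closed_value v1); y \<in> {0..1};
        closed_value v1 i (A \<inter> {..y}) = r\<rbrakk> \<Longrightarrow>
        \<exists>p. \<forall>v. (\<forall>i\<in>G. valuation (v i)) \<and> agree (insert y P) (closed_value v1) (closed_value v) \<longrightarrow> solves n K v p"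
  shows "\<exists>p. \<forall>v. (\<forall>i\<in>G. valuation (v i)) \<and> agree P (closed_value v0) (closed_value v) \<longrightarrow> solves n (Suc n + K) v p"
proof -
  obtain p q where pq: "p \<in> P" "q \<in> P" "p < q" "{p<..q} \<subseteq> A" "closed_value v0 i (A \<inter> {..p}) < r"
    "r < closed_value v0 i (A \<inter> {..p}) + closed_value v0 i {p<..q}"
    using cut_position[OF P prof_closed_value[OF v0] i A r new] by blast
  have pq01: "0 \<le> p" "q \<le> 1" using pq P(3) by auto
  \<comment> \<open>The value still missing at \<open>p\<close>; cutting it off from
    \<open>p\<close> onwards performs the cut of \<open>A\<close>.\<close>
  define a where "a = r - closed_value v0 i (A \<inter> {..p})"
  have a: "0 < a" "a < closed_value v0 i {p<..q}" using pq(5,6) unfolding a_def by auto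
  define ok where "ok y w v \<longleftrightarrow> (\<forall>i\<in>G. valuation (v i)) \<and> agree P (closed_value v0) (closed_value v) \<and>
    closed_value v i (A \<inter> {..y}) = r \<and> (\<forall>j\<in>G. v j {0..y} = w j)" for y :: real and w v
  \<comment> \<open>The tree sees only the answer \<open>y\<close> and the prefix values
    \<open>w\<close>. One continuation that serves all valuations consistent with them is
    chosen.\<close>
  define nxt where "nxt y w = (SOME p. \<forall>v. ok y w v \<longrightarrow> solves n K v p)" for y w
  have nxt': "solves n K v (nxt y w)" if v: "ok y w v" and y: "y \<in> {0<..1}" for v y w
  proof -
    have y': "y \<in> {0..1}" using y by auto
    have "\<exists>p. \<forall>u. (\<forall>i\<in>G. valuation (u i)) \<and> agree (insert y P) (closed_value v) (closed_value u) \<longrightarrow> solves n K u p"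
      using cont[of v y] v y' unfolding ok_def by blast
    then obtain p where p: "\<And>u. (\<forall>i\<in>G. valuation (u i)) \<Longrightarrow> agree (insert y P) (closed_value v) (closed_value u) \<Longrightarrow> solves n K u p"
      by blast
    have "solves n K u p" if u: "ok y w u" for u
    proof (rule p)
      show "\<forall>i\<in>G. valuation (u i)" using u ok_def by auto
      show "agree (insert y P) (closed_value v) (closed_value u)"
      proof (rule agree_by_prefixes)
        fix j z assume j: "j \<in> G" and z: "z \<in> insert y P" "0 < z"
        have vu: "agree P (closed_value v) (closed_value u)"
          using u v agree_trans agree_sym unfolding ok_def by blast
        show "closed_value u j {0<..z} = closed_value v j {0<..z}"
        proof (cases "z = y")
          case True
          then show ?thesis using closed_value_Ioc[OF z(2)] u v j unfolding ok_def by simp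
        next
          case False
          then have zP: "z \<in> P" using z by auto
          have "{0<..1} \<inter> {..z} = {0<..z}" using zP P(3) by auto
          then have "meas P {0<..z}" using meas_le[OF meas_cake zP] by simp
          then show ?thesis using agreeD[OF vu _ j] by simp
        qed
      qed (use P y' u v prof_closed_value ok_def in auto)
    qed
    then have "\<forall>v. ok y w v \<longrightarrow> solves n K v (nxt y w)" unfolding nxt_def by (intro someI[of "\<lambda>p. \<forall>v. ok y w v \<longrightarrow> solves n K v p" p]) blast
    then show ?thesis using v by blast
  qed
  let ?p = "Cut i p a (\<lambda>y. evaluate_all [1..<Suc n] y (\<lambda>_. 0) (nxt y))"
  have "solves n (Suc n + K) v ?p" if v: "\<forall>i\<in>G. valuation (v i)" and ag: "agree P (closed_value v0) (closed_value v)" for v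
  proof -
    have pr: "prof (closed_value v)" using prof_closed_value v by blast
    have vi: "valuation (v i)" using v i by auto
    have pc: "piece {x..y}" if "0 \<le> x" "y \<le> 1" for x y :: real
    proof (cases "x \<le> y")
      case True
      then show ?thesis unfolding piece_def by (intro exI[of _ "{{x..y}}"]) (use that in \<open>auto simp: cake_intervals_def\<close>)
    next
      case False
      then show ?thesis unfolding piece_def by (intro exI[of _ "{}"]) auto
    qed
    have add: "v i {x..z} = v i {x..y} + v i {y..z}" if "0 \<le> x" "x \<le> y" "y \<le> z" "z \<le> 1" for x y z
    proof -
      have "{x..y} \<inter> {y..z} = {y}" "{x..y} \<union> {y..z} = {x..z}" using that by auto
      then show ?thesis using vi pc[of x y] pc[of y z] that unfolding valuation_def by (metis finite.emptyI finite.insertI order_trans)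
    qed
    have nn: "0 \<le> v i {x..y}" if "0 \<le> x" "y \<le> 1" for x y using vi pc[OF that] unfolding valuation_def by blast
    have me: "meas P (A \<inter> {..p})" "meas P {p<..q}"
    proof -
      have "{p<..q} = A \<inter> {..q} \<inter> {p<..}" using pq(4) by auto
      moreover have "meas P (A \<inter> {..q} \<inter> {p<..})" using A pq(1,2) by (intro meas_gt meas_le)
      ultimately show "meas P {p<..q}" by simp
    qed (use A pq(1) in auto)
    have vpq: "a < v i {p..q}" using a(2) agreeD[OF ag me(2) i] closed_value_Ioc[OF pq(3)] by metis
    \<comment> \<open>Every correct answer lies strictly inside the atom, whichever intervals have
      value zero, because \<open>a\<close> is positive and less than the value of the atom.\<close>
    have answer: "y \<in> {0<..1} \<and> ok y (\<lambda>j. if j \<in> set [1..<Suc n] then v j {0..y} else 0) v"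
      if y: "cut_answer (v i) p a y" for y
    proof -
      have y': "p \<le> y" "y \<le> 1" "v i {p..y} = a" using y unfolding cut_answer_def by auto
      have vp: "v i {p..p} = 0" using add[of p p p] pq01 pq(3) by simp
      have "p < y" using y' vp a(1) by (cases "p = y") auto
      have "y < q"
      proof (rule ccontr)
        assume "\<not> y < q"
        then have "v i {p..y} = v i {p..q} + v i {q..y}" using add[of p q y] pq01 pq(3) y'(2) by auto
        then show False using nn[of q y] pq01 pq(3) y' vpq by auto
      qed
      have yP: "meas (insert y P) (A \<inter> {..p})" "meas (insert y P) {p<..y}"
      proof -
        have "{p<..y} = {p<..q} \<inter> {..y}" using \<open>y < q\<close> by auto
        then show "meas (insert y P) {p<..y}" using meas_le[OF meas_mono[OF me(2), of "insert y P"], of y] by auto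
        show "meas (insert y P) (A \<inter> {..p})" using meas_mono[OF me(1), of "insert y P"] by auto
      qed
      have "A \<inter> {..y} = (A \<inter> {..p}) \<union> {p<..y}" using pq(4) \<open>p < y\<close> \<open>y < q\<close> by (fastforce simp: set_eq_iff)
      moreover have "closed_value v i ((A \<inter> {..p}) \<union> {p<..y}) = closed_value v i (A \<inter> {..p}) + closed_value v i {p<..y}"
        using m_Un[OF pr i] alg_meas[of "insert y P"] yP P(1) by (auto simp: disjoint_iff)
      ultimately have "closed_value v i (A \<inter> {..y}) = r"
        using agreeD[OF ag me(1) i] closed_value_Ioc[OF \<open>p < y\<close>] y'(3) unfolding a_def by simp
      moreover have "j \<in> set [1..<Suc n]" if "j \<in> G" for j using that G by auto
      ultimately show ?thesis using v ag y'(2) \<open>p < y\<close> pq01 unfolding ok_def by simp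
    qed
    have "legal n v ?p"
    proof -
      have "a \<le> v i {p..1}" using add[of p q 1] nn[of q 1] pq01 pq(3) vpq by auto
      moreover have "legal n v (evaluate_all [1..<Suc n] y (\<lambda>_. 0) (nxt y))" if "cut_answer (v i) p a y" for y
        by (rule legal_evaluate_all) (use answer[OF that] nxt' solves_def in auto)
      ultimately show ?thesis using i G a(1) pq01 pq(3) by auto
    qed
    moreover have "envy_free_division n v S \<and> q' \<le> Suc n + K" if ex: "executes v ?p q' S" for q' S
    proof -
      obtain y q1 where y: "q' = Suc q1" "cut_answer (v i) p a y"
        "executes v (evaluate_all [1..<Suc n] y (\<lambda>_. 0) (nxt y)) q1 S"
        using ex by (auto elim: executes.cases)
      obtain q2 where "q1 = length [1..<Suc n] + q2"
        "executes v (nxt y (\<lambda>j. if j \<in> set [1..<Suc n] then v j {0..y} else 0)) q2 S"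
        using executes_evaluate_all[OF y(3)] by blast
      then show ?thesis using answer[OF y(2)] nxt' y(1) unfolding solves_def by fastforce
    qed
    ultimately show ?thesis unfolding solves_def by blast
  qed
  then show ?thesis by blast
qed

text \<open>One cut of the game becomes one cut query and \<open>n\<close> evaluations, hence the
  factor \<open>Suc n\<close>. If a known point already gives the requested value, the tree
  continues with it without a query. Answers that no valuations can give leave nothing to
  prove.\<close>

lemma realize:
  assumes G: "G = {1..n}"
    and "can (\<lambda>P m. \<exists>X. alloc G P {0<..1} X \<and> ef G m X \<and> (\<Union>i\<in>G. X i) = {0<..1}) K P m"
    and "finite P" "{0, 1} \<subseteq> P" "P \<subseteq> {0..1}"
  shows "\<exists>p. \<forall>v. (\<forall>i\<in>G. valuation (v i)) \<and> agree P m (closed_value v) \<longrightarrow> solves n (K * Suc n) v p"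
  using assms(2-)
proof (induction rule: can.induct)
  case (can_done P m K)
  show ?case
  proof (cases "\<exists>v. (\<forall>i\<in>G. valuation (v i)) \<and> agree P m (closed_value v)")
    case True
    then obtain v0 where v0: "\<forall>i\<in>G. valuation (v0 i)" "agree P m (closed_value v0)" by blast
    then obtain X where X: "alloc G P {0<..1} X" "ef G (closed_value v0) X" "(\<Union>i\<in>G. X i) = {0<..1}"
      using can_done(1)[OF prof_closed_value v0(2)] by blast
    have "solves n (K * Suc n) v (Output (\<lambda>i. closure (X i)))"
      if "\<forall>i\<in>G. valuation (v i)" "agree P m (closed_value v)" for v
    proof (rule solves_Output[OF G can_done(2-4) X(1) _ X(3)])
      show "ef G (closed_value v) X"
        using ef_agree[OF X(2,1) agree_trans[OF agree_sym[OF v0(2)] that(2)]] by simp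
    qed
    then show ?thesis by blast
  qed blast
next
  case (can_step i P A r m K)
  show ?case
  proof (cases "\<exists>v. (\<forall>i\<in>G. valuation (v i)) \<and> agree P m (closed_value v)")
    case True
    then obtain v0 where v0: "\<And>i. i \<in> G \<Longrightarrow> valuation (v0 i)" "agree P m (closed_value v0)" by blast
    have eq: "agree P m (closed_value v) \<longleftrightarrow> agree P (closed_value v0) (closed_value v)" for v
      using agree_trans agree_sym v0(2) by blast
    have cont: "\<exists>p. \<forall>v. (\<forall>i\<in>G. valuation (v i)) \<and> agree (insert y P) (closed_value v1) (closed_value v) \<longrightarrow> solves n (K * Suc n) v p"
      if "\<And>i. i \<in> G \<Longrightarrow> valuation (v1 i)" "agree P (closed_value v0) (closed_value v1)" "y \<in> {0..1}"
        "closed_value v1 i (A \<inter> {..y}) = r" for v1 y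
      by (rule can_step.IH) (use that prof_closed_value eq can_step.prems in auto)
    show ?thesis
    proof (cases "\<exists>y\<in>P. closed_value v0 i (A \<inter> {..y}) = r")
      case True
      then obtain y where y: "y \<in> P" "closed_value v0 i (A \<inter> {..y}) = r" by blast
      obtain p where "\<And>v. (\<forall>i\<in>G. valuation (v i)) \<Longrightarrow> agree P (closed_value v0) (closed_value v) \<Longrightarrow> solves n (K * Suc n) v p"
        using cont[OF v0(1) agree_refl _ y(2)] y(1) can_step.prems(3) by (metis insert_absorb subsetD)
      then show ?thesis unfolding eq solves_def by fastforce
    next
      case False
      have "closed_value v0 i A = m i A" using agreeD[OF v0(2)] can_step by auto
      then have "\<exists>p. \<forall>v. (\<forall>i\<in>G. valuation (v i)) \<and> agree P (closed_value v0) (closed_value v) \<longrightarrow> solves n (Suc n + K * Suc n) v p"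
        by (intro realize_cut[OF G can_step.prems v0(1) _ _ _ _ _ cont]) (use can_step.hyps False in auto)
      then show ?thesis unfolding eq mult_Suc .
    qed
  qed blast
qed

end

text \<open>The game starts from the cut points 0 and 1, so the values of the whole cake have to be
  known. The \<open>n\<close> initial evaluations supply them, and a tree is chosen according to the
  result.\<close>

lemma envy_free_protocol:
  "\<exists>p. \<forall>v. (\<forall>i\<in>{1..n}. valuation (v i)) \<longrightarrow> agents.solves n (n + total_cost n * Suc n) v p" if n: "1 \<le> n" for n
proof -
  interpret agents "{1..n}" .
  let ?K = "total_cost n * Suc n"
  define ok where "ok w v \<longleftrightarrow> (\<forall>i\<in>{1..n}. valuation (v i)) \<and> (\<forall>j\<in>{1..n}. v j {0..1} = w j)" for w and v :: "nat \<Rightarrow> real set \<Rightarrow> real"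
  define nxt where "nxt w = (SOME p. \<forall>v. ok w v \<longrightarrow> solves n ?K v p)" for w
  have nxt': "solves n ?K v (nxt w)" if v: "ok w v" for v w
  proof -
    have pr: "prof (closed_value v)" using v prof_closed_value ok_def by auto
    then have st: "st {0, 1} (closed_value v)" unfolding st_def by auto
    obtain p where p: "\<And>u. (\<forall>i\<in>{1..n}. valuation (u i)) \<Longrightarrow> agree {0, 1} (closed_value v) (closed_value u) \<Longrightarrow> solves n ?K u p"
      using realize[OF refl envy_free[OF st subset_refl _ _ meas_cake]] n by auto
    have "solves n ?K u p" if u: "ok w u" for u
    proof (rule p)
      show "agree {0, 1} (closed_value v) (closed_value u)"
        by (rule agree_by_prefixes) (use u v pr prof_closed_value ok_def closed_value_Ioc in auto)
    qed (use u ok_def in auto)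
    then have "\<forall>v. ok w v \<longrightarrow> solves n ?K v (nxt w)"
      unfolding nxt_def by (intro someI[of "\<lambda>p. \<forall>v. ok w v \<longrightarrow> solves n ?K v p" p]) blast
    then show ?thesis using v by blast
  qed
  let ?p = "evaluate_all [1..<Suc n] 1 (\<lambda>_. 0) nxt"
  have "solves n (n + ?K) v ?p" if v: "\<forall>i\<in>{1..n}. valuation (v i)" for v
  proof -
    let ?w = "\<lambda>j. if j \<in> set [1..<Suc n] then v j {0..1} else 0"
    have s: "solves n ?K v (nxt ?w)" by (rule nxt') (use v ok_def in auto)
    then have "legal n v ?p" by (intro legal_evaluate_all) (auto simp: solves_def)
    moreover have "envy_free_division n v S \<and> q \<le> n + ?K" if "executes v ?p q S" for q S
      using executes_evaluate_all[OF that] s unfolding solves_def by fastforce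
    ultimately show ?thesis unfolding solves_def by blast
  qed
  then show ?thesis by blast
qed

subsection \<open>The number of queries\<close>

lemma power_mono_both: "a \<le> b \<Longrightarrow> k \<le> l \<Longrightarrow> 1 \<le> b \<Longrightarrow> a ^ k \<le> b ^ l" for a b k l :: nat
  by (meson order_trans power_increasing power_mono zero_le)

lemma dom_cost_mono: "k \<le> n \<Longrightarrow> dom_cost k \<le> dom_cost n"
proof (cases "k = 0")
  case True
  then have "dom_cost k = 0" unfolding dom_cost_def trim_cost_def shrink_cost_def by simp
  then show ?thesis by simp
next
  case False
  assume kn: "k \<le> n"
  have k1: "1 \<le> n" using False kn by simp
  have sq: "k * k \<le> n * n" and cube: "k ^ 3 + 1 \<le> n ^ 3 + 1" using kn by (simp_all add: mult_mono power_mono)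
  have e: "exch_factor k \<le> exch_factor n" unfolding exch_factor_def using kn cube by (intro mult_mono) auto
  have e1: "1 \<le> exch_factor n" unfolding exch_factor_def using k1 by simp
  have "family_size k \<le> family_size n"
    unfolding family_size_def using e cube sq e1 by (intro mult_mono power_mono_both) auto
  then have S: "snap_count k \<le> snap_count n"
    unfolding snap_count_def using kn sq by (intro mult_mono power_mono_both) auto
  have \<kappa>: "trim_cost k \<le> trim_cost n" unfolding trim_cost_def using kn sq by (intro mult_mono power_mono_both) auto
  have shrink_cost: "shrink_cost k \<le> shrink_cost n" unfolding shrink_cost_def using kn \<kappa> by (intro mult_mono add_mono) auto
  have h: "halvings k \<le> halvings n"
    unfolding halvings_def using kn cube sq e by (intro mult_mono add_mono) auto
  show ?thesis
    unfolding dom_cost_def using kn S \<kappa> shrink_cost h sq by (intro mult_mono add_mono) auto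
qed

lemma mult_le_power: "\<lbrakk>x \<le> n ^ a; y \<le> n ^ b; 1 \<le> n; a + b \<le> c\<rbrakk> \<Longrightarrow> x * y \<le> n ^ c" for n :: nat
proof -
  assume a: "x \<le> n ^ a" "y \<le> n ^ b" "1 \<le> n" "a + b \<le> c"
  have "x * y \<le> n ^ (a + b)" using a(1,2) by (simp add: mult_mono power_add)
  also have "\<dots> \<le> n ^ c" using a(4,3) by (rule power_increasing)
  finally show ?thesis .
qed

lemma add_le_power: "\<lbrakk>x \<le> n ^ a; y \<le> n ^ b; 2 \<le> n; Suc a \<le> c; Suc b \<le> c\<rbrakk> \<Longrightarrow> x + y \<le> n ^ c" for n :: nat
proof -
  assume a: "x \<le> n ^ a" "y \<le> n ^ b" "2 \<le> n" "Suc a \<le> c" "Suc b \<le> c"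
  have "n ^ a \<le> n ^ (c - 1)" "n ^ b \<le> n ^ (c - 1)" using a by (intro power_increasing; simp)+
  then have "x + y \<le> 2 * n ^ (c - 1)" using a(1,2) by simp
  also have "\<dots> \<le> n * n ^ (c - 1)" using a(3) by (rule mult_right_mono) simp
  also have "\<dots> = n ^ c" using a(4) by (metis Suc_le_D diff_Suc_1 power_Suc)
  finally show ?thesis .
qed

text \<open>The dominant term is \<open>snap_count n\<close>, at most
  \<open>n ^ (7 * n^2 + 4)\<close>: the types contribute \<open>2 * n^2\<close> to the exponent by
  the crude \<open>n + 1 \<le> n ^ 2\<close>, and the family contributes \<open>5 * n^2\<close>. All
  the rest adds \<open>3 * n\<close> and a constant, which fits into the remaining
  \<open>n^2\<close> from \<open>n = 8\<close> on.\<close>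

lemma query_bound:
  assumes n: "8 \<le> n"
  shows "n + total_cost n * Suc n \<le> n ^ (8 * n\<^sup>2)"
proof -
  have n2: "2 \<le> n" and n1: "1 \<le> n" using n by auto
  have P1: "1 \<le> n ^ a" for a using n1 by (rule one_le_power)
  have one: "1 \<le> n ^ 0" and N: "n \<le> n ^ 1" and two: "2 \<le> n ^ 1" using n2 by auto
  have NN: "n * n \<le> n ^ 2" by (simp add: power2_eq_square)
  have succ: "n + 1 \<le> n ^ 2" by (rule add_le_power[OF N one n2]) auto
  have cube: "n ^ 3 + 1 \<le> n ^ 4" by (rule add_le_power[OF order_refl one n2]) auto
  have ef: "exch_factor n \<le> n ^ 5" unfolding exch_factor_def by (rule mult_le_power[OF N cube n1]) auto
  have pow: "x ^ k \<le> n ^ (a * k)" if "x \<le> n ^ a" for x a k using power_mono[OF that, of k] by (simp add: power_mult)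
  define s where "s = 7 * (n * n) + 4"
  have F: "family_size n \<le> n ^ (4 + 5 * (n * n))"
    unfolding family_size_def by (rule mult_le_power[OF cube pow[OF ef] n1 order_refl])
  have S: "snap_count n \<le> n ^ s"
    unfolding snap_count_def by (rule mult_le_power[OF pow[OF succ] F n1]) (simp add: s_def)
  define u where "u = 1 + 3 * n"
  have "1 + n * n \<le> n ^ 3" by (rule add_le_power[OF one NN n2]) auto
  then have \<kappa>: "trim_cost n \<le> n ^ u" unfolding trim_cost_def by (rule mult_le_power[OF N pow n1]) (simp add: u_def)
  have n\<kappa>: "n + trim_cost n \<le> n ^ (u + 1)" by (rule add_le_power[OF N \<kappa> n2]) (auto simp: u_def)
  have "n * (n + trim_cost n) \<le> n ^ (u + 2)" by (rule mult_le_power[OF N n\<kappa> n1]) simp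
  then have shrink_cost: "shrink_cost n \<le> n ^ (u + 3)" unfolding shrink_cost_def by (rule mult_le_power[OF N _ n1]) simp
  have h: "halvings n \<le> n ^ 10"
  proof -
    have "exch_factor n * (n * n) \<le> n ^ 7" by (rule mult_le_power[OF ef NN n1]) simp
    then have b: "(n ^ 3 + 1) + exch_factor n * (n * n) \<le> n ^ 8" by (rule add_le_power[OF cube _ n2]) auto
    have c: "(n + 1) * (n * n) \<le> n ^ 4" by (rule mult_le_power[OF succ NN n1]) simp
    have d: "2 * (n * n) \<le> n ^ 3" by (rule mult_le_power[OF two NN n1]) simp
    have "(n + 1) * (n * n) + ((n ^ 3 + 1) + exch_factor n * (n * n)) \<le> n ^ 9" by (rule add_le_power[OF c b n2]) auto
    then show ?thesis unfolding halvings_def by (rule add_le_power[OF d _ n2]) auto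
  qed
  define w where "w = s + u + 16"
  have D: "dom_cost n \<le> n ^ (w + 3)"
  proof -
    have t1: "snap_count n * (n + trim_cost n) \<le> n ^ w" by (rule mult_le_power[OF S n\<kappa> n1]) (simp add: w_def)
    have "snap_count n * (n * n) \<le> n ^ (s + 2)" by (rule mult_le_power[OF S NN n1]) simp
    then have x: "1 + snap_count n * (n * n) \<le> n ^ (s + 3)" by (rule add_le_power[OF one _ n2]) auto
    have y: "halvings n * shrink_cost n \<le> n ^ (u + 13)" by (rule mult_le_power[OF h shrink_cost n1]) simp
    have t2: "(1 + snap_count n * (n * n)) * (halvings n * shrink_cost n) \<le> n ^ w"
      by (rule mult_le_power[OF x y n1]) (simp add: w_def)
    have Sn: "snap_count n * n \<le> n ^ (s + 1)" by (rule mult_le_power[OF S N n1]) simp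
    have Snnn: "snap_count n * n * (n * n) \<le> n ^ (s + 3)" by (rule mult_le_power[OF Sn NN n1]) simp
    then have "snap_count n * n * n * n \<le> n ^ (s + 3)" by (simp only: mult.assoc)
    then have t3: "snap_count n * n * n * n + snap_count n * n * (n * n) \<le> n ^ w"
      by (rule add_le_power[OF _ Snnn n2]) (auto simp: w_def)
    have t4: "n * n * trim_cost n \<le> n ^ w" by (rule mult_le_power[OF NN \<kappa> n1]) (simp add: w_def)
    have "(1 + snap_count n * (n * n)) * (halvings n * shrink_cost n) + (snap_count n * n * n * n + snap_count n * n * (n * n)) \<le> n ^ (w + 1)"
      by (rule add_le_power[OF t2 t3 n2]) auto
    then have "snap_count n * (n + trim_cost n) + ((1 + snap_count n * (n * n)) * (halvings n * shrink_cost n) +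
      (snap_count n * n * n * n + snap_count n * n * (n * n))) \<le> n ^ (w + 2)"
      by (rule add_le_power[OF t1 _ n2]) auto
    then show ?thesis unfolding dom_cost_def by (rule add_le_power[OF _ t4 n2]) auto
  qed
  have "total_cost n \<le> (\<Sum>k\<le>n. dom_cost n)" unfolding total_cost_def using dom_cost_mono by (intro sum_mono) auto
  also have "\<dots> = (n + 1) * dom_cost n" by simp
  also have "\<dots> \<le> n ^ (w + 5)" by (rule mult_le_power[OF succ D n1]) simp
  finally have "total_cost n * (n + 1) \<le> n ^ (w + 7)" by (rule mult_le_power[OF _ succ n1]) simp
  then have "n + total_cost n * (n + 1) \<le> n ^ (w + 8)" by (rule add_le_power[OF N _ n2]) auto
  also have "\<dots> \<le> n ^ (8 * n\<^sup>2)"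
  proof (rule power_increasing)
    have "8 * n \<le> n * n" using n by (rule mult_right_mono) simp
    then show "w + 8 \<le> 8 * n\<^sup>2" using n unfolding w_def s_def u_def power2_eq_square by linarith
  qed (use n1 in simp)
  finally show ?thesis by simp
qed

theorem theorem5:
  "\<exists>(\<epsilon> :: nat \<Rightarrow> real) (P :: nat \<Rightarrow> protocol).
     \<epsilon> \<longlonglongrightarrow> 0 \<and>
     (\<forall>n\<ge>2. \<forall>v :: nat \<Rightarrow> real set \<Rightarrow> real.
        (\<forall>i\<in>{1..n}. valuation (v i)) \<longrightarrow>
          legal n v (P n) \<and>
          (\<forall>q S. executes v (P n) q S \<longrightarrow>
             envy_free_division n v S \<and>
             real q \<le> real n powr (8 * (real n)\<^sup>2 * (1 + \<epsilon> n))))"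
proof -
  obtain P where P: "\<And>n v. \<lbrakk>2 \<le> n; \<forall>i\<in>{1..n}. valuation (v i)\<rbrakk> \<Longrightarrow>
      agents.solves n (n + total_cost n * Suc n) v (P n)"
  proof -
    have "\<exists>p. \<forall>v. 2 \<le> n \<longrightarrow> (\<forall>i\<in>{1..n}. valuation (v i)) \<longrightarrow> agents.solves n (n + total_cost n * Suc n) v p" for n
      using envy_free_protocol[of n] by (cases "2 \<le> n") auto
    then show thesis using that by metis
  qed
  define T where "T n = real (n + total_cost n * Suc n)" for n
  define \<epsilon> where "\<epsilon> n = (if T n \<le> real n powr (8 * (real n)\<^sup>2) then 0
    else log (real n) (T n) / (8 * (real n)\<^sup>2) - 1)" for n
  have "\<epsilon> n = 0" if "8 \<le> n" for n
  proof -
    have "T n \<le> real (n ^ (8 * n\<^sup>2))" unfolding T_def using query_bound[OF that] by (simp only: of_nat_le_iff)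
    also have "\<dots> = real n powr (8 * (real n)\<^sup>2)" using that powr_realpow[of "real n" "8 * n\<^sup>2"] by simp
    finally show ?thesis unfolding \<epsilon>_def by simp
  qed
  then have "\<epsilon> \<longlonglongrightarrow> 0" by (intro tendsto_eventually eventually_sequentiallyI[of 8]) simp
  moreover have "T n \<le> real n powr (8 * (real n)\<^sup>2 * (1 + \<epsilon> n))" if "2 \<le> n" for n
  proof (cases "T n \<le> real n powr (8 * (real n)\<^sup>2)")
    case True
    then show ?thesis unfolding \<epsilon>_def by simp
  next
    case False
    then have "8 * (real n)\<^sup>2 * (1 + \<epsilon> n) = log (real n) (T n)" unfolding \<epsilon>_def using that by simp
    moreover have "0 < T n" unfolding T_def unfolding of_nat_0_less_iff using that by linarith
    ultimately show ?thesis using that powr_log_cancel[of "real n" "T n"] by simp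
  qed
  moreover have "legal n v (P n) \<and> (\<forall>q S. executes v (P n) q S \<longrightarrow> envy_free_division n v S \<and> real q \<le> T n)"
    if "2 \<le> n" "\<forall>i\<in>{1..n}. valuation (v i)" for n v
    using P[OF that] unfolding agents.solves_def T_def by (metis of_nat_le_iff)
  ultimately show ?thesis by (meson order_trans)
qed

end
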